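(* Let $\tilde V:\mathbb R^3\to\mathbb R$ be a smooth, radially symmetric function with $\tilde V\ge 0$, $\tilde V\not\equiv 0$, and $\tilde V(x)\le C_0(1+|x|)^{-3-\delta}$ for some $C_0,\delta>0$, and set $V=\lambda\tilde V$. Then there is $\lambda_0=\lambda_0(\tilde V)>0$ such that for every $0<\lambda<\lambda_0$ there are constants $\varrho_0>0$ and $C<\infty$ (depending on $\lambda$ and $\tilde V$) with the following property. For every $0<\varrho<\varrho_0$ there is $L_0$ such that for all $L\ge L_0$, with $N=\varrho L^3$, one can choose numbers $c_k$ ($k\in\Lambda^*\setminus\{0\}$, $|c_k|<1$, $c_k=c_{-k}$) and $N_0>0$ such that the trial state $$\Psi=\exp\Big(\tfrac12\sum_{k\ne0}c_k a_k^+a_{-k}^+ +\sqrt{N_0}\,a_0^+\Big)|0\rangle$$ satisfies the constraint $\big\langle\sum_{m\in\Lambda^*}a_m^+a_m\big\rangle_\Psi=N$ and its energy $E=\langle H\rangle_\Psi$ satisfies $$\big|E-4\pi\varrho N a-Q(h)\big|\le C\,N\varrho^2|\log\varrho|,$$ where $$Q(h)=4\pi aN\varrho\Big[\sqrt{\tfrac{32}{\pi}}\;\Phi(h)\,(a^3\varrho)^{1/2}\Big],$$ $a$ is the scattering length of $V$, $h=\dfrac{\widehat V_0}{8\pi a}-1$, and $$\Phi(h)=\int_0^\infty y^{1/2}\Big(\sqrt{(y+2h)(y+2+2h)}-(y+1+2h)+\frac1{2y}\Big)\,dy .$$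
   Context: Box and Fourier conventions: $\Lambda=[0,L]^3$ with periodic boundary conditions, $|\Lambda|=L^3$, dual lattice $\Lambda^*=(\frac{2\pi}{L}\mathbb Z)^3$; unless restricted, momentum sums run over $\Lambda^*$. For a function $F$ on the torus $\Lambda$, $\widehat F_p=\int_\Lambda e^{-ip\cdot x}F(x)\,dx$, $p\in\Lambda^*$. The interaction $V$ is regarded as a function on the torus by periodization, so that $\widehat V_p=\int_{\mathbb R^3}e^{-ip\cdot x}V(x)\,dx$ for $p\in\Lambda^*$. Fock space and Hamiltonian: on the bosonic Fock space over $\ell^2(\Lambda^* )$ with vacuum $|0\rangle$, let $a_p,a_p^+$ ($p\in\Lambda^*$) be annihilation and creation operators with $[a_p,a_q^+]=1$ if $p=q$ and $0$ otherwise, and $[a_p,a_q]=[a_p^+,a_q^+]=0$. The Hamiltonian is $$H=\sum_p p^2a_p^+a_p+\frac1{2|\Lambda|}\sum_{p,q,u}\widehat V_u\,a_p^+a_q^+a_{p-u}a_{q+u}.$$ For an operator $A$, $\langle A\rangle_\Psi=\langle\Psi,A\Psi\rangle/\langle\Psi,\Psi\rangle$. Scattering length: let $1-w$ be the zero-energy scattering solution on $\mathbb R^3$, i.e. $-\Delta(1-w)+\frac12V(1-w)=0$ with $0\le w<1$ and $w(x)\to0$ as $|x|\to\infty$. Then $a=\frac1{8\pi}\int_{\mathbb R^3}V(x)(1-w(x))\,dx$. *)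

theory Defs
  imports "HOL-Analysis.Analysis"
begin

section \<open>Smooth functions and the zero-energy scattering equation\<close>

definition partial :: "3 \<Rightarrow> (real^3 \<Rightarrow> real) \<Rightarrow> real^3 \<Rightarrow> real" where
  "partial i f x = frechet_derivative f (at x) (axis i 1)"

fun C_k :: "nat \<Rightarrow> (real^3 \<Rightarrow> real) \<Rightarrow> bool" where
  "C_k 0 f \<longleftrightarrow> continuous_on UNIV f"
| "C_k (Suc n) f \<longleftrightarrow> (\<forall>x. f differentiable (at x)) \<and> (\<forall>i. C_k n (partial i f))"

definition smooth :: "(real^3 \<Rightarrow> real) \<Rightarrow> bool" where
  "smooth f \<longleftrightarrow> (\<forall>n. C_k n f)"

definition radial :: "(real^3 \<Rightarrow> real) \<Rightarrow> bool" where
  "radial f \<longleftrightarrow> (\<forall>x y. norm x = norm y \<longrightarrow> f x = f y)"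

definition laplacian :: "(real^3 \<Rightarrow> real) \<Rightarrow> real^3 \<Rightarrow> real" where
  "laplacian f x = (\<Sum>i\<in>UNIV. partial i (partial i f) x)"

definition scattering_equation :: "(real^3 \<Rightarrow> real) \<Rightarrow> (real^3 \<Rightarrow> real) \<Rightarrow> bool" where
  "scattering_equation V w \<longleftrightarrow>
     C_k 2 w \<and>
     (\<forall>x. - laplacian (\<lambda>y. 1 - w y) x + 1/2 * V x * (1 - w x) = 0) \<and>
     (\<forall>x. 0 \<le> w x \<and> w x < 1) \<and>
     (w \<longlongrightarrow> 0) at_infinity"

definition scattering_w :: "(real^3 \<Rightarrow> real) \<Rightarrow> real^3 \<Rightarrow> real" where
  "scattering_w V = (THE w. scattering_equation V w)"

definition scattering_length :: "(real^3 \<Rightarrow> real) \<Rightarrow> real" where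
  "scattering_length V = 1 / (8 * pi) * (LINT x|lborel. V x * (1 - scattering_w V x))"

text \<open>At a dual lattice point this is also the Fourier coefficient, over the torus, of the
  periodization of \<open>V\<close>.\<close>

definition fourier :: "(real^3 \<Rightarrow> real) \<Rightarrow> real^3 \<Rightarrow> complex" where
  "fourier V p = (LINT x|lborel. exp (- \<i> * complex_of_real (p \<bullet> x)) * complex_of_real (V x))"

section \<open>Bosonic Fock space\<close>

text \<open>The Fock space over \<open>\<ell>\<^sup>2\<close> of a set of modes is used in its occupation-number
  representation. An orthonormal basis is indexed by the finite multisets \<open>M\<close> of modes, with
  \<open>count M p\<close> particles in the mode \<open>p\<close>, and a vector is given by its coefficients
  \<open>\<psi> M\<close>. The operators below act on arbitrary coefficient functions; square
  summability is imposed separately.\<close>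

type_synonym 'k fock = "'k multiset \<Rightarrow> complex"

definition fock_space :: "'k set \<Rightarrow> 'k fock set" where
  "fock_space K = {\<psi>. (\<forall>M. \<psi> M \<noteq> 0 \<longrightarrow> set_mset M \<subseteq> K) \<and>
                      (\<lambda>M. (cmod (\<psi> M))\<^sup>2) summable_on UNIV}"

definition fock_inner :: "'k fock \<Rightarrow> 'k fock \<Rightarrow> complex" where
  "fock_inner \<phi> \<psi> = (\<Sum>\<^sub>\<infinity>M. cnj (\<phi> M) * \<psi> M)"

definition vacuum :: "'k fock" where
  "vacuum M = (if M = {#} then 1 else 0)"

definition annihilation :: "'k \<Rightarrow> 'k fock \<Rightarrow> 'k fock" where
  "annihilation p \<psi> M = complex_of_real (sqrt (real (count M p + 1))) * \<psi> (add_mset p M)"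

definition creation :: "'k \<Rightarrow> 'k fock \<Rightarrow> 'k fock" where
  "creation p \<psi> M =
     (if p \<in># M then complex_of_real (sqrt (real (count M p))) * \<psi> (M - {#p#}) else 0)"

lemma commutator_annihilation_creation:
  "annihilation p (creation q \<psi>) M - creation q (annihilation p \<psi>) M = (if p = q then \<psi> M else 0)"
proof (cases "p = q")
  case True
  have sq: "complex_of_real (sqrt (real n)) * (complex_of_real (sqrt (real n)) * z) = of_nat n * z"
    for n z
    by (metis mult.assoc of_nat_0_le_iff of_real_mult of_real_of_nat_eq real_sqrt_mult_self abs_of_nonneg)
  have "annihilation p (creation p \<psi>) M = of_nat (count M p + 1) * \<psi> M"
    using sq[of "Suc (count M p)" "\<psi> M"] by (simp add: annihilation_def creation_def)
  moreover have "creation p (annihilation p \<psi>) M = of_nat (count M p) * \<psi> M"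
  proof (cases "p \<in># M")
    case in_M: True
    then have "Suc (count M p - Suc 0) = count M p" by simp
    then show ?thesis
      using in_M sq[of "count M p" "\<psi> M"] by (simp add: annihilation_def creation_def)
  qed (simp add: creation_def not_in_iff)
  ultimately show ?thesis
    using True by (simp add: algebra_simps)
next
  case False
  then show ?thesis
    by (auto simp: annihilation_def creation_def add_mset_remove_trivial_If diff_union_swap2)
qed

lemma commutator_annihilation:
  "annihilation p (annihilation q \<psi>) = annihilation q (annihilation p \<psi>)"
  by (cases "p = q") (auto simp: fun_eq_iff annihilation_def add_mset_commute)

lemma commutator_creation:
  "creation p (creation q \<psi>) = creation q (creation p \<psi>)"
  by (cases "p = q") (auto simp: fun_eq_iff creation_def in_diff_count add_mset_commute)

lemma annihilation_vacuum: "annihilation p vacuum = (\<lambda>_. 0)"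
  by (simp add: fun_eq_iff annihilation_def vacuum_def)

lemma creation_adjoint: "fock_inner \<phi> (creation p \<psi>) = fock_inner (annihilation p \<phi>) \<psi>"
proof -
  have "fock_inner \<phi> (creation p \<psi>) = (\<Sum>\<^sub>\<infinity>M\<in>range (add_mset p). cnj (\<phi> M) * creation p \<psi> M)"
    unfolding fock_inner_def
  proof (rule infsum_cong_neutral)
    fix M assume "M \<in> UNIV - range (add_mset p)"
    then have "p \<notin># M" by (metis DiffD2 insert_DiffM rangeI)
    then show "cnj (\<phi> M) * creation p \<psi> M = 0" by (simp add: creation_def)
  qed auto
  also have "\<dots> = (\<Sum>\<^sub>\<infinity>M. cnj (\<phi> (add_mset p M)) * creation p \<psi> (add_mset p M))"
    by (subst infsum_reindex) (auto simp: inj_on_def o_def)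
  also have "\<dots> = fock_inner (annihilation p \<phi>) \<psi>"
    by (simp add: fock_inner_def annihilation_def creation_def mult_ac)
  finally show ?thesis .
qed

text \<open>The series is taken coefficientwise.\<close>

definition exp_op :: "('k fock \<Rightarrow> 'k fock) \<Rightarrow> 'k fock \<Rightarrow> 'k fock" where
  "exp_op A \<psi> M = (\<Sum>n. (A ^^ n) \<psi> M / fact n)"

definition expectation :: "('k fock \<Rightarrow> 'k fock) \<Rightarrow> 'k fock \<Rightarrow> complex" where
  "expectation A \<psi> = fock_inner \<psi> (A \<psi>) / fock_inner \<psi> \<psi>"

section \<open>The Bose gas in a periodic box of side length \<open>L\<close>\<close>

definition dual_lattice :: "real \<Rightarrow> (real^3) set" where
  "dual_lattice L = {p. \<forall>i. \<exists>n::int. p $ i = 2 * pi / L * of_int n}"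

text \<open>For fixed \<open>M\<close> only the finitely many modes in \<open>M\<close> contribute to the number operator and
  to the kinetic energy. In the interaction only finitely many \<open>p\<close> and \<open>q\<close> contribute,
  but infinitely many \<open>u\<close> may, so the domain below asks for that sum to converge.\<close>

definition number_op :: "real \<Rightarrow> (real^3) fock \<Rightarrow> (real^3) fock" where
  "number_op L \<psi> M = (\<Sum>\<^sub>\<infinity>m\<in>dual_lattice L. creation m (annihilation m \<psi>) M)"

definition kinetic :: "real \<Rightarrow> (real^3) fock \<Rightarrow> (real^3) fock" where
  "kinetic L \<psi> M =
     (\<Sum>\<^sub>\<infinity>p\<in>dual_lattice L. complex_of_real ((norm p)\<^sup>2) * creation p (annihilation p \<psi>) M)"

definition interaction_term ::
    "(real^3 \<Rightarrow> real) \<Rightarrow> (real^3) fock \<Rightarrow> (real^3) multiset \<Rightarrow> (real^3) \<times> (real^3) \<times> (real^3) \<Rightarrow> complex" where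
  "interaction_term V \<psi> M = (\<lambda>(p, q, u).
     fourier V u * creation p (creation q (annihilation (p - u) (annihilation (q + u) \<psi>))) M)"

definition hamiltonian :: "(real^3 \<Rightarrow> real) \<Rightarrow> real \<Rightarrow> (real^3) fock \<Rightarrow> (real^3) fock" where
  "hamiltonian V L \<psi> M = kinetic L \<psi> M +
     1 / (2 * complex_of_real (L ^ 3)) *
       (\<Sum>\<^sub>\<infinity>t\<in>dual_lattice L \<times> dual_lattice L \<times> dual_lattice L. interaction_term V \<psi> M t)"

definition number_domain :: "real \<Rightarrow> (real^3) fock set" where
  "number_domain L = {\<psi> \<in> fock_space (dual_lattice L). number_op L \<psi> \<in> fock_space (dual_lattice L)}"

definition hamiltonian_domain :: "(real^3 \<Rightarrow> real) \<Rightarrow> real \<Rightarrow> (real^3) fock set" where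
  "hamiltonian_domain V L = {\<psi> \<in> fock_space (dual_lattice L).
     (\<forall>M. interaction_term V \<psi> M summable_on (dual_lattice L \<times> dual_lattice L \<times> dual_lattice L)) \<and>
     hamiltonian V L \<psi> \<in> fock_space (dual_lattice L)}"

definition trial_exponent :: "real \<Rightarrow> (real^3 \<Rightarrow> real) \<Rightarrow> real \<Rightarrow> (real^3) fock \<Rightarrow> (real^3) fock" where
  "trial_exponent L c N0 \<psi> M =
     1/2 * (\<Sum>\<^sub>\<infinity>k\<in>dual_lattice L - {0}. complex_of_real (c k) * creation k (creation (- k) \<psi>) M) +
     complex_of_real (sqrt N0) * creation 0 \<psi> M"

text \<open>Every term of every sum involved in a coefficient of the trial state that does not vanish
  uses only modes in \<open>M\<close>, and the \<open>n\<close>-th power contributes only if \<open>M\<close> has between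
  \<open>n\<close> and \<open>2 n\<close> elements. So all these sums are finite.\<close>

definition trial_state :: "real \<Rightarrow> (real^3 \<Rightarrow> real) \<Rightarrow> real \<Rightarrow> (real^3) fock" where
  "trial_state L c N0 = exp_op (trial_exponent L c N0) vacuum"

section \<open>The second-order term\<close>

definition Phi :: "real \<Rightarrow> real" where
  "Phi h = (LBINT y:{0<..}.
     sqrt y * (sqrt ((y + 2*h) * (y + 2 + 2*h)) - (y + 1 + 2*h) + 1 / (2*y)))"

definition Q_term :: "real \<Rightarrow> real \<Rightarrow> real \<Rightarrow> real \<Rightarrow> real" where
  "Q_term a N \<rho> h = 4 * pi * a * N * \<rho> * (sqrt (32 / pi) * Phi h * sqrt (a ^ 3 * \<rho>))"

end

theory Submission
  imports Defs "HOL-Probability.Sinc_Integral" "HOL-Real_Asymp.Real_Asymp"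
begin

text \<open>The pairing coefficients are chosen with finite support, so Wick's rule turns the energy into a
  finite sum over the occupations \<open>\<gamma> = c\<^sup>2 / (1 - c\<^sup>2)\<close> and the pairings
  \<open>\<alpha> = c / (1 - c\<^sup>2)\<close>. Let \<open>g = V (1 - w)\<close>, so that \<open>8 \<pi> a\<close> is the integral of \<open>g\<close> and the
  Fourier transform of \<open>w\<close> is that of \<open>g\<close> divided by \<open>2 p\<^sup>2\<close>. Replacing \<open>\<alpha>\<close> by its difference to
  \<open>- \<rho>\<close> times a truncation of this transform completes a square in the pairing energy: the energy per
  volume is at most \<open>4 \<pi> a \<rho>\<^sup>2\<close> plus the lattice average of a quadratic expression in each mode, up to
  errors of order \<open>\<rho> ^ 3\<close>. Minimising over each \<open>c p\<close> and passing to the integral gives, after the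
  scaling \<open>p\<^sup>2 = 8 \<pi> a \<rho> y\<close>, the term \<open>Q\<close>.

  Only this upper bound is needed. Give one further pair of modes of very large momentum the coefficient
  \<open>t\<close>: the energy is continuous in \<open>t\<close>, is below the bound at \<open>t = 0\<close> and above it at
  \<open>t = 1 / sqrt 2\<close>, so for some \<open>t\<close> it equals the bound.\<close>

section \<open>Rapidly decaying Fock vectors\<close>

text \<open>The pairing energy is not diagonal in momentum. In position space it is the integral of
  \<open>V\<close> against the square of a cosine sum, and there the square can be completed
  pointwise around \<open>1 - w\<close>. The price is a finite lattice sum that has to approximate
  \<open>w\<close> in L1 and L2 with weight \<open>V\<close>. The transform of \<open>w\<close> is
  bounded by a multiple of p^(-2), which is not integrable at infinity, so it is multiplied by a
  cutoff. The cutoff level depends on the density and is fixed before the box grows.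

  All remaining fluctuations are controlled by the lattice average of \<open>Dr\<close>, of order
  sqrt \<rho>. The depletion and the deviation of the pairing from its main part then have order
  \<rho>^(3/2), and their squares \<rho>^3.

  Finite support makes the energy a finite sum. Yet \<open>H\<close> applied to the state has
  components with arbitrary momentum transfer, and its square summability rests on that of the
  Fourier coefficients of \<open>V\<close> over the dual lattice. This is derived from the decay of
  \<open>V\<close> by a Toeplitz bound.

  The coupling has to be small for the radial scattering equation to be a contraction with values in
  [0, 1).\<close>

definition wt :: "nat \<Rightarrow> 'k fock \<Rightarrow> 'k multiset \<Rightarrow> real" where
  "wt k \<psi> M = (1 + real (size M)) ^ k * (cmod (\<psi> M))\<^sup>2"

text \<open>Creation and annihilation operators cost half a power of the particle number each.
  Vectors with all weighted norms finite form a space stable under both, on which inner products can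
  be manipulated freely.\<close>

definition rapid :: "'k fock set" where
  "rapid = {\<psi>. \<forall>k. wt k \<psi> summable_on UNIV}"

lemma wt_nonneg [simp]: "wt k \<psi> M \<ge> 0"
  by (simp add: wt_def)

lemma rapidD: "\<psi> \<in> rapid \<Longrightarrow> wt k \<psi> summable_on UNIV"
  by (simp add: rapid_def)

lemma rapid_zero [simp]: "(\<lambda>M. 0) \<in> rapid"
  by (auto simp: rapid_def wt_def intro!: summable_on_0)

lemma creation_eq_0: "M \<notin> range (add_mset p) \<Longrightarrow> creation p \<psi> M = 0"
  by (auto simp: creation_def) (metis insert_DiffM rangeI)

lemma wt_creation_le: "wt k (creation p \<psi>) (add_mset p M) \<le> 2 ^ k * wt (Suc k) \<psi> M"
proof -
  have "wt k (creation p \<psi>) (add_mset p M) = (2 + real (size M)) ^ k * (real (count M p + 1) * (cmod (\<psi> M))\<^sup>2)"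
    by (simp add: wt_def creation_def norm_mult power_mult_distrib algebra_simps)
  also have "\<dots> \<le> (2 * (1 + real (size M))) ^ k * ((1 + real (size M)) * (cmod (\<psi> M))\<^sup>2)"
    by (intro mult_mono power_mono mult_right_mono) (auto simp: count_le_size)
  also have "\<dots> = 2 ^ k * wt (Suc k) \<psi> M"
    by (simp only: wt_def power_mult_distrib power_Suc mult_ac)
  finally show ?thesis .
qed

text \<open>The bound in the second part does not depend on \<open>p\<close>. This uniformity
  matters for the interaction, which creates particles in infinitely many modes.\<close>

lemma wt_creation:
  assumes "\<psi> \<in> rapid"
  shows "wt k (creation p \<psi>) summable_on UNIV"
    and "infsum (wt k (creation p \<psi>)) UNIV \<le> 2 ^ k * infsum (wt (Suc k) \<psi>) UNIV"
proof -
  have s: "(\<lambda>M. 2 ^ k * wt (Suc k) \<psi> M) summable_on UNIV"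
    by (intro summable_on_cmult_right rapidD assms)
  have s1: "(\<lambda>M. wt k (creation p \<psi>) (add_mset p M)) summable_on UNIV"
    by (rule summable_on_comparison_test[OF s]) (auto simp: wt_creation_le)
  then have s2: "wt k (creation p \<psi>) summable_on range (add_mset p)"
    by (subst summable_on_reindex) (auto simp: o_def inj_on_def)
  show "wt k (creation p \<psi>) summable_on UNIV"
    using s2 by (rule summable_on_cong_neutral[THEN iffD1, rotated -1])
       (auto simp: wt_def creation_eq_0)
  have "infsum (wt k (creation p \<psi>)) UNIV = infsum (wt k (creation p \<psi>)) (range (add_mset p))"
    by (rule infsum_cong_neutral) (auto simp: wt_def creation_eq_0)
  also have "\<dots> = (\<Sum>\<^sub>\<infinity>M. wt k (creation p \<psi>) (add_mset p M))"
    by (subst infsum_reindex) (auto simp: o_def inj_on_def)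
  also have "\<dots> \<le> (\<Sum>\<^sub>\<infinity>M. 2 ^ k * wt (Suc k) \<psi> M)"
    by (rule infsum_mono[OF s1 s]) (rule wt_creation_le)
  also have "\<dots> = 2 ^ k * infsum (wt (Suc k) \<psi>) UNIV"
    by (rule infsum_cmult_right')
  finally show "infsum (wt k (creation p \<psi>)) UNIV \<le> 2 ^ k * infsum (wt (Suc k) \<psi>) UNIV" .
qed

lemma rapid_creation [intro]: "\<psi> \<in> rapid \<Longrightarrow> creation p \<psi> \<in> rapid"
  using wt_creation(1) by (auto simp: rapid_def)

lemma rapid_annihilation [intro]:
  assumes "\<psi> \<in> rapid"
  shows "annihilation p \<psi> \<in> rapid"
  unfolding rapid_def
proof (intro CollectI allI)
  fix k
  have "wt (Suc k) \<psi> summable_on range (add_mset p)"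
    using rapidD[OF assms] by (rule summable_on_subset_banach) auto
  then have s: "(\<lambda>M. wt (Suc k) \<psi> (add_mset p M)) summable_on UNIV"
    by (subst (asm) summable_on_reindex) (auto simp: o_def inj_on_def)
  show "wt k (annihilation p \<psi>) summable_on UNIV"
  proof (rule summable_on_comparison_test[OF s])
    fix M
    have "wt k (annihilation p \<psi>) M = (1 + real (size M)) ^ k * (real (count M p + 1) * (cmod (\<psi> (add_mset p M)))\<^sup>2)"
      by (simp add: wt_def annihilation_def norm_mult power_mult_distrib algebra_simps)
    also have "\<dots> \<le> (2 + real (size M)) ^ k * ((2 + real (size M)) * (cmod (\<psi> (add_mset p M)))\<^sup>2)"
    proof (intro mult_mono power_mono mult_right_mono)
      have "real (count M p) \<le> real (size M)" by (simp add: count_le_size)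
      then show "real (count M p + 1) \<le> 2 + real (size M)" by simp
    qed auto
    finally show "wt k (annihilation p \<psi>) M \<le> wt (Suc k) \<psi> (add_mset p M)"
      by (simp add: wt_def algebra_simps)
  qed auto
qed

lemma rapid_add [intro]:
  assumes "\<psi> \<in> rapid" "\<phi> \<in> rapid"
  shows "(\<lambda>M. \<psi> M + \<phi> M) \<in> rapid"
  unfolding rapid_def
proof (intro CollectI allI)
  fix k
  have s: "(\<lambda>M. 2 * wt k \<psi> M + 2 * wt k \<phi> M) summable_on UNIV"
    by (intro summable_on_add summable_on_cmult_right rapidD assms)
  show "wt k (\<lambda>M. \<psi> M + \<phi> M) summable_on UNIV"
  proof (rule summable_on_comparison_test[OF s])
    fix M
    have "(cmod (\<psi> M + \<phi> M))\<^sup>2 \<le> (cmod (\<psi> M) + cmod (\<phi> M))\<^sup>2"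
      by (intro power_mono norm_triangle_ineq) auto
    also have "\<dots> \<le> 2 * (cmod (\<psi> M))\<^sup>2 + 2 * (cmod (\<phi> M))\<^sup>2"
      using sum_squares_bound[of "cmod (\<psi> M)" "cmod (\<phi> M)"] by (simp add: power2_sum)
    finally have "wt k (\<lambda>M. \<psi> M + \<phi> M) M
        \<le> (1 + real (size M)) ^ k * (2 * (cmod (\<psi> M))\<^sup>2 + 2 * (cmod (\<phi> M))\<^sup>2)"
      unfolding wt_def by (rule mult_left_mono) auto
    then show "wt k (\<lambda>M. \<psi> M + \<phi> M) M \<le> 2 * wt k \<psi> M + 2 * wt k \<phi> M"
      by (simp add: wt_def distrib_left mult_ac)
  qed auto
qed

lemma rapid_scale [intro]:
  assumes "\<psi> \<in> rapid"
  shows "(\<lambda>M. a * \<psi> M) \<in> rapid"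
  unfolding rapid_def
proof (intro CollectI allI)
  fix k
  have "wt k (\<lambda>M. a * \<psi> M) = (\<lambda>M. (cmod a)\<^sup>2 * wt k \<psi> M)"
    by (auto simp: wt_def norm_mult power_mult_distrib)
  then show "wt k (\<lambda>M. a * \<psi> M) summable_on UNIV"
    using rapidD[OF assms] by (simp add: summable_on_cmult_right)
qed

lemma rapid_sum [intro]:
  assumes "\<And>i. i \<in> I \<Longrightarrow> f i \<in> rapid"
  shows "(\<lambda>M. \<Sum>i\<in>I. f i M) \<in> rapid"
  using assms by (induction I rule: infinite_finite_induct) (auto intro!: rapid_add)

lemma fock_inner_summable:
  assumes "\<psi> \<in> rapid" "\<phi> \<in> rapid"
  shows "(\<lambda>M. cnj (\<psi> M) * \<phi> M) summable_on UNIV"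
proof -
  have s: "(\<lambda>M. wt 0 \<psi> M + wt 0 \<phi> M) summable_on UNIV"
    by (intro summable_on_add rapidD assms)
  have "(\<lambda>M. cmod (cnj (\<psi> M) * \<phi> M)) summable_on UNIV"
  proof (rule summable_on_comparison_test[OF s])
    fix M
    show "cmod (cnj (\<psi> M) * \<phi> M) \<le> wt 0 \<psi> M + wt 0 \<phi> M"
      using sum_squares_bound[of "cmod (\<psi> M)" "cmod (\<phi> M)"]
        mult_nonneg_nonneg[OF norm_ge_zero[of "\<psi> M"] norm_ge_zero[of "\<phi> M"]]
      unfolding wt_def norm_mult complex_mod_cnj power_0 mult_1 by linarith
  qed auto
  then show ?thesis by (rule abs_summable_summable)
qed

lemma fock_inner_add:
  assumes "\<psi> \<in> rapid" "\<phi> \<in> rapid" "\<eta> \<in> rapid"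
  shows "fock_inner \<psi> (\<lambda>M. \<phi> M + \<eta> M) = fock_inner \<psi> \<phi> + fock_inner \<psi> \<eta>"
  unfolding fock_inner_def
  using assms by (subst infsum_add[symmetric]) (auto intro!: fock_inner_summable simp: distrib_left)

lemma fock_inner_scale: "fock_inner \<psi> (\<lambda>M. a * \<phi> M) = a * fock_inner \<psi> \<phi>"
  unfolding fock_inner_def by (subst infsum_cmult_right'[symmetric]) (simp add: mult_ac)

lemma fock_inner_zero [simp]: "fock_inner \<psi> (\<lambda>M. 0) = 0"
  by (simp add: fock_inner_def)

lemma fock_inner_sum:
  assumes "\<psi> \<in> rapid" "\<And>i. i \<in> I \<Longrightarrow> f i \<in> rapid"
  shows "fock_inner \<psi> (\<lambda>M. \<Sum>i\<in>I. f i M) = (\<Sum>i\<in>I. fock_inner \<psi> (f i))"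
  using assms
  by (induction I rule: infinite_finite_induct) (auto simp: fock_inner_add rapid_sum)

lemma fock_inner_cnj: "fock_inner \<phi> \<psi> = cnj (fock_inner \<psi> \<phi>)"
  unfolding fock_inner_def by (subst infsum_cnj[symmetric]) (simp add: mult_ac)

lemma creation_add: "creation p (\<lambda>M. \<psi> M + \<phi> M) = (\<lambda>M. creation p \<psi> M + creation p \<phi> M)"
  by (auto simp: creation_def algebra_simps)

lemma creation_scale: "creation p (\<lambda>M. a * \<psi> M) = (\<lambda>M. a * creation p \<psi> M)"
  by (auto simp: creation_def algebra_simps)

lemma creation_zero: "creation p (\<lambda>M. 0) = (\<lambda>M. 0)"
  by (auto simp: creation_def)

lemma creation_sum: "creation p (\<lambda>M. \<Sum>i\<in>I. f i M) = (\<lambda>M. \<Sum>i\<in>I. creation p (f i) M)"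
  by (auto simp: creation_def sum_distrib_left)

lemma annihilation_add: "annihilation p (\<lambda>M. \<psi> M + \<phi> M) = (\<lambda>M. annihilation p \<psi> M + annihilation p \<phi> M)"
  by (auto simp: annihilation_def algebra_simps)

lemma annihilation_scale: "annihilation p (\<lambda>M. a * \<psi> M) = (\<lambda>M. a * annihilation p \<psi> M)"
  by (auto simp: annihilation_def algebra_simps)

lemma annihilation_zero: "annihilation p (\<lambda>M. 0) = (\<lambda>M. 0)"
  by (auto simp: annihilation_def)

lemma annihilation_sum: "annihilation p (\<lambda>M. \<Sum>i\<in>I. f i M) = (\<lambda>M. \<Sum>i\<in>I. annihilation p (f i) M)"
  by (auto simp: annihilation_def sum_distrib_left)

lemma annihilation_creation:
  "annihilation p (creation q \<psi>) = (\<lambda>M. creation q (annihilation p \<psi>) M + (if p = q then 1 else 0) * \<psi> M)"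
  using commutator_annihilation_creation[of p q \<psi>] by (auto simp: fun_eq_iff algebra_simps)

lemma number_apply: "creation p (annihilation p \<psi>) M = of_nat (count M p) * \<psi> M"
proof (cases "p \<in># M")
  case in_M: True
  then have "Suc (count M p - Suc 0) = count M p" by simp
  moreover have "complex_of_real (sqrt (real n)) * (complex_of_real (sqrt (real n)) * z) = of_nat n * z" for n z
    by (metis mult.assoc of_nat_0_le_iff of_real_mult of_real_of_nat_eq real_sqrt_mult_self abs_of_nonneg)
  ultimately show ?thesis
    using in_M by (simp add: annihilation_def creation_def)
qed (simp add: creation_def not_in_iff)

text \<open>A multiset over a finite \<open>S\<close> is a family of occupation numbers, so the sum
  factorises. The induction splits off the copies of one mode as
  \<open>replicate_mset n p\<close>.\<close>

lemma summable_on_multiset_prod: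
  fixes g :: "'k \<Rightarrow> nat \<Rightarrow> real"
  assumes "finite S" "\<And>p n. p \<in> S \<Longrightarrow> g p n \<ge> 0" "\<And>p. p \<in> S \<Longrightarrow> g p summable_on UNIV"
  shows "(\<lambda>M. \<Prod>p\<in>S. g p (count M p)) summable_on {M. set_mset M \<subseteq> S}"
  using assms
proof (induction S rule: finite_induct)
  case (insert p S)
  let ?f = "\<lambda>M. \<Prod>p\<in>S. g p (count M p)"
  let ?h = "\<lambda>(n, M). replicate_mset n p + M"
  let ?A = "(UNIV :: nat set) \<times> {M. set_mset M \<subseteq> S}"
  have "(\<lambda>(n, M). g p n * ?f M) summable_on ?A"
  proof (rule summable_on_SigmaI[where g = "\<lambda>n. g p n * infsum ?f {M. set_mset M \<subseteq> S}"])
    show "((\<lambda>M. case (n, M) of (n, M) \<Rightarrow> g p n * ?f M) has_sum g p n * infsum ?f {M. set_mset M \<subseteq> S}) {M. set_mset M \<subseteq> S}" for n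
      using insert by (auto intro!: has_sum_cmult_right has_sum_infsum)
    show "(\<lambda>n. g p n * infsum ?f {M. set_mset M \<subseteq> S}) summable_on UNIV"
      using insert by (auto intro!: summable_on_cmult_left)
  qed (use insert in \<open>auto intro!: mult_nonneg_nonneg prod_nonneg\<close>)
  also have "?this \<longleftrightarrow> ((\<lambda>M. \<Prod>q\<in>insert p S. g q (count M q)) \<circ> ?h) summable_on ?A"
  proof (rule summable_on_cong, clarify)
    fix n M assume "set_mset M \<subseteq> S"
    then have "count M p = 0" using insert by (auto simp: count_eq_zero_iff)
    moreover have "(\<Prod>q\<in>S. g q (count (replicate_mset n p + M) q)) = ?f M"
      using insert by (intro prod.cong) auto
    ultimately show "g p n * ?f M = ((\<lambda>M. \<Prod>q\<in>insert p S. g q (count M q)) \<circ> ?h) (n, M)"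
      using insert by simp
  qed
  also have "\<dots> \<longleftrightarrow> (\<lambda>M. \<Prod>q\<in>insert p S. g q (count M q)) summable_on (?h ` ?A)"
  proof (subst summable_on_reindex)
    show "inj_on ?h ?A"
    proof (rule inj_onI, clarify)
      fix n M n' M' assume *: "set_mset M \<subseteq> S" "set_mset M' \<subseteq> S" "replicate_mset n p + M = replicate_mset n' p + M'"
      then have "count M p = 0" "count M' p = 0" using insert by (auto simp: count_eq_zero_iff)
      with arg_cong[OF *(3), of "\<lambda>X. count X p"] have "n = n'" by simp
      with * show "n = n' \<and> M = M'" by simp
    qed
  qed auto
  also have "?h ` ?A = {M. set_mset M \<subseteq> insert p S}"
  proof (intro equalityI subsetI)
    fix M assume "M \<in> {M. set_mset M \<subseteq> insert p S}"
    then have "M = ?h (count M p, filter_mset (\<lambda>q. q \<noteq> p) M)" "set_mset (filter_mset (\<lambda>q. q \<noteq> p) M) \<subseteq> S"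
      by (auto intro!: multiset_eqI)
    then show "M \<in> ?h ` ?A" by blast
  qed (auto split: if_splits)
  finally show ?case .
qed auto

section \<open>Trial states with finitely many pairs\<close>

lemma zero_in_dual_lattice [simp]: "0 \<in> dual_lattice L"
  by (auto simp: dual_lattice_def intro!: exI[of _ "0::int"])

lemma add_in_dual_lattice [intro]:
  assumes "p \<in> dual_lattice L" "q \<in> dual_lattice L"
  shows "p + q \<in> dual_lattice L"
  unfolding dual_lattice_def
proof (intro CollectI allI)
  fix i
  obtain m n :: int where "p $ i = 2 * pi / L * of_int m" "q $ i = 2 * pi / L * of_int n"
    using assms unfolding dual_lattice_def by blast
  then show "\<exists>n::int. (p + q) $ i = 2 * pi / L * of_int n"
    by (intro exI[of _ "m + n"]) (simp add: algebra_simps add_divide_distrib)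
qed

lemma uminus_in_dual_lattice [intro]:
  assumes "p \<in> dual_lattice L"
  shows "- p \<in> dual_lattice L"
  unfolding dual_lattice_def
proof (intro CollectI allI)
  fix i
  obtain m :: int where "p $ i = 2 * pi / L * of_int m"
    using assms unfolding dual_lattice_def by blast
  then show "\<exists>n::int. (- p) $ i = 2 * pi / L * of_int n"
    by (intro exI[of _ "- m"]) simp
qed

lemma diff_in_dual_lattice [intro]: "p \<in> dual_lattice L \<Longrightarrow> q \<in> dual_lattice L \<Longrightarrow> p - q \<in> dual_lattice L"
  using add_in_dual_lattice[of p L "- q"] uminus_in_dual_lattice[of q L] by simp

text \<open>\<open>P\<close> contains the support of \<open>c\<close> but may be larger. This lets
  one set of modes serve a whole family of coefficients, some of which vanish on part of
  \<open>P\<close>.\<close>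

locale pair_state =
  fixes L :: real and c :: "real^3 \<Rightarrow> real" and N0 :: real and P :: "(real^3) set"
  assumes finP: "finite P" and P_sub: "P \<subseteq> dual_lattice L - {0}"
    and c_out: "\<And>k. k \<notin> P \<Longrightarrow> c k = 0" and c_sym: "\<And>k. c (- k) = c k"
    and P_sym: "\<And>k. k \<in> P \<Longrightarrow> - k \<in> P"
    and c_less: "\<And>k. \<bar>c k\<bar> < 1" and N0: "N0 > 0"
begin

abbreviation "T \<equiv> trial_exponent L c N0"
abbreviation "\<Psi> \<equiv> trial_state L c N0"

definition z :: complex where "z = complex_of_real (sqrt N0)"
definition b :: "real^3 \<Rightarrow> complex" where "b p = (if p = 0 then z else 0)"
definition cc :: "real^3 \<Rightarrow> complex" where "cc p = complex_of_real (c p)"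

text \<open>On the trial state \<open>annihilation p\<close> acts as \<open>D p\<close>. This is the source of all the Wick formulas.\<close>

definition D :: "real^3 \<Rightarrow> (real^3) fock \<Rightarrow> (real^3) fock" where
  "D p \<psi> = (\<lambda>M. cc p * creation (- p) \<psi> M + b p * \<psi> M)"

lemma cc_0 [simp]: "cc 0 = 0"
  using c_out[of 0] P_sub by (auto simp: cc_def)

lemma T_eq: "T \<psi> = (\<lambda>M. (\<Sum>k\<in>P. cc k / 2 * creation k (creation (- k) \<psi>) M) + z * creation 0 \<psi> M)"
proof
  fix M
  have "(\<Sum>\<^sub>\<infinity>k\<in>dual_lattice L - {0}. complex_of_real (c k) * creation k (creation (- k) \<psi>) M)
      = (\<Sum>\<^sub>\<infinity>k\<in>P. cc k * creation k (creation (- k) \<psi>) M)"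
    using P_sub c_out by (intro infsum_cong_neutral) (auto simp: cc_def)
  also have "\<dots> = (\<Sum>k\<in>P. cc k * creation k (creation (- k) \<psi>) M)"
    using finP by (rule infsum_finite)
  finally show "T \<psi> M = (\<Sum>k\<in>P. cc k / 2 * creation k (creation (- k) \<psi>) M) + z * creation 0 \<psi> M"
    by (simp add: trial_exponent_def z_def sum_divide_distrib)
qed

lemma annihilation_pair:
  "annihilation p (creation k (creation l \<psi>)) = (\<lambda>M. creation k (creation l (annihilation p \<psi>)) M
     + (if p = l then 1 else 0) * creation k \<psi> M + (if p = k then 1 else 0) * creation l \<psi> M)"
  unfolding annihilation_creation creation_add creation_scale by (simp add: algebra_simps)

text \<open>The commutator of \<open>annihilation p\<close> with the exponent is \<open>D p\<close>.
  The pair {p, -p} occurs twice in the sum over \<open>P\<close>, as k = p and as k = -p, which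
  cancels the factor 1/2.\<close>

lemma annihilation_T: "annihilation p (T \<psi>) = (\<lambda>M. T (annihilation p \<psi>) M + D p \<psi> M)"
proof -
  have s1: "(\<Sum>k\<in>P. cc k / 2 * ((if p = - k then 1 else 0) * creation k \<psi> M)) = cc p / 2 * creation (- p) \<psi> M" for M
  proof -
    have "(\<Sum>k\<in>P. cc k / 2 * ((if p = - k then 1 else 0) * creation k \<psi> M))
        = (\<Sum>k\<in>P. if k = - p then cc k / 2 * creation k \<psi> M else 0)"
      by (intro sum.cong) auto
    also have "\<dots> = cc p / 2 * creation (- p) \<psi> M"
      using finP c_out[of "- p"] c_sym[of p] by (auto simp: sum.delta cc_def)
    finally show ?thesis .
  qed
  have s2: "(\<Sum>k\<in>P. cc k / 2 * ((if p = k then 1 else 0) * creation (- k) \<psi> M)) = cc p / 2 * creation (- p) \<psi> M" for M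
  proof -
    have "(\<Sum>k\<in>P. cc k / 2 * ((if p = k then 1 else 0) * creation (- k) \<psi> M))
        = (\<Sum>k\<in>P. if k = p then cc k / 2 * creation (- k) \<psi> M else 0)"
      by (intro sum.cong) auto
    also have "\<dots> = cc p / 2 * creation (- p) \<psi> M"
      using finP c_out[of p] by (auto simp: sum.delta cc_def)
    finally show ?thesis .
  qed
  show ?thesis
    unfolding T_eq annihilation_add annihilation_sum annihilation_scale annihilation_pair distrib_left sum.distrib s1 s2
    by (auto simp: fun_eq_iff D_def b_def annihilation_creation creation_zero algebra_simps)
qed

lemma T_add: "T (\<lambda>M. \<psi> M + \<phi> M) = (\<lambda>M. T \<psi> M + T \<phi> M)"
  by (simp add: T_eq creation_add distrib_left sum.distrib fun_eq_iff algebra_simps)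

lemma T_scale: "T (\<lambda>M. a * \<psi> M) = (\<lambda>M. a * T \<psi> M)"
  by (simp add: T_eq creation_scale sum_distrib_left fun_eq_iff algebra_simps)

lemma T_creation: "T (creation p \<psi>) = creation p (T \<psi>)"
  unfolding T_eq creation_add creation_sum creation_scale
  by (simp add: commutator_creation[of _ p])

lemma T_D: "T (D p \<psi>) = D p (T \<psi>)"
  unfolding D_def T_add T_scale T_creation ..

abbreviation Tn :: "nat \<Rightarrow> (real^3) fock" where "Tn n \<equiv> (T ^^ n) vacuum"

lemma T_zero: "T (\<lambda>_. 0) = (\<lambda>_. 0)"
  by (simp add: T_eq creation_zero)

text \<open>\<open>D p\<close> consists of creation operators and scalars, so it commutes with
  \<open>T\<close>. Hence commuting past n + 1 factors yields n + 1 equal terms, and the vacuum is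
  annihilated at the end.\<close>

lemma annihilation_Tn: "annihilation p (Tn (Suc n)) = (\<lambda>M. of_nat (Suc n) * D p (Tn n) M)"
proof (induction n)
  case 0
  show ?case by (simp add: annihilation_T annihilation_vacuum T_zero)
next
  case (Suc n)
  have "annihilation p (Tn (Suc (Suc n))) = (\<lambda>M. T (annihilation p (Tn (Suc n))) M + D p (Tn (Suc n)) M)"
    by (simp add: annihilation_T)
  also have "T (annihilation p (Tn (Suc n))) = (\<lambda>M. of_nat (Suc n) * D p (Tn (Suc n)) M)"
    unfolding Suc.IH by (simp add: T_scale T_D)
  finally show ?case by (simp add: algebra_simps fun_eq_iff)
qed

lemma creation_eq_0_size:
  assumes "\<And>M. size M < n \<Longrightarrow> \<psi> M = 0" "size M < Suc n"
  shows "creation k \<psi> M = 0"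
  using assms by (cases "k \<in># M") (auto simp: creation_def dest!: multi_member_split)

lemma Tn_eq_0: "size M < n \<Longrightarrow> Tn n M = 0"
proof (induction n arbitrary: M)
  case (Suc n)
  have *: "creation k (Tn n) M = 0" if "size M < Suc n" for k M
    using Suc.IH that by (rule creation_eq_0_size)
  have "creation k (creation l (Tn n)) M = 0" for k l
    using * Suc.prems by (intro creation_eq_0_size[of n "creation l (Tn n)"]) simp_all
  with * Suc.prems show ?case by (simp add: T_eq[of "Tn n"])
qed simp

lemma trial_state_eq: "size M < K \<Longrightarrow> \<Psi> M = (\<Sum>n<K. Tn n M / fact n)"
  unfolding trial_state_def exp_op_def
  by (rule suminf_finite) (auto simp: Tn_eq_0)

lemma annihilation_Psi: "annihilation p \<Psi> = D p \<Psi>"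
proof
  fix M :: "(real^3) multiset"
  define K where "K = Suc (size M)"
  \<comment> \<open>\<open>add_mset p M\<close> is one larger than \<open>M\<close>, hence one more
    term of the series. The term n = 0 then drops out because the vacuum is annihilated.\<close>
  have "annihilation p \<Psi> M = (\<Sum>n<Suc K. annihilation p (Tn n) M / fact n)"
    by (simp add: annihilation_def trial_state_eq[of "add_mset p M" "Suc K"] K_def sum_distrib_left algebra_simps)
  also have "\<dots> = (\<Sum>n<K. annihilation p (Tn (Suc n)) M / fact (Suc n))"
    by (subst sum.lessThan_Suc_shift) (simp add: annihilation_vacuum)
  also have "\<dots> = (\<Sum>n<K. D p (Tn n) M / fact n)"
    unfolding annihilation_Tn by (intro sum.cong refl) (simp add: divide_simps del: of_nat_Suc)
  also have "\<dots> = D p \<Psi> M"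
    using K_def
    by (auto simp: D_def creation_def trial_state_eq[of M K] trial_state_eq[of "M - {#- p#}" K] size_Diff_singleton
        sum_distrib_left algebra_simps add_divide_distrib sum.distrib)
  finally show "annihilation p \<Psi> M = D p \<Psi> M" .
qed

lemma Psi_empty: "\<Psi> {#} = 1"
  by (simp add: trial_state_eq[of "{#}" 1] vacuum_def)

lemma b_out: "p \<notin> insert 0 P \<Longrightarrow> annihilation p \<Psi> = (\<lambda>M. 0)"
  by (auto simp: annihilation_Psi D_def b_def cc_def c_out)

lemma Psi_supp: "\<Psi> M \<noteq> 0 \<Longrightarrow> set_mset M \<subseteq> insert 0 P"
proof
  fix p assume M: "\<Psi> M \<noteq> 0" "p \<in># M"
  show "p \<in> insert 0 P"
  proof (rule ccontr)
    assume "p \<notin> insert 0 P"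
    then have "annihilation p \<Psi> (M - {#p#}) = 0" using fun_cong[OF b_out] by simp
    moreover have "count M p > 0" using M by simp
    ultimately show False using M by (simp add: annihilation_def)
  qed
qed

lemma uminus_neq: "(p::real^3) \<noteq> 0 \<Longrightarrow> - p \<noteq> p"
  by (metis (no_types) scaleR_2 add.left_inverse scale_eq_0_iff zero_neq_numeral)

text \<open>The number operator of p acts on the state as
  \<open>cc p * creation p (creation (- p) \<Psi>)\<close>, which is symmetric under p ->
  -p.\<close>

lemma Psi_balanced: "p \<noteq> 0 \<Longrightarrow> \<Psi> M \<noteq> 0 \<Longrightarrow> count M p = count M (- p)"
proof -
  assume p: "p \<noteq> 0" "\<Psi> M \<noteq> 0"
  have "of_nat (count M p) * \<Psi> M = cc p * creation p (creation (- p) \<Psi>) M" if "p \<noteq> 0" for p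
    using that unfolding number_apply[symmetric] annihilation_Psi D_def b_def by (simp add: creation_scale)
  from this[of p] this[of "- p"] p have "of_nat (count M p) * \<Psi> M = of_nat (count M (- p)) * \<Psi> M"
    by (simp add: cc_def c_sym commutator_creation[of "- p" p])
  with p show ?thesis by simp
qed

text \<open>Poisson weights for the condensate. Each member of a pair gets |c|^n, so a balanced pair
  of occupations n contributes c^(2n) to the squared amplitude.\<close>

definition wn :: "real^3 \<Rightarrow> nat \<Rightarrow> real" where
  "wn p n = (if p = 0 then N0 ^ n / fact n else \<bar>c p\<bar> ^ n)"

lemma wn_nonneg [simp]: "wn p n \<ge> 0"
  using N0 by (auto simp: wn_def)

lemma wn_0 [simp]: "wn p 0 = 1"
  by (simp add: wn_def)

text \<open>Particles are removed one step at a time through \<open>annihilation_Psi\<close>. In the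
  condensate one particle leaves, with a factor N0 / n; otherwise a particle and its partner of
  opposite momentum leave together, with a factor c^2.\<close>

lemma Psi_bound: "(cmod (\<Psi> M))\<^sup>2 \<le> (\<Prod>p\<in>insert 0 P. wn p (count M p))"
proof (induction "size M" arbitrary: M rule: less_induct)
  case less
  show ?case
  proof (cases "\<Psi> M = 0 \<or> M = {#}")
    case True
    then show ?thesis
      by (auto simp: Psi_empty intro!: prod_nonneg mult_nonneg_nonneg)
  next
    case False
    then obtain p M' where M: "M = add_mset p M'" by (metis multiset_cases)
    have pS: "p \<in> insert 0 P" using Psi_supp[of M] False M by auto
    have rel: "complex_of_real (sqrt (real (count M' p + 1))) * \<Psi> M = D p \<Psi> M'"
      using fun_cong[OF annihilation_Psi[of p], of M'] by (simp add: annihilation_def M)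
    show ?thesis
    proof (cases "p = 0")
      case True
      have eq: "(\<Prod>q\<in>P. wn q (count M q)) = (\<Prod>q\<in>P. wn q (count M' q))"
        using P_sub M True by (intro prod.cong) auto
      have P0: "0 \<notin> P" using P_sub by auto
      have cM: "count M 0 = Suc (count M' 0)" using M True by simp
      have wn0: "real (Suc n) * wn 0 (Suc n) = N0 * wn 0 n" for n
        by (simp add: wn_def del: of_nat_Suc)
      have r: "real (count M' 0 + 1) * (cmod (\<Psi> M))\<^sup>2 = N0 * (cmod (\<Psi> M'))\<^sup>2"
      proof -
        have "cmod (complex_of_real (sqrt (real (count M' p + 1))) * \<Psi> M) ^ 2 = cmod (z * \<Psi> M') ^ 2"
          using rel True by (simp add: D_def b_def)
        then show ?thesis using N0 True by (simp add: norm_mult power_mult_distrib z_def)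
      qed
      have "real (count M' 0 + 1) * (cmod (\<Psi> M))\<^sup>2 \<le> N0 * (\<Prod>p\<in>insert 0 P. wn p (count M' p))"
        unfolding r using N0 less[of M'] M by (intro mult_left_mono) auto
      also have "\<dots> = real (count M' 0 + 1) * (\<Prod>p\<in>insert 0 P. wn p (count M p))"
        using finP P0 cM wn0[of "count M' 0"] by (simp add: eq)
      finally show ?thesis by simp
    next
      case p0: False
      have bal: "count M (- p) = count M' p + 1"
        using Psi_balanced[OF p0, of M] False M by simp
      \<comment> \<open>The square root factors of annihilating p and of creating -p are therefore
        equal and cancel, leaving the plain factor \<open>cc p\<close>.\<close>
      then have in_M': "count M' (- p) = count M' p + 1"
        using uminus_neq[OF p0] M by simp
      then have "- p \<in># M'" by (metis Suc_eq_plus1 count_greater_zero_iff zero_less_Suc)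
      define M2 where "M2 = M' - {#- p#}"
      have M': "M' = add_mset (- p) M2" using \<open>- p \<in># M'\<close> by (simp add: M2_def)
      have mp: "- p \<in> P" "p \<in> P" using pS p0 P_sym by auto
      have P0: "0 \<notin> P" using P_sub by auto
      have "complex_of_real (sqrt (real (count M' p + 1))) * \<Psi> M
          = complex_of_real (sqrt (real (count M' p + 1))) * (cc p * \<Psi> M2)"
        using rel p0 \<open>- p \<in># M'\<close> in_M' by (simp add: D_def b_def creation_def M2_def algebra_simps)
      then have r: "\<Psi> M = cc p * \<Psi> M2"
        by (metis mult_cancel_left of_real_eq_0_iff real_sqrt_eq_zero_cancel_iff of_nat_eq_0_iff Suc_eq_plus1 nat.distinct(2))
      have eq: "(\<Prod>q\<in>insert 0 P. wn q (count M q)) = (c p)\<^sup>2 * (\<Prod>q\<in>insert 0 P. wn q (count M2 q))"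
      proof -
        have "(\<Prod>q\<in>insert 0 P. wn q (count M q)) = (\<Prod>q\<in>insert 0 P. (if q = p then \<bar>c p\<bar> else 1) * (if q = - p then \<bar>c p\<bar> else 1) * wn q (count M2 q))"
          using p0 by (intro prod.cong) (auto simp: M M' wn_def c_sym)
        also have "\<dots> = (\<Prod>q\<in>insert 0 P. if q = p then \<bar>c p\<bar> else 1) * (\<Prod>q\<in>insert 0 P. if q = - p then \<bar>c p\<bar> else 1) * (\<Prod>q\<in>insert 0 P. wn q (count M2 q))"
          by (simp only: prod.distrib)
        also have "(\<Prod>q\<in>insert 0 P. if q = p then \<bar>c p\<bar> else 1) = \<bar>c p\<bar>"
          using mp finP by (subst prod.delta) auto
        also have "(\<Prod>q\<in>insert 0 P. if q = - p then \<bar>c p\<bar> else 1) = \<bar>c p\<bar>"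
          using mp finP by (subst prod.delta) auto
        finally show ?thesis by (simp add: power2_eq_square)
      qed
      have "(cmod (\<Psi> M))\<^sup>2 = (c p)\<^sup>2 * (cmod (\<Psi> M2))\<^sup>2"
        by (simp add: r norm_mult power_mult_distrib cc_def)
      also have "\<dots> \<le> (c p)\<^sup>2 * (\<Prod>q\<in>insert 0 P. wn q (count M2 q))"
        using less[of M2] M M' by (intro mult_left_mono) auto
      finally show ?thesis using eq by simp
    qed
  qed
qed

lemma one_plus_sum_le_prod:
  fixes f :: "'a \<Rightarrow> real"
  assumes "finite A" "\<And>x. x \<in> A \<Longrightarrow> f x \<ge> 0"
  shows "1 + sum f A \<le> (\<Prod>x\<in>A. 1 + f x)"
  using assms
proof (induction A rule: finite_induct)
  case (insert x A)
  have "1 + sum f (insert x A) \<le> (1 + f x) * (1 + sum f A)"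
    using insert sum_nonneg[of A f] by (simp add: algebra_simps)
  also have "\<dots> \<le> (1 + f x) * (\<Prod>x\<in>A. 1 + f x)"
    using insert by (intro mult_left_mono) auto
  finally show ?case using insert by simp
qed auto

lemma summable_poly_geometric:
  fixes x :: real
  assumes "\<bar>x\<bar> < 1"
  shows "summable (\<lambda>n. (1 + real n) ^ k * \<bar>x\<bar> ^ n)"
proof (cases "x = 0")
  case True
  then show ?thesis by (intro summable_finite[of "{0}"]) auto
next
  case False
  show ?thesis
  proof (rule summable_comparison_test_ev)
    define y where "y = (1 + \<bar>x\<bar>) / 2"
    have y: "\<bar>x\<bar> < y" "y < 1" "0 < y" using assms by (auto simp: y_def)
    show "summable (\<lambda>n. y ^ n)" using y by (intro summable_geometric) auto
    have "((\<lambda>n. (1 + real n) ^ k * (\<bar>x\<bar> / y) ^ n) \<longlongrightarrow> 0) sequentially"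
    proof (cases "k = 0")
      case True
      then show ?thesis using y by (auto intro!: LIMSEQ_power_zero)
    next
      case k: False
      \<comment> \<open>With the k-th root of the ratio, the polynomial times the geometric term is
        the k-th power of (1 + n) * r^n, which tends to 0.\<close>
      define r where "r = root k (\<bar>x\<bar> / y)"
      have r: "r ^ k = \<bar>x\<bar> / y" "0 \<le> r" "r < 1" using k y by (auto simp: r_def)
      have "(\<lambda>n. ((r ^ n + real n * r ^ n) ^ k)) \<longlonglongrightarrow> (0 + 0) ^ k"
        using r by (intro tendsto_intros LIMSEQ_power_zero powser_times_n_limit_0) auto
      moreover have "(r ^ n + real n * r ^ n) ^ k = (1 + real n) ^ k * (\<bar>x\<bar> / y) ^ n" for n
      proof -
        have "r ^ n + real n * r ^ n = (1 + real n) * r ^ n" by (simp add: algebra_simps)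
        moreover have "(r ^ n) ^ k = (r ^ k) ^ n" by (simp add: power_mult[symmetric] mult.commute)
        ultimately show ?thesis using r by (simp add: power_mult_distrib)
      qed
      ultimately show ?thesis using k by (simp add: power_0_left)
    qed
    then have "\<forall>\<^sub>F n in sequentially. (1 + real n) ^ k * (\<bar>x\<bar> / y) ^ n < 1"
      by (rule order_tendstoD) auto
    then show "\<forall>\<^sub>F n in sequentially. norm ((1 + real n) ^ k * \<bar>x\<bar> ^ n) \<le> y ^ n"
      by eventually_elim (use y in \<open>auto simp: power_divide divide_simps abs_mult power_abs\<close>)
  qed
qed


text \<open>1 + \<open>size M\<close> is at most the product of 1 + \<open>count M p\<close> over
  the modes. The weighted norm is therefore bounded by a product of one-mode series: an exponential
  series for the condensate and polynomial times geometric ones for the pairs.\<close>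

lemma Psi_rapid: "\<Psi> \<in> rapid"
  unfolding rapid_def
proof (intro CollectI allI)
  fix k
  let ?S = "insert 0 P"
  define g where "g p n = (1 + real n) ^ k * wn p n" for p n
  have "(\<lambda>M. \<Prod>p\<in>?S. g p (count M p)) summable_on {M. set_mset M \<subseteq> ?S}"
  proof (rule summable_on_multiset_prod)
    fix p assume "p \<in> ?S"
    have "summable (g p)"
    proof (cases "p = 0")
      case True
      have "summable (\<lambda>n. (1 + real n) ^ k * (1/2) ^ n)"
        using summable_poly_geometric[of "1/2" k] by simp
      then have "(\<lambda>n. (1 + real n) ^ k * (1/2) ^ n) \<longlonglongrightarrow> 0" by (rule summable_LIMSEQ_zero)
      then have ev: "\<forall>\<^sub>F n in sequentially. (1 + real n) ^ k * (1/2) ^ n < 1"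
        by (rule order_tendstoD) auto
      have "summable (\<lambda>n. inverse (fact n) * (2 * N0) ^ n)" by (rule summable_exp)
      then show ?thesis
      proof (rule summable_comparison_test_ev[rotated])
        show "\<forall>\<^sub>F n in sequentially. norm (g p n) \<le> inverse (fact n) * (2 * N0) ^ n"
          using ev
        proof eventually_elim
          case (elim n)
          \<comment> \<open>The polynomial weight is absorbed by doubling \<open>N0\<close> in the
            exponential series.\<close>
          then have "(1 + real n) ^ k \<le> 2 ^ n" by (simp add: power_one_over field_simps)
          then have "(1 + real n) ^ k * (N0 ^ n / fact n) \<le> 2 ^ n * (N0 ^ n / fact n)"
            using N0 by (intro mult_right_mono) auto
          then show ?case using True N0 by (simp add: g_def wn_def power_mult_distrib field_simps)
        qed
      qed
    next
      case False
      then show ?thesis using summable_poly_geometric[OF c_less[of p]] by (simp add: g_def[abs_def] wn_def)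
    qed
    moreover have "norm (g p n) = g p n" for n by (simp add: g_def)
    ultimately show "g p summable_on UNIV"
      by (intro norm_summable_imp_summable_on) simp
  qed (auto simp: g_def finP)
  then have s: "(\<lambda>M. if set_mset M \<subseteq> ?S then \<Prod>p\<in>?S. g p (count M p) else 0) summable_on UNIV"
    by (rule summable_on_cong_neutral[THEN iffD1, rotated -1]) auto
  show "wt k \<Psi> summable_on UNIV"
  proof (rule summable_on_comparison_test[OF s])
    fix M
    show "wt k \<Psi> M \<le> (if set_mset M \<subseteq> ?S then \<Prod>p\<in>?S. g p (count M p) else 0)"
    proof (cases "set_mset M \<subseteq> ?S")
      case True
      have "real (size M) = (\<Sum>p\<in>?S. real (count M p))"
        using True finP by (simp add: size_multiset_overloaded_eq sum.mono_neutral_left[of ?S "set_mset M"] not_in_iff del: sum.insert)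
      then have "1 + real (size M) \<le> (\<Prod>p\<in>?S. 1 + real (count M p))"
        using one_plus_sum_le_prod[of ?S "\<lambda>p. real (count M p)"] finP by (simp del: sum.insert prod.insert)
      then have "wt k \<Psi> M \<le> (\<Prod>p\<in>?S. 1 + real (count M p)) ^ k * (\<Prod>p\<in>?S. wn p (count M p))"
        unfolding wt_def by (intro mult_mono power_mono Psi_bound) (auto intro!: prod_nonneg mult_nonneg_nonneg)
      also have "\<dots> = (\<Prod>p\<in>?S. g p (count M p))"
        unfolding g_def prod.distrib prod_power_distrib ..
      finally show ?thesis using True by simp
    next
      case False
      then have "\<Psi> M = 0" using Psi_supp[of M] by blast
      then show ?thesis using False by (simp add: wt_def)
    qed
  qed simp
qed

end

section \<open>Wick's rule for the trial state\<close>

context pair_state begin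

lemma ip_zero [simp]: "fock_inner (\<lambda>M. 0) \<phi> = 0"
  by (simp add: fock_inner_def)

abbreviation "S \<equiv> insert 0 P"

abbreviation ip :: "(real^3) fock \<Rightarrow> complex" where "ip \<psi> \<equiv> fock_inner \<psi> \<Psi>"

definition nn :: complex where "nn = fock_inner \<Psi> \<Psi>"
text \<open>For nonzero momentum \<open>ga p\<close> is the expectation of the number operator of p
  and \<open>al p\<close> that of the product of the annihilation operators of p and -p, as
  \<open>two_point\<close> and \<open>pair_point\<close> show.\<close>

definition ga :: "real^3 \<Rightarrow> real" where "ga p = (c p)\<^sup>2 / (1 - (c p)\<^sup>2)"
definition al :: "real^3 \<Rightarrow> real" where "al p = c p / (1 - (c p)\<^sup>2)"

lemma nn_neq_0: "nn \<noteq> 0"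
proof -
  have s: "wt 0 \<Psi> summable_on UNIV" using Psi_rapid by (rule rapidD)
  have "nn = (\<Sum>\<^sub>\<infinity>M. complex_of_real (wt 0 \<Psi> M))"
    unfolding nn_def fock_inner_def wt_def by (simp add: complex_norm_square mult.commute del: of_real_power)
  also have "\<dots> = complex_of_real (\<Sum>\<^sub>\<infinity>M. wt 0 \<Psi> M)"
    using s by (intro infsumI has_sum_of_real has_sum_infsum)
  finally have "nn = complex_of_real (\<Sum>\<^sub>\<infinity>M. wt 0 \<Psi> M)" .
  moreover have "wt 0 \<Psi> {#} \<le> (\<Sum>\<^sub>\<infinity>M. wt 0 \<Psi> M)"
    using finite_sum_le_infsum[OF s, of "{{#}}"] by simp
  ultimately show ?thesis by (auto simp: wt_def Psi_empty)
qed

lemma c2_less: "(c p)\<^sup>2 < 1"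
  using c_less[of p] by (simp add: abs_square_less_1)

lemma annihilation_left: "ip (annihilation s \<psi>) = fock_inner \<psi> (creation s \<Psi>)"
  by (simp add: creation_adjoint)

lemma creation_left: "ip (creation s \<psi>) = fock_inner \<psi> (annihilation s \<Psi>)"
  by (metis creation_adjoint fock_inner_cnj)

lemma ip_add: "\<psi> \<in> rapid \<Longrightarrow> \<phi> \<in> rapid \<Longrightarrow> ip (\<lambda>M. \<psi> M + \<phi> M) = ip \<psi> + ip \<phi>"
  by (subst (1 2 3) fock_inner_cnj) (simp add: fock_inner_add Psi_rapid)

lemma ip_scale: "ip (\<lambda>M. complex_of_real a * \<psi> M) = complex_of_real a * ip \<psi>"
  by (subst (1 2) fock_inner_cnj) (simp add: fock_inner_scale)

text \<open>\<open>annihilation s\<close> acts on \<Psi> as \<open>D s\<close>; its creation part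
  moves to the left as \<open>annihilation (- s)\<close>, which equals \<open>D (- s)\<close> up to
  the contractions \<open>\<zeta>\<close>. The creation part of that reproduces the initial
  expression with factor c^2. Solving this linear equation gives the denominator 1 - c^2.\<close>

lemma wick_step:
  assumes "\<eta> \<in> rapid" "\<zeta> \<in> rapid"
    and comm: "annihilation (- s) \<eta> = (\<lambda>M. D (- s) \<eta> M + \<zeta> M)"
  shows "fock_inner \<eta> (annihilation s \<Psi>) = b s * ip \<eta> + complex_of_real (al s) * ip \<zeta>"
proof -
  let ?G = "fock_inner \<eta> (annihilation s \<Psi>)"
  have b_eq: "b s = complex_of_real (if s = 0 then sqrt N0 else 0)" "b (- s) = b s"
    by (auto simp: b_def z_def)
  have "?G = cc s * fock_inner \<eta> (creation (- s) \<Psi>) + b s * ip \<eta>"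
    unfolding annihilation_Psi D_def
    using assms(1) Psi_rapid by (simp add: fock_inner_add fock_inner_scale rapid_creation rapid_scale)
  also have "fock_inner \<eta> (creation (- s) \<Psi>) = ip (annihilation (- s) \<eta>)"
    by (rule annihilation_left[symmetric])
  also have "\<dots> = cc s * ip (creation s \<eta>) + b s * ip \<eta> + ip \<zeta>"
    unfolding comm D_def using assms(1,2)
    by (simp add: ip_add rapid_add rapid_scale rapid_creation b_eq(2) cc_def c_sym)
       (simp add: b_eq ip_scale)
  also have "ip (creation s \<eta>) = ?G" by (rule creation_left)
  finally have e: "?G = cc s * (cc s * ?G + b s * ip \<eta> + ip \<zeta>) + b s * ip \<eta>" .
  \<comment> \<open>\<open>c\<close> vanishes at momentum 0 and \<open>b\<close> everywhere else, so
    pairs and condensate do not mix.\<close>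
  have cb: "cc s * b s = 0" by (auto simp: b_def)
  from e have "(1 - (cc s)\<^sup>2) * ?G = cc s * b s * ip \<eta> + cc s * ip \<zeta> + b s * ip \<eta>"
    by (simp add: power2_eq_square algebra_simps)
  then have *: "(1 - (cc s)\<^sup>2) * ?G = cc s * ip \<zeta> + b s * ip \<eta>" using cb by simp
  have ne: "1 - (cc s)\<^sup>2 \<noteq> 0"
  proof -
    have "1 - (cc s)\<^sup>2 = complex_of_real (1 - (c s)\<^sup>2)" by (simp add: cc_def)
    then show ?thesis using c2_less[of s] by (metis of_real_eq_0_iff less_irrefl diff_gt_0_iff_gt)
  qed
  have al: "complex_of_real (al s) * (1 - (cc s)\<^sup>2) = cc s"
    using ne by (simp add: al_def cc_def)
  have bb: "b s * (1 - (cc s)\<^sup>2) = b s" using cb by (simp add: algebra_simps power2_eq_square)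
  have "(1 - (cc s)\<^sup>2) * ?G = (1 - (cc s)\<^sup>2) * (b s * ip \<eta> + complex_of_real (al s) * ip \<zeta>)"
    unfolding * by (simp add: distrib_left mult.assoc[symmetric] mult.commute[of "1 - (cc s)\<^sup>2"] al bb)
  then show ?thesis using ne by simp
qed

definition dl :: "real^3 \<Rightarrow> real^3 \<Rightarrow> complex" where "dl p q = (if p = q then 1 else 0)"

lemma ga_eq: "ga p = al p * c p"
  by (simp add: ga_def al_def power2_eq_square)

lemma one_point: "fock_inner \<Psi> (annihilation s \<Psi>) = b s * nn"
  using wick_step[OF Psi_rapid rapid_zero, of s] by (simp add: annihilation_Psi nn_def)

lemma one_point': "ip (annihilation s \<Psi>) = b s * nn"
  using one_point[of s] fock_inner_cnj[of "annihilation s \<Psi>" \<Psi>] fock_inner_cnj[of \<Psi> \<Psi>]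
  by (simp add: b_def z_def nn_def split: if_splits)

lemma annihilation_D: "annihilation p (D q \<psi>) = (\<lambda>M. D q (annihilation p \<psi>) M + cc q * dl p (- q) * \<psi> M)"
  unfolding D_def annihilation_add annihilation_scale annihilation_creation
  by (auto simp: dl_def fun_eq_iff algebra_simps)

lemma cc_uminus [simp]: "cc (- p) = cc p"
  by (simp add: cc_def c_sym)

lemma annihilation_creation': "annihilation p (creation q \<psi>) = (\<lambda>M. creation q (annihilation p \<psi>) M + dl q p * \<psi> M)"
  unfolding annihilation_creation dl_def by (simp add: eq_commute)

text \<open>How the contraction terms grow when one more annihilation operator stands on the left:
  the new operator contributes its own contraction with s.\<close>

lemma annihilation_step:
  assumes "annihilation (- s) \<psi> = (\<lambda>M. D (- s) \<psi> M + \<zeta> M)"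
  shows "annihilation (- s) (annihilation q \<psi>)
    = (\<lambda>M. D (- s) (annihilation q \<psi>) M + (cc s * dl q s * \<psi> M + annihilation q \<zeta> M))"
  unfolding commutator_annihilation[of "- s" q] assms annihilation_add annihilation_D
  by (simp add: algebra_simps)

lemma annihilation2_Psi:
  "annihilation (- s) (annihilation q \<Psi>) = (\<lambda>M. D (- s) (annihilation q \<Psi>) M + cc s * dl q s * \<Psi> M)"
  unfolding commutator_annihilation[of "- s" q] annihilation_Psi[of "- s"] annihilation_D
  by (simp add: cc_def c_sym)

lemma two_point: "fock_inner (annihilation q \<Psi>) (annihilation s \<Psi>) = (b s * b q + complex_of_real (ga s) * dl q s) * nn"
proof -
  have r: "cc s * dl q s = complex_of_real (if q = s then c s else 0)" by (auto simp: cc_def dl_def)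
  have "fock_inner (annihilation q \<Psi>) (annihilation s \<Psi>) = b s * ip (annihilation q \<Psi>) + complex_of_real (al s) * ip (\<lambda>M. cc s * dl q s * \<Psi> M)"
    using Psi_rapid by (intro wick_step annihilation2_Psi) auto
  then show ?thesis
    unfolding one_point' r ip_scale by (simp add: nn_def ga_eq dl_def algebra_simps)
qed

lemma creation_D: "creation p (D q \<psi>) = D q (creation p \<psi>)"
  by (auto simp: D_def creation_add creation_scale commutator_creation[of p])

lemma pair_point: "fock_inner (creation r \<Psi>) (annihilation s \<Psi>) = (b s * b r + complex_of_real (al s) * dl r (- s)) * nn"
proof -
  have r: "dl r (- s) = complex_of_real (if r = - s then 1 else 0)" by (auto simp: dl_def)
  have "annihilation (- s) (creation r \<Psi>) = (\<lambda>M. D (- s) (creation r \<Psi>) M + dl r (- s) * \<Psi> M)"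
    unfolding annihilation_creation annihilation_Psi creation_D by (auto simp: dl_def)
  then have "fock_inner (creation r \<Psi>) (annihilation s \<Psi>) = b s * ip (creation r \<Psi>) + complex_of_real (al s) * ip (\<lambda>M. dl r (- s) * \<Psi> M)"
    using Psi_rapid by (intro wick_step) auto
  then show ?thesis
    unfolding creation_left one_point r ip_scale by (simp add: nn_def algebra_simps)
qed

lemma three_point: "fock_inner (annihilation q (annihilation p \<Psi>)) (annihilation r \<Psi>)
   = (b r * (b p * b q + complex_of_real (al p) * dl q (- p)) + complex_of_real (ga r) * (dl q r * b p + dl p r * b q)) * nn"
proof -
  let ?\<zeta> = "\<lambda>M. cc r * dl q r * annihilation p \<Psi> M + cc r * dl p r * annihilation q \<Psi> M"
  have comm: "annihilation (- r) (annihilation q (annihilation p \<Psi>)) = (\<lambda>M. D (- r) (annihilation q (annihilation p \<Psi>)) M + ?\<zeta> M)"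
    using annihilation_step[OF annihilation2_Psi[of r p], of q]
    unfolding annihilation_scale by (simp add: add.commute)
  have r: "cc r * dl q r = complex_of_real (if q = r then c r else 0)" for q by (auto simp: cc_def dl_def)
  have "fock_inner (annihilation q (annihilation p \<Psi>)) (annihilation r \<Psi>) = b r * ip (annihilation q (annihilation p \<Psi>)) + complex_of_real (al r) * ip ?\<zeta>"
    using Psi_rapid by (intro wick_step comm rapid_add rapid_scale rapid_annihilation)
  also have "ip ?\<zeta> = cc r * dl q r * ip (annihilation p \<Psi>) + cc r * dl p r * ip (annihilation q \<Psi>)"
    unfolding r using Psi_rapid by (subst ip_add) (auto simp: ip_scale simp del: of_real_mult)
  also have "ip (annihilation q (annihilation p \<Psi>)) = cnj (fock_inner (creation q \<Psi>) (annihilation p \<Psi>))"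
    using fock_inner_cnj creation_adjoint by (metis annihilation_left fock_inner_cnj)
  also have "\<dots> = (b p * b q + complex_of_real (al p) * dl q (- p)) * nn"
    unfolding pair_point using fock_inner_cnj[of \<Psi> \<Psi>] by (simp add: b_def z_def dl_def nn_def)
  finally show ?thesis
    unfolding one_point' of_real_mult ga_eq cc_def by algebra
qed

text \<open>The operator r is first moved to the left as a creation operator, and then
  \<open>wick_step\<close> removes s. Contracting s with r yields \<open>al s\<close>, contracting
  it with p or q yields \<open>ga s\<close>; the rest is reduced to the formulas for fewer
  operators.\<close>

lemma four_point: "fock_inner (annihilation q (annihilation p \<Psi>)) (annihilation r (annihilation s \<Psi>))
   = (b s * (b r * (b p * b q + complex_of_real (al p) * dl q (- p)) + complex_of_real (ga r) * (dl q r * b p + dl p r * b q))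
      + complex_of_real (al s) * dl r (- s) * (b p * b q + complex_of_real (al p) * dl q (- p))
      + complex_of_real (ga s) * (dl q s * (b r * b p + complex_of_real (ga r) * dl p r) + dl p s * (b r * b q + complex_of_real (ga r) * dl q r))) * nn"
proof -
  let ?X = "annihilation q (annihilation p \<Psi>)"
  let ?\<zeta> = "\<lambda>M. dl r (- s) * ?X M + (cc s * dl q s * creation r (annihilation p \<Psi>) M + cc s * dl p s * creation r (annihilation q \<Psi>) M)"
  have comm0: "annihilation (- s) ?X = (\<lambda>M. D (- s) ?X M + (cc s * dl q s * annihilation p \<Psi> M + cc s * dl p s * annihilation q \<Psi> M))"
    using annihilation_step[OF annihilation2_Psi[of s p], of q]
    unfolding annihilation_scale .
  have comm: "annihilation (- s) (creation r ?X) = (\<lambda>M. D (- s) (creation r ?X) M + ?\<zeta> M)"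
    unfolding annihilation_creation' comm0 creation_add creation_scale creation_D
    by (simp add: add_ac)
  have r: "cc s * dl q s = complex_of_real (if q = s then c s else 0)" for q by (auto simp: cc_def dl_def)
  have r2: "dl r (- s) = complex_of_real (if r = - s then 1 else 0)" by (auto simp: dl_def)
  have "fock_inner ?X (annihilation r (annihilation s \<Psi>)) = fock_inner (creation r ?X) (annihilation s \<Psi>)"
    by (metis creation_adjoint fock_inner_cnj)
  also have "\<dots> = b s * ip (creation r ?X) + complex_of_real (al s) * ip ?\<zeta>"
    using Psi_rapid by (intro wick_step comm rapid_add rapid_scale rapid_creation rapid_annihilation)
  also have "ip ?\<zeta> = dl r (- s) * ip ?X + (cc s * dl q s * ip (creation r (annihilation p \<Psi>)) + cc s * dl p s * ip (creation r (annihilation q \<Psi>)))"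
    unfolding r r2 by (simp only: ip_scale ip_add rapid_add rapid_scale rapid_creation rapid_annihilation Psi_rapid)
  also have "ip ?X = cnj (fock_inner (creation q \<Psi>) (annihilation p \<Psi>))"
    using fock_inner_cnj creation_adjoint by (metis annihilation_left fock_inner_cnj)
  also have "\<dots> = (b p * b q + complex_of_real (al p) * dl q (- p)) * nn"
    unfolding pair_point using fock_inner_cnj[of \<Psi> \<Psi>] by (simp add: b_def z_def dl_def nn_def)
  finally show ?thesis
    unfolding creation_left three_point two_point of_real_mult ga_eq cc_def by algebra
qed

end

section \<open>The energy expectation\<close>

definition triples :: "'a::ab_group_add set \<Rightarrow> ('a \<times> 'a \<times> 'a) set" where
  "triples A = {(p, q, u). p \<in> A \<and> q \<in> A \<and> p - u \<in> A \<and> q + u \<in> A}"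

lemma finite_triples: "finite A \<Longrightarrow> finite (triples A)"
proof -
  assume A: "finite A"
  have "triples A \<subseteq> (\<lambda>(p, q, r). (p, q, p - r)) ` (A \<times> A \<times> A)"
  proof
    fix t assume "t \<in> triples A"
    then obtain p q u where t: "t = (p, q, u)" "p \<in> A" "q \<in> A" "p - u \<in> A" by (auto simp: triples_def)
    then have "t = (\<lambda>(p, q, r). (p, q, p - r)) (p, q, p - u)" by simp
    then show "t \<in> (\<lambda>(p, q, r). (p, q, p - r)) ` (A \<times> A \<times> A)" using t by (intro image_eqI[of _ _ "(p, q, p - u)"]) auto
  qed
  then show ?thesis by (rule finite_subset) (use A in auto)
qed


text \<open>Each of the three Wick contractions forces one relation among p, q, u. The surviving
  triples then form a two-parameter family indexed by pairs of modes.\<close>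

lemma sum_triples_reindex:
  assumes "finite A" "inj_on i (A \<times> A)" "i ` (A \<times> A) \<subseteq> triples A" "\<And>t. t \<in> triples A - i ` (A \<times> A) \<Longrightarrow> g t = (0::real)"
    "\<And>p r. p \<in> A \<Longrightarrow> r \<in> A \<Longrightarrow> g (i (p, r)) = f p r"
  shows "(\<Sum>t\<in>triples A. g t) = (\<Sum>p\<in>A. \<Sum>r\<in>A. f p r)"
proof -
  have "(\<Sum>t\<in>triples A. g t) = (\<Sum>t\<in>i ` (A \<times> A). g t)"
    using assms by (intro sum.mono_neutral_right finite_triples) auto
  also have "\<dots> = (\<Sum>x\<in>A \<times> A. g (i x))" using assms(2) by (simp add: sum.reindex)
  also have "\<dots> = (\<Sum>(p, r)\<in>A \<times> A. f p r)" using assms(5) by (intro sum.cong) auto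
  finally show ?thesis by (simp add: sum.cartesian_product)
qed

lemma sum_triples_opposite:
  fixes f :: "'a::ab_group_add \<Rightarrow> 'a \<Rightarrow> real"
  assumes "finite A" and sym: "\<And>p. p \<in> A \<Longrightarrow> - p \<in> A"
  shows "(\<Sum>(p, q, u)\<in>triples A. if q = - p then f p (p - u) else 0) = (\<Sum>p\<in>A. \<Sum>r\<in>A. f p r)"
proof (rule sum_triples_reindex[OF assms(1), where i = "\<lambda>(x, y). (x, - x, x - y)"])
  fix t assume t: "t \<in> triples A - (\<lambda>(x, y). (x, - x, x - y)) ` (A \<times> A)"
  obtain p q u where pqu: "t = (p, q, u)" by (cases t)
  have "q \<noteq> - p"
  proof
    assume "q = - p"
    then have "t = (\<lambda>(x, y). (x, - x, x - y)) (p, p - u)" "(p, p - u) \<in> A \<times> A" using t pqu by (auto simp: triples_def)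
    then show False using t by blast
  qed
  then show "(case t of (p, q, u) \<Rightarrow> if q = - p then f p (p - u) else 0) = 0" using pqu by simp
next
  show "(\<lambda>(x, y). (x, - x, x - y)) ` (A \<times> A) \<subseteq> triples A"
    using sym by (simp add: triples_def image_subset_iff)
qed (auto simp: inj_on_def)

lemma sum_triples_direct:
  fixes f :: "'a::ab_group_add \<Rightarrow> 'a \<Rightarrow> real"
  assumes "finite A"
  shows "(\<Sum>(p, q, u)\<in>triples A. if u = 0 then f p q else 0) = (\<Sum>p\<in>A. \<Sum>r\<in>A. f p r)"
proof (rule sum_triples_reindex[OF assms(1), where i = "\<lambda>(x, y). (x, y, 0)"])
  fix t assume t: "t \<in> triples A - (\<lambda>(x, y). (x, y, 0)) ` (A \<times> A)"
  obtain p q u where pqu: "t = (p, q, u)" by (cases t)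
  have "u \<noteq> 0"
  proof
    assume "u = 0"
    then have "t = (\<lambda>(x, y). (x, y, 0)) (p, q)" "(p, q) \<in> A \<times> A" using t pqu by (auto simp: triples_def)
    then show False using t by blast
  qed
  then show "(case t of (p, q, u) \<Rightarrow> if u = 0 then f p q else 0) = 0" using pqu by simp
qed (auto simp: inj_on_def triples_def)

lemma sum_triples_exchange:
  fixes f :: "'a::ab_group_add \<Rightarrow> 'a \<Rightarrow> real"
  assumes "finite A"
  shows "(\<Sum>(p, q, u)\<in>triples A. if q = p - u then f p q else 0) = (\<Sum>p\<in>A. \<Sum>r\<in>A. f p r)"
proof (rule sum_triples_reindex[OF assms(1), where i = "\<lambda>(x, y). (x, y, x - y)"])
  fix t assume t: "t \<in> triples A - (\<lambda>(x, y). (x, y, x - y)) ` (A \<times> A)"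
  obtain p q u where pqu: "t = (p, q, u)" by (cases t)
  have "q \<noteq> p - u"
  proof
    assume "q = p - u"
    then have "t = (\<lambda>(x, y). (x, y, x - y)) (p, q)" "(p, q) \<in> A \<times> A" using t pqu by (auto simp: triples_def)
    then show False using t by blast
  qed
  then show "(case t of (p, q, u) \<Rightarrow> if q = p - u then f p q else 0) = 0" using pqu by simp
qed (auto simp: inj_on_def triples_def)

context pair_state begin

lemma S_sub: "S \<subseteq> dual_lattice L"
  using P_sub by auto

lemma finS: "finite S"
  using finP by simp

lemma P0: "0 \<notin> P"
  using P_sub by auto

lemma S_sym: "p \<in> S \<Longrightarrow> - p \<in> S"
  using P_sym by auto

lemma sum_number_eq:
  fixes w :: "real^3 \<Rightarrow> complex"
  shows "(\<Sum>\<^sub>\<infinity>m\<in>dual_lattice L. w m * creation m (annihilation m \<Psi>) M) = (\<Sum>m\<in>S. w m * creation m (annihilation m \<Psi>) M)"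
proof -
  have "(\<Sum>\<^sub>\<infinity>m\<in>dual_lattice L. w m * creation m (annihilation m \<Psi>) M) = (\<Sum>\<^sub>\<infinity>m\<in>S. w m * creation m (annihilation m \<Psi>) M)"
  proof (rule infsum_cong_neutral)
    fix m assume "m \<in> dual_lattice L - S"
    then show "w m * creation m (annihilation m \<Psi>) M = 0"
      using b_out[of m] by (simp add: creation_zero)
  qed (use S_sub in auto)
  also have "\<dots> = (\<Sum>m\<in>S. w m * creation m (annihilation m \<Psi>) M)"
    using finS by (rule infsum_finite)
  finally show ?thesis .
qed

lemma number_op_eq: "number_op L \<Psi> = (\<lambda>M. \<Sum>m\<in>S. creation m (annihilation m \<Psi>) M)"
  unfolding number_op_def using sum_number_eq[of "\<lambda>_. 1"] by simp

lemma kinetic_eq: "kinetic L \<Psi> = (\<lambda>M. \<Sum>m\<in>S. complex_of_real ((norm m)\<^sup>2) * creation m (annihilation m \<Psi>) M)"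
  unfolding kinetic_def using sum_number_eq[of "\<lambda>p. complex_of_real ((norm p)\<^sup>2)"] by simp

lemma kinetic_rapid: "kinetic L \<Psi> \<in> rapid"
  unfolding kinetic_eq using Psi_rapid by (intro rapid_sum rapid_scale rapid_creation rapid_annihilation)

lemma number_op_rapid: "number_op L \<Psi> \<in> rapid"
  unfolding number_op_eq using Psi_rapid by (intro rapid_sum rapid_creation rapid_annihilation)

lemma rapid_fock_space:
  assumes "\<psi> \<in> rapid" "\<And>M. \<psi> M \<noteq> 0 \<Longrightarrow> set_mset M \<subseteq> dual_lattice L"
  shows "\<psi> \<in> fock_space (dual_lattice L)"
  using assms rapidD[OF assms(1), of 0] by (simp add: fock_space_def wt_def[abs_def])

lemma Psi_fock: "\<Psi> \<in> fock_space (dual_lattice L)"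
  using Psi_rapid Psi_supp S_sub by (intro rapid_fock_space) blast+

lemma number_op_neq_0: "number_op L \<Psi> M \<noteq> 0 \<Longrightarrow> \<Psi> M \<noteq> 0"
  unfolding number_op_eq by (auto simp: number_apply)

lemma kinetic_neq_0: "kinetic L \<Psi> M \<noteq> 0 \<Longrightarrow> \<Psi> M \<noteq> 0"
  unfolding kinetic_eq by (auto simp: number_apply)

lemma Psi_number_domain: "\<Psi> \<in> number_domain L"
  unfolding number_domain_def
proof (intro CollectI conjI Psi_fock rapid_fock_space number_op_rapid)
  show "set_mset M \<subseteq> dual_lattice L" if "number_op L \<Psi> M \<noteq> 0" for M
    using Psi_supp[OF number_op_neq_0[OF that]] S_sub by blast
qed

definition bet :: "real^3 \<Rightarrow> real" where "bet p = (if p = 0 then sqrt N0 else 0)"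
text \<open>The condensate is merged into the pairing and occupation functions at momentum 0, so
  that each contraction is a single expression for all modes.\<close>

definition alt :: "real^3 \<Rightarrow> real" where "alt p = (if p = 0 then N0 else al p)"
definition gt :: "real^3 \<Rightarrow> real" where "gt p = (if p = 0 then N0 else ga p)"

lemma b_bet: "b p = complex_of_real (bet p)"
  by (simp add: b_def bet_def z_def)

lemma al_0 [simp]: "al 0 = 0" and ga_0 [simp]: "ga 0 = 0"
  using c_out[of 0] P0 by (auto simp: al_def ga_def)

lemma abs_N0 [simp]: "\<bar>N0\<bar> = N0"
  using N0 by simp

lemma fock_inner_creation: "fock_inner \<phi> (\<lambda>M. w * creation p \<psi> M) = w * fock_inner (annihilation p \<phi>) \<psi>"
  unfolding fock_inner_scale creation_adjoint ..

lemma two_point_number: "fock_inner (annihilation m \<Psi>) (annihilation m \<Psi>) = complex_of_real (gt m) * nn"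
  using N0 unfolding two_point b_bet by (auto simp: bet_def gt_def dl_def simp flip: of_real_mult of_real_add)

lemma expectation_number: "expectation (number_op L) \<Psi> = complex_of_real (N0 + (\<Sum>m\<in>P. ga m))"
proof -
  have "fock_inner \<Psi> (number_op L \<Psi>) = (\<Sum>m\<in>S. fock_inner (annihilation m \<Psi>) (annihilation m \<Psi>))"
    unfolding number_op_eq using Psi_rapid
    by (subst fock_inner_sum) (auto simp: creation_adjoint rapid_creation rapid_annihilation)
  also have "\<dots> = complex_of_real (\<Sum>m\<in>S. gt m) * nn"
    unfolding two_point_number by (simp add: sum_distrib_right distrib_right del: sum.insert)
  also have "(\<Sum>m\<in>S. gt m) = N0 + (\<Sum>m\<in>P. ga m)"
  proof -
    have "(\<Sum>m\<in>P. gt m) = (\<Sum>m\<in>P. ga m)" using P0 by (intro sum.cong) (auto simp: gt_def)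
    then show ?thesis using finP P0 by (simp add: gt_def)
  qed
  finally show ?thesis using nn_neq_0 by (simp add: expectation_def nn_def)
qed

lemma kinetic_inner: "fock_inner \<Psi> (kinetic L \<Psi>) = complex_of_real (\<Sum>m\<in>P. (norm m)\<^sup>2 * ga m) * nn"
proof -
  have "fock_inner \<Psi> (kinetic L \<Psi>) = (\<Sum>m\<in>S. complex_of_real ((norm m)\<^sup>2) * fock_inner (annihilation m \<Psi>) (annihilation m \<Psi>))"
    unfolding kinetic_eq using Psi_rapid
    by (subst fock_inner_sum) (auto simp: fock_inner_creation rapid_scale rapid_creation rapid_annihilation simp del: of_real_power)
  also have "\<dots> = complex_of_real (\<Sum>m\<in>S. (norm m)\<^sup>2 * gt m) * nn"
    unfolding two_point_number by (simp add: sum_distrib_right distrib_right mult.assoc del: sum.insert)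
  also have "(\<Sum>m\<in>S. (norm m)\<^sup>2 * gt m) = (\<Sum>m\<in>P. (norm m)\<^sup>2 * ga m)"
  proof -
    have "(\<Sum>m\<in>P. (norm m)\<^sup>2 * gt m) = (\<Sum>m\<in>P. (norm m)\<^sup>2 * ga m)" using P0 by (intro sum.cong) (auto simp: gt_def)
    then show ?thesis using finP P0 by simp
  qed
  finally show ?thesis .
qed

definition dr :: "real^3 \<Rightarrow> real^3 \<Rightarrow> real" where "dr p q = (if p = q then 1 else 0)"

lemma dl_dr: "dl p q = complex_of_real (dr p q)"
  by (simp add: dl_def dr_def)

text \<open>In each of the three contractions the merged functions contain the product of four
  condensate amplitudes, which should be counted once. Subtracting 2 * N0^2 at zero momenta corrects
  this. The momentum relation determines s from p, q, r.\<close>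

lemma four_point':
  assumes "p + q = r + s"
  shows "fock_inner (annihilation q (annihilation p \<Psi>)) (annihilation r (annihilation s \<Psi>))
    = complex_of_real (alt p * alt r * dr q (- p) + gt p * gt q * dr p r + gt p * gt q * dr q r
        - (if p = 0 \<and> q = 0 \<and> r = 0 then 2 * N0\<^sup>2 else 0)) * nn"
proof -
  have pair: "bet p * bet q + al p * dr q (- p) = alt p * dr q (- p)" for p q
    by (auto simp: bet_def alt_def dr_def)
  have "bet s * (bet r * (bet p * bet q + al p * dr q (- p)) + ga r * (dr q r * bet p + dr p r * bet q))
      + al s * dr r (- s) * (bet p * bet q + al p * dr q (- p))
      + ga s * (dr q s * (bet r * bet p + ga r * dr p r) + dr p s * (bet r * bet q + ga r * dr q r))
    = alt p * alt r * dr q (- p) + gt p * gt q * dr p r + gt p * gt q * dr q r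
        - (if p = 0 \<and> q = 0 \<and> r = 0 then 2 * N0\<^sup>2 else 0)" (is "?l = ?r")
  proof -
    have "?l = (bet s * bet r + al s * dr r (- s)) * (alt p * dr q (- p))
       + ((bet q * bet s + ga s * dr q s) * (bet p * bet r + ga r * dr p r)
         + (bet p * bet s + ga s * dr p s) * (bet q * bet r + ga r * dr q r))
       - 2 * (bet p * bet q * bet r * bet s)"
      unfolding pair[of p q] by (simp add: algebra_simps)
    also have "(bet s * bet r + al s * dr r (- s)) * (alt p * dr q (- p)) = alt p * alt r * dr q (- p)"
    proof (cases "q = - p")
      case True
      then have "s = - r" using assms by (metis add.right_inverse add_eq_0_iff)
      moreover have "alt s = alt r" using \<open>s = - r\<close> by (simp add: alt_def al_def c_sym)
      ultimately show ?thesis using True pair[of s r] by (simp add: dr_def)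
    qed (simp add: dr_def)
    also have "(bet q * bet s + ga s * dr q s) * (bet p * bet r + ga r * dr p r) = gt p * gt q * dr p r"
      using assms by (auto simp: bet_def gt_def dr_def)
    also have "(bet p * bet s + ga s * dr p s) * (bet q * bet r + ga r * dr q r) = gt p * gt q * dr q r"
    proof (cases "q = r")
      case True
      then have "s = p" using assms by (metis add.commute add_left_cancel)
      then show ?thesis using True by (auto simp: bet_def gt_def dr_def)
    next
      case False
      then show ?thesis by (auto simp: bet_def dr_def)
    qed
    also have "bet p * bet q * bet r * bet s = (if p = 0 \<and> q = 0 \<and> r = 0 then N0\<^sup>2 else 0)"
    proof -
      have "sqrt N0 * sqrt N0 * sqrt N0 * sqrt N0 = N0\<^sup>2"
        using N0 by (simp add: power2_eq_square mult.assoc)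
      then show ?thesis using assms by (auto simp: bet_def)
    qed
    finally show ?thesis by auto
  qed
  then show ?thesis
    unfolding four_point b_bet dl_dr by (simp only: of_real_mult[symmetric] of_real_add[symmetric])
qed

section \<open>The interaction energy and the domain of the Hamiltonian\<close>

context
  fixes V :: "real^3 \<Rightarrow> real" and v :: "real^3 \<Rightarrow> real"
  assumes fourier_v: "\<And>u. fourier V u = complex_of_real (v u)"
    and summable_v: "(\<lambda>u. (v u)\<^sup>2) summable_on dual_lattice L"
begin

abbreviation "It \<equiv> interaction_term V \<Psi>"
abbreviation "\<Lambda>3 \<equiv> dual_lattice L \<times> dual_lattice L \<times> dual_lattice L"

lemma creation_neq_0: "creation p \<psi> M \<noteq> 0 \<Longrightarrow> \<exists>M'. M = add_mset p M' \<and> \<psi> M' \<noteq> 0"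
  by (auto simp: creation_def split: if_splits intro!: exI[of _ "M - {#p#}"])

lemma It_neq_0:
  assumes "It M (p, q, u) \<noteq> 0"
  shows "p \<in># M \<and> q \<in># M \<and> p - u \<in> S \<and> q + u \<in> S \<and> set_mset M \<subseteq> {p, q} \<union> S"
proof -
  let ?X = "annihilation (p - u) (annihilation (q + u) \<Psi>)"
  have "creation p (creation q ?X) M \<noteq> 0"
    using assms by (simp add: interaction_term_def)
  then obtain M2 where M: "M = add_mset p (add_mset q M2)" and X: "?X M2 \<noteq> 0"
    using creation_neq_0 by metis
  have "q + u \<in> S"
  proof (rule ccontr)
    assume *: "q + u \<notin> S"
    from X show False unfolding b_out[OF *] annihilation_zero by simp
  qed
  moreover have "p - u \<in> S"
  proof (rule ccontr)
    assume *: "p - u \<notin> S"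
    from X show False
      unfolding commutator_annihilation[of "p - u" "q + u"] b_out[OF *] annihilation_zero by simp
  qed
  moreover have "set_mset M2 \<subseteq> S"
    using X Psi_supp[of "add_mset (q + u) (add_mset (p - u) M2)"] by (auto simp: annihilation_def)
  ultimately show ?thesis using M by auto
qed

definition Tm :: "(real^3) multiset \<Rightarrow> ((real^3) \<times> (real^3) \<times> (real^3)) set" where
  "Tm M = {t \<in> \<Lambda>3. It M t \<noteq> 0}"

text \<open>A triple is determined by p, p - u and q + u. The first is one of the particles of
  \<open>M\<close>, the others are modes of the state, so the count grows only linearly with
  \<open>size M\<close>.\<close>

lemma Tm_bound: "finite (Tm M)" "card (Tm M) \<le> size M * (card S)\<^sup>2"
proof -
  let ?f = "\<lambda>(p, q, u). (p, p - u, q + u)"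
  have inj: "inj_on ?f (Tm M)" by (auto simp: inj_on_def)
  have sub: "?f ` Tm M \<subseteq> set_mset M \<times> S \<times> S"
    using It_neq_0 by (fastforce simp: Tm_def)
  show "finite (Tm M)"
    using finite_subset[OF sub] finS inj by (auto dest: finite_imageD)
  have "card (Tm M) = card (?f ` Tm M)" using inj by (simp add: card_image)
  also have "\<dots> \<le> card (set_mset M \<times> S \<times> S)" using sub finS by (intro card_mono) auto
  also have "\<dots> = card (set_mset M) * (card S)\<^sup>2" by (simp only: card_cartesian_product power2_eq_square)
  also have "\<dots> \<le> size M * (card S)\<^sup>2"
  proof (rule mult_right_mono)
    show "card (set_mset M) \<le> size M" by (induction M) (auto simp: card_insert_if)
  qed auto
  finally show "card (Tm M) \<le> size M * (card S)\<^sup>2" .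
qed

lemma infsum_It: "(\<Sum>\<^sub>\<infinity>t\<in>\<Lambda>3. It M t) = (\<Sum>t\<in>Tm M. It M t)"
proof -
  have "(\<Sum>\<^sub>\<infinity>t\<in>\<Lambda>3. It M t) = (\<Sum>\<^sub>\<infinity>t\<in>Tm M. It M t)"
    by (rule infsum_cong_neutral) (auto simp: Tm_def)
  then show ?thesis using Tm_bound by simp
qed

lemma summable_It: "It M summable_on \<Lambda>3"
proof -
  have "It M summable_on Tm M" using Tm_bound by simp
  then show ?thesis
    by (rule summable_on_cong_neutral[THEN iffD1, rotated -1]) (auto simp: Tm_def)
qed

definition Iop :: "(real^3) fock" where "Iop M = (\<Sum>\<^sub>\<infinity>t\<in>\<Lambda>3. It M t)"

definition KI :: real where "KI = (\<Sum>r\<in>S. \<Sum>s\<in>S. infsum (wt 3 (annihilation r (annihilation s \<Psi>))) UNIV)"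

lemma sum_It_bound:
  assumes "finite F" "p - u \<in> S" "q + u \<in> S"
  shows "(\<Sum>M\<in>F. real (size M) * (cmod (It M (p, q, u)))\<^sup>2) \<le> 8 * KI * (v u)\<^sup>2"
proof -
  let ?\<phi> = "annihilation (p - u) (annihilation (q + u) \<Psi>)"
  have r: "?\<phi> \<in> rapid" "creation q ?\<phi> \<in> rapid" "creation p (creation q ?\<phi>) \<in> rapid"
    using Psi_rapid by auto
  have "(\<Sum>M\<in>F. real (size M) * (cmod (It M (p, q, u)))\<^sup>2) \<le> (\<Sum>M\<in>F. (v u)\<^sup>2 * wt 1 (creation p (creation q ?\<phi>)) M)"
  proof (rule sum_mono)
    fix M
    show "real (size M) * (cmod (It M (p, q, u)))\<^sup>2 \<le> (v u)\<^sup>2 * wt 1 (creation p (creation q ?\<phi>)) M"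
      by (simp add: interaction_term_def wt_def fourier_v norm_mult power_mult_distrib algebra_simps)
  qed
  also have "\<dots> = (v u)\<^sup>2 * (\<Sum>M\<in>F. wt 1 (creation p (creation q ?\<phi>)) M)"
    by (simp add: sum_distrib_left)
  also have "(\<Sum>M\<in>F. wt 1 (creation p (creation q ?\<phi>)) M) \<le> infsum (wt 1 (creation p (creation q ?\<phi>))) UNIV"
    using assms r by (intro finite_sum_le_infsum rapidD) auto
  also have "\<dots> \<le> 2 ^ 1 * infsum (wt (Suc 1) (creation q ?\<phi>)) UNIV"
    by (rule wt_creation(2)) (rule r)
  also have "infsum (wt (Suc 1) (creation q ?\<phi>)) UNIV \<le> 2 ^ Suc 1 * infsum (wt (Suc (Suc 1)) ?\<phi>) UNIV"
    by (rule wt_creation(2)) (rule r)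
  also have "infsum (wt (Suc (Suc 1)) ?\<phi>) UNIV \<le> KI"
  proof -
    have "infsum (wt 3 ?\<phi>) UNIV \<le> (\<Sum>s\<in>S. infsum (wt 3 (annihilation (p - u) (annihilation s \<Psi>))) UNIV)"
      using assms finS by (intro member_le_sum[where f = "\<lambda>s. infsum (wt 3 (annihilation (p - u) (annihilation s \<Psi>))) UNIV"]) (auto intro: infsum_nonneg)
    also have "\<dots> \<le> KI"
      unfolding KI_def using assms finS
      by (intro member_le_sum[where f = "\<lambda>r. \<Sum>s\<in>S. infsum (wt 3 (annihilation r (annihilation s \<Psi>))) UNIV"]) (auto intro!: sum_nonneg infsum_nonneg simp del: sum.insert)
    finally show ?thesis by (simp add: numeral_3_eq_3)
  qed
  finally show ?thesis by (simp add: mult_left_mono mult_right_mono mult.commute)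
qed

text \<open>By Cauchy-Schwarz and \<open>Tm_bound\<close>, the squared sum costs a factor
  \<open>size M\<close>, absorbed by a weighted norm. Grouping the triples by (p - u, q + u), of
  which there are finitely many, leaves a sum of \<open>(v u)\<^sup>2\<close> over u, which
  converges by \<open>summable_v\<close>.\<close>

lemma Iop_summable: "(\<lambda>M. (cmod (Iop M))\<^sup>2) summable_on UNIV"
proof (rule nonneg_bounded_partial_sums_imp_summable_on)
  define B where "B = (real (card S))\<^sup>2 * (8 * KI * ((real (card S))\<^sup>2 * infsum (\<lambda>u. (v u)\<^sup>2) (dual_lattice L)))"
  have KI0: "KI \<ge> 0" unfolding KI_def by (intro sum_nonneg infsum_nonneg) auto
  show "\<forall>\<^sub>F X in finite_subsets_at_top UNIV. (\<Sum>M\<in>X. (cmod (Iop M))\<^sup>2) \<le> B"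
  proof (intro eventually_finite_subsets_at_top_weakI)
    fix F :: "(real^3) multiset set" assume F: "finite F"
    define TT where "TT = (\<Union>M\<in>F. Tm M)"
    have TT: "finite TT" using F Tm_bound by (auto simp: TT_def)
    have TTs: "p - u \<in> S" "q + u \<in> S" "u \<in> dual_lattice L" if "(p, q, u) \<in> TT" for p q u
      using that It_neq_0 by (auto simp: TT_def Tm_def)
    have "(\<Sum>M\<in>F. (cmod (Iop M))\<^sup>2) \<le> (\<Sum>M\<in>F. (real (card S))\<^sup>2 * (\<Sum>t\<in>TT. real (size M) * (cmod (It M t))\<^sup>2))"
    proof (rule sum_mono)
      fix M assume M: "M \<in> F"
      have "(cmod (Iop M))\<^sup>2 \<le> (\<Sum>t\<in>Tm M. cmod (It M t))\<^sup>2"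
        unfolding Iop_def infsum_It by (intro power_mono norm_sum) auto
      also have "\<dots> \<le> (\<Sum>t\<in>Tm M. (cmod (It M t))\<^sup>2) * card (Tm M)"
        by (rule sum_squared_le_sum_of_squares)
      also have "\<dots> \<le> (\<Sum>t\<in>TT. (cmod (It M t))\<^sup>2) * (real (size M) * (real (card S))\<^sup>2)"
      proof (intro mult_mono)
        have "real (card (Tm M)) \<le> real (size M * (card S)\<^sup>2)" using Tm_bound(2) by (simp only: of_nat_le_iff)
        then show "real (card (Tm M)) \<le> real (size M) * (real (card S))\<^sup>2" by simp
        show "(\<Sum>t\<in>Tm M. (cmod (It M t))\<^sup>2) \<le> (\<Sum>t\<in>TT. (cmod (It M t))\<^sup>2)"
          using M TT by (intro sum_mono2) (auto simp: TT_def)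
      qed (auto intro: sum_nonneg)
      finally show "(cmod (Iop M))\<^sup>2 \<le> (real (card S))\<^sup>2 * (\<Sum>t\<in>TT. real (size M) * (cmod (It M t))\<^sup>2)"
        by (simp add: sum_distrib_left sum_distrib_right mult_ac)
    qed
    also have "\<dots> = (real (card S))\<^sup>2 * (\<Sum>t\<in>TT. \<Sum>M\<in>F. real (size M) * (cmod (It M t))\<^sup>2)"
      by (subst sum.swap) (simp add: sum_distrib_left)
    also have "\<dots> \<le> (real (card S))\<^sup>2 * (\<Sum>t\<in>TT. 8 * KI * (v (snd (snd t)))\<^sup>2)"
    proof (intro mult_left_mono sum_mono)
      fix t assume "t \<in> TT"
      then show "(\<Sum>M\<in>F. real (size M) * (cmod (It M t))\<^sup>2) \<le> 8 * KI * (v (snd (snd t)))\<^sup>2"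
        using sum_It_bound[OF F] TTs by (cases t) auto
    qed auto
    also have "(\<Sum>t\<in>TT. 8 * KI * (v (snd (snd t)))\<^sup>2) = 8 * KI * (\<Sum>t\<in>TT. (v (snd (snd t)))\<^sup>2)"
      by (simp add: sum_distrib_left)
    also have "(\<Sum>t\<in>TT. (v (snd (snd t)))\<^sup>2) \<le> (real (card S))\<^sup>2 * infsum (\<lambda>u. (v u)\<^sup>2) (dual_lattice L)"
    proof -
      \<comment> \<open>A triple is recovered from its two annihilated momenta and its transfer u,
        so every u occurs at most \<open>(card S)\<^sup>2\<close> times.\<close>
      let ?f = "\<lambda>(p, q, u). ((p - u, q + u), u)"
      let ?U = "(snd \<circ> snd) ` TT"
      have inj: "inj_on ?f TT" by (auto simp: inj_on_def)
      have "(\<Sum>t\<in>TT. (v (snd (snd t)))\<^sup>2) = (\<Sum>x\<in>?f ` TT. (v (snd x))\<^sup>2)"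
        by (subst sum.reindex[OF inj]) (auto intro!: sum.cong)
      also have "\<dots> \<le> (\<Sum>x\<in>(S \<times> S) \<times> ?U. (v (snd x))\<^sup>2)"
      proof (rule sum_mono2)
        show "finite ((S \<times> S) \<times> ?U)" using finS TT by (intro finite_cartesian_product finite_imageI)
        show "?f ` TT \<subseteq> (S \<times> S) \<times> ?U"
        proof (rule image_subsetI)
          fix t assume t: "t \<in> TT"
          obtain p q u where pqu: "t = (p, q, u)" by (cases t)
          then have "p - u \<in> S" "q + u \<in> S" using TTs t by blast+
          moreover have "u \<in> ?U" using t pqu by (intro image_eqI[of _ _ t]) auto
          ultimately show "?f t \<in> (S \<times> S) \<times> ?U" unfolding pqu by (simp only: prod.case mem_Times_iff fst_conv snd_conv)
        qed
      qed simp
      also have "\<dots> = (\<Sum>x\<in>S \<times> S. \<Sum>u\<in>?U. (v u)\<^sup>2)"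
        by (subst sum.cartesian_product) (auto intro!: sum.cong)
      also have "\<dots> = (real (card S))\<^sup>2 * (\<Sum>u\<in>?U. (v u)\<^sup>2)"
        by (simp only: sum_constant card_cartesian_product power2_eq_square of_nat_mult)
      also have "\<dots> \<le> (real (card S))\<^sup>2 * infsum (\<lambda>u. (v u)\<^sup>2) (dual_lattice L)"
        using TT TTs by (intro mult_left_mono finite_sum_le_infsum summable_v) auto
      finally show ?thesis .
    qed
    finally show "(\<Sum>M\<in>F. (cmod (Iop M))\<^sup>2) \<le> B"
      using KI0 by (simp add: B_def mult_left_mono)
  qed
qed auto

lemma hamiltonian_eq: "hamiltonian V L \<Psi> = (\<lambda>M. kinetic L \<Psi> M + 1 / (2 * complex_of_real (L ^ 3)) * Iop M)"
  by (simp add: fun_eq_iff hamiltonian_def Iop_def)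

lemma Psi_hamiltonian_domain: "\<Psi> \<in> hamiltonian_domain V L"
  unfolding hamiltonian_domain_def
proof (intro CollectI conjI allI Psi_fock summable_It)
  let ?k = "1 / (2 * complex_of_real (L ^ 3))"
  show "hamiltonian V L \<Psi> \<in> fock_space (dual_lattice L)"
    unfolding fock_space_def
  proof (intro CollectI conjI allI impI)
    fix M assume "hamiltonian V L \<Psi> M \<noteq> 0"
    then have "kinetic L \<Psi> M \<noteq> 0 \<or> Iop M \<noteq> 0" by (auto simp: hamiltonian_eq)
    then consider "kinetic L \<Psi> M \<noteq> 0" | "Iop M \<noteq> 0" by blast
    then show "set_mset M \<subseteq> dual_lattice L"
    proof cases
      case 1
      then show ?thesis using Psi_supp[OF kinetic_neq_0] S_sub by blast
    next
      case 2
      then obtain t where "t \<in> Tm M" unfolding Iop_def infsum_It by (metis (no_types, lifting) sum.neutral)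
      then obtain p q u where "p \<in> dual_lattice L" "q \<in> dual_lattice L" "It M (p, q, u) \<noteq> 0"
        by (cases t) (auto simp: Tm_def)
      then show ?thesis using It_neq_0[of M p q u] S_sub by blast
    qed
  next
    have s: "(\<lambda>M. 2 * wt 0 (kinetic L \<Psi>) M + 2 * (cmod ?k)\<^sup>2 * (cmod (Iop M))\<^sup>2) summable_on UNIV"
      by (intro summable_on_add summable_on_cmult_right rapidD kinetic_rapid Iop_summable)
    show "(\<lambda>M. (cmod (hamiltonian V L \<Psi> M))\<^sup>2) summable_on UNIV"
    proof (rule summable_on_comparison_test[OF s])
      fix M
      have "(cmod (hamiltonian V L \<Psi> M))\<^sup>2 \<le> (cmod (kinetic L \<Psi> M) + cmod ?k * cmod (Iop M))\<^sup>2"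
        unfolding hamiltonian_eq norm_mult[symmetric] by (intro power_mono norm_triangle_ineq) auto
      also have "\<dots> \<le> 2 * (cmod (kinetic L \<Psi> M))\<^sup>2 + 2 * (cmod ?k * cmod (Iop M))\<^sup>2"
        using sum_squares_bound[of "cmod (kinetic L \<Psi> M)" "cmod ?k * cmod (Iop M)"] by (simp add: power2_sum)
      finally show "(cmod (hamiltonian V L \<Psi> M))\<^sup>2 \<le> 2 * wt 0 (kinetic L \<Psi>) M + 2 * (cmod ?k)\<^sup>2 * (cmod (Iop M))\<^sup>2"
        by (simp add: wt_def power_mult_distrib)
    qed auto
  qed
qed

abbreviation "T0 \<equiv> triples S"

lemma finT0: "finite T0"
  using finS by (rule finite_triples)

text \<open>Against \<Psi> only configurations with all particles in \<open>S\<close> matter. There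
  the created momenta p and q lie in \<open>S\<close> as well, and the sum over all triples becomes
  finite.\<close>

lemma Iop_inner: "fock_inner \<Psi> Iop = (\<Sum>(p, q, u)\<in>T0. complex_of_real (v u)
    * fock_inner (annihilation q (annihilation p \<Psi>)) (annihilation (p - u) (annihilation (q + u) \<Psi>)))"
proof -
  have eq: "Iop M = (\<Sum>t\<in>T0. It M t)" if "\<Psi> M \<noteq> 0" for M
  proof -
    have M: "set_mset M \<subseteq> S" using that Psi_supp by blast
    have "Tm M \<subseteq> T0" using It_neq_0 M by (fastforce simp: Tm_def triples_def simp del: insert_iff)
    moreover have "It M t = 0" if "t \<in> T0 - Tm M" for t
    proof -
      obtain p q u where t: "t = (p, q, u)" by (cases t)
      then have "p \<in> dual_lattice L" "q \<in> dual_lattice L" "p - u \<in> dual_lattice L"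
        using that S_sub by (auto simp: triples_def)
      moreover from this have "p - (p - u) \<in> dual_lattice L" by blast
      ultimately show ?thesis using that t by (auto simp: Tm_def)
    qed
    ultimately show ?thesis
      unfolding Iop_def infsum_It using finT0 by (intro sum.mono_neutral_left) auto
  qed
  have "fock_inner \<Psi> Iop = fock_inner \<Psi> (\<lambda>M. \<Sum>t\<in>T0. It M t)"
    unfolding fock_inner_def using eq by (intro infsum_cong) (metis complex_cnj_zero mult_zero_left)
  also have "\<dots> = (\<Sum>t\<in>T0. fock_inner \<Psi> (\<lambda>M. It M t))"
  proof (rule fock_inner_sum[OF Psi_rapid])
    fix t
    show "(\<lambda>M. It M t) \<in> rapid"
      using Psi_rapid by (cases t) (auto simp: interaction_term_def intro!: rapid_scale)
  qed
  also have "\<dots> = (\<Sum>(p, q, u)\<in>T0. complex_of_real (v u)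
    * fock_inner (annihilation q (annihilation p \<Psi>)) (annihilation (p - u) (annihilation (q + u) \<Psi>)))"
    by (intro sum.cong) (auto simp: interaction_term_def fock_inner_scale creation_adjoint fourier_v)
  finally show ?thesis .
qed

lemma sum_T0:
  "(\<Sum>(p, q, u)\<in>T0. v u * (alt p * alt (p - u) * dr q (- p))) = (\<Sum>p\<in>S. \<Sum>r\<in>S. v (p - r) * (alt p * alt r))"
  "(\<Sum>(p, q, u)\<in>T0. v u * (gt p * gt q * dr p (p - u))) = v 0 * (\<Sum>p\<in>S. gt p)\<^sup>2"
  "(\<Sum>(p, q, u)\<in>T0. v u * (gt p * gt q * dr q (p - u))) = (\<Sum>p\<in>S. \<Sum>r\<in>S. v (p - r) * (gt p * gt r))"
  "(\<Sum>(p, q, u)\<in>T0. v u * (if p = 0 \<and> q = 0 \<and> p - u = 0 then 2 * N0\<^sup>2 else 0)) = v 0 * (2 * N0\<^sup>2)"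
proof -
  have "(\<Sum>(p, q, u)\<in>T0. v u * (alt p * alt (p - u) * dr q (- p)))
      = (\<Sum>(p, q, u)\<in>T0. if q = - p then v (p - (p - u)) * (alt p * alt (p - u)) else 0)"
    by (intro sum.cong) (auto simp: dr_def)
  also have "\<dots> = (\<Sum>p\<in>S. \<Sum>r\<in>S. v (p - r) * (alt p * alt r))"
    using finS S_sym by (rule sum_triples_opposite)
  finally show "(\<Sum>(p, q, u)\<in>T0. v u * (alt p * alt (p - u) * dr q (- p))) = (\<Sum>p\<in>S. \<Sum>r\<in>S. v (p - r) * (alt p * alt r))" .
  have "(\<Sum>(p, q, u)\<in>T0. v u * (gt p * gt q * dr p (p - u))) = (\<Sum>(p, q, u)\<in>T0. if u = 0 then v 0 * (gt p * gt q) else 0)"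
    by (intro sum.cong) (auto simp: dr_def)
  also have "\<dots> = (\<Sum>p\<in>S. \<Sum>q\<in>S. v 0 * (gt p * gt q))"
    using finS by (rule sum_triples_direct)
  also have "\<dots> = v 0 * (\<Sum>p\<in>S. gt p)\<^sup>2"
    unfolding power2_eq_square sum_product by (simp only: sum_distrib_left)
  finally show "(\<Sum>(p, q, u)\<in>T0. v u * (gt p * gt q * dr p (p - u))) = v 0 * (\<Sum>p\<in>S. gt p)\<^sup>2" .
  have "(\<Sum>(p, q, u)\<in>T0. v u * (gt p * gt q * dr q (p - u))) = (\<Sum>(p, q, u)\<in>T0. if q = p - u then v (p - q) * (gt p * gt q) else 0)"
    by (intro sum.cong) (auto simp: dr_def)
  also have "\<dots> = (\<Sum>p\<in>S. \<Sum>r\<in>S. v (p - r) * (gt p * gt r))"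
    using finS by (rule sum_triples_exchange)
  finally show "(\<Sum>(p, q, u)\<in>T0. v u * (gt p * gt q * dr q (p - u))) = (\<Sum>p\<in>S. \<Sum>r\<in>S. v (p - r) * (gt p * gt r))" .
  have "(0, 0, 0) \<in> T0" by (simp add: triples_def)
  moreover have "(\<Sum>(p, q, u)\<in>T0. v u * (if p = 0 \<and> q = 0 \<and> p - u = 0 then 2 * N0\<^sup>2 else 0))
    = (\<Sum>t\<in>T0. if t = (0, 0, 0) then v 0 * (2 * N0\<^sup>2) else 0)"
    by (intro sum.cong) (auto split: if_splits)
  ultimately show "(\<Sum>(p, q, u)\<in>T0. v u * (if p = 0 \<and> q = 0 \<and> p - u = 0 then 2 * N0\<^sup>2 else 0)) = v 0 * (2 * N0\<^sup>2)"
    using finT0 by simp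
qed

lemma expectation_hamiltonian:
  "expectation (hamiltonian V L) \<Psi> = complex_of_real ((\<Sum>p\<in>P. (norm p)\<^sup>2 * ga p) + 1 / (2 * L ^ 3) *
     (v 0 * (\<Sum>p\<in>S. gt p)\<^sup>2 + (\<Sum>p\<in>S. \<Sum>r\<in>S. v (p - r) * (alt p * alt r)) + (\<Sum>p\<in>S. \<Sum>r\<in>S. v (p - r) * (gt p * gt r)) - v 0 * (2 * N0\<^sup>2)))"
proof -
  have "fock_inner \<Psi> Iop = (\<Sum>(p, q, u)\<in>T0. complex_of_real (v u * (alt p * alt (p - u) * dr q (- p) + gt p * gt q * dr p (p - u) + gt p * gt q * dr q (p - u)
        - (if p = 0 \<and> q = 0 \<and> p - u = 0 then 2 * N0\<^sup>2 else 0))) * nn)"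
    unfolding Iop_inner by (intro sum.cong refl) (auto simp: four_point' simp del: of_real_add of_real_diff)
  also have "\<dots> = complex_of_real (\<Sum>(p, q, u)\<in>T0. v u * (alt p * alt (p - u) * dr q (- p) + gt p * gt q * dr p (p - u) + gt p * gt q * dr q (p - u)
        - (if p = 0 \<and> q = 0 \<and> p - u = 0 then 2 * N0\<^sup>2 else 0))) * nn"
    by (simp only: of_real_sum sum_distrib_right case_prod_unfold)
  also have "(\<Sum>(p, q, u)\<in>T0. v u * (alt p * alt (p - u) * dr q (- p) + gt p * gt q * dr p (p - u) + gt p * gt q * dr q (p - u)
        - (if p = 0 \<and> q = 0 \<and> p - u = 0 then 2 * N0\<^sup>2 else 0)))
      = (\<Sum>p\<in>S. \<Sum>r\<in>S. v (p - r) * (alt p * alt r)) + v 0 * (\<Sum>p\<in>S. gt p)\<^sup>2 + (\<Sum>p\<in>S. \<Sum>r\<in>S. v (p - r) * (gt p * gt r)) - v 0 * (2 * N0\<^sup>2)"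
    unfolding sum_T0[symmetric] by (simp only: distrib_left right_diff_distrib sum.distrib sum_subtractf case_prod_unfold)
  finally have I: "fock_inner \<Psi> Iop = complex_of_real ((\<Sum>p\<in>S. \<Sum>r\<in>S. v (p - r) * (alt p * alt r)) + v 0 * (\<Sum>p\<in>S. gt p)\<^sup>2 + (\<Sum>p\<in>S. \<Sum>r\<in>S. v (p - r) * (gt p * gt r)) - v 0 * (2 * N0\<^sup>2)) * nn" .
  \<comment> \<open>\<open>Iop\<close> is known to be square summable but not \<open>rapid\<close>,
    so summability against \<Psi> is obtained directly.\<close>
  have s: "(\<lambda>M. cnj (\<Psi> M) * Iop M) summable_on UNIV"
  proof -
    have "(\<lambda>M. cmod (cnj (\<Psi> M) * Iop M)) summable_on UNIV"
    proof (rule summable_on_comparison_test)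
      show "(\<lambda>M. wt 0 \<Psi> M + (cmod (Iop M))\<^sup>2) summable_on UNIV"
        by (intro summable_on_add rapidD Psi_rapid Iop_summable)
      show "cmod (cnj (\<Psi> M) * Iop M) \<le> wt 0 \<Psi> M + (cmod (Iop M))\<^sup>2" for M
        using sum_squares_bound[of "cmod (\<Psi> M)" "cmod (Iop M)"]
          mult_nonneg_nonneg[OF norm_ge_zero[of "\<Psi> M"] norm_ge_zero[of "Iop M"]]
        unfolding wt_def norm_mult complex_mod_cnj power_0 mult_1 by linarith
    qed auto
    then show ?thesis by (rule abs_summable_summable)
  qed
  have "fock_inner \<Psi> (hamiltonian V L \<Psi>) = fock_inner \<Psi> (kinetic L \<Psi>) + 1 / (2 * complex_of_real (L ^ 3)) * fock_inner \<Psi> Iop"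
  proof -
    have "fock_inner \<Psi> (hamiltonian V L \<Psi>) = (\<Sum>\<^sub>\<infinity>M. cnj (\<Psi> M) * kinetic L \<Psi> M + 1 / (2 * complex_of_real (L ^ 3)) * (cnj (\<Psi> M) * Iop M))"
      unfolding fock_inner_def hamiltonian_eq by (simp add: algebra_simps)
    also have "\<dots> = fock_inner \<Psi> (kinetic L \<Psi>) + 1 / (2 * complex_of_real (L ^ 3)) * fock_inner \<Psi> Iop"
      unfolding fock_inner_def infsum_cmult_right'[symmetric]
      by (intro infsum_add summable_on_cmult_right s fock_inner_summable Psi_rapid kinetic_rapid)
    finally show ?thesis .
  qed
  then show ?thesis
    unfolding kinetic_inner I expectation_def nn_def[symmetric] using nn_neq_0
    by (simp add: field_simps)
qed

end
end

section \<open>Radial integration in three dimensions\<close>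

text \<open>Half-lines are a generator stable under intersection. Coordinate changes below are
  thereby reduced to computing distribution functions.\<close>

lemma measure_eq_density_atMost:
  fixes M :: "real measure"
  assumes [measurable_cong]: "sets M = sets borel"
    and M: "\<And>t. emeasure M {..t} = ennreal (c * max 0 t)" and c: "c \<ge> 0"
  shows "M = density lborel (\<lambda>u. ennreal (c * indicator {0<..} u))"
proof (rule measure_eqI_generator_eq)
  let ?E = "range (\<lambda>a. {..a::real})"
  show "Int_stable ?E" by (auto simp: Int_stable_def)
  have s: "sets borel = sigma_sets UNIV ?E" by (simp add: borel_eq_atMost)
  show "sets M = sigma_sets UNIV ?E" using assms s by simp
  show "sets (density lborel (\<lambda>u. ennreal (c * indicator {0<..} u))) = sigma_sets UNIV ?E" using s by simp
  show "range (\<lambda>n. {..real n}) \<subseteq> ?E" by auto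
  show "(\<Union>n. {..real n}) = UNIV" using real_arch_simple by auto
  show "emeasure M {..real n} \<noteq> \<infinity>" for n by (simp add: M)
  fix X assume "X \<in> ?E"
  then obtain t where X: "X = {..t}" by auto
  have "emeasure (density lborel (\<lambda>u. ennreal (c * indicator {0<..} u))) {..t}
      = (\<integral>\<^sup>+u. ennreal c * indicator {0<..t} u \<partial>lborel)"
    by (subst emeasure_density) (auto intro!: nn_integral_cong simp: indicator_def)
  also have "\<dots> = ennreal (c * max 0 t)"
    by (subst nn_integral_cmult_indicator) (auto simp: ennreal_mult' c emeasure_lborel_Ioc max_def)
  finally show "emeasure M X = emeasure (density lborel (\<lambda>u. ennreal (c * indicator {0<..} u))) X"
    using M X by simp
qed auto

lemma square_le_iff: "(x::real)\<^sup>2 \<le> t \<longleftrightarrow> \<bar>x\<bar> \<le> sqrt t"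
  using real_sqrt_le_iff[of "x\<^sup>2" t] by simp

text \<open>The disc of radius sqrt t has area pi * t. Taking the squared modulus as the variable
  makes the density of polar coordinates constant.\<close>

lemma distr_norm_sq_complex:
  "distr lborel borel (\<lambda>w::complex. (norm w)\<^sup>2) = density lborel (\<lambda>u. ennreal (pi * indicator {0<..} u))"
proof (rule measure_eq_density_atMost)
  fix t :: real
  have "emeasure (distr lborel borel (\<lambda>w::complex. (norm w)\<^sup>2)) {..t} = emeasure lborel {w::complex. (norm w)\<^sup>2 \<le> t}"
    by (subst emeasure_distr) (auto simp: vimage_def)
  also have "\<dots> = ennreal (pi * max 0 t)"
  proof (cases "t \<ge> 0")
    case True
    have "{w::complex. (norm w)\<^sup>2 \<le> t} = cball 0 (sqrt t)"
      unfolding set_eq_iff by (simp add: square_le_iff)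
    then show ?thesis using True
      by (simp add: emeasure_cball unit_ball_vol_numeral(1)[of Num.One, simplified])
  next
    case False
    then have "{w::complex. (norm w)\<^sup>2 \<le> t} = {}"
      by (auto dest: order_trans[OF zero_le_power2])
    then show ?thesis using False by (simp only: emeasure_empty) (simp add: max_def)
  qed
  finally show "emeasure (distr lborel borel (\<lambda>w::complex. (norm w)\<^sup>2)) {..t} = ennreal (pi * max 0 t)" .
qed auto

lemma distr_square:
  "distr (density lborel (\<lambda>s. ennreal (2 * s * indicator {0<..} s))) borel (\<lambda>s::real. s\<^sup>2)
    = density lborel (\<lambda>u. ennreal (1 * indicator {0<..} u))"
proof (rule measure_eq_density_atMost)
  fix t :: real
  have "emeasure (distr (density lborel (\<lambda>s. ennreal (2 * s * indicator {0<..} s))) borel (\<lambda>s::real. s\<^sup>2)) {..t}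
      = (\<integral>\<^sup>+s. ennreal (2 * s * indicator {0<..} s) * indicator {s. s\<^sup>2 \<le> t} s \<partial>lborel)"
    by (subst emeasure_distr) (auto simp: vimage_def emeasure_density)
  also have "\<dots> = ennreal (1 * max 0 t)"
  proof (cases "t \<ge> 0")
    case True
    have "(\<integral>\<^sup>+s. ennreal (2 * s * indicator {0<..} s) * indicator {s. s\<^sup>2 \<le> t} s \<partial>lborel)
        = (\<integral>\<^sup>+s. ennreal (2 * s) * indicator {0..sqrt t} s \<partial>lborel)"
      by (intro nn_integral_cong) (auto simp: indicator_def square_le_iff)
    also have "\<dots> = ennreal ((sqrt t)\<^sup>2 - 0\<^sup>2)"
      using True by (intro nn_integral_FTC_Icc) (auto intro!: derivative_eq_intros)
    finally show ?thesis using True by simp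
  next
    case False
    then have "\<not> s\<^sup>2 \<le> t" for s :: real by (auto dest: order_trans[OF zero_le_power2])
    then show ?thesis using False by (simp add: max_def)
  qed
  finally show "emeasure (distr (density lborel (\<lambda>s. ennreal (2 * s * indicator {0<..} s))) borel (\<lambda>s::real. s\<^sup>2)) {..t}
    = ennreal (1 * max 0 t)" .
qed auto

lemma nn_integral_norm_sq_complex:
  assumes [measurable]: "f \<in> borel_measurable borel"
  shows "(\<integral>\<^sup>+w. f ((norm (w::complex))\<^sup>2) \<partial>lborel) = (\<integral>\<^sup>+u. ennreal pi * (indicator {0<..} u * f u) \<partial>lborel)"
proof -
  have "(\<integral>\<^sup>+w. f ((norm (w::complex))\<^sup>2) \<partial>lborel) = (\<integral>\<^sup>+u. f u \<partial>distr lborel borel (\<lambda>w::complex. (norm w)\<^sup>2))"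
    by (subst nn_integral_distr) auto
  also have "\<dots> = (\<integral>\<^sup>+u. ennreal pi * (indicator {0<..} u * f u) \<partial>lborel)"
    unfolding distr_norm_sq_complex by (subst nn_integral_density) (auto intro!: nn_integral_cong simp: indicator_def)
  finally show ?thesis .
qed

lemma nn_integral_square:
  assumes [measurable]: "f \<in> borel_measurable borel"
  shows "(\<integral>\<^sup>+u. indicator {0<..} u * f u \<partial>lborel) = (\<integral>\<^sup>+s. ennreal (2 * s) * (indicator {0<..} s * f (s\<^sup>2)) \<partial>lborel)"
proof -
  have "(\<integral>\<^sup>+u. indicator {0<..} u * f u \<partial>lborel) = (\<integral>\<^sup>+u. f u \<partial>density lborel (\<lambda>u. ennreal (1 * indicator {0<..} u)))"
    by (subst nn_integral_density) (auto intro!: nn_integral_cong simp: indicator_def)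
  also have "\<dots> = (\<integral>\<^sup>+s. f (s\<^sup>2) \<partial>density lborel (\<lambda>s. ennreal (2 * s * indicator {0<..} s)))"
    unfolding distr_square[symmetric] by (subst nn_integral_distr) auto
  also have "\<dots> = (\<integral>\<^sup>+s. ennreal (2 * s) * (indicator {0<..} s * f (s\<^sup>2)) \<partial>lborel)"
    by (subst nn_integral_density) (auto intro!: nn_integral_cong simp: indicator_def)
  finally show ?thesis .
qed

definition cyl :: "real \<times> complex \<Rightarrow> real^3" where
  "cyl = (\<lambda>(z, w). Re w *\<^sub>R axis 1 1 + Im w *\<^sub>R axis 2 1 + z *\<^sub>R axis 3 1)"

lemma cyl_nth [simp]: "cyl (z, w) $ 1 = Re w" "cyl (z, w) $ 2 = Im w" "cyl (z, w) $ 3 = z"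
  by (simp_all add: cyl_def axis_def)

lemma norm_vec3: "(norm (x::real^3))\<^sup>2 = (x $ 1)\<^sup>2 + (x $ 2)\<^sup>2 + (x $ 3)\<^sup>2"
  by (simp add: norm_vec_def L2_set_def sum_3 sum_nonneg)

lemma norm_cyl: "(norm (cyl (z, w)))\<^sup>2 = z\<^sup>2 + (norm w)\<^sup>2"
  by (simp add: norm_vec3 cmod_power2)

lemma measurable_cyl [measurable]: "cyl \<in> borel_measurable (lborel \<Otimes>\<^sub>M lborel)"
proof -
  have "cyl \<in> borel_measurable borel"
    unfolding cyl_def case_prod_unfold by (intro borel_measurable_continuous_onI continuous_intros)
  then show ?thesis by (simp add: lborel_prod)
qed

lemma Basis_real3: "(Basis :: (real^3) set) = {axis 1 1, axis 2 1, axis 3 1}"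
  by (auto simp: Basis_vec_def) (metis exhaust_3)

lemma prod_Basis_real3:
  fixes f :: "real^3 \<Rightarrow> 'b::comm_monoid_mult"
  shows "(\<Prod>b\<in>Basis. f b) = f (axis 1 1) * (f (axis 2 1) * f (axis 3 1))"
  unfolding Basis_real3 by (simp add: axis_eq_axis)

lemma distr_cyl: "distr (lborel \<Otimes>\<^sub>M lborel) borel cyl = lborel"
proof (rule lborel_eqI[symmetric])
  fix l u :: "real^3"
  assume lu: "\<And>b. b \<in> Basis \<Longrightarrow> l \<bullet> b \<le> u \<bullet> b"
  then have le: "l $ 1 \<le> u $ 1" "l $ 2 \<le> u $ 2" "l $ 3 \<le> u $ 3"
    using lu[of "axis 1 1"] lu[of "axis 2 1"] lu[of "axis 3 1"] by (auto simp: Basis_real3 inner_axis)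
  have vim: "cyl -` box l u = {l $ 3 <..< u $ 3} \<times> box (Complex (l $ 1) (l $ 2)) (Complex (u $ 1) (u $ 2))"
  proof -
    have "cyl (z, w) \<in> box l u \<longleftrightarrow> z \<in> {l $ 3 <..< u $ 3} \<and> w \<in> box (Complex (l $ 1) (l $ 2)) (Complex (u $ 1) (u $ 2))" for z w
      by (auto simp: mem_box Basis_real3 inner_axis Basis_complex_def)
    then show ?thesis by auto
  qed
  have "emeasure (distr (lborel \<Otimes>\<^sub>M lborel) borel cyl) (box l u) = emeasure (lborel \<Otimes>\<^sub>M lborel) (cyl -` box l u)"
    by (subst emeasure_distr) (auto simp: space_pair_measure)
  also have "\<dots> = emeasure lborel {l $ 3 <..< u $ 3} * emeasure lborel (box (Complex (l $ 1) (l $ 2)) (Complex (u $ 1) (u $ 2)))"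
    unfolding vim by (subst lborel.emeasure_pair_measure_Times) auto
  also have "\<dots> = ennreal (u $ 3 - l $ 3) * ennreal ((u $ 1 - l $ 1) * (u $ 2 - l $ 2))"
    using le by (subst emeasure_lborel_box) (auto simp: Basis_complex_def)
  also have "\<dots> = ennreal (\<Prod>b\<in>Basis. (u - l) \<bullet> b)"
    using le by (simp add: prod_Basis_real3 inner_axis ennreal_mult'[symmetric] mult_ac)
  finally show "emeasure (distr (lborel \<Otimes>\<^sub>M lborel) borel cyl) (box l u) = ennreal (\<Prod>b\<in>Basis. (u - l) \<bullet> b)" .
qed simp

text \<open>Each plane orthogonal to the third axis is integrated in the squared distance from the
  axis, which has density pi. Passing to the squared norm u and then to its root s gives the density
  2 * pi * s on |z| < s: the third coordinate is uniformly distributed on a sphere.\<close>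

lemma nn_integral_cylindrical:
  fixes \<phi> :: "real \<Rightarrow> real \<Rightarrow> ennreal"
  assumes [measurable]: "case_prod \<phi> \<in> borel_measurable (borel \<Otimes>\<^sub>M borel)"
  shows "(\<integral>\<^sup>+x. \<phi> (norm (x::real^3)) (x $ 3) \<partial>lborel)
    = (\<integral>\<^sup>+s. \<integral>\<^sup>+z. ennreal (2 * pi * s) * (indicator {0<..} s * indicator {-s<..<s} z * \<phi> s z) \<partial>lborel \<partial>lborel)"
proof -
  have [measurable]: "(\<lambda>x::real^3. x $ 3) \<in> borel_measurable borel"
    by (intro borel_measurable_continuous_onI continuous_intros)
  have nn: "norm (cyl (z, w)) = sqrt (z\<^sup>2 + (norm w)\<^sup>2)" for z w
    by (metis norm_cyl real_sqrt_abs abs_norm_cancel)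
  have "(\<integral>\<^sup>+x. \<phi> (norm (x::real^3)) (x $ 3) \<partial>lborel) = (\<integral>\<^sup>+x. \<phi> (norm (x::real^3)) (x $ 3) \<partial>distr (lborel \<Otimes>\<^sub>M lborel) borel cyl)"
    unfolding distr_cyl ..
  also have "\<dots> = (\<integral>\<^sup>+y. \<phi> (norm (cyl y)) (cyl y $ 3) \<partial>(lborel \<Otimes>\<^sub>M lborel))"
    by (subst nn_integral_distr) auto
  also have "\<dots> = (\<integral>\<^sup>+z. \<integral>\<^sup>+w. \<phi> (sqrt (z\<^sup>2 + (norm (w::complex))\<^sup>2)) z \<partial>lborel \<partial>lborel)"
    by (subst lborel.nn_integral_fst[symmetric]) (auto simp: nn)
  also have "\<dots> = (\<integral>\<^sup>+z. \<integral>\<^sup>+u. ennreal pi * (indicator {0<..} u * \<phi> (sqrt (z\<^sup>2 + u)) z) \<partial>lborel \<partial>lborel)"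
    by (intro nn_integral_cong nn_integral_norm_sq_complex[where f = "\<lambda>u. \<phi> (sqrt (_\<^sup>2 + u)) _"]) measurable
  \<comment> \<open>The shift by z^2 makes the inner variable the full squared norm, so that the
    order of integration can be exchanged.\<close>
  also have "\<dots> = (\<integral>\<^sup>+z. \<integral>\<^sup>+u. ennreal pi * (indicator {0<..} (u - z\<^sup>2) * \<phi> (sqrt u) z) \<partial>lborel \<partial>lborel)"
  proof (rule nn_integral_cong)
    fix z :: real
    show "(\<integral>\<^sup>+u. ennreal pi * (indicator {0<..} u * \<phi> (sqrt (z\<^sup>2 + u)) z) \<partial>lborel)
        = (\<integral>\<^sup>+u. ennreal pi * (indicator {0<..} (u - z\<^sup>2) * \<phi> (sqrt u) z) \<partial>lborel)"
      by (subst (2) nn_integral_real_affine[where c = 1 and t = "z\<^sup>2"])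
        (auto intro!: nn_integral_cong simp: indicator_def)
  qed
  also have "\<dots> = (\<integral>\<^sup>+u. \<integral>\<^sup>+z. ennreal pi * (indicator {0<..} (u - z\<^sup>2) * \<phi> (sqrt u) z) \<partial>lborel \<partial>lborel)"
  proof (rule lborel_pair.Fubini')
    have "(\<lambda>(u, z). ennreal pi * (indicator {0<..} (u - z\<^sup>2) * \<phi> (sqrt u) z)) \<in> borel_measurable (borel \<Otimes>\<^sub>M borel)"
      by measurable
    also have "borel_measurable (borel \<Otimes>\<^sub>M borel) = borel_measurable (lborel \<Otimes>\<^sub>M lborel)"
      by (intro measurable_cong_sets sets_pair_measure_cong) auto
    finally show "(\<lambda>(u, z). ennreal pi * (indicator {0<..} (u - z\<^sup>2) * \<phi> (sqrt u) z)) \<in> borel_measurable (lborel \<Otimes>\<^sub>M lborel)" .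
  qed
  also have "\<dots> = (\<integral>\<^sup>+u. indicator {0<..} u * (\<integral>\<^sup>+z. ennreal pi * (indicator {0<..} (u - z\<^sup>2) * \<phi> (sqrt u) z) \<partial>lborel) \<partial>lborel)"
  proof (rule nn_integral_cong)
    fix u :: real
    show "(\<integral>\<^sup>+z. ennreal pi * (indicator {0<..} (u - z\<^sup>2) * \<phi> (sqrt u) z) \<partial>lborel)
      = indicator {0<..} u * (\<integral>\<^sup>+z. ennreal pi * (indicator {0<..} (u - z\<^sup>2) * \<phi> (sqrt u) z) \<partial>lborel)"
    proof (cases "u > 0")
      case False
      then have "\<not> z\<^sup>2 < u" for z :: real by (meson le_less_trans not_less zero_le_power2)
      then show ?thesis by (simp add: indicator_def)
    qed simp
  qed
  also have "\<dots> = (\<integral>\<^sup>+s. ennreal (2 * s) * (indicator {0<..} s * (\<integral>\<^sup>+z. ennreal pi * (indicator {0<..} (s\<^sup>2 - z\<^sup>2) * \<phi> (sqrt (s\<^sup>2)) z) \<partial>lborel)) \<partial>lborel)"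
    by (rule nn_integral_square) measurable
  also have "\<dots> = (\<integral>\<^sup>+s. \<integral>\<^sup>+z. ennreal (2 * pi * s) * (indicator {0<..} s * indicator {-s<..<s} z * \<phi> s z) \<partial>lborel \<partial>lborel)"
  proof (rule nn_integral_cong)
    fix s :: real
    show "ennreal (2 * s) * (indicator {0<..} s * (\<integral>\<^sup>+z. ennreal pi * (indicator {0<..} (s\<^sup>2 - z\<^sup>2) * \<phi> (sqrt (s\<^sup>2)) z) \<partial>lborel))
      = (\<integral>\<^sup>+z. ennreal (2 * pi * s) * (indicator {0<..} s * indicator {-s<..<s} z * \<phi> s z) \<partial>lborel)"
    proof (cases "s > 0")
      case True
      have sq: "z\<^sup>2 < s\<^sup>2 \<longleftrightarrow> -s < z \<and> z < s" for z
      proof -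
        have "z\<^sup>2 < s\<^sup>2 \<longleftrightarrow> \<not> \<bar>s\<bar> \<le> \<bar>z\<bar>" by (simp add: abs_le_square_iff not_le)
        then show ?thesis using True by auto
      qed
      have "(\<integral>\<^sup>+z. ennreal (2 * pi * s) * (indicator {0<..} s * indicator {-s<..<s} z * \<phi> s z) \<partial>lborel)
          = (\<integral>\<^sup>+z. ennreal (2 * s) * (ennreal pi * (indicator {0<..} (s\<^sup>2 - z\<^sup>2) * \<phi> (sqrt (s\<^sup>2)) z)) \<partial>lborel)"
        using True by (intro nn_integral_cong) (auto simp: indicator_def sq ennreal_mult' mult_ac)
      also have "\<dots> = ennreal (2 * s) * (\<integral>\<^sup>+z. ennreal pi * (indicator {0<..} (s\<^sup>2 - z\<^sup>2) * \<phi> (sqrt (s\<^sup>2)) z) \<partial>lborel)"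
        by (rule nn_integral_cmult) measurable
      finally show ?thesis using True by simp
    qed simp
  qed
  finally show ?thesis .
qed

lemma measurable_nth [measurable]: "(\<lambda>x::real^'n. x $ i) \<in> borel_measurable borel"
  by (intro borel_measurable_continuous_onI continuous_intros)

lemma distr_orthogonal_transformation:
  fixes f :: "real^3 \<Rightarrow> real^3"
  assumes "orthogonal_transformation f"
  shows "distr lborel borel f = lborel"
proof (rule lborel_eqI[symmetric])
  fix l u :: "real^3"
  assume lu: "\<And>b. b \<in> Basis \<Longrightarrow> l \<bullet> b \<le> u \<bullet> b"
  define g where "g = inv f"
  have g: "orthogonal_transformation g" unfolding g_def using assms by (rule orthogonal_transformation_inv)
  have bij: "bij f" using assms by (rule orthogonal_transformation_bij)
  have [measurable]: "f \<in> borel_measurable borel"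
    using assms by (intro borel_measurable_continuous_onI linear_continuous_on)
      (auto simp: orthogonal_transformation_def linear_conv_bounded_linear)
  have vim: "f -` box l u = g ` box l u"
    unfolding g_def using bij by (simp add: bij_vimage_eq_inv_image)
  have lm: "box l u \<in> lmeasurable" by simp
  have det: "\<bar>det (matrix g)\<bar> = 1"
    using g det_orthogonal_matrix[of "matrix g"] by (auto simp: orthogonal_transformation_matrix)
  have lg: "linear g" using g by (simp add: orthogonal_transformation_def)
  have "emeasure (distr lborel borel f) (box l u) = emeasure lborel (g ` box l u)"
    by (subst emeasure_distr) (auto simp: vim)
  also have "\<dots> = emeasure lebesgue (g ` box l u)"
    using measurable_sets_borel[of f lborel "box l u"] by (simp add: vim)
  also have "\<dots> = ennreal (measure lebesgue (g ` box l u))"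
    using measurable_linear_image[OF lg lm] by (simp add: emeasure_eq_measure2)
  also have "measure lebesgue (g ` box l u) = measure lebesgue (box l u)"
    using measure_linear_image[OF lg lm] det by simp
  also have "\<dots> = (\<Prod>b\<in>Basis. (u - l) \<bullet> b)"
    using lu by (simp add: measure_lborel_box)
  finally show "emeasure (distr lborel borel f) (box l u) = ennreal (\<Prod>b\<in>Basis. (u - l) \<bullet> b)" .
qed simp

text \<open>As an identity of measures, the cylindrical formula also applies to signed
  integrands.\<close>

lemma distr_norm_nth:
  "distr lborel (borel \<Otimes>\<^sub>M borel) (\<lambda>x::real^3. (norm x, x $ 3))
    = density (lborel \<Otimes>\<^sub>M lborel) (\<lambda>y. ennreal (2 * pi * fst y * (indicator {0<..} (fst y) * indicator {0<..} ((fst y)\<^sup>2 - (snd y)\<^sup>2))))"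
  (is "?l = density _ ?d")
proof (rule measure_eqI)
  have sets: "sets (lborel \<Otimes>\<^sub>M lborel :: (real \<times> real) measure) = sets (borel \<Otimes>\<^sub>M borel)"
    by (intro sets_pair_measure_cong) auto
  show "sets ?l = sets (density (lborel \<Otimes>\<^sub>M lborel) ?d)"
    using sets by simp
  fix A assume "A \<in> sets ?l"
  then have A: "A \<in> sets (borel \<Otimes>\<^sub>M borel :: (real \<times> real) measure)" by simp
  have A': "A \<in> sets (lborel \<Otimes>\<^sub>M lborel)" using A sets by simp
  have [measurable]: "?d \<in> borel_measurable (lborel \<Otimes>\<^sub>M lborel)"
  proof -
    have "?d \<in> borel_measurable (borel \<Otimes>\<^sub>M borel)" by measurable
    then show ?thesis using measurable_cong_sets[OF sets refl] by blast
  qed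
  have "emeasure ?l A = (\<integral>\<^sup>+x. indicator A (norm (x::real^3), x $ 3) \<partial>lborel)"
  proof -
    have [measurable]: "A \<in> sets (borel \<Otimes>\<^sub>M borel)" by (rule A)
    have "emeasure ?l A = (\<integral>\<^sup>+x. indicator A x \<partial>?l)" using A by simp
    also have "\<dots> = (\<integral>\<^sup>+x. indicator A (norm (x::real^3), x $ 3) \<partial>lborel)"
      by (rule nn_integral_distr) measurable
    finally show ?thesis .
  qed
  also have "\<dots> = (\<integral>\<^sup>+s. \<integral>\<^sup>+z. ennreal (2 * pi * s) * (indicator {0<..} s * indicator {-s<..<s} z * indicator A (s, z)) \<partial>lborel \<partial>lborel)"
    by (rule nn_integral_cylindrical) (use A in \<open>simp add: case_prod_beta\<close>)
  also have "\<dots> = (\<integral>\<^sup>+s. \<integral>\<^sup>+z. ?d (s, z) * indicator A (s, z) \<partial>lborel \<partial>lborel)"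
  proof (intro nn_integral_cong)
    fix s z :: real
    have "s > 0 \<Longrightarrow> s\<^sup>2 - z\<^sup>2 > 0 \<longleftrightarrow> - s < z \<and> z < s"
    proof -
      assume "s > 0"
      have "s\<^sup>2 - z\<^sup>2 > 0 \<longleftrightarrow> \<not> \<bar>s\<bar> \<le> \<bar>z\<bar>" by (simp add: abs_le_square_iff not_le)
      then show ?thesis using \<open>s > 0\<close> by auto
    qed
    then show "ennreal (2 * pi * s) * (indicator {0<..} s * indicator {-s<..<s} z * indicator A (s, z)) = ?d (s, z) * indicator A (s, z)"
      by (cases "s > 0") (auto simp: indicator_def)
  qed
  also have "\<dots> = (\<integral>\<^sup>+y. ?d y * indicator A y \<partial>(lborel \<Otimes>\<^sub>M lborel))"
    by (rule lborel.nn_integral_fst) (use A' in measurable)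
  also have "\<dots> = emeasure (density (lborel \<Otimes>\<^sub>M lborel) ?d) A"
    using A' by (subst emeasure_density) auto
  finally show "emeasure ?l A = emeasure (density (lborel \<Otimes>\<^sub>M lborel) ?d) A" .
qed

lemma has_bochner_cos:
  assumes "s > 0"
  shows "has_bochner_integral lborel (\<lambda>z. indicator {0<..} (s\<^sup>2 - z\<^sup>2) * cos (t * z)) (2 * s * sinc (t * s))"
proof -
  define G where "G z = (if t = 0 then z else sin (t * z) / t)" for z
  have "has_bochner_integral lborel (\<lambda>z. cos (t * z) * indicator {-s..s} z) (G s - G (- s))"
  proof (rule has_bochner_integral_FTC_Icc_real)
    show "(G has_real_derivative cos (t * z)) (at z)" for z
      unfolding G_def[abs_def] by (cases "t = 0") (auto intro!: derivative_eq_intros)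
  qed (use assms in \<open>auto intro!: continuous_intros\<close>)
  moreover have "G s - G (- s) = 2 * s * sinc (t * s)"
    using assms by (auto simp: G_def)
  moreover have "has_bochner_integral lborel (\<lambda>z. indicator {0<..} (s\<^sup>2 - z\<^sup>2) * cos (t * z)) x
      \<longleftrightarrow> has_bochner_integral lborel (\<lambda>z. cos (t * z) * indicator {-s..s} z) x" for x
  proof (rule has_bochner_integral_cong_AE)
    have "AE z in lborel. z \<noteq> s \<and> z \<noteq> - s"
      using AE_lborel_singleton[of s] AE_lborel_singleton[of "- s"] by eventually_elim auto
    then show "AE z in lborel. indicator {0<..} (s\<^sup>2 - z\<^sup>2) * cos (t * z) = cos (t * z) * indicator {-s..s} z"
    proof eventually_elim
      case (elim z)
      have "s\<^sup>2 - z\<^sup>2 > 0 \<longleftrightarrow> \<not> \<bar>s\<bar> \<le> \<bar>z\<bar>" by (simp add: abs_le_square_iff not_le)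
      then show ?case using elim assms by (auto simp: indicator_def)
    qed
  qed auto
  ultimately show ?thesis by simp
qed

text \<open>On the sphere of radius s the third coordinate is uniform on (-s, s), and the average of
  cos (t * z) over this interval is sinc (t * s). Fubini applies because the inner integral of the
  absolute value is at most a multiple of s^2 * |F s|.\<close>

lemma radial_fourier_axis:
  fixes F :: "real \<Rightarrow> real"
  assumes [measurable]: "F \<in> borel_measurable borel"
    and int: "integrable lborel (\<lambda>s. indicator {0<..} s * (s\<^sup>2 * F s))"
  shows "integrable lborel (\<lambda>x::real^3. F (norm x) * cos (t * x $ 3))"
    and "(LINT x|lborel. F (norm (x::real^3)) * cos (t * x $ 3))
      = (LINT s|lborel. indicator {0<..} s * (4 * pi * s\<^sup>2 * F s * sinc (t * s)))"
proof -
  let ?d = "\<lambda>y::real\<times>real. 2 * pi * fst y * (indicator {0<..} (fst y) * indicator {0<..} ((fst y)\<^sup>2 - (snd y)\<^sup>2)) :: real"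
  let ?h = "\<lambda>y. F (fst y) * cos (t * snd y)"
  have sets: "sets (lborel \<Otimes>\<^sub>M lborel :: (real \<times> real) measure) = sets (borel \<Otimes>\<^sub>M borel)"
    by (intro sets_pair_measure_cong) auto
  have hm: "?h \<in> borel_measurable (borel \<Otimes>\<^sub>M borel)" by measurable
  have dm: "?d \<in> borel_measurable (borel \<Otimes>\<^sub>M borel)" by measurable
  have hm'[measurable]: "?h \<in> borel_measurable (lborel \<Otimes>\<^sub>M lborel)" "?d \<in> borel_measurable (lborel \<Otimes>\<^sub>M lborel)"
    using hm dm measurable_cong_sets[OF sets refl] by blast+
  have inner: "has_bochner_integral lborel (\<lambda>z. ?d (s, z) * ?h (s, z)) (indicator {0<..} s * (4 * pi * s\<^sup>2 * F s * sinc (t * s)))" for s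
  proof (cases "s > 0")
    case True
    have "has_bochner_integral lborel (\<lambda>z. 2 * pi * s * F s * (indicator {0<..} (s\<^sup>2 - z\<^sup>2) * cos (t * z))) (2 * pi * s * F s * (2 * s * sinc (t * s)))"
      by (rule has_bochner_integral_mult_right) (rule has_bochner_cos[OF True])
    then show ?thesis using True by (simp add: power2_eq_square mult_ac cong: if_cong)
  qed (simp add: has_bochner_integral_zero)
  have d_nn: "?d y \<ge> 0" for y by (auto simp: indicator_def)
  have int2: "integrable (lborel \<Otimes>\<^sub>M lborel) (\<lambda>y. ?d y * ?h y)"
  proof (rule lborel_pair.Fubini_integrable)
    show "integrable lborel (\<lambda>s. LINT z|lborel. norm (?d (s, z) * ?h (s, z)))"
    proof (rule Bochner_Integration.integrable_bound[OF integrable_mult_right[OF int, of "4 * pi"]])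
      show "AE s in lborel. norm (LINT z|lborel. norm (?d (s, z) * ?h (s, z))) \<le> norm (4 * pi * (indicator {0<..} s * (s\<^sup>2 * F s)))"
      proof (intro AE_I2)
        fix s :: real
        show "norm (LINT z|lborel. norm (?d (s, z) * ?h (s, z))) \<le> norm (4 * pi * (indicator {0<..} s * (s\<^sup>2 * F s)))"
        proof (cases "s > 0")
          case True
          have "(LINT z|lborel. norm (?d (s, z) * ?h (s, z))) \<le> (LINT z|lborel. 2 * pi * s * \<bar>F s\<bar> * (indicator {0<..} (s\<^sup>2 - z\<^sup>2) * cos (0 * z)))"
          proof (rule integral_mono)
            show "integrable lborel (\<lambda>z. norm (?d (s, z) * ?h (s, z)))"
              using inner[of s] by (intro integrable_norm) (rule integrable.intros)
            show "integrable lborel (\<lambda>z. 2 * pi * s * \<bar>F s\<bar> * (indicator {0<..} (s\<^sup>2 - z\<^sup>2) * cos (0 * z)))"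
              by (intro integrable_mult_right integrable.intros[OF has_bochner_cos[OF True]])
            show "norm (?d (s, z) * ?h (s, z)) \<le> 2 * pi * s * \<bar>F s\<bar> * (indicator {0<..} (s\<^sup>2 - z\<^sup>2) * cos (0 * z))" for z
              using True by (auto simp: indicator_def abs_mult intro!: mult_left_le)
          qed
          also have "\<dots> = 2 * pi * s * \<bar>F s\<bar> * (2 * s * sinc (0 * s))"
            by (rule has_bochner_integral_integral_eq, rule has_bochner_integral_mult_right, rule has_bochner_cos[OF True])
          finally show ?thesis using True by (simp add: abs_mult power2_eq_square mult_ac)
        qed simp
      qed
    qed measurable
    show "AE s in lborel. integrable lborel (\<lambda>z. ?d (s, z) * ?h (s, z))"
      using inner by (auto intro: integrable.intros)
  qed measurable
  have meas: "(\<lambda>x::real^3. (norm x, x $ 3)) \<in> measurable lborel (borel \<Otimes>\<^sub>M borel)" by measurable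
  have "integrable (density (lborel \<Otimes>\<^sub>M lborel) ?d) ?h"
    using int2 d_nn by (subst integrable_density) auto
  then have "integrable (distr lborel (borel \<Otimes>\<^sub>M borel) (\<lambda>x::real^3. (norm x, x $ 3))) ?h"
    unfolding distr_norm_nth .
  then show "integrable lborel (\<lambda>x::real^3. F (norm x) * cos (t * x $ 3))"
    by (subst (asm) integrable_distr_eq[OF meas hm]) simp
  have "(LINT x|lborel. F (norm (x::real^3)) * cos (t * x $ 3)) = (LINT y|distr lborel (borel \<Otimes>\<^sub>M borel) (\<lambda>x::real^3. (norm x, x $ 3)). ?h y)"
    by (subst integral_distr[OF meas hm]) simp
  also have "\<dots> = (LINT y|(lborel \<Otimes>\<^sub>M lborel). ?d y * ?h y)"
    unfolding distr_norm_nth using d_nn by (subst integral_density) auto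
  also have "\<dots> = (LINT s|lborel. LINT z|lborel. ?d (s, z) * ?h (s, z))"
    by (rule lborel_pair.integral_fst'[OF int2, symmetric])
  also have "\<dots> = (LINT s|lborel. indicator {0<..} s * (4 * pi * s\<^sup>2 * F s * sinc (t * s)))"
    by (intro Bochner_Integration.integral_cong refl has_bochner_integral_integral_eq inner)
  finally show "(LINT x|lborel. F (norm (x::real^3)) * cos (t * x $ 3))
      = (LINT s|lborel. indicator {0<..} s * (4 * pi * s\<^sup>2 * F s * sinc (t * s)))" .
qed

text \<open>An orthogonal map turns p into a multiple of the third axis and preserves both Lebesgue
  measure and the radial factor.\<close>

theorem radial_fourier:
  fixes F :: "real \<Rightarrow> real" and p :: "real^3"
  assumes [measurable]: "F \<in> borel_measurable borel"
    and int: "integrable lborel (\<lambda>s. indicator {0<..} s * (s\<^sup>2 * F s))"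
  shows "integrable lborel (\<lambda>x. F (norm x) * cos (p \<bullet> x))"
    and "(LINT x|lborel. F (norm x) * cos (p \<bullet> x))
      = (LINT s|lborel. indicator {0<..} s * (4 * pi * s\<^sup>2 * F s * sinc (norm p * s)))"
proof -
  have "norm p = norm (norm p *\<^sub>R axis 3 1 :: real^3)" by simp
  then obtain f :: "real^3 \<Rightarrow> real^3" where f: "orthogonal_transformation f" "f p = norm p *\<^sub>R axis 3 1"
    by (metis orthogonal_transformation_exists)
  have fm: "f \<in> measurable lborel borel"
    using f(1) by (simp, intro borel_measurable_continuous_onI linear_continuous_on)
      (auto simp: orthogonal_transformation_def linear_conv_bounded_linear)
  have eq: "F (norm x) * cos (p \<bullet> x) = F (norm (f x)) * cos (norm p * f x $ 3)" for x
  proof -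
    have "p \<bullet> x = f p \<bullet> f x" using f(1) by (simp add: orthogonal_transformation_def)
    then show ?thesis using f by (simp add: orthogonal_transformation_norm inner_axis')
  qed
  let ?g = "\<lambda>x::real^3. F (norm x) * cos (norm p * x $ 3)"
  have gm: "?g \<in> borel_measurable borel" by measurable
  show "integrable lborel (\<lambda>x. F (norm x) * cos (p \<bullet> x))"
    unfolding eq integrable_distr_eq[OF fm gm, symmetric] distr_orthogonal_transformation[OF f(1)]
    by (rule radial_fourier_axis[OF assms])
  show "(LINT x|lborel. F (norm x) * cos (p \<bullet> x))
      = (LINT s|lborel. indicator {0<..} s * (4 * pi * s\<^sup>2 * F s * sinc (norm p * s)))"
    unfolding eq integral_distr[OF fm gm, symmetric] distr_orthogonal_transformation[OF f(1)]
    by (rule radial_fourier_axis[OF assms])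
qed

corollary radial_integral:
  fixes F :: "real \<Rightarrow> real"
  assumes "F \<in> borel_measurable borel"
    and "integrable lborel (\<lambda>s. indicator {0<..} s * (s\<^sup>2 * F s))"
  shows "integrable lborel (\<lambda>x::real^3. F (norm x))"
    and "(LINT x|lborel. F (norm (x::real^3))) = (LINT s|lborel. indicator {0<..} s * (4 * pi * s\<^sup>2 * F s))"
  using radial_fourier[OF assms, of 0] by simp_all

section \<open>The scattering solution\<close>

text \<open>Newton's theorem: averaged over the sphere of radius t, the Green function of the
  Laplacian depends on the larger of the two radii. So integrating a profile f against
  \<open>kern\<close> solves -Laplace W = f. The absolute value extends it evenly to negative
  r.\<close>

definition kern :: "real \<Rightarrow> real \<Rightarrow> real" where
  "kern r t = indicator {0<..} t * (t\<^sup>2 / max \<bar>r\<bar> t)"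

lemma kern_nonneg: "kern r t \<ge> 0"
  by (auto simp: kern_def indicator_def)

lemma kern_le: "kern r t \<le> indicator {0<..} t * t"
proof (cases "t > 0")
  case True
  then have "t\<^sup>2 / max \<bar>r\<bar> t \<le> t\<^sup>2 / t" by (intro divide_left_mono) auto
  then show ?thesis using True by (simp add: kern_def power2_eq_square)
qed (simp add: kern_def)

lemma kern_measurable [measurable]: "(\<lambda>t. kern r t) \<in> borel_measurable borel"
  unfolding kern_def by measurable

locale profile =
  fixes v :: "real \<Rightarrow> real"
  assumes cont_v: "continuous_on UNIV v" and v_nonneg: "\<And>s. v s \<ge> 0"
    and int_v1: "integrable lborel (\<lambda>s. indicator {0<..} s * (s * v s))"
    and int_v2: "integrable lborel (\<lambda>s. indicator {0<..} s * (s\<^sup>2 * v s))"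
begin

lemma v_measurable [measurable]: "v \<in> borel_measurable borel"
  using cont_v by (rule borel_measurable_continuous_onI)

definition J :: real where "J = (LINT s|lborel. indicator {0<..} s * (s * v s))"

definition Tint :: "(real \<Rightarrow> real) \<Rightarrow> real \<Rightarrow> real" where
  "Tint g r = (LINT t|lborel. kern r t * (v t * g t))"

lemma kern_bound:
  assumes "\<bar>g t\<bar> \<le> B"
  shows "\<bar>kern r t * (v t * g t)\<bar> \<le> B * (indicator {0<..} t * (t * v t))"
proof -
  have "\<bar>kern r t * (v t * g t)\<bar> = kern r t * (v t * \<bar>g t\<bar>)"
    using kern_nonneg v_nonneg by (simp add: abs_mult)
  also have "\<dots> \<le> (indicator {0<..} t * t) * (v t * B)"
    using assms kern_le v_nonneg order_trans[OF kern_nonneg kern_le]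
    by (intro mult_mono[OF kern_le mult_left_mono]) (auto simp: mult_nonneg_nonneg)
  finally show ?thesis by (simp add: mult_ac)
qed

lemma Tint_integrable:
  assumes [measurable]: "g \<in> borel_measurable borel" and "\<And>t. \<bar>g t\<bar> \<le> B"
  shows "integrable lborel (\<lambda>t. kern r t * (v t * g t))"
proof (rule Bochner_Integration.integrable_bound[OF integrable_mult_right[OF int_v1, of B]])
  show "AE t in lborel. norm (kern r t * (v t * g t)) \<le> norm (B * (indicator {0<..} t * (t * v t)))"
  proof (intro AE_I2)
    fix t
    have "B * (indicator {0<..} t * (t * v t)) \<ge> 0"
      using order_trans[OF abs_ge_zero assms(2)[of t]] v_nonneg by (auto simp: indicator_def)
    then show "norm (kern r t * (v t * g t)) \<le> norm (B * (indicator {0<..} t * (t * v t)))"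
      using kern_bound[of g, OF assms(2)] by simp
  qed
qed measurable

lemma Tint_bound:
  assumes "g \<in> borel_measurable borel" and "\<And>t. \<bar>g t\<bar> \<le> B"
  shows "\<bar>Tint g r\<bar> \<le> B * J"
proof -
  have "\<bar>Tint g r\<bar> \<le> (LINT t|lborel. \<bar>kern r t * (v t * g t)\<bar>)"
    unfolding Tint_def by (rule integral_abs_bound)
  also have "\<dots> \<le> (LINT t|lborel. B * (indicator {0<..} t * (t * v t)))"
    using Tint_integrable[OF assms] int_v1 kern_bound[of g, OF assms(2)]
    by (intro integral_mono integrable_abs integrable_mult_right) auto
  finally show ?thesis by (simp add: J_def)
qed

lemma Tint_cont:
  assumes [measurable]: "g \<in> borel_measurable borel" and "\<And>t. \<bar>g t\<bar> \<le> B"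
  shows "continuous_on UNIV (Tint g)"
proof (rule continuous_on_sequentiallyI)
  fix u :: "nat \<Rightarrow> real" and r assume u: "u \<longlonglongrightarrow> r"
  show "(\<lambda>n. Tint g (u n)) \<longlonglongrightarrow> Tint g r"
    unfolding Tint_def
  proof (rule integral_dominated_convergence[where w = "\<lambda>t. B * (indicator {0<..} t * (t * v t))"])
    show "AE t in lborel. (\<lambda>n. kern (u n) t * (v t * g t)) \<longlonglongrightarrow> kern r t * (v t * g t)"
    proof (intro AE_I2)
      fix t
      show "(\<lambda>n. kern (u n) t * (v t * g t)) \<longlonglongrightarrow> kern r t * (v t * g t)"
        using u by (cases "t > 0") (auto simp: kern_def intro!: tendsto_intros)
    qed
    show "AE t in lborel. norm (kern (u n) t * (v t * g t)) \<le> B * (indicator {0<..} t * (t * v t))" for n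
      using kern_bound[of g, OF assms(2)] by auto
  qed (use int_v1 in \<open>auto intro: integrable_mult_right\<close>)
qed

lemma Tint_diff:
  assumes "g \<in> borel_measurable borel" "\<And>t. \<bar>g t\<bar> \<le> B" "h \<in> borel_measurable borel" "\<And>t. \<bar>h t\<bar> \<le> B'"
  shows "Tint g r - Tint h r = Tint (\<lambda>t. g t - h t) r"
  unfolding Tint_def
    Bochner_Integration.integral_diff[OF Tint_integrable[OF assms(1,2)] Tint_integrable[OF assms(3,4)], symmetric]
  by (simp add: algebra_simps)

lemma Tint_tendsto_0:
  assumes [measurable]: "g \<in> borel_measurable borel" and "\<And>t. \<bar>g t\<bar> \<le> B"
  shows "(Tint g \<longlongrightarrow> 0) at_top"
proof -
  have "((\<lambda>r. Tint g r) \<longlongrightarrow> (LINT t::real|lborel. 0)) at_top"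
    unfolding Tint_def
  proof (rule integral_dominated_convergence_at_top[where w = "\<lambda>t. B * (indicator {0<..} t * (t * v t))"])
    show "AE t in lborel. ((\<lambda>r. kern r t * (v t * g t)) \<longlongrightarrow> 0) at_top"
    proof (intro AE_I2)
      fix t :: real
      have "((\<lambda>r. kern r t) \<longlongrightarrow> 0) at_top"
      proof (rule Lim_transform_eventually)
        have "((\<lambda>r::real. indicator {0<..} t * (t\<^sup>2 * inverse r)) \<longlongrightarrow> indicator {0<..} t * (t\<^sup>2 * 0)) at_top"
          by (intro tendsto_intros tendsto_inverse_0_at_top filterlim_ident)
        then show "((\<lambda>r::real. indicator {0<..} t * (t\<^sup>2 * inverse r)) \<longlongrightarrow> 0) at_top" by simp
        show "\<forall>\<^sub>F r in at_top. indicator {0<..} t * (t\<^sup>2 * inverse r) = kern r t"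
          using eventually_ge_at_top[of "max t 1"]
          by eventually_elim (simp add: kern_def divide_inverse max_absorb1)
      qed
      from tendsto_mult_right[OF this, of "v t * g t"]
      show "((\<lambda>r. kern r t * (v t * g t)) \<longlongrightarrow> 0) at_top" by simp
    qed
    show "\<forall>\<^sub>F r in at_top. AE t in lborel. norm (kern r t * (v t * g t)) \<le> B * (indicator {0<..} t * (t * v t))"
      using kern_bound[of g, OF assms(2)] by auto
  qed (use int_v1 in \<open>auto intro: integrable_mult_right\<close>)
  then show ?thesis by simp
qed

text \<open>The radial scattering equation is the fixed point equation for \<phi> ->
  \<open>Tint\<close> of (1 - \<phi>) / 2 on bounded continuous functions. By
  \<open>Tint_bound\<close> it contracts with constant J / 2.\<close>

lemma Tint_fixed_point:
  assumes "J < 1"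
  obtains \<phi> where "continuous_on UNIV \<phi>" "\<And>r. \<phi> r = Tint (\<lambda>t. (1 - \<phi> t) / 2) r" "\<And>r. 0 \<le> \<phi> r" "\<And>r. \<phi> r < 1"
proof -
  define T :: "(real \<Rightarrow>\<^sub>C real) \<Rightarrow> (real \<Rightarrow>\<^sub>C real)" where "T u = Bcontfun (Tint (\<lambda>t. (1 - apply_bcontfun u t) / 2))" for u
  have meas: "(\<lambda>t. (1 - apply_bcontfun u t) / 2) \<in> borel_measurable borel" for u :: "real \<Rightarrow>\<^sub>C real"
    by (intro borel_measurable_continuous_onI continuous_intros) auto
  have bound: "\<bar>(1 - apply_bcontfun u t) / 2\<bar> \<le> (1 + norm u) / 2" for u :: "real \<Rightarrow>\<^sub>C real" and t
    using norm_bounded[of u t] by (auto simp: abs_le_iff)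
  have T: "apply_bcontfun (T u) r = Tint (\<lambda>t. (1 - apply_bcontfun u t) / 2) r" for u r
    unfolding T_def using Tint_cont[OF meas bound] Tint_bound[OF meas bound]
    by (subst Bcontfun_inverse) (auto intro!: bcontfun_normI[of _ "(1 + norm u) / 2 * J"])
  have "\<exists>!u. T u = u"
  proof (rule banach_fix_type[of "1/2"], goal_cases)
    case 3
    show ?case
    proof (intro allI dist_bound)
      fix u w :: "real \<Rightarrow>\<^sub>C real" and r
      have "dist (apply_bcontfun (T u) r) (apply_bcontfun (T w) r)
          = \<bar>Tint (\<lambda>t. (1 - apply_bcontfun u t) / 2 - (1 - apply_bcontfun w t) / 2) r\<bar>"
        unfolding T dist_real_def Tint_diff[OF meas bound meas bound] ..
      also have "\<dots> \<le> (dist u w / 2) * J"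
      proof (rule Tint_bound)
        show "(\<lambda>t. (1 - apply_bcontfun u t) / 2 - (1 - apply_bcontfun w t) / 2) \<in> borel_measurable borel"
          using meas by (intro borel_measurable_diff)
        fix t
        show "\<bar>(1 - apply_bcontfun u t) / 2 - (1 - apply_bcontfun w t) / 2\<bar> \<le> dist u w / 2"
          using dist_bounded[of u t w] by (simp add: dist_real_def abs_if field_simps split: if_splits)
      qed
      also have "\<dots> \<le> dist u w / 2 * 1" using assms by (intro mult_left_mono) auto
      finally show "dist (apply_bcontfun (T u) r) (apply_bcontfun (T w) r) \<le> 1 / 2 * dist u w" by simp
    qed
  qed auto
  then obtain u where u: "T u = u" by blast
  define \<phi> where "\<phi> = apply_bcontfun u"
  have fixp: "\<phi> r = Tint (\<lambda>t. (1 - \<phi> t) / 2) r" for r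
    using T[of u r] unfolding u \<phi>_def .
  \<comment> \<open>The fixed point bounds its own norm. With J < 1 this first gives norm at most 1,
    and then, by strictness, norm below 1.\<close>
  have "norm u \<le> (1 + norm u) / 2 * J"
  proof (rule norm_bound)
    show "norm (apply_bcontfun u r) \<le> (1 + norm u) / 2 * J" for r
      using Tint_bound[OF meas bound, of u r] unfolding T[symmetric] u by simp
  qed
  also have "(1 + norm u) / 2 * J \<le> (1 + norm u) / 2 * 1"
    using assms by (intro mult_left_mono) auto
  finally have "norm u \<le> 1" by simp
  moreover have "(1 + norm u) / 2 * J < (1 + norm u) / 2 * 1"
    using assms by (intro mult_strict_left_mono) (auto intro: add_pos_nonneg)
  ultimately have lt: "norm u < 1" using \<open>norm u \<le> (1 + norm u) / 2 * J\<close> by simp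
  have \<phi>_less: "\<bar>\<phi> r\<bar> < 1" for r
    using norm_bounded[of u r] lt by (simp add: \<phi>_def)
  \<comment> \<open>Since |\<phi>| < 1 the integrand v * (1 - \<phi>) / 2 is nonnegative, and the
    kernel is too.\<close>
  have "\<phi> r \<ge> 0" for r
    unfolding fixp[of r] Tint_def using \<phi>_less kern_nonneg v_nonneg
    by (intro integral_nonneg_AE AE_I2 mult_nonneg_nonneg) (auto simp: abs_less_iff less_imp_le)
  moreover have "continuous_on UNIV \<phi>" by (simp add: \<phi>_def)
  moreover have "\<phi> r < 1" for r using \<phi>_less[of r] by simp
  ultimately show ?thesis using that[of \<phi>] fixp by blast
qed

end

section \<open>The Newton potential of a radial source\<close>

locale newton =
  fixes f :: "real \<Rightarrow> real"
  assumes cont_f: "continuous_on UNIV f"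
    and int_f: "integrable lborel (\<lambda>s. indicator {0<..} s * (s * f s))"
begin

definition \<phi> :: "real \<Rightarrow> real" where "\<phi> r = (LINT t|lborel. kern r t * f t)"

definition I1 :: "real \<Rightarrow> real" where "I1 r = integral {0..r} (\<lambda>t. t\<^sup>2 * f t)"
definition I2 :: "real \<Rightarrow> real" where "I2 r = integral {0..r} (\<lambda>t. t * f t)"

lemma cont_on_f: "continuous_on S f"
  using cont_f by (rule continuous_on_subset) simp

lemma has_derivative_integral:
  fixes g :: "real \<Rightarrow> real"
  assumes "continuous_on UNIV g" "r > 0"
  shows "((\<lambda>r. integral {0..r} g) has_real_derivative g r) (at r)"
proof -
  have "((\<lambda>r. integral {0..r} g) has_real_derivative g r) (at r within {0..r + 1})"
    using assms by (intro integral_has_real_derivative) (auto intro: continuous_on_subset)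
  moreover have "at r within {0..r + 1} = at r" using assms by (intro at_within_Icc_at) auto
  ultimately show ?thesis by simp
qed

lemma I1_deriv: "r > 0 \<Longrightarrow> (I1 has_real_derivative r\<^sup>2 * f r) (at r)"
  unfolding I1_def[abs_def] by (rule has_derivative_integral) (auto intro!: continuous_intros cont_f)

lemma I2_deriv: "r > 0 \<Longrightarrow> (I2 has_real_derivative r * f r) (at r)"
  unfolding I2_def[abs_def] by (rule has_derivative_integral) (auto intro!: continuous_intros cont_f)

lemma lborel_integral_Icc:
  fixes g :: "real \<Rightarrow> real"
  assumes "continuous_on UNIV g"
  shows "integrable lborel (\<lambda>t. indicator {0..r} t * g t)" "(LINT t|lborel. indicator {0..r} t * g t) = integral {0..r} g"
proof -
  have "set_integrable lborel {0..r} g"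
    using assms by (intro borel_integrable_atLeastAtMost' continuous_on_subset[OF assms]) auto
  then show "integrable lborel (\<lambda>t. indicator {0..r} t * g t)" "(LINT t|lborel. indicator {0..r} t * g t) = integral {0..r} g"
    using set_borel_integral_eq_integral[of "{0..r}" g] by (auto simp: set_integrable_def set_lebesgue_integral_def)
qed

lemma \<phi>_0: "\<phi> 0 = (LINT t|lborel. indicator {0<..} t * (t * f t))"
  unfolding \<phi>_def by (intro Bochner_Integration.integral_cong) (auto simp: kern_def indicator_def power2_eq_square)

text \<open>The kernel is split at t = r. Writing the outer integral as the full one minus
  \<open>I2\<close> leaves integrals over bounded intervals, to which the fundamental theorem
  applies.\<close>

lemma \<phi>_eq:
  assumes "r > 0"
  shows "\<phi> r = I1 r / r + \<phi> 0 - I2 r"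
proof -
  have i1: "integrable lborel (\<lambda>t. indicator {0..r} t * (t\<^sup>2 * f t))" "(LINT t|lborel. indicator {0..r} t * (t\<^sup>2 * f t)) = I1 r"
    unfolding I1_def by (intro lborel_integral_Icc continuous_intros cont_f)+
  have i2: "integrable lborel (\<lambda>t. indicator {0..r} t * (t * f t))" "(LINT t|lborel. indicator {0..r} t * (t * f t)) = I2 r"
    unfolding I2_def by (intro lborel_integral_Icc continuous_intros cont_f)+
  have "\<phi> r = (LINT t|lborel. (indicator {0..r} t * (t\<^sup>2 * f t)) / r + indicator {0<..} t * (t * f t) - indicator {0..r} t * (t * f t))"
    unfolding \<phi>_def
    using assms by (intro Bochner_Integration.integral_cong) (auto simp: kern_def indicator_def power2_eq_square max_def)
  also have "\<dots> = I1 r / r + \<phi> 0 - I2 r"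
    using i1 i2 int_f by (simp add: \<phi>_0)
  finally show ?thesis .
qed

text \<open>The gradient of \<open>\<lambda>x. \<phi> (norm x)\<close> is \<open>- m (norm x) *\<^sub>R x\<close>; the value at \<open>0\<close> makes it continuous.\<close>

definition m :: "real \<Rightarrow> real" where "m r = (if r = 0 then f 0 / 3 else I1 r / r ^ 3)"

lemma \<phi>_deriv:
  assumes "r > 0"
  shows "(\<phi> has_real_derivative - r * m r) (at r)"
proof -
  have "((\<lambda>r. I1 r / r + \<phi> 0 - I2 r) has_real_derivative - r * m r) (at r)"
    using assms by (auto intro!: derivative_eq_intros I1_deriv I2_deriv simp: m_def field_simps power2_eq_square power3_eq_cube)
  moreover have "\<forall>\<^sub>F r in nhds r. \<phi> r = I1 r / r + \<phi> 0 - I2 r"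
    using eventually_nhds_in_open[of "{0<..}" r] assms by (auto elim!: eventually_mono simp: \<phi>_eq)
  ultimately show ?thesis
    by (simp add: DERIV_cong_ev)
qed

lemma m_deriv:
  assumes "r > 0"
  shows "(m has_real_derivative (f r - 3 * m r) / r) (at r)"
proof -
  have "((\<lambda>r. I1 r / r ^ 3) has_real_derivative (f r - 3 * m r) / r) (at r)"
    using assms by (auto intro!: derivative_eq_intros I1_deriv simp: m_def field_simps power2_eq_square power3_eq_cube)
  moreover have "\<forall>\<^sub>F r in nhds r. m r = I1 r / r ^ 3"
    using eventually_nhds_in_open[of "{0<..}" r, OF _ assms[folded greaterThan_iff]] by (rule eventually_mono) (auto simp: m_def)
  ultimately show ?thesis
    by (simp add: DERIV_cong_ev)
qed

lemma m_tendsto_0: "(m \<longlongrightarrow> f 0 / 3) (at_right 0)"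
proof -
  have "((\<lambda>r. I1 r / r ^ 3) \<longlongrightarrow> f 0 / 3) (at_right 0)"
  proof (rule lhopital_right_0)
    have "continuous_on {0..1} I1"
      unfolding I1_def[abs_def]
      by (intro indefinite_integral_continuous_1 integrable_continuous_interval continuous_intros cont_on_f)
    then have "(I1 \<longlongrightarrow> I1 0) (at_right 0)"
      by (simp add: continuous_on_Icc_at_rightD)
    then show "(I1 \<longlongrightarrow> 0) (at_right 0)" by (simp add: I1_def)
    show "((\<lambda>r::real. r ^ 3) \<longlongrightarrow> 0) (at_right 0)"
      by (auto intro!: tendsto_eq_intros)
    show "\<forall>\<^sub>F r in at_right 0. r ^ 3 \<noteq> (0::real)" "\<forall>\<^sub>F r in at_right 0. 3 * r\<^sup>2 \<noteq> (0::real)"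
      by (auto simp: eventually_at_right_less intro!: eventually_at_rightI[of 0 1])
    show "\<forall>\<^sub>F r in at_right 0. (I1 has_real_derivative r\<^sup>2 * f r) (at r)"
      by (auto intro!: eventually_at_rightI[of 0 1] I1_deriv)
    show "\<forall>\<^sub>F r in at_right 0. ((\<lambda>r::real. r ^ 3) has_real_derivative 3 * r\<^sup>2) (at r)"
      by (auto intro!: eventually_at_rightI[of 0 1] derivative_eq_intros)
    have "(f \<longlongrightarrow> f 0) (at_right 0)"
      using cont_f by (metis continuous_on_eq_continuous_within continuous_within UNIV_I at_within_open filterlim_at_split open_UNIV)
    then have "((\<lambda>r. f r / 3) \<longlongrightarrow> f 0 / 3) (at_right 0)" by (intro tendsto_intros) auto
    then show "((\<lambda>r. r\<^sup>2 * f r / (3 * r\<^sup>2)) \<longlongrightarrow> f 0 / 3) (at_right 0)"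
      by (rule Lim_transform_eventually) (rule eventually_at_rightI[of 0 1], simp_all)
  qed
  then show ?thesis
    by (rule Lim_transform_eventually) (rule eventually_at_rightI[of 0 1], simp_all add: m_def)
qed

lemma m_norm_cont: "isCont (\<lambda>x::real^3. m (norm x)) x"
proof (cases "x = 0")
  case True
  have "filterlim (norm :: real^3 \<Rightarrow> real) (at_right 0) (at 0)"
    unfolding filterlim_at using tendsto_norm_zero[OF tendsto_ident_at]
    by (simp add: eventually_at_filter)
  then have "((\<lambda>x::real^3. m (norm x)) \<longlongrightarrow> f 0 / 3) (at 0)"
    by (rule filterlim_compose[OF m_tendsto_0])
  then show ?thesis using True by (simp add: isCont_def m_def)
next
  case False
  then have "isCont m (norm x)" using m_deriv[of "norm x"] by (intro DERIV_isCont) auto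
  moreover have "isCont (norm :: real^3 \<Rightarrow> real) x" by (intro continuous_intros)
  ultimately show ?thesis by (rule isCont_o2[rotated])
qed

lemma f_norm_cont: "isCont (\<lambda>x::real^3. f (norm x)) x"
proof -
  have "isCont f (norm x)" using cont_f by (simp add: continuous_on_eq_continuous_at)
  moreover have "isCont (norm :: real^3 \<Rightarrow> real) x" by (intro continuous_intros)
  ultimately show ?thesis by (rule isCont_o2[rotated])
qed

definition W :: "real^3 \<Rightarrow> real" where "W x = \<phi> (norm x)"

lemma \<phi>_near_0:
  assumes "\<And>t. 0 \<le> t \<Longrightarrow> t \<le> 1 \<Longrightarrow> \<bar>f t\<bar> \<le> B" "0 < r" "r \<le> 1"
  shows "\<bar>\<phi> r - \<phi> 0\<bar> \<le> 2 * B * r\<^sup>2"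
proof -
  have B: "B \<ge> 0" using assms(1)[of 0] by simp
  have "\<bar>I1 r\<bar> \<le> (B * r\<^sup>2) * r"
  proof -
    have "norm (I1 r) \<le> (B * r\<^sup>2) * measure lborel (cbox 0 r)"
      unfolding I1_def cbox_interval[symmetric]
    proof (rule integrable_bound)
      show "norm (t\<^sup>2 * f t) \<le> B * r\<^sup>2" if "t \<in> cbox 0 r" for t
        using that assms(1)[of t] assms(2,3) B mult_mono[of "\<bar>f t\<bar>" B "t\<^sup>2" "r\<^sup>2"]
        by (auto simp: abs_mult mult.commute power_mono)
    qed (use B in \<open>auto intro!: integrable_continuous_interval continuous_intros cont_on_f\<close>)
    then show ?thesis using assms by simp
  qed
  moreover have "\<bar>I2 r\<bar> \<le> (B * r) * r"
  proof -
    have "norm (I2 r) \<le> (B * r) * measure lborel (cbox 0 r)"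
      unfolding I2_def cbox_interval[symmetric]
    proof (rule integrable_bound)
      show "norm (t * f t) \<le> B * r" if "t \<in> cbox 0 r" for t
        using that assms(1)[of t] assms(2,3) B mult_mono[of "\<bar>f t\<bar>" B "t" "r"]
        by (auto simp: abs_mult mult.commute)
    qed (use B assms in \<open>auto intro!: integrable_continuous_interval continuous_intros cont_on_f\<close>)
    then show ?thesis using assms by simp
  qed
  moreover have "\<bar>I1 r / r\<bar> \<le> B * r\<^sup>2"
    using \<open>\<bar>I1 r\<bar> \<le> (B * r\<^sup>2) * r\<close> assms by (simp add: field_simps)
  moreover have "\<bar>\<phi> r - \<phi> 0\<bar> \<le> \<bar>I1 r / r\<bar> + \<bar>I2 r\<bar>"
    using assms by (simp only: \<phi>_eq)
  moreover have "(B * r) * r = B * r\<^sup>2" by (simp add: power2_eq_square)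
  ultimately show ?thesis by linarith
qed

text \<open>At the origin the norm is not differentiable. There the quadratic estimate
  \<open>\<phi>_near_0\<close> shows that the derivative vanishes; elsewhere the chain rule
  applies.\<close>

lemma W_deriv: "(W has_derivative (\<lambda>h. - (x \<bullet> h) * m (norm x))) (at x)"
proof (cases "x = 0")
  case True
  have "compact ((\<lambda>t. \<bar>f t\<bar>) ` {0..1})"
    by (intro compact_continuous_image continuous_intros cont_on_f) auto
  then have "bdd_above ((\<lambda>t. \<bar>f t\<bar>) ` {0..1})" by (intro bounded_imp_bdd_above compact_imp_bounded)
  then obtain B where "\<forall>t\<in>{0..1}. \<bar>f t\<bar> \<le> B" by (auto simp: bdd_above_def)
  then have B: "\<And>t. 0 \<le> t \<Longrightarrow> t \<le> 1 \<Longrightarrow> \<bar>f t\<bar> \<le> B" by simp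
  have "((\<lambda>h. (W h - W 0) / norm h) \<longlongrightarrow> 0) (at (0::real^3))"
  proof (rule Lim_null_comparison)
    show "\<forall>\<^sub>F h in at (0::real^3). norm ((W h - W 0) / norm h) \<le> 2 * B * norm h"
    proof (rule eventually_at_ball'[THEN eventually_mono, of 1 _ UNIV])
      fix h :: "real^3" assume h: "h \<in> ball 0 1 \<and> h \<noteq> 0 \<and> h \<in> UNIV"
      then have "\<bar>W h - W 0\<bar> \<le> 2 * B * (norm h)\<^sup>2"
        using \<phi>_near_0[OF B, of "norm h"] by (auto simp: W_def)
      then show "norm ((W h - W 0) / norm h) \<le> 2 * B * norm h"
        using h by (simp add: field_simps power2_eq_square)
    qed simp
    show "((\<lambda>h::real^3. 2 * B * norm h) \<longlongrightarrow> 0) (at 0)"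
      by (auto intro!: tendsto_eq_intros)
  qed
  then have "((\<lambda>h. \<bar>(W h - W 0) / norm h\<bar>) \<longlongrightarrow> 0) (at (0::real^3))"
    by (rule tendsto_rabs_zero)
  then have "(W has_derivative (\<lambda>h. 0)) (at 0)"
    unfolding has_derivative_at by (simp add: abs_divide)
  then show ?thesis using True by simp
next
  case False
  have "(norm has_derivative (\<lambda>h. h \<bullet> sgn x)) (at x)" using False by (rule has_derivative_norm)
  moreover have "(\<phi> has_derivative (\<lambda>h. (- norm x * m (norm x)) * h)) (at (norm x))"
    by (rule \<phi>_deriv[unfolded has_field_derivative_def]) (use False in simp)
  ultimately have "((\<lambda>x. \<phi> (norm x)) has_derivative (\<lambda>h. (- norm x * m (norm x)) * (h \<bullet> sgn x))) (at x)"
    by (rule has_derivative_compose)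
  moreover have "(\<lambda>h. (- norm x * m (norm x)) * (h \<bullet> sgn x)) = (\<lambda>h. - (x \<bullet> h) * m (norm x))"
    using False by (simp add: fun_eq_iff sgn_div_norm inner_commute)
  ultimately show ?thesis unfolding W_def[abs_def] by (simp only:)
qed

lemma partial_W: "partial i W = (\<lambda>x. - (x $ i) * m (norm x))"
proof
  fix x
  have "partial i W x = - (x \<bullet> axis i 1) * m (norm x)"
    unfolding partial_def using frechet_derivative_at[OF W_deriv[of x]] by metis
  then show "partial i W x = - (x $ i) * m (norm x)" by (simp add: inner_axis)
qed

definition W2 :: "3 \<Rightarrow> real^3 \<Rightarrow> real^3 \<Rightarrow> real" where
  "W2 i x h = - (h $ i * m (norm x) + (if x = 0 then 0 else x $ i * ((f (norm x) - 3 * m (norm x)) * (x \<bullet> h) / (norm x)\<^sup>2)))"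

text \<open>No differentiability of m at 0 is available. The factor \<open>x $ i\<close>
  compensates: continuity of m (norm x) at the origin is enough for the product to be differentiable
  there.\<close>

lemma partial_W_deriv: "((\<lambda>x. - (x $ i) * m (norm x)) has_derivative W2 i x) (at x)"
proof (cases "x = 0")
  case True
  have "((\<lambda>h::real^3. m (norm h) - m 0) \<longlongrightarrow> m 0 - m 0) (at 0)"
    using m_norm_cont[of 0] by (intro tendsto_intros) (simp add: isCont_def)
  then have lim: "((\<lambda>h::real^3. \<bar>m (norm h) - m 0\<bar>) \<longlongrightarrow> 0) (at 0)"
    by (simp add: tendsto_rabs_zero_iff)
  have "((\<lambda>h. norm (- (h $ i) * m (norm h) - W2 i 0 h) / norm h) \<longlongrightarrow> 0) (at (0::real^3))"
  proof (rule Lim_null_comparison[OF _ lim], rule always_eventually, rule allI)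
    fix h :: "real^3"
    have "- (h $ i) * m (norm h) - W2 i 0 h = - (h $ i) * (m (norm h) - m 0)"
      by (simp add: W2_def algebra_simps)
    then have "norm (- (h $ i) * m (norm h) - W2 i 0 h) = \<bar>h $ i\<bar> * \<bar>m (norm h) - m 0\<bar>" by (simp add: abs_mult)
    also have "\<dots> \<le> norm h * \<bar>m (norm h) - m 0\<bar>" by (intro mult_right_mono component_le_norm_cart) auto
    finally show "norm (norm (- (h $ i) * m (norm h) - W2 i 0 h) / norm h) \<le> \<bar>m (norm h) - m 0\<bar>"
      by (cases "h = 0") (auto simp: field_simps)
  qed
  moreover have "bounded_linear (W2 i 0)"
    unfolding W2_def[abs_def] by (auto intro!: bounded_linear_intros bounded_linear_minus bounded_linear_mult_const bounded_linear_vec_nth)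
  ultimately show ?thesis
    using True unfolding has_derivative_at by simp
next
  case False
  have "(norm has_derivative (\<lambda>h. h \<bullet> sgn x)) (at x)" using False by (rule has_derivative_norm)
  moreover have "(m has_derivative (\<lambda>h. (f (norm x) - 3 * m (norm x)) / norm x * h)) (at (norm x))"
    by (rule m_deriv[unfolded has_field_derivative_def]) (use False in simp)
  ultimately have "((\<lambda>x. m (norm x)) has_derivative (\<lambda>h. (f (norm x) - 3 * m (norm x)) / norm x * (h \<bullet> sgn x))) (at x)"
    by (rule has_derivative_compose)
  then have "((\<lambda>x. - (x $ i) * m (norm x)) has_derivative (\<lambda>h. - (x $ i) * ((f (norm x) - 3 * m (norm x)) / norm x * (h \<bullet> sgn x)) + - (h $ i) * m (norm x))) (at x)"
    by (intro derivative_intros bounded_linear_imp_has_derivative bounded_linear_vec_nth)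
  moreover have "(\<lambda>h. - (x $ i) * ((f (norm x) - 3 * m (norm x)) / norm x * (h \<bullet> sgn x)) + - (h $ i) * m (norm x)) = W2 i x"
    using False by (simp add: fun_eq_iff W2_def sgn_div_norm inner_commute power2_eq_square mult_ac divide_inverse)
  ultimately show ?thesis by (simp only:)
qed

lemma partial2_W: "partial j (partial i W) = (\<lambda>x. W2 i x (axis j 1))"
proof
  fix x
  show "partial j (partial i W) x = W2 i x (axis j 1)"
    unfolding partial_W partial_def[of j] using frechet_derivative_at[OF partial_W_deriv[of i x]] by metis
qed

text \<open>The direction-dependent factor x_i * x_j / |x|^2 is bounded by 1, and f - 3 * m tends to
  0 at the origin because m 0 = f 0 / 3.\<close>

lemma W2_cont: "isCont (\<lambda>x. W2 i x (axis j 1)) x"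
proof -
  let ?g = "\<lambda>x::real^3. if x = 0 then 0 else x $ i * ((f (norm x) - 3 * m (norm x)) * x $ j / (norm x)\<^sup>2)"
  have "isCont ?g x"
  proof (cases "x = 0")
    case True
    have "((\<lambda>x::real^3. f (norm x) - 3 * m (norm x)) \<longlongrightarrow> f 0 - 3 * m 0) (at 0)"
      using m_norm_cont[of 0] f_norm_cont[of 0] by (intro tendsto_intros) (auto simp: isCont_def)
    then have lim: "((\<lambda>x::real^3. \<bar>f (norm x) - 3 * m (norm x)\<bar>) \<longlongrightarrow> 0) (at 0)"
      by (simp add: m_def tendsto_rabs_zero_iff)
    have "(?g \<longlongrightarrow> 0) (at 0)"
    proof (rule Lim_null_comparison[OF _ lim], rule always_eventually, rule allI)
      fix x :: "real^3"
      show "norm (?g x) \<le> \<bar>f (norm x) - 3 * m (norm x)\<bar>"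
      proof (cases "x = 0")
        case False
        have "\<bar>x $ i\<bar> * \<bar>x $ j\<bar> \<le> norm x * norm x" by (intro mult_mono component_le_norm_cart) auto
        then have "\<bar>x $ i\<bar> * \<bar>x $ j\<bar> * \<bar>f (norm x) - 3 * m (norm x)\<bar> \<le> (norm x)\<^sup>2 * \<bar>f (norm x) - 3 * m (norm x)\<bar>"
          by (intro mult_right_mono) (auto simp: power2_eq_square)
        moreover have "norm (?g x) = \<bar>x $ i\<bar> * \<bar>x $ j\<bar> * \<bar>f (norm x) - 3 * m (norm x)\<bar> / (norm x)\<^sup>2"
          using False by (simp add: abs_mult)
        ultimately show ?thesis using False by (simp add: divide_le_eq mult.commute)
      qed simp
    qed
    then show ?thesis using True by (simp add: isCont_def)
  next
    case False
    have "isCont (\<lambda>x::real^3. x $ i * ((f (norm x) - 3 * m (norm x)) * x $ j / (norm x)\<^sup>2)) x"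
      using False by (intro continuous_intros m_norm_cont f_norm_cont) auto
    moreover have "\<forall>\<^sub>F y in nhds x. y \<noteq> 0"
      using eventually_nhds_in_open[of "- {0}" x] False by (auto elim!: eventually_mono)
    then have "\<forall>\<^sub>F y in nhds x. ?g y = y $ i * ((f (norm y) - 3 * m (norm y)) * y $ j / (norm y)\<^sup>2)"
      by eventually_elim simp
    ultimately show ?thesis by (simp add: isCont_cong)
  qed
  then have "isCont (\<lambda>x. - (axis j 1 $ i * m (norm x) + ?g x)) x"
    by (intro continuous_intros m_norm_cont)
  then show ?thesis by (simp add: W2_def inner_axis cong: if_cong)
qed

lemma C2_W: "C_k 2 W"
proof -
  have "W differentiable (at x)" for x using W_deriv by (auto simp: differentiable_def)
  moreover have "partial i W differentiable (at x)" for i x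
    unfolding partial_W using partial_W_deriv by (auto simp: differentiable_def)
  moreover have "continuous_on UNIV (partial j (partial i W))" for i j
    unfolding partial2_W by (auto intro!: continuous_at_imp_continuous_on W2_cont)
  ultimately show ?thesis by (simp add: numeral_2_eq_2)
qed

lemma laplacian_W: "laplacian W x = - f (norm x)"
proof -
  have "laplacian W x = (\<Sum>i\<in>UNIV. W2 i x (axis i 1))"
    unfolding laplacian_def partial2_W ..
  also have "\<dots> = - (3 * m (norm x) + (if x = 0 then 0 else (f (norm x) - 3 * m (norm x)) * ((x $ 1)\<^sup>2 + (x $ 2)\<^sup>2 + (x $ 3)\<^sup>2) / (norm x)\<^sup>2))"
  proof -
    have "axis i (1::real) $ i = (1::real)" for i :: 3 by (simp add: axis_def)
    then show ?thesis
      by (cases "x = 0") (simp_all add: W2_def sum_3 inner_axis add_divide_distrib distrib_left power2_eq_square mult_ac)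
  qed
  also have "\<dots> = - f (norm x)"
    by (cases "x = 0") (auto simp: norm_vec3[symmetric] m_def)
  finally show ?thesis .
qed

end

section \<open>Maximum principle and uniqueness of the scattering solution\<close>

lemma partial_eqI:
  assumes "(f has_derivative f') (at x)"
  shows "partial i f x = f' (axis i 1)"
  using frechet_derivative_at[OF assms] by (simp add: partial_def)

lemma partial_diff:
  assumes "f differentiable (at x)" "g differentiable (at x)"
  shows "partial i (\<lambda>y. f y - g y) x = partial i f x - partial i g x"
proof -
  obtain f' g' where d: "(f has_derivative f') (at x)" "(g has_derivative g') (at x)"
    using assms by (auto simp: differentiable_def)
  show ?thesis
    using partial_eqI[OF has_derivative_diff[OF d], of i] partial_eqI[OF d(1), of i] partial_eqI[OF d(2), of i] by simp
qed

lemma laplacian_diff: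
  assumes "\<And>x. f differentiable (at x)" "\<And>x. g differentiable (at x)"
    and "\<And>i x. partial i f differentiable (at x)" "\<And>i x. partial i g differentiable (at x)"
  shows "laplacian (\<lambda>y. f y - g y) x = laplacian f x - laplacian g x"
proof -
  have "partial i (\<lambda>y. f y - g y) = (\<lambda>x. partial i f x - partial i g x)" for i
    using partial_diff[OF assms(1,2)] by auto
  then show ?thesis
    unfolding laplacian_def using partial_diff[OF assms(3,4)] by (simp add: sum_subtractf)
qed

lemma partial_const: "partial i (\<lambda>_. c) = (\<lambda>_. 0)"
  using partial_eqI[OF has_derivative_const] by auto

lemma has_derivative_line:
  fixes u :: "real^3 \<Rightarrow> real"
  assumes "u differentiable (at (y + t *\<^sub>R axis i 1))"
  shows "((\<lambda>t. u (y + t *\<^sub>R axis i 1)) has_real_derivative partial i u (y + t *\<^sub>R axis i 1)) (at t)"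
proof -
  obtain u' where u': "(u has_derivative u') (at (y + t *\<^sub>R axis i 1))"
    using assms by (auto simp: differentiable_def)
  have "((\<lambda>t. y + t *\<^sub>R axis i 1) has_derivative (\<lambda>h. h *\<^sub>R axis i (1::real))) (at t)"
    by (auto intro!: derivative_eq_intros)
  from has_derivative_compose[OF this u']
  have "((\<lambda>t. u (y + t *\<^sub>R axis i 1)) has_derivative (\<lambda>h. u' (h *\<^sub>R axis i 1))) (at t)" .
  moreover have "(\<lambda>h. u' (h *\<^sub>R axis i 1)) = (*) (u' (axis i 1))"
    using has_derivative_bounded_linear[OF u'] by (auto simp: linear_scale bounded_linear.linear)
  ultimately show ?thesis
    by (simp add: has_field_derivative_def partial_eqI[OF u'])
qed

lemma second_derivative_test:
  fixes g g' :: "real \<Rightarrow> real"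
  assumes d1: "\<And>t. (g has_real_derivative g' t) (at t)" and d2: "(g' has_real_derivative D) (at 0)"
    and max: "e > 0" "\<And>t. \<bar>t\<bar> < e \<Longrightarrow> g t \<le> g 0"
  shows "D \<le> 0"
proof (rule ccontr)
  assume "\<not> D \<le> 0"
  then have "D > 0" by simp
  have "g' 0 = 0"
    using d1[of 0] max by (intro DERIV_local_max[of g "g' 0" 0 e]) auto
  obtain d where d: "d > 0" "\<And>h. h > 0 \<Longrightarrow> h < d \<Longrightarrow> g' 0 < g' (0 + h)"
    using DERIV_pos_inc_right[OF d2 \<open>D > 0\<close>] by blast
  define h where "h = min d e / 2"
  have h: "0 < h" "h < d" "h < e" using d max by (auto simp: h_def min_def)
  have "\<exists>z>0. z < h \<and> g h - g 0 = (h - 0) * g' z"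
    using h d1 by (intro MVT2) auto
  then obtain z where z: "0 < z" "z < h" "g h - g 0 = h * g' z" by auto
  moreover have "h * g' z > 0" using d(2)[of z] h z \<open>g' 0 = 0\<close> by (intro mult_pos_pos) auto
  ultimately have "g h > g 0" by simp
  then show False using max(2)[of h] h by simp
qed

text \<open>A positive value would force a positive maximum by the decay at infinity. A nonnegative
  Laplacian does not contradict a maximum of u itself, so a small multiple of the squared norm is
  added to make the second derivatives strictly negative.\<close>

lemma maximum_principle:
  fixes u :: "real^3 \<Rightarrow> real"
  assumes d: "\<And>x. u differentiable (at x)" "\<And>i x. partial i u differentiable (at x)"
    and eq: "\<And>x. u x > 0 \<Longrightarrow> laplacian u x \<ge> 0" and lim: "(u \<longlongrightarrow> 0) at_infinity"
  shows "u x \<le> 0"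
proof (rule ccontr)
  assume "\<not> u x \<le> 0"
  define \<eta> where "\<eta> = u x / 2"
  have \<eta>: "\<eta> > 0" "u x = 2 * \<eta>" using \<open>\<not> u x \<le> 0\<close> by (auto simp: \<eta>_def)
  have "\<forall>\<^sub>F y in at_infinity. u y < \<eta>" by (rule order_tendstoD(2)[OF lim \<eta>(1)])
  then obtain R0 where R0: "\<And>y. norm y \<ge> R0 \<Longrightarrow> u y < \<eta>" by (auto simp: eventually_at_infinity)
  define R where "R = max R0 (norm x + 1)"
  have R: "\<And>y. norm y \<ge> R \<Longrightarrow> u y < \<eta>" "norm x < R" "R > 0"
  proof -
    show "u y < \<eta>" if "norm y \<ge> R" for y using that R0[of y] by (simp add: R_def)
    show "norm x < R" by (simp add: R_def)
    then show "R > 0" using norm_ge_zero[of x] by linarith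
  qed
  \<comment> \<open>On the ball the perturbation is at most \<eta> / 2, while u is below \<eta> at
    the boundary and the perturbed maximum is at least 2 * \<eta>. Hence the maximum is interior,
    and u is positive there.\<close>
  define \<epsilon> where "\<epsilon> = \<eta> / (2 * R\<^sup>2)"
  have \<epsilon>: "\<epsilon> > 0" "\<epsilon> * R\<^sup>2 = \<eta> / 2" using R \<eta> by (auto simp: \<epsilon>_def)
  define V where "V y = u y + \<epsilon> * (y \<bullet> y)" for y
  have "continuous_on (cball 0 R) u"
    using d(1) by (intro continuous_at_imp_continuous_on) (auto intro: differentiable_imp_continuous_within)
  then have "continuous_on (cball 0 R) V" unfolding V_def by (intro continuous_intros)
  then obtain y where y: "y \<in> cball 0 R" "\<And>z. z \<in> cball 0 R \<Longrightarrow> V z \<le> V y"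
    using continuous_attains_sup[of "cball (0::real^3) R" V] R by auto
  have "V x \<le> V y" using y R by auto
  then have Vy: "V y \<ge> 2 * \<eta>" using \<eta> \<epsilon> by (simp add: V_def) (smt (verit) inner_ge_zero mult_nonneg_nonneg)
  have le: "\<epsilon> * (y \<bullet> y) \<le> \<eta> / 2"
    using y(1) \<epsilon> by (simp add: power2_norm_eq_inner[symmetric] power_mono flip: \<epsilon>(2))
  have yR: "norm y < R"
  proof (rule ccontr)
    assume "\<not> norm y < R"
    then have "u y < \<eta>" using R by simp
    then show False using Vy le \<eta> by (simp add: V_def)
  qed
  have "u y > 0" using Vy le \<eta> by (simp add: V_def)
  \<comment> \<open>The restriction of the perturbed function to a coordinate line through y has a
    local maximum; its second derivative is that of u plus 2 * \<epsilon>.\<close>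
  have part: "partial i (partial i u) y \<le> - 2 * \<epsilon>" for i
  proof -
    define g where "g t = V (y + t *\<^sub>R axis i 1)" for t
    define g' where "g' t = partial i u (y + t *\<^sub>R axis i 1) + \<epsilon> * (2 * (y $ i + t))" for t
    have sq: "(y + t *\<^sub>R axis i 1) \<bullet> (y + t *\<^sub>R axis i 1) = y \<bullet> y + 2 * t * y $ i + t\<^sup>2" for t
      by (simp add: inner_add_left inner_add_right inner_axis inner_axis' power2_eq_square algebra_simps)
    have "partial i (partial i u) y + 2 * \<epsilon> \<le> 0"
    proof (rule second_derivative_test)
      show "(g has_real_derivative g' t) (at t)" for t
      proof -
        have "((\<lambda>t. \<epsilon> * (y \<bullet> y + 2 * t * y $ i + t\<^sup>2)) has_real_derivative \<epsilon> * (2 * (y $ i + t))) (at t)"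
          by (auto intro!: derivative_eq_intros)
        from DERIV_add[OF has_derivative_line[OF d(1)] this] show ?thesis
          unfolding g_def[abs_def] V_def g'_def sq .
      qed
      have "((\<lambda>t. partial i u (y + t *\<^sub>R axis i 1)) has_real_derivative partial i (partial i u) (y + 0 *\<^sub>R axis i 1)) (at 0)"
        by (rule has_derivative_line) (rule d)
      then have "((\<lambda>t. partial i u (y + t *\<^sub>R axis i 1)) has_real_derivative partial i (partial i u) y) (at 0)" by simp
      then show "(g' has_real_derivative partial i (partial i u) y + 2 * \<epsilon>) (at 0)"
      proof -
        assume a: "((\<lambda>t. partial i u (y + t *\<^sub>R axis i 1)) has_real_derivative partial i (partial i u) y) (at 0)"
        have "((\<lambda>t. \<epsilon> * (2 * (y $ i + t))) has_real_derivative 2 * \<epsilon>) (at 0)"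
          by (auto intro!: derivative_eq_intros)
        from DERIV_add[OF a this] show ?thesis unfolding g'_def[abs_def] .
      qed
      show "R - norm y > 0" using yR by simp
      fix t assume "\<bar>t\<bar> < R - norm y"
      moreover have "norm (y + t *\<^sub>R axis i (1::real)) \<le> norm y + \<bar>t\<bar>"
        using norm_triangle_ineq[of y "t *\<^sub>R axis i (1::real)"] by simp
      ultimately have "y + t *\<^sub>R axis i 1 \<in> cball 0 R" by simp
      then show "g t \<le> g 0" using y(2) by (simp add: g_def)
    qed
    then show ?thesis by simp
  qed
  have "laplacian u y \<le> (\<Sum>i::3\<in>UNIV. - 2 * \<epsilon>)"
    unfolding laplacian_def by (intro sum_mono part)
  also have "\<dots> < 0" using \<epsilon> by simp
  finally show False using eq[OF \<open>u y > 0\<close>] by simp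
qed

text \<open>The difference u of two solutions satisfies Laplace u = V * u / 2, which is nonnegative
  where u is positive. The maximum principle applies in both directions.\<close>

lemma scattering_equation_unique:
  assumes V: "\<And>x. V x \<ge> 0" and w: "scattering_equation V w1" "scattering_equation V w2"
  shows "w1 = w2"
proof -
  have le: "w x \<le> w' x" if w: "scattering_equation V w" and w': "scattering_equation V w'" for w w' x
  proof -
    have d: "\<And>x. w differentiable (at x)" "\<And>i x. partial i w differentiable (at x)"
      "\<And>x. w' differentiable (at x)" "\<And>i x. partial i w' differentiable (at x)"
      using w w' by (auto simp: scattering_equation_def numeral_2_eq_2)
    have lap: "laplacian (\<lambda>y. 1 - w y) x = - laplacian w x" if "\<And>x. w differentiable (at x)" "\<And>i x. partial i w differentiable (at x)" for w x
      using laplacian_diff[of "\<lambda>_. 1" w] that by (simp add: partial_const laplacian_def)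
    have "w x - w' x \<le> 0"
    proof (rule maximum_principle)
      show "(\<lambda>x. w x - w' x) differentiable at x" for x using d by (intro differentiable_diff)
      have "partial i (\<lambda>y. w y - w' y) = (\<lambda>x. partial i w x - partial i w' x)" for i
        using partial_diff[OF d(1,3)] by auto
      then show "partial i (\<lambda>x. w x - w' x) differentiable at x" for i x using d by (simp add: differentiable_diff)
      show "((\<lambda>x. w x - w' x) \<longlongrightarrow> 0) at_infinity"
        using tendsto_diff[of w 0 at_infinity w' 0] w w' by (simp add: scattering_equation_def)
      fix x assume pos: "w x - w' x > 0"
      have "laplacian w x + 1/2 * V x * (1 - w x) = 0" "laplacian w' x + 1/2 * V x * (1 - w' x) = 0"
        using w w' d by (auto simp: scattering_equation_def lap)
      then have "laplacian (\<lambda>x. w x - w' x) x = 1/2 * V x * (w x - w' x)"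
      proof -
        have "1/2 * V x * (1 - w' x) - 1/2 * V x * (1 - w x) = 1/2 * V x * (w x - w' x)"
          by algebra
        moreover have "laplacian (\<lambda>x. w x - w' x) x = laplacian w x - laplacian w' x"
          using d by (intro laplacian_diff)
        ultimately show ?thesis
          using \<open>laplacian w x + 1/2 * V x * (1 - w x) = 0\<close> \<open>laplacian w' x + 1/2 * V x * (1 - w' x) = 0\<close> by linarith
      qed
      then show "laplacian (\<lambda>x. w x - w' x) x \<ge> 0" using V[of x] pos by (simp only:) (simp add: mult_nonneg_nonneg)
    qed
    then show ?thesis by simp
  qed
  show ?thesis using le[OF w] le[OF w(2,1)] by (auto intro!: ext order_antisym)
qed

text \<open>The fixed point is the Newton potential of v * (1 - \<phi>) / 2 and therefore twice
  continuously differentiable. It solves the equation, and uniqueness identifies it with the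
  described function \<open>scattering_w V\<close>.\<close>

theorem (in profile) scattering_w_radial:
  assumes V: "\<And>x. V x = v (norm (x::real^3))" and J: "J < 1"
  obtains \<phi> where "continuous_on UNIV \<phi>" "\<And>r. 0 \<le> \<phi> r" "\<And>r. \<phi> r < 1" "\<And>x. scattering_w V x = \<phi> (norm x)"
    "\<And>r. \<phi> r = (LINT t|lborel. kern r t * (v t * (1 - \<phi> t) / 2))"
proof -
  obtain \<phi> where \<phi>: "continuous_on UNIV \<phi>" "\<And>r. \<phi> r = Tint (\<lambda>t. (1 - \<phi> t) / 2) r" "\<And>r. 0 \<le> \<phi> r" "\<And>r. \<phi> r < 1"
    using Tint_fixed_point[OF J] by blast
  define f where "f t = v t * (1 - \<phi> t) / 2" for t
  have f_cont: "continuous_on UNIV f" unfolding f_def by (intro continuous_intros cont_v \<phi>) auto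
  then have f_meas[measurable]: "f \<in> borel_measurable borel" by (rule borel_measurable_continuous_onI)
  interpret newton f
  proof
    show "continuous_on UNIV f" by (rule f_cont)
    show "integrable lborel (\<lambda>s. indicator {0<..} s * (s * f s))"
    proof (rule Bochner_Integration.integrable_bound[OF int_v1])
      show "AE s in lborel. norm (indicator {0<..} s * (s * f s)) \<le> norm (indicator {0<..} s * (s * v s))"
      proof (intro AE_I2)
        fix s
        have "\<bar>f s\<bar> \<le> \<bar>v s\<bar>" using \<phi>(3)[of s] \<phi>(4)[of s] v_nonneg[of s]
            mult_left_mono[of "1 - \<phi> s" 2 "v s"]
          by (auto simp: f_def abs_mult)
        then show "norm (indicator {0<..} s * (s * f s)) \<le> norm (indicator {0<..} s * (s * v s))"
          by (auto simp: indicator_def abs_mult mult_left_mono)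
      qed
    qed measurable
  qed
  have eq: "newton.\<phi> f r = \<phi> r" for r
    unfolding newton.\<phi>_def[OF newton_axioms] \<phi>(2)[of r] Tint_def f_def by (simp only: times_divide_eq_right)
  have W: "W = (\<lambda>x. \<phi> (norm x))" unfolding W_def[abs_def] eq ..
  have "((\<lambda>x::real^3. \<phi> (norm x)) \<longlongrightarrow> 0) at_infinity"
  proof -
    have "(\<lambda>t. (1 - \<phi> t) / 2) \<in> borel_measurable borel"
      by (intro borel_measurable_continuous_onI continuous_intros \<phi>) auto
    then have "(Tint (\<lambda>t. (1 - \<phi> t) / 2) \<longlongrightarrow> 0) at_top"
    proof (rule Tint_tendsto_0)
      show "\<bar>(1 - \<phi> t) / 2\<bar> \<le> 1" for t using \<phi>(3)[of t] \<phi>(4)[of t] by (simp add: abs_if)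
    qed
    moreover have "Tint (\<lambda>t. (1 - \<phi> t) / 2) = \<phi>" by (rule ext, rule \<phi>(2)[symmetric])
    ultimately have "(\<phi> \<longlongrightarrow> 0) at_top" by (simp only:)
    then show ?thesis by (rule filterlim_compose[OF _ filterlim_norm_at_top])
  qed
  moreover have "- laplacian (\<lambda>y. 1 - \<phi> (norm y)) x + 1/2 * V x * (1 - \<phi> (norm x)) = 0" for x :: "real^3"
  proof -
    have "laplacian (\<lambda>y. 1 - W y) x = laplacian (\<lambda>_. 1) x - laplacian W x"
      using C2_W by (intro laplacian_diff) (auto simp: numeral_2_eq_2 partial_const)
    then have "laplacian (\<lambda>y. 1 - W y) x = f (norm x)"
      by (simp add: laplacian_W) (simp add: laplacian_def partial_const)
    then show ?thesis by (simp add: W f_def V)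
  qed
  ultimately have "scattering_equation V (\<lambda>x. \<phi> (norm x))"
    using C2_W \<phi>(3,4) by (simp add: scattering_equation_def W)
  then have "scattering_w V = (\<lambda>x. \<phi> (norm x))"
    unfolding scattering_w_def using scattering_equation_unique[of V] v_nonneg V by (intro the_equality) auto
  then have "scattering_w V x = \<phi> (norm x)" for x by simp
  moreover have "\<phi> r = (LINT t|lborel. kern r t * (v t * (1 - \<phi> t) / 2))" for r
    using \<phi>(2)[of r] unfolding Tint_def times_divide_eq_right .
  ultimately show ?thesis using that[OF \<phi>(1,3,4)] by blast
qed

section \<open>Fourier inversion for the scattering solution\<close>

text \<open>The spherical Bessel function of order zero, as a constant that stays folded in products
  instead of a conditional expression.\<close>

definition bessel0 :: "real \<Rightarrow> real" where "bessel0 x = sinc x"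

lemma bessel0_eq: "x \<noteq> 0 \<Longrightarrow> bessel0 x = sin x / x"
  by (simp add: bessel0_def)

lemma bessel0_0 [simp]: "bessel0 0 = 1"
  by (simp add: bessel0_def)

lemma isCont_bessel0: "isCont bessel0 x"
  using isCont_sinc[of x] by (simp add: bessel0_def[abs_def])

lemma bessel0_measurable [measurable]: "bessel0 \<in> borel_measurable borel"
  unfolding bessel0_def[abs_def] by measurable

lemma DERIV_Si_bessel0: "(Si has_real_derivative bessel0 x) (at x)"
  unfolding bessel0_def by (rule DERIV_Si)

lemma abs_bessel0_le_1: "\<bar>bessel0 x\<bar> \<le> 1"
  using abs_sin_x_le_abs_x[of x] by (auto simp: bessel0_def field_simps)

lemma abs_bessel0_le_inverse: "x > 0 \<Longrightarrow> \<bar>bessel0 x\<bar> \<le> 1 / x"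
  using abs_sin_le_one[of x] by (auto simp: bessel0_def field_simps)

text \<open>The bounds 1 and 1 / (a * b * q^2), added, give one majorant integrable both at 0 and at
  infinity.\<close>

lemma abs_bessel0_mult_le:
  assumes "a > 0" "b > 0" "q > 0"
  shows "\<bar>bessel0 (q * a) * bessel0 (q * b)\<bar> \<le> 2 / (1 + a * b * q\<^sup>2)"
proof -
  have 1: "\<bar>bessel0 (q * a) * bessel0 (q * b)\<bar> \<le> 1"
    unfolding abs_mult using abs_bessel0_le_1 mult_mono[of "\<bar>bessel0 (q * a)\<bar>" 1 "\<bar>bessel0 (q * b)\<bar>" 1] by simp
  have "\<bar>bessel0 (q * a) * bessel0 (q * b)\<bar> \<le> 1 / (q * a) * (1 / (q * b))"
    unfolding abs_mult using assms by (intro mult_mono abs_bessel0_le_inverse) auto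
  then have "a * b * q\<^sup>2 * \<bar>bessel0 (q * a) * bessel0 (q * b)\<bar> \<le> a * b * q\<^sup>2 * (1 / (q * a) * (1 / (q * b)))"
    using assms by (intro mult_left_mono) auto
  also have "\<dots> = 1" using assms by (simp add: power2_eq_square)
  finally have "(1 + a * b * q\<^sup>2) * \<bar>bessel0 (q * a) * bessel0 (q * b)\<bar> \<le> 2"
    using 1 unfolding distrib_right by linarith
  moreover have "1 + a * b * q\<^sup>2 > 0" using assms by (simp add: add_pos_nonneg)
  ultimately show ?thesis by (simp add: pos_le_divide_eq mult.commute)
qed

lemma has_bochner_lorentz:
  assumes "c > 0"
  shows "integrable lborel (\<lambda>q. indicator {0<..} q * (2 / (1 + c * q\<^sup>2)))"
    and "(LINT q|lborel. indicator {0<..} q * (2 / (1 + c * q\<^sup>2))) = pi / sqrt c"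
proof -
  have nn: "1 + c * q\<^sup>2 > 0" for q :: real using assms by (simp add: add_pos_nonneg)
  have "(\<integral>\<^sup>+q. ennreal (indicator {0<..} q * (2 / (1 + c * q\<^sup>2))) \<partial>lborel) = (\<integral>\<^sup>+q. ennreal (2 / (1 + c * q\<^sup>2)) * indicator {0..} q \<partial>lborel)"
  proof (rule nn_integral_cong_AE)
    show "AE q in lborel. ennreal (indicator {0<..} q * (2 / (1 + c * q\<^sup>2))) = ennreal (2 / (1 + c * q\<^sup>2)) * indicator {0..} q"
      using AE_lborel_singleton[of 0] by eventually_elim (auto simp: indicator_def)
  qed
  also have "\<dots> = ennreal (pi / sqrt c - 2 * arctan (sqrt c * 0) / sqrt c)"
  proof (rule nn_integral_FTC_atLeast)
    fix q :: real
    show "((\<lambda>q. 2 * arctan (sqrt c * q) / sqrt c) has_real_derivative 2 / (1 + c * q\<^sup>2)) (at q)"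
      using assms by (auto intro!: derivative_eq_intros simp: power_mult_distrib divide_inverse)
    show "0 \<le> 2 / (1 + c * q\<^sup>2)" using nn[of q] by simp
  next
    have "((\<lambda>q. 2 * arctan (sqrt c * q) / sqrt c) \<longlongrightarrow> 2 * (pi / 2) / sqrt c) at_top"
      using assms by (intro tendsto_intros filterlim_compose[OF tendsto_arctan_at_top]
          filterlim_tendsto_pos_mult_at_top[OF tendsto_const _ filterlim_ident]) auto
    then show "((\<lambda>q. 2 * arctan (sqrt c * q) / sqrt c) \<longlongrightarrow> pi / sqrt c) at_top" by simp
  qed measurable
  finally have eq: "(\<integral>\<^sup>+q. ennreal (indicator {0<..} q * (2 / (1 + c * q\<^sup>2))) \<partial>lborel) = ennreal (pi / sqrt c)" by simp
  have "has_bochner_integral lborel (\<lambda>q. indicator {0<..} q * (2 / (1 + c * q\<^sup>2))) (pi / sqrt c)"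
    using eq nn assms by (intro has_bochner_integral_nn_integral) (auto intro!: AE_I2 mult_nonneg_nonneg less_imp_le)
  then show "integrable lborel (\<lambda>q. indicator {0<..} q * (2 / (1 + c * q\<^sup>2)))"
    and "(LINT q|lborel. indicator {0<..} q * (2 / (1 + c * q\<^sup>2))) = pi / sqrt c"
    by (auto simp: has_bochner_integral_iff)
qed

lemma bessel0_bessel0_integrable:
  assumes "a > 0" "b > 0"
  shows "integrable lborel (\<lambda>q. indicator {0<..} q * (bessel0 (q * a) * bessel0 (q * b)))"
proof (rule Bochner_Integration.integrable_bound[OF has_bochner_lorentz(1)[of "a * b"]])
  show "AE q in lborel. norm (indicator {0<..} q * (bessel0 (q * a) * bessel0 (q * b))) \<le> norm (indicator {0<..} q * (2 / (1 + a * b * q\<^sup>2)))"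
  proof (intro AE_I2)
    fix q :: real
    show "norm (indicator {0<..} q * (bessel0 (q * a) * bessel0 (q * b))) \<le> norm (indicator {0<..} q * (2 / (1 + a * b * q\<^sup>2)))"
      using order_trans[OF abs_bessel0_mult_le[OF assms, of q] abs_ge_self] by (cases "q > 0") (simp_all only: indicator_simps greaterThan_iff if_True mult_1 real_norm_def, simp)
  qed
qed (use assms in \<open>auto\<close>)

text \<open>\<open>H\<close> is an antiderivative: the integrand is sin (q * a) * sin (q * b) / (a *
  b * q^2), one integration by parts removes a power of q, and the product formulas turn the rest
  into sine integrals of a + b and a - b. This produces the Newton kernel from its
  transform.\<close>

lemma bessel0_bessel0_integral_le:
  assumes b: "0 < b" and ba: "b \<le> a"
  shows "(LINT q|lborel. indicator {0<..} q * (bessel0 (q * a) * bessel0 (q * b))) = pi / 2 / a"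
proof -
  have a: "a > 0" using assms by simp
  define H where "H q = - q * (bessel0 (q * a) * bessel0 (q * b)) + ((a + b) * Si ((a + b) * q) - (a - b) * Si ((a - b) * q)) / (2 * (a * b))" for q
  have fin: "(LINT q|lborel. indicator {0..T} q * (indicator {0<..} q * (bessel0 (q * a) * bessel0 (q * b)))) = H T" if T: "T > 0" for T
  proof -
    have cs: "continuous_on S (\<lambda>q. bessel0 (q * c))" for c S
      by (rule continuous_on_compose2[of UNIV bessel0]) (auto intro!: continuous_at_imp_continuous_on isCont_bessel0 continuous_intros)
    have cSi: "continuous_on S (\<lambda>q. Si (c * q))" for c S
      by (rule continuous_on_compose2[of UNIV Si]) (auto intro!: continuous_at_imp_continuous_on isCont_Si continuous_intros)
    have "((\<lambda>q. bessel0 (q * a) * bessel0 (q * b)) has_integral (H T - H 0)) {0..T}"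
    proof (rule fundamental_theorem_of_calculus_interior)
      show "continuous_on {0..T} H"
        unfolding H_def[abs_def] using a b by (intro continuous_intros cs cSi) auto
      fix q assume q: "q \<in> {0<..<T}"
      have d1: "((\<lambda>q. - (sin (q * a) * sin (q * b)) / (a * b * q)) has_real_derivative
          sin (q * a) * sin (q * b) / (a * b * q\<^sup>2) - (a * cos (q * a) * sin (q * b) + b * sin (q * a) * cos (q * b)) / (a * b * q)) (at q)"
        using q a b by (auto intro!: derivative_eq_intros simp: field_simps power2_eq_square)
      have ev: "\<forall>\<^sub>F x in nhds q. - x * (bessel0 (x * a) * bessel0 (x * b)) = - (sin (x * a) * sin (x * b)) / (a * b * x)"
      proof -
        have "\<forall>\<^sub>F x in nhds q. x \<in> {0<..}" using q by (intro eventually_nhds_in_open) auto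
        then show ?thesis by eventually_elim (use a b in \<open>auto simp: bessel0_eq field_simps\<close>)
      qed
      have d1': "((\<lambda>q. - q * (bessel0 (q * a) * bessel0 (q * b))) has_real_derivative
          sin (q * a) * sin (q * b) / (a * b * q\<^sup>2) - (a * cos (q * a) * sin (q * b) + b * sin (q * a) * cos (q * b)) / (a * b * q)) (at q)"
        using d1 by (subst DERIV_cong_ev[OF refl ev refl])
      have dSi: "((\<lambda>q. Si (c * q)) has_real_derivative bessel0 (c * q) * c) (at q)" for c
        by (rule DERIV_chain2[OF DERIV_Si_bessel0]) (auto intro!: derivative_eq_intros)
      have "(H has_real_derivative sin (q * a) * sin (q * b) / (a * b * q\<^sup>2) - (a * cos (q * a) * sin (q * b) + b * sin (q * a) * cos (q * b)) / (a * b * q)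
          + ((a + b) * (bessel0 ((a + b) * q) * (a + b)) - (a - b) * (bessel0 ((a - b) * q) * (a - b))) / (2 * (a * b))) (at q)"
        unfolding H_def[abs_def] by (intro DERIV_add d1' DERIV_cdivide DERIV_diff DERIV_cmult dSi)
      moreover have "(a + b) * (bessel0 ((a + b) * q) * (a + b)) - (a - b) * (bessel0 ((a - b) * q) * (a - b))
          = 2 * (a * cos (q * a) * sin (q * b) + b * sin (q * a) * cos (q * b)) / q"
      proof -
        have s: "c * (bessel0 (c * q) * c) = c * sin (c * q) / q" for c using q by (cases "c = 0") (auto simp: bessel0_eq)
        have e1: "sin ((a + b) * q) = sin (q * a) * cos (q * b) + cos (q * a) * sin (q * b)"
          using sin_add[of "q * a" "q * b"] by (simp add: algebra_simps)
        have e2: "sin ((a - b) * q) = sin (q * a) * cos (q * b) - cos (q * a) * sin (q * b)"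
          using sin_diff[of "q * a" "q * b"] by (simp add: algebra_simps)
        show ?thesis unfolding s e1 e2 diff_divide_distrib[symmetric] by (simp add: algebra_simps)
      qed
      moreover have "bessel0 (q * a) * bessel0 (q * b) = sin (q * a) * sin (q * b) / (a * b * q\<^sup>2)"
        using q a b by (simp add: bessel0_eq power2_eq_square mult_ac)
      moreover have "X / (a * b * q) = 2 * X / q / (2 * (a * b))" for X using q a b by (simp add: mult_ac)
      ultimately have "(H has_real_derivative bessel0 (q * a) * bessel0 (q * b)) (at q)"
        by (simp only: diff_add_cancel)
      then show "(H has_vector_derivative bessel0 (q * a) * bessel0 (q * b)) (at q)"
        by (simp add: has_real_derivative_iff_has_vector_derivative)
    qed (use T in auto)
    then have I: "integral {0..T} (\<lambda>q. bessel0 (q * a) * bessel0 (q * b)) = H T"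
      using Si_neg[of 0] by (simp add: integral_unique H_def)
    have "set_integrable lborel {0..T} (\<lambda>q. bessel0 (q * a) * bessel0 (q * b))"
      by (intro borel_integrable_atLeastAtMost' continuous_on_mult cs)
    from set_borel_integral_eq_integral(2)[OF this] I
    have "(LINT q|lborel. indicator {0..T} q * (bessel0 (q * a) * bessel0 (q * b))) = H T"
      by (simp add: set_lebesgue_integral_def)
    moreover have "(LINT q|lborel. indicator {0..T} q * (indicator {0<..} q * (bessel0 (q * a) * bessel0 (q * b))))
      = (LINT q|lborel. indicator {0..T} q * (bessel0 (q * a) * bessel0 (q * b)))"
    proof (rule integral_cong_AE)
      show "AE q in lborel. indicator {0..T} q * (indicator {0<..} q * (bessel0 (q * a) * bessel0 (q * b))) = indicator {0..T} q * (bessel0 (q * a) * bessel0 (q * b))"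
        using AE_lborel_singleton[of 0] by eventually_elim (auto simp: indicator_def)
    qed measurable
    ultimately show ?thesis by simp
  qed
  have "((\<lambda>T. LINT q|lborel. indicator {0..T} q * (indicator {0<..} q * (bessel0 (q * a) * bessel0 (q * b)))) \<longlongrightarrow>
      (LINT q|lborel. indicator {0<..} q * (bessel0 (q * a) * bessel0 (q * b)))) at_top"
  proof (rule integral_dominated_convergence_at_top[where w = "\<lambda>q. norm (indicator {0<..} q * (bessel0 (q * a) * bessel0 (q * b)))"])
    show "AE q in lborel. ((\<lambda>T. indicator {0..T} q * (indicator {0<..} q * (bessel0 (q * a) * bessel0 (q * b)))) \<longlongrightarrow> indicator {0<..} q * (bessel0 (q * a) * bessel0 (q * b))) at_top"
    proof (intro AE_I2)
      fix q :: real
      have "\<forall>\<^sub>F T in at_top. indicator {0<..} q * (bessel0 (q * a) * bessel0 (q * b)) = indicator {0..T} q * (indicator {0<..} q * (bessel0 (q * a) * bessel0 (q * b)))"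
        using eventually_ge_at_top[of q] by eventually_elim (auto simp: indicator_def)
      then show "((\<lambda>T. indicator {0..T} q * (indicator {0<..} q * (bessel0 (q * a) * bessel0 (q * b)))) \<longlongrightarrow> indicator {0<..} q * (bessel0 (q * a) * bessel0 (q * b))) at_top"
        by (rule Lim_transform_eventually[OF tendsto_const])
    qed
    show "integrable lborel (\<lambda>q. norm (indicator {0<..} q * (bessel0 (q * a) * bessel0 (q * b))))"
      using a b by (intro integrable_norm bessel0_bessel0_integrable)
    show "\<forall>\<^sub>F T in at_top. AE q in lborel. norm (indicator {0..T} q * (indicator {0<..} q * (bessel0 (q * a) * bessel0 (q * b)))) \<le> norm (indicator {0<..} q * (bessel0 (q * a) * bessel0 (q * b)))"
      by (intro always_eventually allI AE_I2) (auto simp: indicator_def)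
  qed measurable
  moreover have "((\<lambda>T. LINT q|lborel. indicator {0..T} q * (indicator {0<..} q * (bessel0 (q * a) * bessel0 (q * b)))) \<longlongrightarrow> pi / 2 / a) at_top"
  proof (rule Lim_transform_eventually)
    show "\<forall>\<^sub>F T in at_top. H T = (LINT q|lborel. indicator {0..T} q * (indicator {0<..} q * (bessel0 (q * a) * bessel0 (q * b))))"
      using eventually_gt_at_top[of 0] by eventually_elim (simp add: fin)
    have Silim: "((\<lambda>T. c * Si (c * T)) \<longlongrightarrow> c * (pi / 2)) at_top" if "c \<ge> 0" for c
    proof (cases "c = 0")
      case False
      then show ?thesis using that by (intro tendsto_intros filterlim_compose[OF Si_at_top]
          filterlim_tendsto_pos_mult_at_top[OF tendsto_const _ filterlim_ident]) auto
    qed simp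
    have "((\<lambda>q. - q * (bessel0 (q * a) * bessel0 (q * b))) \<longlongrightarrow> 0) at_top"
    proof (rule Lim_null_comparison)
      show "\<forall>\<^sub>F q in at_top. norm (- q * (bessel0 (q * a) * bessel0 (q * b))) \<le> 1 / (a * b) * inverse q"
        using eventually_gt_at_top[of 0]
      proof eventually_elim
        case (elim q)
        have "\<bar>bessel0 (q * a) * bessel0 (q * b)\<bar> \<le> 1 / (q * a) * (1 / (q * b))"
          unfolding abs_mult using elim a b by (intro mult_mono abs_bessel0_le_inverse) auto
        then have "q * \<bar>bessel0 (q * a) * bessel0 (q * b)\<bar> \<le> q * (1 / (q * a) * (1 / (q * b)))"
          using elim by (intro mult_left_mono) auto
        then show ?case using elim a b by (simp add: abs_mult field_simps)
      qed
      show "((\<lambda>q. 1 / (a * b) * inverse q) \<longlongrightarrow> 0) at_top"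
        by (rule tendsto_mult_right_zero) (intro tendsto_inverse_0_at_top filterlim_ident)
    qed
    \<comment> \<open>Both sine integrals tend to pi / 2 times a nonnegative coefficient because b
      <= a. This is where the larger of the two radii gets selected.\<close>
    then have "(H \<longlongrightarrow> 0 + ((a + b) * (pi / 2) - (a - b) * (pi / 2)) / (2 * (a * b))) at_top"
      unfolding H_def[abs_def] using a b ba by (intro tendsto_add tendsto_divide tendsto_diff tendsto_const Silim) auto
    then show "(H \<longlongrightarrow> pi / 2 / a) at_top"
      using a b by (simp add: field_simps)
  qed
  ultimately show ?thesis
    by (rule tendsto_unique[rotated]) simp
qed

lemma bessel0_bessel0_integral:
  assumes "0 < a" "0 < b"
  shows "(LINT q|lborel. indicator {0<..} q * (bessel0 (q * a) * bessel0 (q * b))) = pi / 2 / max a b"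
proof (cases "b \<le> a")
  case True
  then show ?thesis using bessel0_bessel0_integral_le[of b a] assms by (simp only: max_absorb1)
next
  case False
  then have "a \<le> b" by simp
  then show ?thesis using bessel0_bessel0_integral_le[of a b] assms by (simp only: max_absorb2 mult.commute[of "bessel0 (_ * b)"])
qed

section \<open>The cut-off Fourier integral of the scattering solution\<close>

locale scattering_profile = profile +
  fixes \<phi> :: "real \<Rightarrow> real"
  assumes cont_\<phi>: "continuous_on UNIV \<phi>" and \<phi>_nonneg: "\<And>r. 0 \<le> \<phi> r" and \<phi>_less: "\<And>r. \<phi> r < 1"
    and \<phi>_eq: "\<And>r. \<phi> r = (LINT t|lborel. kern r t * (v t * (1 - \<phi> t) / 2))"
begin

definition gs :: "real \<Rightarrow> real" where "gs s = v s * (1 - \<phi> s)"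

lemma \<phi>_measurable [measurable]: "\<phi> \<in> borel_measurable borel"
  using cont_\<phi> by (rule borel_measurable_continuous_onI)

lemma gs_measurable [measurable]: "gs \<in> borel_measurable borel"
  unfolding gs_def[abs_def] by measurable

lemma gs_nonneg: "gs s \<ge> 0" and gs_le: "gs s \<le> v s"
  using v_nonneg[of s] \<phi>_nonneg[of s] \<phi>_less[of s] by (auto simp: gs_def mult_left_le)

lemma integrable_v12: "integrable lborel (\<lambda>s. indicator {0<..} s * ((s + s\<^sup>2) * v s))"
  using Bochner_Integration.integrable_add[OF int_v1 int_v2] by (simp add: algebra_simps)

lemma integrable_gs2: "integrable lborel (\<lambda>s. indicator {0<..} s * (s\<^sup>2 * gs s))"
proof (rule Bochner_Integration.integrable_bound[OF int_v2])
  show "AE s in lborel. norm (indicator {0<..} s * (s\<^sup>2 * gs s)) \<le> norm (indicator {0<..} s * (s\<^sup>2 * v s))"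
    using gs_nonneg gs_le v_nonneg by (intro AE_I2) (auto simp: indicator_def abs_mult intro!: mult_left_mono)
qed measurable

definition Gh :: "real \<Rightarrow> real" where "Gh q = (LINT s|lborel. indicator {0<..} s * (4 * pi * s\<^sup>2 * gs s * bessel0 (q * s)))"

lemma Gh_measurable [measurable]: "Gh \<in> borel_measurable borel"
  unfolding Gh_def[abs_def] by measurable

lemma gh_eq: "(LINT x|lborel. gs (norm (x::real^3)) * cos (p \<bullet> x)) = Gh (norm p)"
  unfolding Gh_def bessel0_def by (rule radial_fourier(2)[OF gs_measurable integrable_gs2])

lemma gh_integrable: "integrable lborel (\<lambda>x::real^3. gs (norm x) * cos (p \<bullet> x))"
  by (rule radial_fourier(1)[OF gs_measurable integrable_gs2])

text \<open>This is 8 * pi times the scattering length, by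
  \<open>scattering_length_eq\<close>.\<close>

definition \<kappa> :: real where "\<kappa> = (LINT x|lborel. gs (norm (x::real^3)))"

lemma abs_Gh_le: "\<bar>Gh q\<bar> \<le> \<kappa>"
proof -
  have "\<exists>p::real^3. norm p = \<bar>q\<bar>" by (rule exI[of _ "q *\<^sub>R axis 1 1"]) simp
  then obtain p :: "real^3" where p: "norm p = \<bar>q\<bar>" by blast
  have "Gh q = Gh \<bar>q\<bar>"
    unfolding Gh_def by (intro Bochner_Integration.integral_cong) (auto simp: bessel0_def abs_if)
  also have "\<dots> = (LINT x|lborel. gs (norm (x::real^3)) * cos (p \<bullet> x))" by (simp add: gh_eq p)
  finally have "\<bar>Gh q\<bar> \<le> (LINT x|lborel. \<bar>gs (norm (x::real^3)) * cos (p \<bullet> x)\<bar>)"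
    using integral_abs_bound by simp
  also have "\<dots> \<le> \<kappa>"
    unfolding \<kappa>_def using gs_nonneg gh_integrable[of 0]
    by (intro integral_mono integrable_abs gh_integrable) (auto simp: abs_mult mult_left_le)
  finally show ?thesis .
qed

text \<open>A Fejer cutoff. Its bounded support makes lattice sums finite, its continuity is needed
  for Riemann sums, and near 0 it differs from 1 by at most |q| / n, so low momenta are hardly
  affected.\<close>

definition \<theta> :: "nat \<Rightarrow> real \<Rightarrow> real" where "\<theta> n q = max 0 (1 - \<bar>q\<bar> / real n)"

lemma \<theta>_nonneg: "\<theta> n q \<ge> 0" and \<theta>_le_1: "\<theta> n q \<le> 1"
  by (auto simp: \<theta>_def)

lemma \<theta>_measurable [measurable]: "\<theta> n \<in> borel_measurable borel"
  unfolding \<theta>_def[abs_def] by measurable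

lemma \<theta>_eq_0: "n > 0 \<Longrightarrow> q \<ge> real n \<Longrightarrow> \<theta> n q = 0"
  by (auto simp: \<theta>_def max_def field_simps)

lemma \<theta>_integrable:
  assumes "n > 0"
  shows "integrable lborel (\<lambda>q. indicator {0<..} q * \<theta> n q)"
proof -
  have "integrable lborel (\<lambda>q::real. indicator {0..real n} q *\<^sub>R (\<theta> n q))"
    by (rule integrableI_bounded_set_indicator[where B = 1]) (use \<theta>_nonneg[of n] \<theta>_le_1[of n] in auto)
  then show ?thesis
  proof (rule Bochner_Integration.integrable_bound)
    show "AE q in lborel. norm (indicator {0<..} q * \<theta> n q) \<le> norm (indicator {0..real n} q *\<^sub>R (\<theta> n q))"
      using \<theta>_eq_0[OF assms] by (intro AE_I2) (auto simp: indicator_def)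
  qed measurable
qed

lemma \<theta>_tendsto: "(\<lambda>n. \<theta> n q) \<longlonglongrightarrow> 1"
proof -
  have "(\<lambda>n. max 0 (1 - \<bar>q\<bar> / real n)) \<longlonglongrightarrow> max 0 (1 - 0)"
    by (intro tendsto_intros tendsto_divide_0[OF tendsto_const] filterlim_at_top_imp_at_infinity filterlim_real_sequentially)
  then show ?thesis by (simp add: \<theta>_def)
qed

definition K :: "nat \<Rightarrow> real \<Rightarrow> real \<Rightarrow> real" where
  "K n r s = (LINT q|lborel. indicator {0<..} q * (\<theta> n q * (bessel0 (q * r) * bessel0 (q * s))))"

lemma K_measurable [measurable]: "(\<lambda>s. K n r s) \<in> borel_measurable borel"
  unfolding K_def by measurable

lemma K_integrand_le:
  assumes "r > 0" "s > 0"
  shows "\<bar>indicator {0<..} q * (\<theta> n q * (bessel0 (q * r) * bessel0 (q * s)))\<bar> \<le> indicator {0<..} q * (2 / (1 + r * s * q\<^sup>2))"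
proof (cases "q > 0")
  case True
  have "\<theta> n q * \<bar>bessel0 (q * r) * bessel0 (q * s)\<bar> \<le> 1 * (2 / (1 + r * s * q\<^sup>2))"
    using \<theta>_le_1 \<theta>_nonneg abs_bessel0_mult_le[OF assms True] by (intro mult_mono) auto
  then show ?thesis using True \<theta>_nonneg[of n q] by (simp add: abs_mult)
qed simp

lemma K_bound:
  assumes "r > 0" "s > 0"
  shows "\<bar>K n r s\<bar> \<le> pi / sqrt (r * s)"
proof -
  have rs: "r * s > 0" using assms by simp
  have "\<bar>K n r s\<bar> \<le> (LINT q|lborel. \<bar>indicator {0<..} q * (\<theta> n q * (bessel0 (q * r) * bessel0 (q * s)))\<bar>)"
    unfolding K_def by (rule integral_abs_bound)
  also have "\<dots> \<le> (LINT q|lborel. indicator {0<..} q * (2 / (1 + r * s * q\<^sup>2)))"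
  proof (rule integral_mono')
    show "integrable lborel (\<lambda>q. indicator {0<..} q * (2 / (1 + r * s * q\<^sup>2)))" by (rule has_bochner_lorentz(1)[OF rs])
  qed (use K_integrand_le[OF assms] order_trans[OF abs_ge_zero K_integrand_le[OF assms]] in auto)
  also have "\<dots> = pi / sqrt (r * s)" by (rule has_bochner_lorentz(2)[OF rs])
  finally show ?thesis .
qed

lemma K_tendsto:
  assumes "r > 0" "s > 0"
  shows "(\<lambda>n. K n r s) \<longlonglongrightarrow> pi / 2 / max r s"
proof -
  have "(\<lambda>n. K n r s) \<longlonglongrightarrow> (LINT q|lborel. indicator {0<..} q * (bessel0 (q * r) * bessel0 (q * s)))"
    unfolding K_def
  proof (rule integral_dominated_convergence[where w = "\<lambda>q. indicator {0<..} q * (2 / (1 + r * s * q\<^sup>2))"])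
    show "integrable lborel (\<lambda>q. indicator {0<..} q * (2 / (1 + r * s * q\<^sup>2)))"
      using assms by (intro has_bochner_lorentz(1)) simp
    show "AE q in lborel. (\<lambda>n. indicator {0<..} q * (\<theta> n q * (bessel0 (q * r) * bessel0 (q * s)))) \<longlonglongrightarrow> indicator {0<..} q * (bessel0 (q * r) * bessel0 (q * s))"
    proof (intro AE_I2)
      fix q
      have "(\<lambda>n. indicator {0<..} q * (\<theta> n q * (bessel0 (q * r) * bessel0 (q * s)))) \<longlonglongrightarrow> indicator {0<..} q * (1 * (bessel0 (q * r) * bessel0 (q * s)))"
        by (intro tendsto_intros \<theta>_tendsto)
      then show "(\<lambda>n. indicator {0<..} q * (\<theta> n q * (bessel0 (q * r) * bessel0 (q * s)))) \<longlonglongrightarrow> indicator {0<..} q * (bessel0 (q * r) * bessel0 (q * s))" by simp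
    qed
    show "AE q in lborel. norm (indicator {0<..} q * (\<theta> n q * (bessel0 (q * r) * bessel0 (q * s)))) \<le> indicator {0<..} q * (2 / (1 + r * s * q\<^sup>2))" for n
      using K_integrand_le[OF assms] by auto
  qed measurable
  then show ?thesis using bessel0_bessel0_integral[OF assms] by simp
qed

definition rad :: "nat \<Rightarrow> real \<Rightarrow> real" where
  "rad n r = 1 / (4 * pi\<^sup>2) * (LINT q|lborel. indicator {0<..} q * (\<theta> n q * Gh q * bessel0 (q * r)))"

lemma rad_measurable [measurable]: "rad n \<in> borel_measurable borel"
  unfolding rad_def[abs_def] by measurable

text \<open>Inserting the radial formula for \<open>Gh\<close> and exchanging integrals, which the
  cutoff permits, moves all dependence on n into the kernel \<open>K\<close>.\<close>

lemma rad_eq: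
  assumes n: "n > 0"
  shows "rad n r = 1 / pi * (LINT s|lborel. indicator {0<..} s * (s\<^sup>2 * gs s * K n r s))"
proof -
  let ?f = "\<lambda>q s. indicator {0<..} q * (indicator {0<..} s * (\<theta> n q * bessel0 (q * r) * (4 * pi * s\<^sup>2 * gs s * bessel0 (q * s)))) :: real"
  have meas: "case_prod ?f \<in> borel_measurable (lborel \<Otimes>\<^sub>M lborel)"
  proof -
    have "case_prod ?f \<in> borel_measurable (borel \<Otimes>\<^sub>M borel)" by measurable
    also have "borel_measurable (borel \<Otimes>\<^sub>M borel) = borel_measurable (lborel \<Otimes>\<^sub>M lborel)"
      by (intro measurable_cong_sets sets_pair_measure_cong) auto
    finally show ?thesis .
  qed
  have int: "integrable (lborel \<Otimes>\<^sub>M lborel) (case_prod ?f)"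
  proof (rule Bochner_Integration.integrable_bound)
    show "integrable (lborel \<Otimes>\<^sub>M lborel) (\<lambda>y. (indicator {0<..} (fst y) * \<theta> n (fst y)) * (4 * pi * (indicator {0<..} (snd y) * ((snd y)\<^sup>2 * gs (snd y)))) :: real)"
    proof (rule lborel_pair.Fubini_integrable)
      show "integrable lborel (\<lambda>q. LINT s|lborel. norm ((indicator {0<..} (fst (q, s)) * \<theta> n (fst (q, s))) * (4 * pi * (indicator {0<..} (snd (q, s)) * ((snd (q, s))\<^sup>2 * gs (snd (q, s))))) :: real))"
        using \<theta>_integrable[OF n] by (simp add: abs_mult abs_of_nonneg[OF \<theta>_nonneg] integrable_mult_left)
      show "AE q in lborel. integrable lborel (\<lambda>s. (indicator {0<..} (fst (q, s)) * \<theta> n (fst (q, s))) * (4 * pi * (indicator {0<..} (snd (q, s)) * ((snd (q, s))\<^sup>2 * gs (snd (q, s))))) :: real)"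
        using integrable_gs2 by (simp add: integrable_mult_right)
      have "(\<lambda>y. (indicator {0<..} (fst y) * \<theta> n (fst y)) * (4 * pi * (indicator {0<..} (snd y) * ((snd y)\<^sup>2 * gs (snd y)))) :: real) \<in> borel_measurable (borel \<Otimes>\<^sub>M borel)" by measurable
      also have "borel_measurable (borel \<Otimes>\<^sub>M borel) = borel_measurable (lborel \<Otimes>\<^sub>M lborel)"
        by (intro measurable_cong_sets sets_pair_measure_cong) auto
      finally show "(\<lambda>y. (indicator {0<..} (fst y) * \<theta> n (fst y)) * (4 * pi * (indicator {0<..} (snd y) * ((snd y)\<^sup>2 * gs (snd y)))) :: real) \<in> borel_measurable (lborel \<Otimes>\<^sub>M lborel)" .
    qed
    show "AE y in lborel \<Otimes>\<^sub>M lborel. norm (case_prod ?f y) \<le> norm ((indicator {0<..} (fst y) * \<theta> n (fst y)) * (4 * pi * (indicator {0<..} (snd y) * ((snd y)\<^sup>2 * gs (snd y)))) :: real)"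
    proof (intro AE_I2)
      fix y :: "real \<times> real"
      obtain q s where y: "y = (q, s)" by (cases y)
      have "\<bar>bessel0 (q * r)\<bar> * \<bar>bessel0 (q * s)\<bar> \<le> 1 * 1" by (intro mult_mono abs_bessel0_le_1) auto
      then have "(\<theta> n q * (4 * pi * (s\<^sup>2 * gs s))) * (\<bar>bessel0 (q * r)\<bar> * \<bar>bessel0 (q * s)\<bar>) \<le> (\<theta> n q * (4 * pi * (s\<^sup>2 * gs s))) * 1"
        using \<theta>_nonneg[of n q] gs_nonneg[of s] by (intro mult_left_mono) auto
      then show "norm (case_prod ?f y) \<le> norm ((indicator {0<..} (fst y) * \<theta> n (fst y)) * (4 * pi * (indicator {0<..} (snd y) * ((snd y)\<^sup>2 * gs (snd y)))) :: real)"
        using \<theta>_nonneg[of n q] gs_nonneg[of s] by (simp add: y indicator_def abs_mult mult_ac)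
    qed
  qed (rule meas)
  have "(LINT q|lborel. indicator {0<..} q * (\<theta> n q * Gh q * bessel0 (q * r))) = (LINT q|lborel. LINT s|lborel. ?f q s)"
  proof (intro Bochner_Integration.integral_cong refl)
    fix q
    have "(LINT s|lborel. ?f q s) = (LINT s|lborel. (indicator {0<..} q * (\<theta> n q * bessel0 (q * r))) * (indicator {0<..} s * (4 * pi * s\<^sup>2 * gs s * bessel0 (q * s))))"
      by (intro Bochner_Integration.integral_cong) (auto simp: mult_ac)
    also have "\<dots> = indicator {0<..} q * (\<theta> n q * Gh q * bessel0 (q * r))"
      unfolding Gh_def by (subst integral_mult_right_zero) (simp add: mult_ac)
    finally show "indicator {0<..} q * (\<theta> n q * Gh q * bessel0 (q * r)) = (LINT s|lborel. ?f q s)" by (rule sym)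
  qed
  also have "\<dots> = (LINT s|lborel. LINT q|lborel. ?f q s)"
    by (rule lborel_pair.Fubini_integral[symmetric]) (use int in simp)
  also have "\<dots> = (LINT s|lborel. 4 * pi * (indicator {0<..} s * (s\<^sup>2 * gs s * K n r s)))"
  proof (intro Bochner_Integration.integral_cong refl)
    fix s
    have "(LINT q|lborel. ?f q s) = (LINT q|lborel. (4 * pi * (indicator {0<..} s * (s\<^sup>2 * gs s))) * (indicator {0<..} q * (\<theta> n q * (bessel0 (q * r) * bessel0 (q * s)))))"
      by (intro Bochner_Integration.integral_cong) (auto simp: mult_ac)
    also have "\<dots> = 4 * pi * (indicator {0<..} s * (s\<^sup>2 * gs s * K n r s))"
      unfolding K_def by (subst integral_mult_right_zero) (simp add: mult_ac)
    finally show "(LINT q|lborel. ?f q s) = 4 * pi * (indicator {0<..} s * (s\<^sup>2 * gs s * K n r s))" .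
  qed
  also have "\<dots> = 4 * pi * (LINT s|lborel. indicator {0<..} s * (s\<^sup>2 * gs s * K n r s))"
    by (rule integral_mult_right_zero)
  finally show ?thesis by (simp add: rad_def power2_eq_square)
qed

text \<open>The bound pi / sqrt (r * s) for \<open>K\<close> leaves s^(3/2) * v, and s^(3/2) is at
  most s + s^2. Both moments of v are finite.\<close>

lemma rad_integrand_le:
  assumes "r > 0"
  shows "\<bar>indicator {0<..} s * (s\<^sup>2 * gs s * K n r s)\<bar> \<le> pi / sqrt r * (indicator {0<..} s * ((s + s\<^sup>2) * v s))"
proof (cases "s > 0")
  case True
  have "sqrt s \<le> 1 + s"
    using True by (intro real_le_lsqrt) (auto simp: power2_eq_square algebra_simps)
  then have s: "s\<^sup>2 / sqrt s \<le> s + s\<^sup>2"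
    using True mult_left_mono[of "sqrt s" "1 + s" s]
    by (simp add: power2_eq_square real_div_sqrt algebra_simps flip: times_divide_eq_right)
  have "s\<^sup>2 * gs s * \<bar>K n r s\<bar> \<le> s\<^sup>2 * v s * (pi / sqrt (r * s))"
    using gs_le gs_nonneg v_nonneg K_bound[OF assms True] by (intro mult_mono mult_left_mono mult_nonneg_nonneg) auto
  also have "\<dots> = pi / sqrt r * (s\<^sup>2 / sqrt s * v s)" by (simp add: real_sqrt_mult)
  also have "\<dots> \<le> pi / sqrt r * ((s + s\<^sup>2) * v s)"
    using s v_nonneg assms by (intro mult_left_mono mult_right_mono) auto
  finally show ?thesis using True gs_nonneg[of s] by (simp add: abs_mult)
qed simp

definition Cr :: real where "Cr = (LINT s|lborel. indicator {0<..} s * ((s + s\<^sup>2) * v s))"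

lemma rad_bound:
  assumes "n > 0" "r > 0"
  shows "\<bar>rad n r\<bar> \<le> Cr / sqrt r"
proof -
  have "\<bar>LINT s|lborel. indicator {0<..} s * (s\<^sup>2 * gs s * K n r s)\<bar> \<le> (LINT s|lborel. \<bar>indicator {0<..} s * (s\<^sup>2 * gs s * K n r s)\<bar>)"
    by (rule integral_abs_bound)
  also have "\<dots> \<le> (LINT s|lborel. pi / sqrt r * (indicator {0<..} s * ((s + s\<^sup>2) * v s)))"
    by (rule integral_mono') (use integrable_v12 rad_integrand_le[OF assms(2)] order_trans[OF abs_ge_zero rad_integrand_le[OF assms(2)]] in auto)
  also have "\<dots> = pi / sqrt r * Cr" unfolding Cr_def by (rule integral_mult_right_zero)
  finally show ?thesis unfolding rad_eq[OF assms(1)] by (simp add: abs_mult field_simps)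
qed

text \<open>As n grows, \<open>K\<close> tends to pi / 2 times the reciprocal of the larger radius,
  and the limit integral is exactly the right-hand side of \<open>\<phi>_eq\<close>. The integral
  equation thus serves as the inversion formula.\<close>

lemma rad_tendsto:
  assumes "r > 0"
  shows "(\<lambda>n. rad n r) \<longlonglongrightarrow> \<phi> r"
proof -
  have lim: "(\<lambda>n. 1 / pi * (LINT s|lborel. indicator {0<..} s * (s\<^sup>2 * gs s * K n r s))) \<longlonglongrightarrow> 1 / pi * (LINT s|lborel. indicator {0<..} s * (s\<^sup>2 * gs s * (pi / 2 / max r s)))"
  proof (intro tendsto_mult_left integral_dominated_convergence[where w = "\<lambda>s. pi / sqrt r * (indicator {0<..} s * ((s + s\<^sup>2) * v s))"])
    show "AE s in lborel. (\<lambda>n. indicator {0<..} s * (s\<^sup>2 * gs s * K n r s)) \<longlonglongrightarrow> indicator {0<..} s * (s\<^sup>2 * gs s * (pi / 2 / max r s))"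
    proof (intro AE_I2)
      fix s
      have "s > 0 \<Longrightarrow> (\<lambda>n. s\<^sup>2 * gs s * K n r s) \<longlonglongrightarrow> s\<^sup>2 * gs s * (pi / 2 / max r s)"
        by (intro tendsto_mult_left K_tendsto assms)
      then show "(\<lambda>n. indicator {0<..} s * (s\<^sup>2 * gs s * K n r s)) \<longlonglongrightarrow> indicator {0<..} s * (s\<^sup>2 * gs s * (pi / 2 / max r s))"
        by (cases "s > 0") simp_all
    qed
    show "AE s in lborel. norm (indicator {0<..} s * (s\<^sup>2 * gs s * K n r s)) \<le> pi / sqrt r * (indicator {0<..} s * ((s + s\<^sup>2) * v s))" for n
      using rad_integrand_le[OF assms] by auto
  qed (use integrable_v12 in \<open>auto intro: integrable_mult_right\<close>)
  have val: "1 / pi * (LINT s|lborel. indicator {0<..} s * (s\<^sup>2 * gs s * (pi / 2 / max r s))) = \<phi> r"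
    unfolding \<phi>_eq[of r]
    by (subst integral_mult_right_zero[symmetric])
      (use assms in \<open>auto intro!: Bochner_Integration.integral_cong simp: kern_def gs_def\<close>)
  have ev: "\<forall>\<^sub>F n in sequentially. 1 / pi * (LINT s|lborel. indicator {0<..} s * (s\<^sup>2 * gs s * K n r s)) = rad n r"
    using eventually_gt_at_top[of 0] by eventually_elim (simp only: rad_eq)
  show ?thesis using Lim_transform_eventually[OF lim ev] unfolding val .
qed


definition Wn :: "nat \<Rightarrow> real^3 \<Rightarrow> real" where
  "Wn n x = 1 / (2 * pi) ^ 3 * (LINT p|lborel. \<theta> n (norm p) * Gh (norm p) / (2 * (norm p)\<^sup>2) * cos (p \<bullet> x))"

lemma Gh_cutoff_integrable:
  assumes n: "n > 0"
  shows "integrable lborel (\<lambda>s. indicator {0<..} s * (s\<^sup>2 * (\<theta> n s * Gh s / (2 * s\<^sup>2))))"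
proof (rule Bochner_Integration.integrable_bound[OF integrable_mult_right[OF \<theta>_integrable[OF n], of "\<kappa>"]])
  show "AE s in lborel. norm (indicator {0<..} s * (s\<^sup>2 * (\<theta> n s * Gh s / (2 * s\<^sup>2)))) \<le> norm (\<kappa> * (indicator {0<..} s * \<theta> n s))"
  proof (intro AE_I2)
    fix s :: real
    show "norm (indicator {0<..} s * (s\<^sup>2 * (\<theta> n s * Gh s / (2 * s\<^sup>2)))) \<le> norm (\<kappa> * (indicator {0<..} s * \<theta> n s))"
    proof (cases "s > 0")
      case True
      have "\<bar>Gh s\<bar> / 2 \<le> \<bar>\<kappa>\<bar>" using abs_Gh_le[of s] by linarith
      then have "\<bar>\<theta> n s\<bar> * (\<bar>Gh s\<bar> / 2) \<le> \<bar>\<theta> n s\<bar> * \<bar>\<kappa>\<bar>" by (rule mult_left_mono) simp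
      then show ?thesis using True by (simp add: abs_mult mult.commute)
    qed simp
  qed
qed measurable

lemma Wn_eq:
  assumes n: "n > 0"
  shows "Wn n x = rad n (norm x)"
proof -
  have "(LINT p|lborel. \<theta> n (norm p) * Gh (norm p) / (2 * (norm p)\<^sup>2) * cos (p \<bullet> x))
      = (LINT p|lborel. (\<lambda>s. \<theta> n s * Gh s / (2 * s\<^sup>2)) (norm p) * cos (x \<bullet> p))"
    by (simp add: inner_commute)
  also have "\<dots> = (LINT s|lborel. indicator {0<..} s * (4 * pi * s\<^sup>2 * (\<theta> n s * Gh s / (2 * s\<^sup>2)) * bessel0 (norm x * s)))"
    unfolding bessel0_def by (rule radial_fourier(2)[OF _ Gh_cutoff_integrable[OF n]]) measurable
  also have "\<dots> = (LINT s|lborel. 2 * pi * (indicator {0<..} s * (\<theta> n s * Gh s * bessel0 (s * norm x))))"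
    by (intro Bochner_Integration.integral_cong) (auto simp: indicator_def mult_ac)
  also have "\<dots> = 2 * pi * (LINT s|lborel. indicator {0<..} s * (\<theta> n s * Gh s * bessel0 (s * norm x)))"
    by (rule integral_mult_right_zero)
  finally show ?thesis
    unfolding Wn_def rad_def by (simp add: power2_eq_square power3_eq_cube)
qed

lemma Cr_nonneg: "Cr \<ge> 0"
  unfolding Cr_def using v_nonneg by (intro integral_nonneg_AE AE_I2) (auto simp: indicator_def)

text \<open>The uniform bound \<open>rad_bound\<close> is singular like r^(-1/2). Its square is of
  order 1 / r, which is integrable against s^2 * v.\<close>

lemma radial_error_bound:
  assumes "n > 0" "r > 0"
  shows "\<bar>\<phi> r - rad n r\<bar> \<le> 3 + 2 * Cr\<^sup>2 / r" "(\<phi> r - rad n r)\<^sup>2 \<le> 3 + 2 * Cr\<^sup>2 / r"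
proof -
  have le: "\<bar>\<phi> r - rad n r\<bar> \<le> 1 + Cr / sqrt r"
    using rad_bound[OF assms] \<phi>_nonneg[of r] \<phi>_less[of r] by linarith
  define y where "y = Cr / sqrt r"
  have y: "y \<ge> 0" "y\<^sup>2 = Cr\<^sup>2 / r" using Cr_nonneg assms by (auto simp: y_def power_divide)
  have "(\<phi> r - rad n r)\<^sup>2 \<le> (1 + y)\<^sup>2"
    using le y unfolding y_def[symmetric] by (simp add: abs_le_square_iff[symmetric])
  also have "\<dots> \<le> 2 + 2 * y\<^sup>2" using sum_squares_bound[of 1 y] by (simp add: power2_sum)
  finally show "(\<phi> r - rad n r)\<^sup>2 \<le> 3 + 2 * Cr\<^sup>2 / r" using y by simp
  have "1 + y \<le> 3 + 2 * y\<^sup>2" using sum_squares_bound[of 1 y] y by simp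
  then show "\<bar>\<phi> r - rad n r\<bar> \<le> 3 + 2 * Cr\<^sup>2 / r" using le y unfolding y_def[symmetric] by simp
qed

text \<open>The function h stands for the absolute value and for the square: weighted L1 and L2
  convergence follow from one dominated convergence argument.\<close>

lemma radial_error_tendsto:
  fixes h :: "real \<Rightarrow> real"
  assumes h[measurable]: "h \<in> borel_measurable borel" and h0: "isCont h 0" "h 0 = 0"
    and bound: "\<And>n r. n > 0 \<Longrightarrow> r > 0 \<Longrightarrow> \<bar>h (\<phi> r - rad n r)\<bar> \<le> 3 + 2 * Cr\<^sup>2 / r"
  shows "(\<lambda>n. LINT x|lborel. v (norm (x::real^3)) * h (\<phi> (norm x) - Wn n x)) \<longlonglongrightarrow> 0"
    and "n > 0 \<Longrightarrow> integrable lborel (\<lambda>x::real^3. v (norm x) * h (\<phi> (norm x) - Wn n x))"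
proof -
  define D where "D = 3 + 2 * Cr\<^sup>2"
  have D: "D \<ge> 0" by (simp add: D_def)
  have le: "\<bar>indicator {0<..} s * (s\<^sup>2 * (v s * h (\<phi> s - rad n s)))\<bar> \<le> D * (indicator {0<..} s * ((s + s\<^sup>2) * v s))"
    if n: "n > 0" for n s
  proof (cases "s > 0")
    case True
    have "s\<^sup>2 * \<bar>h (\<phi> s - rad n s)\<bar> \<le> s\<^sup>2 * (3 + 2 * Cr\<^sup>2 / s)"
      using bound[OF n True] by (rule mult_left_mono) simp
    also have "\<dots> = 3 * s\<^sup>2 + 2 * Cr\<^sup>2 * s" using True by (simp add: field_simps power2_eq_square)
    also have "\<dots> \<le> D * s\<^sup>2 + D * s"
      using True unfolding D_def by (intro add_mono mult_right_mono) auto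
    finally have "s\<^sup>2 * \<bar>h (\<phi> s - rad n s)\<bar> * v s \<le> (D * s\<^sup>2 + D * s) * v s"
      using v_nonneg by (rule mult_right_mono)
    then show ?thesis using True v_nonneg[of s] by (simp add: abs_mult algebra_simps)
  qed simp
  have int: "integrable lborel (\<lambda>s. indicator {0<..} s * (s\<^sup>2 * (v s * h (\<phi> s - rad n s))))" if n: "n > 0" for n
  proof (rule Bochner_Integration.integrable_bound[OF integrable_mult_right[OF integrable_v12, of D]])
    show "AE s in lborel. norm (indicator {0<..} s * (s\<^sup>2 * (v s * h (\<phi> s - rad n s)))) \<le> norm (D * (indicator {0<..} s * ((s + s\<^sup>2) * v s)))"
      using order_trans[OF le[OF n] abs_ge_self] by (intro AE_I2) (simp only: real_norm_def)
  qed measurable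
  have meas: "(\<lambda>s. v s * h (\<phi> s - rad n s)) \<in> borel_measurable borel" for n by measurable
  have eq: "v (norm x) * h (\<phi> (norm x) - Wn n x) = (\<lambda>s. v s * h (\<phi> s - rad n s)) (norm x)" if "n > 0" for n and x :: "real^3"
    using Wn_eq[OF that] by simp
  show "integrable lborel (\<lambda>x::real^3. v (norm x) * h (\<phi> (norm x) - Wn n x))" if n: "n > 0"
    unfolding eq[OF n] by (rule radial_integral(1)[OF meas int[OF n]])
  \<comment> \<open>The index is shifted by one so that the cutoff level is positive
    throughout.\<close>
  have "(\<lambda>n. LINT s|lborel. indicator {0<..} s * (s\<^sup>2 * (v s * h (\<phi> s - rad (Suc n) s)))) \<longlonglongrightarrow> (LINT s::real|lborel. 0)"
  proof (rule integral_dominated_convergence[where w = "\<lambda>s. D * (indicator {0<..} s * ((s + s\<^sup>2) * v s))"])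
    show "AE s in lborel. (\<lambda>n. indicator {0<..} s * (s\<^sup>2 * (v s * h (\<phi> s - rad (Suc n) s)))) \<longlonglongrightarrow> 0"
    proof (intro AE_I2)
      fix s
      show "(\<lambda>n. indicator {0<..} s * (s\<^sup>2 * (v s * h (\<phi> s - rad (Suc n) s)))) \<longlonglongrightarrow> 0"
      proof (cases "s > 0")
        case True
        have "(\<lambda>n. \<phi> s - rad (Suc n) s) \<longlonglongrightarrow> \<phi> s - \<phi> s"
          using LIMSEQ_Suc[OF rad_tendsto[OF True]] by (intro tendsto_intros)
        then have "(\<lambda>n. \<phi> s - rad (Suc n) s) \<longlonglongrightarrow> 0" by simp
        then have "(\<lambda>n. h (\<phi> s - rad (Suc n) s)) \<longlonglongrightarrow> h 0"
          by (rule isCont_tendsto_compose[OF h0(1)])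
        then have "(\<lambda>n. s\<^sup>2 * (v s * h (\<phi> s - rad (Suc n) s))) \<longlonglongrightarrow> s\<^sup>2 * (v s * h 0)"
          by (intro tendsto_mult_left)
        then show ?thesis using True h0 by simp
      qed simp
    qed
    show "AE s in lborel. norm (indicator {0<..} s * (s\<^sup>2 * (v s * h (\<phi> s - rad (Suc n) s)))) \<le> D * (indicator {0<..} s * ((s + s\<^sup>2) * v s))" for n
      using le[of "Suc n"] by auto
  qed (use integrable_v12 in \<open>auto intro: integrable_mult_right\<close>)
  then have "(\<lambda>n. 4 * pi * (LINT s|lborel. indicator {0<..} s * (s\<^sup>2 * (v s * h (\<phi> s - rad (Suc n) s))))) \<longlonglongrightarrow> 4 * pi * 0"
    by (intro tendsto_mult_left) simp
  also have "(\<lambda>n. 4 * pi * (LINT s|lborel. indicator {0<..} s * (s\<^sup>2 * (v s * h (\<phi> s - rad (Suc n) s)))))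
      = (\<lambda>n. LINT x|lborel. v (norm (x::real^3)) * h (\<phi> (norm x) - Wn (Suc n) x))"
  proof
    fix n
    have "(LINT x|lborel. v (norm (x::real^3)) * h (\<phi> (norm x) - Wn (Suc n) x)) = (LINT s|lborel. indicator {0<..} s * (4 * pi * s\<^sup>2 * (v s * h (\<phi> s - rad (Suc n) s))))"
      unfolding eq[OF zero_less_Suc] by (rule radial_integral(2)[OF meas int]) simp
    also have "\<dots> = (LINT s|lborel. 4 * pi * (indicator {0<..} s * (s\<^sup>2 * (v s * h (\<phi> s - rad (Suc n) s)))))"
      by (intro Bochner_Integration.integral_cong) (auto simp: mult_ac)
    also have "\<dots> = 4 * pi * (LINT s|lborel. indicator {0<..} s * (s\<^sup>2 * (v s * h (\<phi> s - rad (Suc n) s))))"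
      by (rule integral_mult_right_zero)
    finally show "4 * pi * (LINT s|lborel. indicator {0<..} s * (s\<^sup>2 * (v s * h (\<phi> s - rad (Suc n) s))))
      = (LINT x|lborel. v (norm (x::real^3)) * h (\<phi> (norm x) - Wn (Suc n) x))" by (rule sym)
  qed
  finally have "(\<lambda>n. LINT x|lborel. v (norm (x::real^3)) * h (\<phi> (norm x) - Wn (Suc n) x)) \<longlonglongrightarrow> 0"
    by simp
  then show "(\<lambda>n. LINT x|lborel. v (norm (x::real^3)) * h (\<phi> (norm x) - Wn n x)) \<longlonglongrightarrow> 0"
    by (rule LIMSEQ_imp_Suc)
qed

lemma Wn_error:
  shows "(\<lambda>n. LINT x|lborel. v (norm (x::real^3)) * \<bar>\<phi> (norm x) - Wn n x\<bar>) \<longlonglongrightarrow> 0"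
    and "(\<lambda>n. LINT x|lborel. v (norm (x::real^3)) * (\<phi> (norm x) - Wn n x)\<^sup>2) \<longlonglongrightarrow> 0"
proof -
  show "(\<lambda>n. LINT x|lborel. v (norm (x::real^3)) * \<bar>\<phi> (norm x) - Wn n x\<bar>) \<longlonglongrightarrow> 0"
    using radial_error_bound(1) by (intro radial_error_tendsto(1)[of abs]) auto
  show "(\<lambda>n. LINT x|lborel. v (norm (x::real^3)) * (\<phi> (norm x) - Wn n x)\<^sup>2) \<longlonglongrightarrow> 0"
    using radial_error_bound(2) by (intro radial_error_tendsto(1)[of "\<lambda>y. y\<^sup>2"]) auto
qed

end

section \<open>Riemann sums over the dual lattice\<close>

definition lattice_round :: "real \<Rightarrow> real^3 \<Rightarrow> real^3" where "lattice_round h p = (\<chi> i. h * of_int \<lfloor>p $ i / h\<rfloor>)"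

lemma lattice_round_nth [simp]: "lattice_round h p $ i = h * of_int \<lfloor>p $ i / h\<rfloor>"
  by (simp add: lattice_round_def)

lemma measurable_vec_lambda3:
  fixes f :: "'a \<Rightarrow> real^3"
  assumes "\<And>i. (\<lambda>x. f x $ i) \<in> borel_measurable M"
  shows "f \<in> borel_measurable M"
proof (subst borel_measurable_euclidean_space, intro ballI)
  fix b :: "real^3" assume "b \<in> Basis"
  then obtain i where "b = axis i 1" by (auto simp: Basis_vec_def)
  then show "(\<lambda>x. f x \<bullet> b) \<in> borel_measurable M" using assms[of i] by (simp add: inner_axis)
qed

lemma lattice_round_measurable [measurable]: "lattice_round h \<in> borel_measurable borel"
  by (rule measurable_vec_lambda3) (simp, measurable)

lemma lattice_round_bounds:
  assumes "h > 0"
  shows "0 \<le> p $ i - lattice_round h p $ i" "p $ i - lattice_round h p $ i < h"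
proof -
  have "h * of_int \<lfloor>p $ i / h\<rfloor> \<le> h * (p $ i / h)" using assms by (intro mult_left_mono of_int_floor_le) auto
  then show "0 \<le> p $ i - lattice_round h p $ i" using assms by simp
  have "p $ i / h < of_int \<lfloor>p $ i / h\<rfloor> + 1" by linarith
  then show "p $ i - lattice_round h p $ i < h" using assms by (simp add: pos_divide_less_eq algebra_simps)
qed

lemma norm_diff_lattice_round_le:
  assumes "h > 0"
  shows "norm (p - lattice_round h p) \<le> 3 * h"
proof -
  have "norm (p - lattice_round h p) \<le> (\<Sum>i\<in>UNIV. \<bar>(p - lattice_round h p) $ i\<bar>)" by (rule norm_le_l1_cart)
  also have "\<dots> \<le> (\<Sum>i::3\<in>UNIV. h)"
    using lattice_round_bounds[OF assms, of p] by (intro sum_mono) (simp add: less_imp_le)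
  finally show ?thesis by simp
qed

lemma norm_lattice_round_ge:
  assumes "h > 0" "lattice_round h p \<noteq> 0"
  shows "h \<le> norm (lattice_round h p)"
proof -
  obtain i where "lattice_round h p $ i \<noteq> 0" using assms by (auto simp: vec_eq_iff)
  then have "\<lfloor>p $ i / h\<rfloor> \<noteq> 0" by auto
  then have "1 \<le> \<bar>real_of_int \<lfloor>p $ i / h\<rfloor>\<bar>" by linarith
  then have "h * 1 \<le> h * \<bar>real_of_int \<lfloor>p $ i / h\<rfloor>\<bar>" using assms by (intro mult_left_mono) auto
  also have "\<dots> = \<bar>lattice_round h p $ i\<bar>" using assms by (simp add: abs_mult)
  also have "\<dots> \<le> norm (lattice_round h p)" by (rule component_le_norm_cart)
  finally show ?thesis by simp
qed

text \<open>Rounding moves a point by at most 3 * h, and a nonzero lattice point has norm at least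
  h; together this gives the factor 4.\<close>

lemma norm_le_norm_lattice_round:
  assumes "h > 0" "lattice_round h p \<noteq> 0"
  shows "norm p \<le> 4 * norm (lattice_round h p)"
proof -
  have "norm p \<le> norm (lattice_round h p) + norm (p - lattice_round h p)"
    by (metis norm_triangle_ineq add.commute diff_add_cancel)
  then show ?thesis using norm_diff_lattice_round_le[OF assms(1), of p] norm_lattice_round_ge[OF assms] by linarith
qed

lemma lattice_round_eq_iff:
  assumes h: "h > 0" and q: "\<And>i. \<exists>n::int. q $ i = h * of_int n"
  shows "lattice_round h p = q \<longleftrightarrow> (\<forall>i. q $ i \<le> p $ i \<and> p $ i < q $ i + h)"
proof -
  have "lattice_round h p $ i = q $ i \<longleftrightarrow> q $ i \<le> p $ i \<and> p $ i < q $ i + h" for i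
  proof -
    obtain n :: int where n: "q $ i = h * of_int n" using q by blast
    have "lattice_round h p $ i = q $ i \<longleftrightarrow> \<lfloor>p $ i / h\<rfloor> = n" using h by (simp add: n)
    also have "\<dots> \<longleftrightarrow> of_int n \<le> p $ i / h \<and> p $ i / h < of_int n + 1" by (rule floor_eq_iff)
    also have "\<dots> \<longleftrightarrow> q $ i \<le> p $ i \<and> p $ i < q $ i + h"
      using h by (simp add: n pos_le_divide_eq pos_divide_less_eq algebra_simps)
    finally show ?thesis .
  qed
  then show ?thesis by (simp add: vec_eq_iff)
qed

text \<open>The half-open cell is squeezed between an open and a closed box of the same
  volume.\<close>

lemma measure_cell:
  assumes h: "h > 0" and q: "\<And>i. \<exists>n::int. q $ i = h * of_int n"
  shows "emeasure lborel {p. lattice_round h p = q} = ennreal (h ^ 3)"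
proof -
  let ?u = "\<chi> i. q $ i + h"
  have eq: "{p. lattice_round h p = q} = {p. \<forall>i. q $ i \<le> p $ i \<and> p $ i < q $ i + h}"
    using lattice_round_eq_iff[OF h q] by simp
  have s: "{p. lattice_round h p = q} \<in> sets lborel" by (simp add: pred_def[symmetric])
  have p3: "(\<Prod>b\<in>Basis. (?u - q) \<bullet> b) = h ^ 3" by (simp add: prod_Basis_real3 inner_axis power3_eq_cube)
  have le: "\<And>b. b \<in> Basis \<Longrightarrow> q \<bullet> b \<le> ?u \<bullet> b" using h by (auto simp: Basis_real3 inner_axis)
  have "box q ?u \<subseteq> {p. lattice_round h p = q}" unfolding eq by (auto simp: mem_box_cart less_imp_le)
  then have "emeasure lborel (box q ?u) \<le> emeasure lborel {p. lattice_round h p = q}" using s by (rule emeasure_mono)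
  moreover have "{p. lattice_round h p = q} \<subseteq> cbox q ?u" unfolding eq by (auto simp: mem_box_cart less_imp_le)
  then have "emeasure lborel {p. lattice_round h p = q} \<le> emeasure lborel (cbox q ?u)" by (rule emeasure_mono) simp
  ultimately show ?thesis
    using p3 le by (simp add: emeasure_lborel_box emeasure_lborel_cbox order_antisym)
qed

text \<open>The majorant for all Riemann sums: of order r^(-2) at 0 and r^(-4) at infinity, hence
  integrable in three dimensions. By \<open>Dm_le\<close> it changes by a bounded factor under
  rounding to the lattice.\<close>

definition Dm :: "real \<Rightarrow> real" where "Dm r = 1 / (r\<^sup>2 * (r\<^sup>2 + 1))"

lemma Dm_nonneg [simp]: "Dm r \<ge> 0"
  by (simp add: Dm_def)

lemma Dm_measurable [measurable]: "Dm \<in> borel_measurable borel"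
  unfolding Dm_def[abs_def] by measurable

lemma Dm_le:
  assumes "0 < r" "r \<le> 4 * s"
  shows "Dm s \<le> 256 * Dm r"
proof -
  have "r\<^sup>2 \<le> (4 * s)\<^sup>2" using assms by (intro power_mono) auto
  then have le: "r\<^sup>2 \<le> 16 * s\<^sup>2" by (simp add: power_mult_distrib)
  have "r\<^sup>2 * (r\<^sup>2 + 1) \<le> (16 * s\<^sup>2) * (16 * (s\<^sup>2 + 1))"
    using le by (intro mult_mono) auto
  then have "1 / ((16 * s\<^sup>2) * (16 * (s\<^sup>2 + 1))) \<le> 1 / (r\<^sup>2 * (r\<^sup>2 + 1))"
    using assms by (intro divide_left_mono) (auto intro!: mult_pos_pos add_nonneg_pos)
  moreover have "1 / ((16 * s\<^sup>2) * (16 * (s\<^sup>2 + 1))) = Dm s / 256" by (simp add: Dm_def)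
  ultimately have "Dm s / 256 \<le> Dm r" by (simp only: Dm_def[of r])
  then show ?thesis by simp
qed

lemma Dm_integrable: "integrable lborel (\<lambda>p::real^3. Dm (norm p))"
proof (rule radial_integral(1))
  have "integrable lborel (\<lambda>s. indicator {0<..} s * (2 / (1 + 1 * s\<^sup>2)) / 2 :: real)"
    by (intro integrable_divide has_bochner_lorentz) simp
  also have "(\<lambda>s. indicator {0<..} s * (2 / (1 + 1 * s\<^sup>2)) / 2 :: real) = (\<lambda>s. indicator {0<..} s * (s\<^sup>2 * Dm s))"
    by (auto simp: Dm_def indicator_def fun_eq_iff divide_simps)
  finally show "integrable lborel (\<lambda>s. indicator {0<..} s * (s\<^sup>2 * Dm s))" .
qed measurable

text \<open>A lattice sum over nonzero momenta is the integral of this step function up to the cell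
  volume. The cell of 0 is set to 0, since the summands may be singular there.\<close>

definition lattice_step :: "real \<Rightarrow> (real^3 \<Rightarrow> real) \<Rightarrow> real^3 \<Rightarrow> real" where
  "lattice_step L f p = (if lattice_round (2 * pi / L) p = 0 then 0 else f (lattice_round (2 * pi / L) p))"

lemma lattice_step_measurable [measurable]:
  assumes [measurable]: "f \<in> borel_measurable borel"
  shows "lattice_step L f \<in> borel_measurable borel"
  unfolding lattice_step_def[abs_def] by measurable

lemma lattice_step_bound:
  assumes "L > 0" and f: "\<And>p. p \<noteq> 0 \<Longrightarrow> \<bar>f p\<bar> \<le> C * Dm (norm p)"
  shows "\<bar>lattice_step L f p\<bar> \<le> 256 * C * Dm (norm p)"
proof -
  have "C * Dm (norm (axis 1 1 :: real^3)) \<ge> 0" using order_trans[OF abs_ge_zero f[of "axis 1 1"]] by (simp add: axis_eq_0_iff)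
  then have C: "C \<ge> 0" by (simp add: Dm_def)
  show ?thesis
  proof (cases "lattice_round (2 * pi / L) p = 0")
    case False
    have h: "2 * pi / L > 0" using assms by simp
    have "lattice_round (2 * pi / L) 0 = 0" by (simp add: vec_eq_iff)
    then have p: "p \<noteq> 0" using False by metis
    have "\<bar>lattice_step L f p\<bar> \<le> C * Dm (norm (lattice_round (2 * pi / L) p))" using f False by (simp add: lattice_step_def)
    also have "\<dots> \<le> C * (256 * Dm (norm p))"
      using C p norm_le_norm_lattice_round[OF h False] by (intro mult_left_mono Dm_le) auto
    finally show ?thesis by simp
  qed (use C in \<open>simp add: lattice_step_def\<close>)
qed

lemma lattice_step_integrable:
  assumes "L > 0" "f \<in> borel_measurable borel" "\<And>p. p \<noteq> 0 \<Longrightarrow> \<bar>f p\<bar> \<le> C * Dm (norm p)"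
  shows "integrable lborel (lattice_step L f)"
  by (rule Bochner_Integration.integrable_bound[OF integrable_mult_right[OF Dm_integrable, of "256 * C"]])
    (use assms order_trans[OF lattice_step_bound[OF assms(1,3)] abs_ge_self] in \<open>auto intro!: AE_I2\<close>)

lemma lattice_round_tendsto: "((\<lambda>L. lattice_round (2 * pi / L) p) \<longlongrightarrow> p) at_top"
proof -
  have "((\<lambda>L. lattice_round (2 * pi / L) p - p) \<longlongrightarrow> 0) at_top"
  proof (rule Lim_null_comparison)
    show "\<forall>\<^sub>F L in at_top. norm (lattice_round (2 * pi / L) p - p) \<le> 6 * pi * inverse L"
      using eventually_gt_at_top[of 0]
    proof eventually_elim
      case (elim L)
      then show ?case using norm_diff_lattice_round_le[of "2 * pi / L" p] by (simp add: norm_minus_commute divide_inverse)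
    qed
    show "((\<lambda>L. 6 * pi * inverse L) \<longlongrightarrow> 0) at_top"
      by (intro tendsto_mult_right_zero tendsto_inverse_0_at_top filterlim_ident)
  qed
  then show ?thesis by (rule LIM_zero_cancel)
qed

text \<open>Dominated convergence, with a majorant independent of the box. The singularity at the
  origin is harmless because the rounded point is at least a quarter as far from 0 as the original
  one.\<close>

theorem riemann_limit:
  assumes f[measurable]: "f \<in> borel_measurable borel" and cont: "\<And>p. p \<noteq> 0 \<Longrightarrow> isCont f p"
    and bound: "\<And>p. p \<noteq> 0 \<Longrightarrow> \<bar>f p\<bar> \<le> C * Dm (norm p)"
  shows "((\<lambda>L. LINT p|lborel. lattice_step L f p) \<longlongrightarrow> (LINT p|lborel. f p)) at_top"
proof (rule integral_dominated_convergence_at_top[where w = "\<lambda>p. 256 * C * Dm (norm p)"])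
  show "AE p in lborel. ((\<lambda>L. lattice_step L f p) \<longlongrightarrow> f p) at_top"
    using AE_lborel_singleton[of "0::real^3"]
  proof eventually_elim
    case (elim p)
    have "((\<lambda>L. f (lattice_round (2 * pi / L) p)) \<longlongrightarrow> f p) at_top"
      by (rule isCont_tendsto_compose[OF cont[OF elim] lattice_round_tendsto])
    moreover have "\<forall>\<^sub>F L in at_top. lattice_round (2 * pi / L) p \<in> - {0}"
      by (rule topological_tendstoD[OF lattice_round_tendsto]) (use elim in auto)
    then have "\<forall>\<^sub>F L in at_top. f (lattice_round (2 * pi / L) p) = lattice_step L f p"
      by eventually_elim (simp add: lattice_step_def)
    ultimately show ?case by (rule Lim_transform_eventually)
  qed
  show "\<forall>\<^sub>F L in at_top. AE p in lborel. norm (lattice_step L f p) \<le> 256 * C * Dm (norm p)"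
    using eventually_gt_at_top[of 0] by eventually_elim (use lattice_step_bound[of _ f C] bound in auto)
qed (use Dm_integrable in \<open>auto intro!: integrable_mult_right\<close>)

lemma finite_lattice_sum:
  assumes L: "L > 0" and P: "finite P" "P \<subseteq> dual_lattice L - {0}"
  shows "integrable lborel (\<lambda>p. \<Sum>q\<in>P. f q * indicator {p. lattice_round (2 * pi / L) p = q} p)"
    and "(LINT p|lborel. (\<Sum>q\<in>P. f q * indicator {p. lattice_round (2 * pi / L) p = q} p)) = (2 * pi) ^ 3 / L ^ 3 * sum f P"
proof -
  have h: "2 * pi / L > 0" using L by simp
  have s: "{p. lattice_round (2 * pi / L) p = q} \<in> sets lborel" for q by (simp add: pred_def[symmetric])
  have m: "emeasure lborel {p. lattice_round (2 * pi / L) p = q} = ennreal ((2 * pi / L) ^ 3)" if "q \<in> P" for q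
    using that P by (intro measure_cell[OF h]) (auto simp: dual_lattice_def)
  have i: "has_bochner_integral lborel (\<lambda>p. f q * indicator {p. lattice_round (2 * pi / L) p = q} p) (f q * (2 * pi / L) ^ 3)" if "q \<in> P" for q
    using has_bochner_integral_real_indicator[OF s[of q]] m[OF that] h
    by (intro has_bochner_integral_mult_right) (auto simp: measure_def)
  have "has_bochner_integral lborel (\<lambda>p. \<Sum>q\<in>P. f q * indicator {p. lattice_round (2 * pi / L) p = q} p) (\<Sum>q\<in>P. f q * (2 * pi / L) ^ 3)"
    by (rule has_bochner_integral_sum) (rule i)
  moreover have "(\<Sum>q\<in>P. f q * (2 * pi / L) ^ 3) = (2 * pi) ^ 3 / L ^ 3 * sum f P"
    unfolding sum_distrib_right[symmetric] power_divide by simp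
  ultimately show "integrable lborel (\<lambda>p. \<Sum>q\<in>P. f q * indicator {p. lattice_round (2 * pi / L) p = q} p)"
    "(LINT p|lborel. (\<Sum>q\<in>P. f q * indicator {p. lattice_round (2 * pi / L) p = q} p)) = (2 * pi) ^ 3 / L ^ 3 * sum f P"
    by (auto simp: has_bochner_integral_iff)
qed

lemma sum_indicator_cell:
  assumes "finite P"
  shows "(\<Sum>q\<in>P. f q * indicator {p. lattice_round h p = q} p) = (if lattice_round h p \<in> P then f (lattice_round h p) else (0::real))"
proof -
  have "(\<Sum>q\<in>P. f q * indicator {p. lattice_round h p = q} p) = (\<Sum>q\<in>P. if lattice_round h p = q then f q else 0)"
    by (intro sum.cong) (auto simp: indicator_def)
  then show ?thesis using assms by simp
qed

lemma lattice_round_in_dual_lattice: "lattice_round (2 * pi / L) p \<in> dual_lattice L"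
  by (auto simp: dual_lattice_def)

lemma lattice_sum_le:
  assumes L: "L > 0" and P: "finite P" "P \<subseteq> dual_lattice L - {0}"
    and f: "f \<in> borel_measurable borel" "\<And>p. f p \<ge> 0" "\<And>p. p \<noteq> 0 \<Longrightarrow> \<bar>f p\<bar> \<le> C * Dm (norm p)"
  shows "(2 * pi) ^ 3 / L ^ 3 * sum f P \<le> (LINT p|lborel. lattice_step L f p)"
  unfolding finite_lattice_sum(2)[OF L P, symmetric]
proof (rule integral_mono[OF finite_lattice_sum(1)[OF L P] lattice_step_integrable[OF L f(1,3)]])
  fix p
  show "(\<Sum>q\<in>P. f q * indicator {p. lattice_round (2 * pi / L) p = q} p) \<le> lattice_step L f p"
    unfolding sum_indicator_cell[OF P(1)] using P f(2) by (auto simp: lattice_step_def)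
qed

lemma lattice_sum_eq:
  assumes L: "L > 0" and P: "finite P" "P \<subseteq> dual_lattice L - {0}"
    and f: "\<And>p. p \<in> dual_lattice L \<Longrightarrow> p \<noteq> 0 \<Longrightarrow> p \<notin> P \<Longrightarrow> f p = 0"
  shows "(2 * pi) ^ 3 / L ^ 3 * sum f P = (LINT p|lborel. lattice_step L f p)"
  unfolding finite_lattice_sum(2)[OF L P, symmetric]
proof (rule Bochner_Integration.integral_cong[OF refl])
  fix p
  show "(\<Sum>q\<in>P. f q * indicator {p. lattice_round (2 * pi / L) p = q} p) = lattice_step L f p"
    unfolding sum_indicator_cell[OF P(1)] using P f[of "lattice_round (2 * pi / L) p"] lattice_round_in_dual_lattice[of L p] by (auto simp: lattice_step_def)
qed

lemma finite_dual_lattice_ball: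
  assumes "L > 0"
  shows "finite {p \<in> dual_lattice L. norm p \<le> R}"
proof -
  define A :: "real set" where "A = (\<lambda>n::int. 2 * pi / L * of_int n) ` {- \<lceil>R * L / (2 * pi)\<rceil> .. \<lceil>R * L / (2 * pi)\<rceil>}"
  have "{p \<in> dual_lattice L. norm p \<le> R} \<subseteq> vec_lambda ` (UNIV \<rightarrow>\<^sub>E A)"
  proof clarify
    fix p :: "real^3" assume p: "p \<in> dual_lattice L" "norm p \<le> R"
    have "p $ i \<in> A" for i
    proof -
      obtain n :: int where n: "p $ i = 2 * pi / L * of_int n" using p by (auto simp: dual_lattice_def)
      have "\<bar>p $ i\<bar> \<le> R" using component_le_norm_cart[of p i] p by linarith
      then have "\<bar>real_of_int n\<bar> \<le> R * L / (2 * pi)" using assms by (simp add: n abs_mult field_simps)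
      then have "\<bar>n\<bar> \<le> \<lceil>R * L / (2 * pi)\<rceil>" by linarith
      then show ?thesis unfolding A_def using n by (intro image_eqI[of _ _ n]) (auto simp: abs_le_iff)
    qed
    then show "p \<in> vec_lambda ` (UNIV \<rightarrow>\<^sub>E A)" by (intro image_eqI[of _ _ "\<lambda>i. p $ i"]) auto
  qed
  moreover have "finite (vec_lambda ` ((UNIV::3 set) \<rightarrow>\<^sub>E A))"
    by (intro finite_imageI finite_PiE) (auto simp: A_def)
  ultimately show ?thesis by (rule finite_subset)
qed

section \<open>Square summability of the Fourier coefficients\<close>

text \<open>\<open>G\<close> is the imaginary part of an antiderivative of s * exp (- (1 - i*k) *
  s). \<open>C\<close> and \<open>A\<close> are the real and imaginary parts of 1 / (1 - i*k), and
  \<open>E\<close> and \<open>B\<close> those of its square.\<close>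

lemma integral_exp_sin:
  fixes k :: real
  shows "integrable lborel (\<lambda>s. indicator {0<..} s * (s * exp (- s) * sin (k * s)))"
    and "(LINT s|lborel. indicator {0<..} s * (s * exp (- s) * sin (k * s))) = 2 * k / (1 + k\<^sup>2)\<^sup>2"
proof -
  define d where "d = 1 + k\<^sup>2"
  have d: "d > 0" by (simp add: d_def add_pos_nonneg)
  define f where "f s = s * exp (- s) * sin (k * s)" for s
  define C where "C = 1 / d"
  define A where "A = k * C"
  define B where "B = 2 * k * C\<^sup>2"
  define E where "E = (1 - k\<^sup>2) * C\<^sup>2"
  have C1: "C + k * A = 1" using d by (simp add: A_def C_def d_def field_simps power2_eq_square)
  have Cd: "C = C\<^sup>2 * d" using d by (simp add: C_def power2_eq_square)
  have E1: "E + k * B = C" unfolding E_def B_def by (subst Cd) (simp add: d_def algebra_simps power2_eq_square)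
  have B1: "B - A - k * E = 0" unfolding A_def E_def B_def by (subst Cd) (simp add: d_def algebra_simps power2_eq_square)
  define G where "G s = exp (- s) * (cos (k * s) * (- s * A - B) + sin (k * s) * (- s * C - E))" for s
  have G': "(G has_real_derivative f s) (at s)" for s
  proof -
    have "(G has_real_derivative exp (- s) * (cos (k * s) * (s * (A - k * C) + (B - A - k * E)) + sin (k * s) * (s * (C + k * A) + (E + k * B) - C))) (at s)"
      unfolding G_def[abs_def] by (auto intro!: derivative_eq_intros simp: algebra_simps)
    also have "exp (- s) * (cos (k * s) * (s * (A - k * C) + (B - A - k * E)) + sin (k * s) * (s * (C + k * A) + (E + k * B) - C)) = f s"
      unfolding C1 E1 B1 by (simp add: A_def f_def)
    finally show ?thesis .
  qed
  have int: "integrable lborel (\<lambda>s. indicator {0<..} s * f s)"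
  proof (rule Bochner_Integration.integrable_bound)
    show "integrable lborel (\<lambda>s::real. s ^ 1 * exp (- s) * indicator {0<..} s)"
      using has_bochner_integral_I0i_power_exp_m[of 1] by (rule integrable.intros)
    show "AE s in lborel. norm (indicator {0<..} s * f s) \<le> norm (s ^ 1 * exp (- s) * indicator {0<..} s)"
      by (intro AE_I2) (auto simp: f_def indicator_def abs_mult intro!: mult_left_le)
  qed (auto simp: f_def)
  then show "integrable lborel (\<lambda>s. indicator {0<..} s * (s * exp (- s) * sin (k * s)))" by (simp add: f_def)
  have lim1: "((\<lambda>T. LINT s|lborel. indicator {0..T} s * (indicator {0<..} s * f s)) \<longlongrightarrow> (LINT s|lborel. indicator {0<..} s * f s)) at_top"
  proof (rule integral_dominated_convergence_at_top[where w = "\<lambda>s. norm (indicator {0<..} s * f s)"])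
    show "AE s in lborel. ((\<lambda>T. indicator {0..T} s * (indicator {0<..} s * f s)) \<longlongrightarrow> indicator {0<..} s * f s) at_top"
    proof (intro AE_I2)
      fix s :: real
      have "\<forall>\<^sub>F T in at_top. indicator {0<..} s * f s = indicator {0..T} s * (indicator {0<..} s * f s)"
        using eventually_ge_at_top[of s] by eventually_elim (auto simp: indicator_def)
      then show "((\<lambda>T. indicator {0..T} s * (indicator {0<..} s * f s)) \<longlongrightarrow> indicator {0<..} s * f s) at_top"
        by (rule Lim_transform_eventually[OF tendsto_const])
    qed
    show "\<forall>\<^sub>F T in at_top. AE s in lborel. norm (indicator {0..T} s * (indicator {0<..} s * f s)) \<le> norm (indicator {0<..} s * f s)"
      by (intro always_eventually allI AE_I2) (auto simp: indicator_def)
  qed (use int in \<open>auto simp: f_def\<close>)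
  have fin: "(LINT s|lborel. indicator {0..T} s * (indicator {0<..} s * f s)) = G T - G 0" if "T \<ge> 0" for T
  proof -
    have "(LINT s|lborel. indicator {0..T} s * (indicator {0<..} s * f s)) = (LINT s|lborel. indicator {0..T} s *\<^sub>R f s)"
      by (intro Bochner_Integration.integral_cong) (auto simp: indicator_def f_def)
    also have "\<dots> = G T - G 0"
      using that G' by (intro integral_FTC_atLeastAtMost)
        (auto simp: f_def[abs_def] has_real_derivative_iff_has_vector_derivative[symmetric] intro!: continuous_intros intro: DERIV_subset)
    finally show ?thesis .
  qed
  have G0: "(G \<longlongrightarrow> 0) at_top"
  proof (rule Lim_null_comparison)
    show "\<forall>\<^sub>F s in at_top. norm (G s) \<le> exp (- s) * ((s * \<bar>A\<bar> + \<bar>B\<bar>) + (s * \<bar>C\<bar> + \<bar>E\<bar>))"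
      using eventually_ge_at_top[of 0]
    proof eventually_elim
      case (elim s)
      have t: "\<bar>- s * X - Y\<bar> \<le> s * \<bar>X\<bar> + \<bar>Y\<bar>" for X Y
        using elim abs_triangle_ineq4[of "- s * X" Y] by (simp add: abs_mult)
      have "\<bar>cos (k * s)\<bar> * \<bar>- s * A - B\<bar> + \<bar>sin (k * s)\<bar> * \<bar>- s * C - E\<bar>
          \<le> 1 * (s * \<bar>A\<bar> + \<bar>B\<bar>) + 1 * (s * \<bar>C\<bar> + \<bar>E\<bar>)"
        by (intro add_mono mult_mono t) auto
      then have "\<bar>cos (k * s) * (- s * A - B) + sin (k * s) * (- s * C - E)\<bar> \<le> (s * \<bar>A\<bar> + \<bar>B\<bar>) + (s * \<bar>C\<bar> + \<bar>E\<bar>)"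
        by (intro order_trans[OF abs_triangle_ineq]) (simp add: abs_mult)
      then show ?case unfolding G_def by (simp only: real_norm_def abs_mult abs_exp_cancel) (rule mult_left_mono, auto)
    qed
    show "((\<lambda>s. exp (- s) * ((s * \<bar>A\<bar> + \<bar>B\<bar>) + (s * \<bar>C\<bar> + \<bar>E\<bar>))) \<longlongrightarrow> 0) at_top"
      by real_asymp
  qed
  have "((\<lambda>T. LINT s|lborel. indicator {0..T} s * (indicator {0<..} s * f s)) \<longlongrightarrow> 0 - G 0) at_top"
  proof (rule Lim_transform_eventually)
    show "((\<lambda>T. G T - G 0) \<longlongrightarrow> 0 - G 0) at_top" by (intro tendsto_intros G0)
    show "\<forall>\<^sub>F T in at_top. G T - G 0 = (LINT s|lborel. indicator {0..T} s * (indicator {0<..} s * f s))"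
      using eventually_ge_at_top[of 0] by eventually_elim (simp only: fin)
  qed
  from tendsto_unique[OF _ lim1 this] have "(LINT s|lborel. indicator {0<..} s * f s) = 0 - G 0" by simp
  then show "(LINT s|lborel. indicator {0<..} s * (s * exp (- s) * sin (k * s))) = 2 * k / (1 + k\<^sup>2)\<^sup>2"
    by (simp add: f_def G_def B_def C_def d_def power_divide)
qed

text \<open>Averaging \<open>V\<close> against this weight costs only a constant, and its explicit Fourier transform is summable
  over the lattice. Hence the Toeplitz matrix with entries given by the Fourier transform of \<open>V\<close> at
  \<open>u - u'\<close> is bounded.\<close>

definition \<eta> :: "real^3 \<Rightarrow> real" where "\<eta> x = exp (- norm x)"

lemma \<eta>_measurable [measurable]: "\<eta> \<in> borel_measurable borel"
  unfolding \<eta>_def[abs_def] by measurable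

lemma exp_moment_integrable: "integrable lborel (\<lambda>s::real. indicator {0<..} s * (s\<^sup>2 * exp (- s)))"
  using integrable.intros[OF has_bochner_integral_I0i_power_exp_m[of 2]] by (simp add: mult_ac)

lemma \<eta>_cos_integrable: "integrable lborel (\<lambda>x. \<eta> x * cos (k \<bullet> x))"
  unfolding \<eta>_def by (rule radial_fourier(1)[OF _ exp_moment_integrable]) measurable

definition \<eta>h :: "real^3 \<Rightarrow> real" where "\<eta>h k = (LINT x|lborel. \<eta> x * cos (k \<bullet> x))"

lemma \<eta>h_le:
  assumes "k \<noteq> 0"
  shows "\<bar>\<eta>h k\<bar> \<le> 8 * pi * Dm (norm k)"
proof -
  define q where "q = norm k"
  have q: "q > 0" using assms by (simp add: q_def)
  have "\<eta>h k = (LINT s|lborel. indicator {0<..} s * (4 * pi * s\<^sup>2 * exp (- s) * bessel0 (q * s)))"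
    unfolding \<eta>h_def \<eta>_def bessel0_def q_def by (rule radial_fourier(2)[OF _ exp_moment_integrable]) measurable
  also have "\<dots> = (LINT s|lborel. 4 * pi / q * (indicator {0<..} s * (s * exp (- s) * sin (q * s))))"
    using q by (intro Bochner_Integration.integral_cong) (auto simp: indicator_def bessel0_eq power2_eq_square)
  also have "\<dots> = 4 * pi / q * (2 * q / (1 + q\<^sup>2)\<^sup>2)"
    by (subst integral_mult_right_zero) (simp only: integral_exp_sin(2))
  also have "\<dots> = 8 * pi * (1 / (1 + q\<^sup>2)\<^sup>2)" using q by simp
  finally have "\<bar>\<eta>h k\<bar> = 8 * pi * (1 / (1 + q\<^sup>2)\<^sup>2)" by simp
  also have "1 / (1 + q\<^sup>2)\<^sup>2 \<le> 1 / (q\<^sup>2 * (q\<^sup>2 + 1))"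
  proof (rule divide_left_mono)
    have "q\<^sup>2 * (q\<^sup>2 + 1) \<le> (1 + q\<^sup>2) * (q\<^sup>2 + 1)" by (intro mult_right_mono) auto
    then show "q\<^sup>2 * (q\<^sup>2 + 1) \<le> (1 + q\<^sup>2)\<^sup>2" by (simp add: power2_eq_square add.commute)
  qed (use q in \<open>auto intro!: mult_pos_pos add_pos_nonneg zero_less_power\<close>)
  finally show ?thesis by (simp add: Dm_def q_def mult_left_mono)
qed

lemma \<eta>_shift:
  "integrable lborel (\<lambda>z. \<eta> z * cos (k \<bullet> (y + z)))" "(LINT z|lborel. \<eta> z * cos (k \<bullet> (y + z))) = cos (k \<bullet> y) * \<eta>h k"
proof -
  have s: "integrable lborel (\<lambda>z. \<eta> z * sin (k \<bullet> z))"
  proof (rule Bochner_Integration.integrable_bound[OF \<eta>_cos_integrable[of 0]])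
    show "AE z in lborel. norm (\<eta> z * sin (k \<bullet> z)) \<le> norm (\<eta> z * cos (0 \<bullet> z))"
      by (intro AE_I2) (auto simp: abs_mult intro!: mult_left_le)
  qed measurable
  have ort: "orthogonal_transformation (uminus :: real^3 \<Rightarrow> real^3)"
    by (auto simp: orthogonal_transformation_def intro!: linearI)
  have "(LINT z|lborel. \<eta> z * sin (k \<bullet> z)) = (LINT z|distr lborel borel uminus. \<eta> z * sin (k \<bullet> z))"
    by (simp add: distr_orthogonal_transformation[OF ort])
  also have "\<dots> = (LINT z|lborel. \<eta> (- z) * sin (k \<bullet> (- z)))"
    by (rule integral_distr) measurable
  also have "\<dots> = - (LINT z|lborel. \<eta> z * sin (k \<bullet> z))" by (simp add: \<eta>_def)
  finally have s0: "(LINT z|lborel. \<eta> z * sin (k \<bullet> z)) = 0" by simp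
  have eq: "\<eta> z * cos (k \<bullet> (y + z)) = cos (k \<bullet> y) * (\<eta> z * cos (k \<bullet> z)) - sin (k \<bullet> y) * (\<eta> z * sin (k \<bullet> z))" for z
    by (simp add: inner_add_right cos_add algebra_simps)
  show "integrable lborel (\<lambda>z. \<eta> z * cos (k \<bullet> (y + z)))"
    unfolding eq using s \<eta>_cos_integrable by (intro Bochner_Integration.integrable_diff integrable_mult_right)
  show "(LINT z|lborel. \<eta> z * cos (k \<bullet> (y + z))) = cos (k \<bullet> y) * \<eta>h k"
    unfolding eq using s \<eta>_cos_integrable[of k] s0
    by (subst Bochner_Integration.integral_diff) (auto simp: \<eta>h_def)
qed

definition trig :: "(real^3) set \<Rightarrow> (real^3 \<Rightarrow> real) \<Rightarrow> real^3 \<Rightarrow> real" where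
  "trig F t x = (\<Sum>u\<in>F. t u * cos (u \<bullet> x))"

lemma trig_measurable [measurable]: "trig F t \<in> borel_measurable borel"
  unfolding trig_def[abs_def] by measurable

text \<open>Adding the square of the sine sum makes the right-hand side depend on the differences u
  - u' alone, which is the Toeplitz form.\<close>

lemma trig_square_le:
  assumes "finite F"
  shows "(trig F t x)\<^sup>2 \<le> (\<Sum>u\<in>F. \<Sum>u'\<in>F. t u * t u' * cos ((u - u') \<bullet> x))"
proof -
  have "(trig F t x)\<^sup>2 \<le> (trig F t x)\<^sup>2 + (\<Sum>u\<in>F. t u * sin (u \<bullet> x))\<^sup>2" by simp
  also have "\<dots> = (\<Sum>u\<in>F. \<Sum>u'\<in>F. t u * t u' * cos ((u - u') \<bullet> x))"
    unfolding trig_def power2_eq_square sum_product sum.distrib[symmetric]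
    by (intro sum.cong refl) (simp add: inner_diff_left cos_diff algebra_simps)
  finally show ?thesis .
qed

definition lattice_const :: "real \<Rightarrow> real" where
  "lattice_const L = \<eta>h 0 + 8 * pi * (L ^ 3 / (2 * pi) ^ 3 * (LINT p|lborel. lattice_step L (\<lambda>p. Dm (norm p)) p))"

lemma sum_\<eta>h_le:
  assumes L: "L > 0" and F: "finite F" "F \<subseteq> dual_lattice L" and u: "u \<in> dual_lattice L"
  shows "(\<Sum>u'\<in>F. \<bar>\<eta>h (u - u')\<bar>) \<le> lattice_const L"
proof -
  have \<eta>h0: "\<eta>h 0 \<ge> 0" unfolding \<eta>h_def \<eta>_def by (intro integral_nonneg_AE AE_I2) auto
  define P where "P = (\<lambda>u'. u - u') ` F - {0}"
  have P: "finite P" "P \<subseteq> dual_lattice L - {0}" using F u by (auto simp: P_def intro!: diff_in_dual_lattice)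
  have "(\<Sum>u'\<in>F. \<bar>\<eta>h (u - u')\<bar>) = (\<Sum>k\<in>(\<lambda>u'. u - u') ` F. \<bar>\<eta>h k\<bar>)"
    by (subst sum.reindex) (auto simp: inj_on_def)
  also have "\<dots> \<le> (\<Sum>k\<in>insert 0 P. \<bar>\<eta>h k\<bar>)"
    using P F by (intro sum_mono2) (auto simp: P_def)
  also have "\<dots> = \<eta>h 0 + (\<Sum>k\<in>P. \<bar>\<eta>h k\<bar>)"
    using P \<eta>h0 by (subst sum.insert) auto
  also have "(\<Sum>k\<in>P. \<bar>\<eta>h k\<bar>) \<le> (\<Sum>k\<in>P. 8 * pi * Dm (norm k))"
    using P by (intro sum_mono \<eta>h_le) auto
  also have "\<dots> = 8 * pi * (\<Sum>k\<in>P. Dm (norm k))" by (simp add: sum_distrib_left)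
  also have "(\<Sum>k\<in>P. Dm (norm k)) = L ^ 3 / (2 * pi) ^ 3 * ((2 * pi) ^ 3 / L ^ 3 * (\<Sum>k\<in>P. Dm (norm k)))"
    using L by simp
  also have "\<dots> \<le> L ^ 3 / (2 * pi) ^ 3 * (LINT p|lborel. lattice_step L (\<lambda>p. Dm (norm p)) p)"
    using L P by (intro mult_left_mono lattice_sum_le[where C = 1]) auto
  finally show ?thesis by (simp add: lattice_const_def mult_left_mono)
qed

text \<open>A Schur test: the entries are \<eta>h (u - u') up to cosines of modulus at most 1, and
  \<open>sum_\<eta>h_le\<close> bounds all row sums. The resulting constant does not depend on the
  translation y.\<close>

lemma weighted_trig_bound:
  assumes L: "L > 0" and F: "finite F" "F \<subseteq> dual_lattice L"
  shows "(\<integral>\<^sup>+z. ennreal (\<eta> z * (trig F t (y + z))\<^sup>2) \<partial>lborel) \<le> ennreal (lattice_const L * (\<Sum>u\<in>F. (t u)\<^sup>2))"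
proof -
  let ?h = "\<lambda>z. \<Sum>u\<in>F. \<Sum>u'\<in>F. t u * t u' * (\<eta> z * cos ((u - u') \<bullet> (y + z)))"
  have int: "integrable lborel ?h"
    by (intro Bochner_Integration.integrable_sum integrable_mult_right \<eta>_shift)
  have le: "\<eta> z * (trig F t (y + z))\<^sup>2 \<le> ?h z" for z
  proof -
    have "\<eta> z * (trig F t (y + z))\<^sup>2 \<le> \<eta> z * (\<Sum>u\<in>F. \<Sum>u'\<in>F. t u * t u' * cos ((u - u') \<bullet> (y + z)))"
      using trig_square_le[OF F(1)] by (intro mult_left_mono) (auto simp: \<eta>_def)
    also have "\<dots> = ?h z" by (simp add: sum_distrib_left mult_ac)
    finally show ?thesis .
  qed
  have "(\<integral>\<^sup>+z. ennreal (\<eta> z * (trig F t (y + z))\<^sup>2) \<partial>lborel) \<le> (\<integral>\<^sup>+z. ennreal (?h z) \<partial>lborel)"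
    using le by (intro nn_integral_mono ennreal_leI)
  also have "\<dots> = ennreal (LINT z|lborel. ?h z)"
  proof (rule nn_integral_eq_integral[OF int])
    show "AE z in lborel. 0 \<le> ?h z"
      by (intro AE_I2 order_trans[OF _ le]) (auto simp: \<eta>_def)
  qed
  also have "(LINT z|lborel. ?h z) = (\<Sum>u\<in>F. \<Sum>u'\<in>F. t u * t u' * (cos ((u - u') \<bullet> y) * \<eta>h (u - u')))"
    by (subst Bochner_Integration.integral_sum, intro Bochner_Integration.integrable_sum integrable_mult_right \<eta>_shift,
        intro sum.cong refl, subst Bochner_Integration.integral_sum, intro integrable_mult_right \<eta>_shift,
        intro sum.cong refl, simp add: \<eta>_shift)
  \<comment> \<open>The product t u * t u' is split by the arithmetic-geometric mean inequality; by
    evenness of \<open>\<eta>h\<close> both halves give the same row sums.\<close>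
  also have "\<dots> \<le> (\<Sum>u\<in>F. \<Sum>u'\<in>F. ((t u)\<^sup>2 / 2 + (t u')\<^sup>2 / 2) * \<bar>\<eta>h (u - u')\<bar>)"
  proof (intro sum_mono)
    fix u u'
    have 1: "\<bar>t u * t u'\<bar> \<le> (t u)\<^sup>2 / 2 + (t u')\<^sup>2 / 2"
      using sum_squares_bound[of "\<bar>t u\<bar>" "\<bar>t u'\<bar>"] by (simp add: abs_mult)
    have "t u * t u' * (cos ((u - u') \<bullet> y) * \<eta>h (u - u')) \<le> \<bar>t u * t u'\<bar> * (\<bar>cos ((u - u') \<bullet> y)\<bar> * \<bar>\<eta>h (u - u')\<bar>)"
      by (simp add: abs_mult[symmetric])
    also have "\<dots> \<le> ((t u)\<^sup>2 / 2 + (t u')\<^sup>2 / 2) * (1 * \<bar>\<eta>h (u - u')\<bar>)"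
      using 1 by (intro mult_mono) auto
    finally show "t u * t u' * (cos ((u - u') \<bullet> y) * \<eta>h (u - u')) \<le> ((t u)\<^sup>2 / 2 + (t u')\<^sup>2 / 2) * \<bar>\<eta>h (u - u')\<bar>" by simp
  qed
  also have "\<dots> = (\<Sum>u\<in>F. \<Sum>u'\<in>F. (t u)\<^sup>2 / 2 * \<bar>\<eta>h (u - u')\<bar>) + (\<Sum>u\<in>F. \<Sum>u'\<in>F. (t u')\<^sup>2 / 2 * \<bar>\<eta>h (u - u')\<bar>)"
    by (simp add: distrib_right sum.distrib)
  also have "(\<Sum>u\<in>F. \<Sum>u'\<in>F. (t u')\<^sup>2 / 2 * \<bar>\<eta>h (u - u')\<bar>) = (\<Sum>u'\<in>F. \<Sum>u\<in>F. (t u')\<^sup>2 / 2 * \<bar>\<eta>h (u' - u)\<bar>)"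
  proof -
    have "\<eta>h (u - u') = \<eta>h (u' - u)" for u u'
      unfolding \<eta>h_def by (intro Bochner_Integration.integral_cong) (auto simp: inner_diff_left cos_diff)
    then show ?thesis by (subst sum.swap) simp
  qed
  also have "(\<Sum>u\<in>F. \<Sum>u'\<in>F. (t u)\<^sup>2 / 2 * \<bar>\<eta>h (u - u')\<bar>) + (\<Sum>u'\<in>F. \<Sum>u\<in>F. (t u')\<^sup>2 / 2 * \<bar>\<eta>h (u' - u)\<bar>)
      = (\<Sum>u\<in>F. (t u)\<^sup>2 * (\<Sum>u'\<in>F. \<bar>\<eta>h (u - u')\<bar>))"
    by (simp add: sum_distrib_left sum.distrib[symmetric] mult_ac)
  also have "\<dots> \<le> (\<Sum>u\<in>F. (t u)\<^sup>2 * lattice_const L)"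
    using F by (intro sum_mono mult_left_mono sum_\<eta>h_le L) auto
  also have "\<dots> = lattice_const L * (\<Sum>u\<in>F. (t u)\<^sup>2)" by (simp add: sum_distrib_left mult.commute)
  finally show ?thesis by (simp add: ennreal_leI)
qed

lemma powr_integrable:
  assumes "\<delta> > 0"
  shows "integrable lborel (\<lambda>s::real. indicator {0<..} s * (1 + s) powr (- 1 - \<delta>))"
proof -
  have "(\<integral>\<^sup>+s. ennreal (indicator {0<..} s * (1 + s) powr (- 1 - \<delta>)) \<partial>(lborel :: real measure)) \<le> (\<integral>\<^sup>+s. ennreal ((1 + s) powr (- 1 - \<delta>)) * indicator {0..} s \<partial>lborel)"
    by (intro nn_integral_mono) (auto simp: indicator_def)
  also have "\<dots> = ennreal (0 - (- ((1 + 0) powr (- \<delta>)) / \<delta>))"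
  proof (rule nn_integral_FTC_atLeast)
    fix s :: real assume "0 \<le> s"
    then show "((\<lambda>s. - ((1 + s) powr (- \<delta>)) / \<delta>) has_real_derivative (1 + s) powr (- 1 - \<delta>)) (at s)"
    proof -
      have "((\<lambda>s. (1 + s) powr (- \<delta>)) has_real_derivative - \<delta> * (1 + s) powr (- \<delta> - of_nat 1) * 1) (at s)"
        by (rule DERIV_fun_powr) (use \<open>0 \<le> s\<close> in \<open>auto intro!: derivative_eq_intros\<close>)
      from DERIV_cdivide[OF DERIV_minus[OF this], of \<delta>]
      have "((\<lambda>s. - ((1 + s) powr (- \<delta>)) / \<delta>) has_real_derivative - (- \<delta> * (1 + s) powr (- \<delta> - of_nat 1) * 1) / \<delta>) (at s)" .
      moreover have "- (- \<delta> * (1 + s) powr (- \<delta> - of_nat 1) * 1) / \<delta> = (1 + s) powr (- 1 - \<delta>)"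
      proof -
        have e: "- \<delta> - of_nat 1 = - 1 - \<delta>" by simp
        show ?thesis unfolding e using assms by simp
      qed
      ultimately show ?thesis by simp
    qed
  next
    show "((\<lambda>s. - ((1 + s) powr (- \<delta>)) / \<delta>) \<longlongrightarrow> 0) at_top"
      using assms by real_asymp
  qed auto
  also have "\<dots> < \<infinity>" by simp
  finally show ?thesis by (intro integrableI_nonneg) (auto simp: indicator_def)
qed


definition japanese :: "real \<Rightarrow> real^3 \<Rightarrow> real" where "japanese \<delta> x = (1 + norm x) powr (- 3 - \<delta>)"

lemma japanese_measurable [measurable]: "japanese \<delta> \<in> borel_measurable borel"
  unfolding japanese_def[abs_def] by measurable

lemma powr_square_integrable:
  assumes "\<delta> > 0"
  shows "integrable lborel (\<lambda>s::real. indicator {0<..} s * (s\<^sup>2 * (1 + s) powr (- 3 - \<delta>)))"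
proof (rule Bochner_Integration.integrable_bound[OF powr_integrable[OF assms]])
  show "AE s in lborel. norm (indicator {0<..} s * (s\<^sup>2 * (1 + s) powr (- 3 - \<delta>))) \<le> norm (indicator {0<..} s * (1 + s) powr (- 1 - \<delta>))"
  proof (intro AE_I2)
    fix s :: real
    show "norm (indicator {0<..} s * (s\<^sup>2 * (1 + s) powr (- 3 - \<delta>))) \<le> norm (indicator {0<..} s * (1 + s) powr (- 1 - \<delta>))"
    proof (cases "s > 0")
      case True
      have "s\<^sup>2 * (1 + s) powr (- 3 - \<delta>) \<le> (1 + s)\<^sup>2 * (1 + s) powr (- 3 - \<delta>)"
        using True by (intro mult_right_mono power_mono) auto
      also have "\<dots> = (1 + s) powr (- 1 - \<delta>)"
      proof -
        have "(1 + s)\<^sup>2 = (1 + s) powr 2" using True by simp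
        moreover have "(1 + s) powr 2 * (1 + s) powr (- 3 - \<delta>) = (1 + s) powr (2 + (- 3 - \<delta>))"
          by (rule powr_add[symmetric])
        moreover have "2 + (- 3 - \<delta>) = - 1 - \<delta>" by simp
        ultimately show ?thesis by simp
      qed
      finally show ?thesis using True by simp
    qed simp
  qed
qed measurable

lemma japanese_integrable: "\<delta> > 0 \<Longrightarrow> integrable lborel (japanese \<delta>)"
  unfolding japanese_def[abs_def] by (rule radial_integral(1)[OF _ powr_square_integrable]) measurable

text \<open>A shift by less than 1 changes 1 + |x| by a factor of at most 2, and \<eta> is at least
  exp (-1) on the unit ball. So averaging over this ball already dominates the function up to a
  constant.\<close>

lemma japanese_le_average:
  assumes \<delta>: "\<delta> > 0" and C0: "C0 \<ge> 0"
  obtains c where "c \<ge> 0" "\<And>x. ennreal (C0 * japanese \<delta> x) \<le> (\<integral>\<^sup>+z. ennreal (c * japanese \<delta> (x - z) * \<eta> z) \<partial>lborel)"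
proof -
  define b where "b = measure lborel (ball (0::real^3) 1)"
  have b: "b > 0" unfolding b_def by (rule content_ball_pos) simp
  have eb: "emeasure lborel (ball (0::real^3) 1) = ennreal b" unfolding b_def
    by (intro emeasure_eq_ennreal_measure) (use emeasure_lborel_ball_finite[of "0::real^3" 1] in auto)
  define c where "c = C0 * 2 powr (3 + \<delta>) * exp 1 / b"
  have c: "c \<ge> 0" using C0 b by (simp add: c_def)
  have "ennreal (C0 * japanese \<delta> x) \<le> (\<integral>\<^sup>+z. ennreal (c * japanese \<delta> (x - z) * \<eta> z) \<partial>lborel)" for x
  proof -
    have "ennreal (C0 * japanese \<delta> x) = (\<integral>\<^sup>+z. ennreal (C0 * japanese \<delta> x / b) * indicator (ball (0::real^3) 1) z \<partial>lborel)"
      using C0 b by (subst nn_integral_cmult_indicator) (auto simp: eb ennreal_mult'[symmetric] japanese_def)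
    also have "\<dots> \<le> (\<integral>\<^sup>+z. ennreal (c * japanese \<delta> (x - z) * \<eta> z) \<partial>lborel)"
    proof (intro nn_integral_mono)
      fix z :: "real^3"
      show "ennreal (C0 * japanese \<delta> x / b) * indicator (ball (0::real^3) 1) z \<le> ennreal (c * japanese \<delta> (x - z) * \<eta> z)"
      proof (cases "z \<in> ball 0 1")
        case True
        then have z: "norm z < 1" by simp
        have e: "exp (- 1) \<le> \<eta> z" using z by (simp add: \<eta>_def)
        have "1 + norm (x - z) \<le> 2 * (1 + norm x)"
        proof -
          have "norm (x - z) \<le> norm x + 1" using z norm_triangle_ineq4[of x z] by linarith
          moreover have "0 \<le> norm x" by simp
          ultimately show ?thesis by argo
        qed
        then have "(2 * (1 + norm x)) powr (- 3 - \<delta>) \<le> japanese \<delta> (x - z)"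
          unfolding japanese_def using \<delta> by (intro powr_mono2') (auto intro: add_pos_nonneg)
        then have j: "2 powr (- 3 - \<delta>) * japanese \<delta> x \<le> japanese \<delta> (x - z)"
          unfolding japanese_def by (subst (asm) powr_mult) auto
        have p: "2 powr (3 + \<delta>) * 2 powr (- 3 - \<delta>) = (1::real)" by (simp add: powr_add[symmetric])
        have "C0 * japanese \<delta> x / b = (C0 / b) * (2 powr (3 + \<delta>) * 2 powr (- 3 - \<delta>)) * (exp 1 * exp (- 1)) * japanese \<delta> x"
          unfolding p by (simp add: exp_add[symmetric])
        also have "\<dots> = c * ((2 powr (- 3 - \<delta>) * japanese \<delta> x) * exp (- 1))"
          by (simp add: c_def mult_ac)
        also have "\<dots> \<le> c * (japanese \<delta> (x - z) * \<eta> z)"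
          using j e c by (intro mult_left_mono mult_mono) (auto simp: japanese_def)
        finally show ?thesis using True by (simp add: mult.assoc ennreal_leI)
      qed simp
    qed
    finally show ?thesis .
  qed
  then show ?thesis using c that by blast
qed

lemma nn_integral_translate:
  fixes c :: "real^3"
  assumes [measurable]: "f \<in> borel_measurable borel"
  shows "(\<integral>\<^sup>+x. f (c + x) \<partial>lborel) = (\<integral>\<^sup>+x. f x \<partial>lborel)"
proof -
  have "(\<integral>\<^sup>+x. f x \<partial>lborel) = (\<integral>\<^sup>+x. f x \<partial>distr lborel borel ((+) c))" by (simp add: lborel_distr_plus)
  also have "\<dots> = (\<integral>\<^sup>+x. f (c + x) \<partial>lborel)" by (rule nn_integral_distr) measurable
  finally show ?thesis by simp
qed

text \<open>The polynomial weight is dominated by an average of translates of the exponential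
  weight, each of which obeys the same bound. Tonelli and a translation reduce the claim to
  \<open>weighted_trig_bound\<close>.\<close>

lemma toeplitz_bound:
  assumes L: "L > 0" and \<delta>: "\<delta> > 0" and C0: "C0 \<ge> 0"
  obtains A where "A \<ge> 0" "\<And>F t. finite F \<Longrightarrow> F \<subseteq> dual_lattice L \<Longrightarrow>
    (\<integral>\<^sup>+x. ennreal (C0 * japanese \<delta> x * (trig F t x)\<^sup>2) \<partial>lborel) \<le> ennreal (A * (\<Sum>u\<in>F. (t u)\<^sup>2))"
proof -
  obtain c where c: "c \<ge> 0" "\<And>x. ennreal (C0 * japanese \<delta> x) \<le> (\<integral>\<^sup>+z. ennreal (c * japanese \<delta> (x - z) * \<eta> z) \<partial>lborel)"
    using japanese_le_average[OF \<delta> C0] by blast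
  define B where "B = (LINT y|lborel. c * japanese \<delta> y)"
  have B: "(\<integral>\<^sup>+y. ennreal (c * japanese \<delta> y) \<partial>lborel) = ennreal B" "B \<ge> 0"
  proof -
    have nn: "0 \<le> c * japanese \<delta> y" for y using c(1) by (simp add: japanese_def)
    show "(\<integral>\<^sup>+y. ennreal (c * japanese \<delta> y) \<partial>lborel) = ennreal B" unfolding B_def
      by (rule nn_integral_eq_integral[OF integrable_mult_right[OF japanese_integrable[OF \<delta>]]]) (use nn in auto)
    show "B \<ge> 0" unfolding B_def by (rule Bochner_Integration.integral_nonneg) (rule nn)
  qed
  have lc: "lattice_const L \<ge> 0"
    using sum_\<eta>h_le[of L "{}" 0] L by simp
  have "(\<integral>\<^sup>+x. ennreal (C0 * japanese \<delta> x * (trig F t x)\<^sup>2) \<partial>lborel) \<le> ennreal (B * lattice_const L * (\<Sum>u\<in>F. (t u)\<^sup>2))"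
    if F: "finite F" "F \<subseteq> dual_lattice L" for F t
  proof -
    let ?T = "trig F t" and ?X = "\<Sum>u\<in>F. (t u)\<^sup>2"
    have X: "?X \<ge> 0" by (simp add: sum_nonneg)
    have meas: "case_prod f \<in> borel_measurable (borel \<Otimes>\<^sub>M borel) \<Longrightarrow> case_prod f \<in> borel_measurable (lborel \<Otimes>\<^sub>M lborel)" for f :: "real^3 \<Rightarrow> real^3 \<Rightarrow> ennreal"
      using measurable_cong_sets[OF sets_pair_measure_cong[OF sets_lborel sets_lborel] refl] by blast
    have "(\<integral>\<^sup>+x. ennreal (C0 * japanese \<delta> x * (?T x)\<^sup>2) \<partial>lborel) \<le> (\<integral>\<^sup>+x. \<integral>\<^sup>+z. ennreal (c * japanese \<delta> (x - z) * \<eta> z * (?T x)\<^sup>2) \<partial>lborel \<partial>lborel)"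
    proof (intro nn_integral_mono)
      fix x
      have "ennreal (C0 * japanese \<delta> x * (?T x)\<^sup>2) = ennreal (C0 * japanese \<delta> x) * ennreal ((?T x)\<^sup>2)"
        by (rule ennreal_mult'') simp
      also have "\<dots> \<le> (\<integral>\<^sup>+z. ennreal (c * japanese \<delta> (x - z) * \<eta> z) \<partial>lborel) * ennreal ((?T x)\<^sup>2)"
        by (intro mult_right_mono c) simp
      also have "\<dots> = (\<integral>\<^sup>+z. ennreal (c * japanese \<delta> (x - z) * \<eta> z) * ennreal ((?T x)\<^sup>2) \<partial>lborel)"
        by (subst nn_integral_multc) auto
      also have "\<dots> = (\<integral>\<^sup>+z. ennreal (c * japanese \<delta> (x - z) * \<eta> z * (?T x)\<^sup>2) \<partial>lborel)"
        by (intro nn_integral_cong ennreal_mult''[symmetric]) simp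
      finally show "ennreal (C0 * japanese \<delta> x * (?T x)\<^sup>2) \<le> (\<integral>\<^sup>+z. ennreal (c * japanese \<delta> (x - z) * \<eta> z * (?T x)\<^sup>2) \<partial>lborel)" .
    qed
    also have "\<dots> = (\<integral>\<^sup>+z. \<integral>\<^sup>+x. ennreal (c * japanese \<delta> (x - z) * \<eta> z * (?T x)\<^sup>2) \<partial>lborel \<partial>lborel)"
      by (rule lborel_pair.Fubini'[symmetric], rule meas) measurable
    also have "\<dots> = (\<integral>\<^sup>+z. \<integral>\<^sup>+y. ennreal (c * japanese \<delta> y * \<eta> z * (?T (y + z))\<^sup>2) \<partial>lborel \<partial>lborel)"
    proof (rule nn_integral_cong)
      fix z
      show "(\<integral>\<^sup>+x. ennreal (c * japanese \<delta> (x - z) * \<eta> z * (?T x)\<^sup>2) \<partial>lborel) = (\<integral>\<^sup>+y. ennreal (c * japanese \<delta> y * \<eta> z * (?T (y + z))\<^sup>2) \<partial>lborel)"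
        by (subst nn_integral_translate[symmetric, where c = z]) (auto simp: add.commute)
    qed
    also have "\<dots> = (\<integral>\<^sup>+y. \<integral>\<^sup>+z. ennreal (c * japanese \<delta> y * \<eta> z * (?T (y + z))\<^sup>2) \<partial>lborel \<partial>lborel)"
      by (rule lborel_pair.Fubini', rule meas) measurable
    also have "\<dots> \<le> (\<integral>\<^sup>+y. ennreal (c * japanese \<delta> y) * ennreal (lattice_const L * ?X) \<partial>lborel)"
    proof (intro nn_integral_mono)
      fix y
      have "(\<integral>\<^sup>+z. ennreal (c * japanese \<delta> y * \<eta> z * (?T (y + z))\<^sup>2) \<partial>lborel) = (\<integral>\<^sup>+z. ennreal (c * japanese \<delta> y) * ennreal (\<eta> z * (?T (y + z))\<^sup>2) \<partial>lborel)"
        using c by (intro nn_integral_cong) (simp add: ennreal_mult'[symmetric] japanese_def mult_ac)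
      also have "\<dots> = ennreal (c * japanese \<delta> y) * (\<integral>\<^sup>+z. ennreal (\<eta> z * (?T (y + z))\<^sup>2) \<partial>lborel)"
        by (rule nn_integral_cmult) measurable
      also have "\<dots> \<le> ennreal (c * japanese \<delta> y) * ennreal (lattice_const L * ?X)"
        by (intro mult_left_mono weighted_trig_bound L F) simp
      finally show "(\<integral>\<^sup>+z. ennreal (c * japanese \<delta> y * \<eta> z * (?T (y + z))\<^sup>2) \<partial>lborel) \<le> ennreal (c * japanese \<delta> y) * ennreal (lattice_const L * ?X)" .
    qed
    also have "\<dots> = ennreal B * ennreal (lattice_const L * ?X)"
      by (subst nn_integral_multc) (auto simp: B)
    also have "\<dots> = ennreal (B * lattice_const L * ?X)"
      using B lc X by (simp add: ennreal_mult'[symmetric] mult.assoc)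
    finally show ?thesis .
  qed
  moreover have "B * lattice_const L \<ge> 0" using B lc by simp
  ultimately show ?thesis using that by blast
qed

text \<open>A duality argument. For finite F the sum X of squared coefficients is the integral of V
  times the trigonometric sum formed with these very coefficients, while the integral of V times its
  square is at most A * X.\<close>

theorem fourier_square_summable:
  fixes V :: "real^3 \<Rightarrow> real"
  assumes L: "L > 0" and \<delta>: "\<delta> > 0" and [measurable]: "V \<in> borel_measurable borel"
    and V: "\<And>x. 0 \<le> V x" "\<And>x. V x \<le> C0 * (1 + norm x) powr (- 3 - \<delta>)"
  shows "(\<lambda>u. (LINT x|lborel. V x * cos (u \<bullet> x))\<^sup>2) summable_on dual_lattice L"
proof -
  define t where "t u = (LINT x|lborel. V x * cos (u \<bullet> x))" for u
  have C0: "C0 \<ge> 0"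
    using order_trans[OF V(1)[of 0] V(2)[of 0]] by simp
  obtain A where A: "A \<ge> 0" "\<And>F t. finite F \<Longrightarrow> F \<subseteq> dual_lattice L \<Longrightarrow>
    (\<integral>\<^sup>+x. ennreal (C0 * japanese \<delta> x * (trig F t x)\<^sup>2) \<partial>lborel) \<le> ennreal (A * (\<Sum>u\<in>F. (t u)\<^sup>2))"
    using toeplitz_bound[OF L \<delta> C0] by blast
  have intV: "integrable lborel V"
    by (rule Bochner_Integration.integrable_bound[OF integrable_mult_right[OF japanese_integrable[OF \<delta>], of C0]])
      (use V C0 in \<open>auto simp: japanese_def abs_mult\<close>)
  have intc: "integrable lborel (\<lambda>x. V x * cos (u \<bullet> x))" for u
    by (rule Bochner_Integration.integrable_bound[OF intV]) (auto simp: abs_mult intro!: AE_I2 mult_left_le)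
  have "(\<Sum>u\<in>F. (t u)\<^sup>2) \<le> (A + 1) * (LINT x|lborel. V x)" if F: "finite F" "F \<subseteq> dual_lattice L" for F
  proof -
    let ?T = "trig F t" and ?X = "\<Sum>u\<in>F. (t u)\<^sup>2"
    have X: "?X \<ge> 0" by (simp add: sum_nonneg)
    have nn: "(\<integral>\<^sup>+x. ennreal (V x * (?T x)\<^sup>2) \<partial>lborel) \<le> ennreal (A * ?X)"
    proof -
      have "(\<integral>\<^sup>+x. ennreal (V x * (?T x)\<^sup>2) \<partial>lborel) \<le> (\<integral>\<^sup>+x. ennreal (C0 * japanese \<delta> x * (?T x)\<^sup>2) \<partial>lborel)"
        using V by (intro nn_integral_mono ennreal_leI mult_right_mono) (auto simp: japanese_def)
      then show ?thesis using A(2)[OF F, of t] by (rule order_trans)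
    qed
    have iT: "integrable lborel (\<lambda>x. V x * (?T x)\<^sup>2)"
      using nn V by (intro integrableI_nonneg) (auto intro: le_less_trans)
    have "ennreal (LINT x|lborel. V x * (?T x)\<^sup>2) \<le> ennreal (A * ?X)"
      using nn V by (subst nn_integral_eq_integral[symmetric]) (auto intro: iT)
    then have sq: "(LINT x|lborel. V x * (?T x)\<^sup>2) \<le> A * ?X"
      using A(1) X by simp
    have A1: "A + 1 > 0" using A(1) by simp
    have "?X = (\<Sum>u\<in>F. t u * (LINT x|lborel. V x * cos (u \<bullet> x)))" by (simp add: t_def power2_eq_square)
    also have "\<dots> = (LINT x|lborel. V x * ?T x)"
      unfolding trig_def sum_distrib_left
      by (subst Bochner_Integration.integral_sum) (auto intro!: integrable_mult_right intc simp: mult.left_commute[of "V _"])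
    \<comment> \<open>Young's inequality with parameter A + 1, positive even for A = 0. The
      quadratic term then contributes at most X / 2 and is absorbed on the left.\<close>
    also have "\<dots> \<le> (LINT x|lborel. (A + 1) / 2 * V x + 1 / (2 * (A + 1)) * (V x * (?T x)\<^sup>2))"
    proof (rule integral_mono)
      show "integrable lborel (\<lambda>x. V x * ?T x)"
        unfolding trig_def sum_distrib_left
        by (auto intro!: integrable_mult_right intc simp: mult.left_commute[of "V _"])
      show "integrable lborel (\<lambda>x. (A + 1) / 2 * V x + 1 / (2 * (A + 1)) * (V x * (?T x)\<^sup>2))"
        by (intro Bochner_Integration.integrable_add integrable_mult_right intV iT)
      fix x
      have "0 \<le> ((A + 1) - ?T x)\<^sup>2 / (2 * (A + 1))" using A1 by simp
      also have "\<dots> = ((A + 1) / 2 + 1 / (2 * (A + 1)) * (?T x)\<^sup>2) - ?T x"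
        using A1 by (simp add: field_simps power2_eq_square)
      finally have "V x * ?T x \<le> V x * ((A + 1) / 2 + 1 / (2 * (A + 1)) * (?T x)\<^sup>2)"
        using V by (intro mult_left_mono) auto
      then show "V x * ?T x \<le> (A + 1) / 2 * V x + 1 / (2 * (A + 1)) * (V x * (?T x)\<^sup>2)"
        by (simp add: algebra_simps)
    qed
    also have "\<dots> = (A + 1) / 2 * (LINT x|lborel. V x) + 1 / (2 * (A + 1)) * (LINT x|lborel. V x * (?T x)\<^sup>2)"
      using intV iT by simp
    also have "\<dots> \<le> (A + 1) / 2 * (LINT x|lborel. V x) + 1 / (2 * (A + 1)) * ((A + 1) * ?X)"
    proof -
      have "(LINT x|lborel. V x * (?T x)\<^sup>2) \<le> (A + 1) * ?X" using sq X by (simp add: algebra_simps)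
      then show ?thesis using A1 by (intro add_left_mono mult_left_mono) auto
    qed
    also have "1 / (2 * (A + 1)) * ((A + 1) * ?X) = ?X / 2"
    proof -
      have "1 / (2 * b) * (b * X) = X / 2" if "b > 0" for b X :: real using that by simp
      then show ?thesis using A1 by blast
    qed
    finally have "?X \<le> (A + 1) / 2 * (LINT x|lborel. V x) + ?X / 2" .
    moreover have "X \<le> b * I" if "X \<le> b / 2 * I + X / 2" for b X I :: real
      using that by (simp add: field_simps)
    ultimately show ?thesis by blast
  qed
  then show ?thesis
    unfolding t_def[symmetric]
    by (intro nonneg_bounded_partial_sums_imp_summable_on[where C = "(A + 1) * (LINT x|lborel. V x)"] eventually_finite_subsets_at_top_weakI) auto
qed

section \<open>Approximation of the scattering solution by finite lattice sums\<close>

context scattering_profile begin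

lemma Gh_isCont: "isCont Gh q"
  unfolding continuous_at_sequentially
proof (intro allI impI)
  fix X :: "nat \<Rightarrow> real" assume X: "X \<longlonglongrightarrow> q"
  show "(Gh \<circ> X) \<longlonglongrightarrow> Gh q"
    unfolding o_def Gh_def
  proof (rule integral_dominated_convergence[where w = "\<lambda>s. 4 * pi * (indicator {0<..} s * (s\<^sup>2 * gs s))"])
    show "integrable lborel (\<lambda>s. 4 * pi * (indicator {0<..} s * (s\<^sup>2 * gs s)))"
      by (rule integrable_mult_right[OF integrable_gs2])
    show "AE s in lborel. (\<lambda>n. indicator {0<..} s * (4 * pi * s\<^sup>2 * gs s * bessel0 (X n * s))) \<longlonglongrightarrow> indicator {0<..} s * (4 * pi * s\<^sup>2 * gs s * bessel0 (q * s))"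
      by (intro AE_I2 tendsto_mult tendsto_const isCont_tendsto_compose[OF isCont_bessel0] X)
    show "AE s in lborel. norm (indicator {0<..} s * (4 * pi * s\<^sup>2 * gs s * bessel0 (X n * s))) \<le> 4 * pi * (indicator {0<..} s * (s\<^sup>2 * gs s))" for n
    proof (intro AE_I2)
      fix s
      have "\<bar>4 * pi * s\<^sup>2 * gs s\<bar> * \<bar>bessel0 (X n * s)\<bar> \<le> \<bar>4 * pi * s\<^sup>2 * gs s\<bar> * 1"
        by (intro mult_left_mono abs_bessel0_le_1) simp
      then show "norm (indicator {0<..} s * (4 * pi * s\<^sup>2 * gs s * bessel0 (X n * s))) \<le> 4 * pi * (indicator {0<..} s * (s\<^sup>2 * gs s))"
        using gs_nonneg[of s] by (auto simp: indicator_def abs_mult mult_ac)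
    qed
  qed measurable
qed

lemma \<kappa>_nonneg: "\<kappa> \<ge> 0"
  using abs_Gh_le[of 0] by simp

definition om :: "nat \<Rightarrow> real^3 \<Rightarrow> real" where
  "om n p = \<theta> n (norm p) * Gh (norm p) / (2 * (norm p)\<^sup>2)"

lemma om_measurable [measurable]: "om n \<in> borel_measurable borel"
  unfolding om_def[abs_def] by measurable

lemma om_eq_0: "n > 0 \<Longrightarrow> norm p \<ge> real n \<Longrightarrow> om n p = 0"
  by (simp add: om_def \<theta>_eq_0)

lemma om_bound:
  assumes "n > 0" "p \<noteq> 0"
  shows "\<bar>om n p\<bar> \<le> \<kappa> * ((real n)\<^sup>2 + 1) / 2 * Dm (norm p)"
proof (cases "norm p \<ge> real n")
  case True
  then show ?thesis using assms \<kappa>_nonneg by (simp add: om_eq_0)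
next
  case False
  have p: "norm p > 0" using assms by simp
  have "\<bar>om n p\<bar> = \<theta> n (norm p) * \<bar>Gh (norm p)\<bar> / (2 * (norm p)\<^sup>2)"
    using \<theta>_nonneg by (simp add: om_def abs_mult)
  also have "\<dots> \<le> 1 * \<kappa> / (2 * (norm p)\<^sup>2)"
    using \<theta>_nonneg \<theta>_le_1 abs_Gh_le by (intro divide_right_mono mult_mono) auto
  also have "\<dots> = \<kappa> * ((norm p)\<^sup>2 + 1) / 2 * Dm (norm p)"
  proof -
    have "(norm p)\<^sup>2 + 1 \<noteq> 0" "norm p \<noteq> 0" using p by (smt (verit) zero_le_power2)+
    then show ?thesis by (simp add: Dm_def)
  qed
  also have "\<dots> \<le> \<kappa> * ((real n)\<^sup>2 + 1) / 2 * Dm (norm p)"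
    using False \<kappa>_nonneg by (intro mult_right_mono divide_right_mono mult_left_mono add_right_mono power_mono) auto
  finally show ?thesis .
qed

lemma om_isCont:
  assumes "n > 0" "p \<noteq> 0"
  shows "isCont (\<lambda>p. om n p * cos (p \<bullet> x)) p"
proof -
  have "isCont (\<lambda>p::real^3. Gh (norm p)) p"
    by (rule isCont_o2[OF continuous_norm[OF continuous_ident] Gh_isCont])
  then show ?thesis
    unfolding om_def \<theta>_def using assms by (intro continuous_intros) auto
qed

definition WL :: "nat \<Rightarrow> real \<Rightarrow> real^3 \<Rightarrow> real" where
  "WL n L x = 1 / L ^ 3 * (\<Sum>p\<in>{p \<in> dual_lattice L. norm p \<le> real n} - {0}. om n p * cos (p \<bullet> x))"

lemma WL_measurable [measurable]: "WL n L \<in> borel_measurable borel"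
  unfolding WL_def[abs_def] by measurable

text \<open>Beyond the cutoff the summands vanish, so every finite set containing the modes below it
  gives the same value. The set of modes can therefore be enlarged later.\<close>

lemma WL_eq:
  assumes "L > 0" "n > 0" and P: "finite P" "P \<subseteq> dual_lattice L - {0}"
    and "\<And>p. p \<in> dual_lattice L \<Longrightarrow> p \<noteq> 0 \<Longrightarrow> norm p < real n \<Longrightarrow> p \<in> P"
  shows "1 / L ^ 3 * (\<Sum>p\<in>P. om n p * cos (p \<bullet> x)) = 1 / (2 * pi) ^ 3 * (LINT p|lborel. lattice_step L (\<lambda>p. om n p * cos (p \<bullet> x)) p)"
proof -
  have "(2 * pi) ^ 3 / L ^ 3 * (\<Sum>p\<in>P. om n p * cos (p \<bullet> x)) = (LINT p|lborel. lattice_step L (\<lambda>p. om n p * cos (p \<bullet> x)) p)"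
    by (rule lattice_sum_eq[OF assms(1) P]) (use assms in \<open>force simp: om_eq_0 not_less\<close>)
  then show ?thesis by (simp add: field_simps)
qed

lemma WL_integral:
  assumes "L > 0" "n > 0"
  shows "WL n L x = 1 / (2 * pi) ^ 3 * (LINT p|lborel. lattice_step L (\<lambda>p. om n p * cos (p \<bullet> x)) p)"
  unfolding WL_def by (rule WL_eq) (use assms finite_dual_lattice_ball[OF assms(1)] in auto)

lemma om_cos_bound:
  assumes "n > 0" "p \<noteq> 0"
  shows "\<bar>om n p * cos (p \<bullet> x)\<bar> \<le> \<kappa> * ((real n)\<^sup>2 + 1) / 2 * Dm (norm p)"
  using om_bound[OF assms] mult_mono[OF order_refl[of "\<bar>om n p\<bar>"] abs_cos_le_one[of "p \<bullet> x"]]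
  by (simp add: abs_mult)

lemma WL_tendsto:
  assumes "n > 0"
  shows "((\<lambda>L. WL n L x) \<longlongrightarrow> Wn n x) at_top"
proof -
  have "((\<lambda>L. 1 / (2 * pi) ^ 3 * (LINT p|lborel. lattice_step L (\<lambda>p. om n p * cos (p \<bullet> x)) p)) \<longlongrightarrow> Wn n x) at_top"
    unfolding Wn_def om_def[symmetric]
    by (intro tendsto_mult tendsto_const riemann_limit[OF _ om_isCont[OF assms] om_cos_bound[OF assms]]) auto
  then show ?thesis
  proof (rule Lim_transform_eventually)
    show "\<forall>\<^sub>F L in at_top. 1 / (2 * pi) ^ 3 * (LINT p|lborel. lattice_step L (\<lambda>p. om n p * cos (p \<bullet> x)) p) = WL n L x"
      using eventually_gt_at_top[of 0] by eventually_elim (use WL_integral[OF _ assms] in simp)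
  qed
qed

definition MW :: "nat \<Rightarrow> real" where
  "MW n = 1 / (2 * pi) ^ 3 * (LINT p|lborel. 256 * (\<kappa> * ((real n)\<^sup>2 + 1) / 2) * Dm (norm (p::real^3)))"

lemma WL_bound:
  assumes "n > 0" "L > 0"
  shows "\<bar>WL n L x\<bar> \<le> MW n"
proof -
  let ?f = "\<lambda>p. om n p * cos (p \<bullet> x)"
  have b: "\<bar>lattice_step L ?f p\<bar> \<le> 256 * (\<kappa> * ((real n)\<^sup>2 + 1) / 2) * Dm (norm p)" for p
    by (rule lattice_step_bound[OF assms(2) om_cos_bound[OF assms(1)]])
  have "\<bar>LINT p|lborel. lattice_step L ?f p\<bar> \<le> (LINT p|lborel. \<bar>lattice_step L ?f p\<bar>)" by (rule integral_abs_bound)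
  also have "\<dots> \<le> (LINT p|lborel. 256 * (\<kappa> * ((real n)\<^sup>2 + 1) / 2) * Dm (norm (p::real^3)))"
    by (rule integral_mono'[OF integrable_mult_right[OF Dm_integrable]]) (use b order_trans[OF abs_ge_zero b] in auto)
  finally show ?thesis
    unfolding WL_integral[OF assms(2,1)] MW_def by (simp add: abs_mult field_simps)
qed

definition MD :: "nat \<Rightarrow> real" where "MD n = 1 + MW n"

lemma WL_diff_bound:
  assumes "n > 0" "L > 0"
  shows "\<bar>\<phi> r - WL n L x\<bar> \<le> MD n" "(\<phi> r - WL n L x)\<^sup>2 \<le> (MD n)\<^sup>2"
proof -
  show 1: "\<bar>\<phi> r - WL n L x\<bar> \<le> MD n"
    using WL_bound[OF assms, of x] \<phi>_nonneg[of r] \<phi>_less[of r] by (simp add: MD_def)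
  show "(\<phi> r - WL n L x)\<^sup>2 \<le> (MD n)\<^sup>2"
    using 1 by (simp add: abs_le_square_iff[symmetric])
qed

lemma integrable_v: "integrable lborel (\<lambda>x::real^3. v (norm x))"
  by (rule radial_integral(1)[OF _ int_v2]) simp

lemma WL_error_tendsto:
  assumes n: "n > 0"
  shows "((\<lambda>L. LINT x|lborel. v (norm x) * \<bar>\<phi> (norm x) - WL n L x\<bar>) \<longlongrightarrow> (LINT x|lborel. v (norm x) * \<bar>\<phi> (norm x) - Wn n x\<bar>)) at_top" (is ?A)
    and "((\<lambda>L. LINT x|lborel. v (norm x) * (\<phi> (norm x) - WL n L x)\<^sup>2) \<longlongrightarrow> (LINT x|lborel. v (norm x) * (\<phi> (norm x) - Wn n x)\<^sup>2)) at_top" (is ?B)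
proof -
  have Wn_meas[measurable]: "Wn n \<in> borel_measurable borel"
    by (subst ext[OF Wn_eq[OF n]]) measurable
  show ?A
  proof (rule integral_dominated_convergence_at_top[where w = "\<lambda>x. MD n * v (norm x)"])
    show "AE x in lborel. ((\<lambda>L. v (norm x) * \<bar>\<phi> (norm x) - WL n L x\<bar>) \<longlongrightarrow> v (norm x) * \<bar>\<phi> (norm x) - Wn n x\<bar>) at_top"
      by (intro AE_I2 tendsto_intros WL_tendsto n)
    show "\<forall>\<^sub>F L in at_top. AE x in lborel. norm (v (norm x) * \<bar>\<phi> (norm x) - WL n L x\<bar>) \<le> MD n * v (norm x)"
      using eventually_gt_at_top[of 0]
      by eventually_elim (use WL_diff_bound(1)[OF n] v_nonneg in \<open>auto simp: abs_mult mult.commute[of "MD n"] intro!: mult_left_mono\<close>)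
  qed (use integrable_v in \<open>auto intro!: integrable_mult_right\<close>)
  show ?B
  proof (rule integral_dominated_convergence_at_top[where w = "\<lambda>x. (MD n)\<^sup>2 * v (norm x)"])
    show "AE x in lborel. ((\<lambda>L. v (norm x) * (\<phi> (norm x) - WL n L x)\<^sup>2) \<longlongrightarrow> v (norm x) * (\<phi> (norm x) - Wn n x)\<^sup>2) at_top"
      by (intro AE_I2 tendsto_intros WL_tendsto n)
    show "\<forall>\<^sub>F L in at_top. AE x in lborel. norm (v (norm x) * (\<phi> (norm x) - WL n L x)\<^sup>2) \<le> (MD n)\<^sup>2 * v (norm x)"
      using eventually_gt_at_top[of 0]
      by eventually_elim (use WL_diff_bound(2)[OF n] v_nonneg in \<open>auto simp: abs_mult mult.commute[of "(MD n)\<^sup>2"] intro!: mult_left_mono\<close>)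
  qed (use integrable_v in \<open>auto intro!: integrable_mult_right\<close>)
qed

text \<open>The order of limits matters: the cutoff n is chosen first from the convergence on the
  whole space, and then the box grows at fixed n.\<close>

lemma discrete_error:
  assumes "\<epsilon> > 0"
  obtains n where "n > 0" "\<forall>\<^sub>F L in at_top. (LINT x|lborel. v (norm x) * \<bar>\<phi> (norm x) - WL n L x\<bar>) < \<epsilon>
    \<and> (LINT x|lborel. v (norm x) * (\<phi> (norm x) - WL n L x)\<^sup>2) < \<epsilon>"
proof -
  have "\<forall>\<^sub>F n in sequentially. n > 0 \<and> (LINT x|lborel. v (norm (x::real^3)) * \<bar>\<phi> (norm x) - Wn n x\<bar>) < \<epsilon>
     \<and> (LINT x|lborel. v (norm (x::real^3)) * (\<phi> (norm x) - Wn n x)\<^sup>2) < \<epsilon>"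
    by (intro eventually_conj eventually_gt_at_top order_tendstoD(2)[OF Wn_error(1)] order_tendstoD(2)[OF Wn_error(2)] assms)
  then obtain n where n: "n > 0" "(LINT x|lborel. v (norm (x::real^3)) * \<bar>\<phi> (norm x) - Wn n x\<bar>) < \<epsilon>"
     "(LINT x|lborel. v (norm (x::real^3)) * (\<phi> (norm x) - Wn n x)\<^sup>2) < \<epsilon>"
    using eventually_happens'[OF sequentially_bot] by blast
  show ?thesis
    by (rule that[OF n(1)], intro eventually_conj order_tendstoD(2)[OF WL_error_tendsto(1)[OF n(1)]] order_tendstoD(2)[OF WL_error_tendsto(2)[OF n(1)]] n)
qed

end

section \<open>Optimisation of a single mode\<close>

definition gam :: "real \<Rightarrow> real" where "gam c = c\<^sup>2 / (1 - c\<^sup>2)"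
definition alp :: "real \<Rightarrow> real" where "alp c = c / (1 - c\<^sup>2)"
definition disp :: "real \<Rightarrow> real \<Rightarrow> real" where "disp A B = sqrt (A\<^sup>2 - B\<^sup>2)"
text \<open>The minimiser of \<open>A * gam c + B * alp c\<close> in \<open>c\<close>.\<close>

definition amp :: "real \<Rightarrow> real \<Rightarrow> real" where "amp A B = - B / (A + disp A B)"
text \<open>The minimal mode energy (disp A B - A) / 2 plus a counterterm produced by completing the
  square in the pairing energy. For large s the former behaves like -B^2 / (4 * s), so the sum gains
  an order of decay and becomes integrable.\<close>

definition bog :: "real \<Rightarrow> real \<Rightarrow> real \<Rightarrow> real" where "bog s A B = (disp A B - A + B\<^sup>2 / (2 * s)) / 2"

lemma amp_0 [simp]: "amp A 0 = 0"
  by (simp add: amp_def)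

context
  fixes s A B :: real
  assumes s: "s > 0" and A: "A \<ge> s + \<bar>B\<bar>"
begin

lemma disp_ge: "disp A B \<ge> s"
proof -
  have "s * s \<le> (A - B) * (A + B)" using s A by (intro mult_mono) auto
  then have "s\<^sup>2 \<le> A\<^sup>2 - B\<^sup>2" by (simp add: power2_eq_square algebra_simps)
  then show ?thesis unfolding disp_def using s by (simp add: real_le_rsqrt)
qed

lemma disp_square: "(disp A B)\<^sup>2 = A\<^sup>2 - B\<^sup>2"
proof -
  have "\<bar>B\<bar> \<le> \<bar>A\<bar>" using s A by linarith
  then show ?thesis by (simp add: disp_def abs_le_square_iff)
qed

lemma disp_le: "disp A B \<le> A"
  unfolding disp_def using s A by (intro real_le_lsqrt) auto

text \<open>With S = disp A B the factorisation B^2 = (A + S) * (A - S) gives c^2 = (A - S) / (A +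
  S) and 1 - c^2 = 2 * S / (A + S).\<close>

lemma amp_eqs:
  "gam (amp A B) = (A - disp A B) / (2 * disp A B)" "alp (amp A B) = - B / (2 * disp A B)" "\<bar>amp A B\<bar> < 1"
proof -
  let ?S = "disp A B"
  have S: "?S > 0" and AS: "A + ?S > 0" using disp_ge s A by linarith+
  have B2: "B\<^sup>2 = (A + ?S) * (A - ?S)" using disp_square by (simp add: power2_eq_square algebra_simps)
  have c2: "(amp A B)\<^sup>2 = (A - ?S) / (A + ?S)"
    using AS unfolding amp_def power_divide power2_minus B2 by (simp add: power2_eq_square)
  have d: "1 - (amp A B)\<^sup>2 = 2 * ?S / (A + ?S)"
  proof -
    have "1 - (A - ?S) / (A + ?S) = (A + ?S) / (A + ?S) - (A - ?S) / (A + ?S)" using AS by simp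
    also have "\<dots> = 2 * ?S / (A + ?S)" by (subst diff_divide_distrib[symmetric]) simp
    finally show ?thesis unfolding c2 .
  qed
  show "gam (amp A B) = (A - ?S) / (2 * ?S)" unfolding gam_def using AS S by (subst d, subst c2) simp
  show "alp (amp A B) = - B / (2 * ?S)" unfolding alp_def d using AS S by (simp add: amp_def)
  have "1 - (amp A B)\<^sup>2 > 0" unfolding d using AS S by simp
  then show "\<bar>amp A B\<bar> < 1" by (simp add: abs_square_less_1)
qed

lemma gam_amp: "gam (amp A B) = B\<^sup>2 / (2 * disp A B * (A + disp A B))"
proof -
  have AS: "A + disp A B > 0" using disp_ge s A by linarith
  have "B\<^sup>2 = (A - disp A B) * (A + disp A B)" using disp_square by (simp add: power2_eq_square algebra_simps)
  then show ?thesis using AS by (simp add: amp_eqs)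
qed

lemma mode_energy: "A * gam (amp A B) + B * alp (amp A B) + B\<^sup>2 / (4 * s) = bog s A B"
proof -
  let ?S = "disp A B"
  have S: "?S > 0" using disp_ge s by linarith
  have "A * (A - ?S) - B\<^sup>2 = ?S * (?S - A)" using disp_square by (simp add: power2_eq_square algebra_simps)
  then have "(A * (A - ?S) - B\<^sup>2) / (2 * ?S) = (?S - A) / 2" using S by simp
  moreover have "A * gam (amp A B) + B * alp (amp A B) = (A * (A - ?S) - B\<^sup>2) / (2 * ?S)"
    unfolding amp_eqs by (simp add: power2_eq_square minus_divide_left[symmetric] diff_divide_distrib[symmetric])
  ultimately show ?thesis by (simp add: bog_def field_simps)
qed

end

text \<open>Since both square roots are at least s, replacing B by K lowers \<open>disp\<close> by
  at most (K^2 - B^2) / (2 * s), which is what the counterterm gains. This allows the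
  momentum-dependent coupling to be replaced by its supremum.\<close>

lemma bog_mono:
  assumes s: "s > 0" and A: "A \<ge> s + K" and B: "\<bar>B\<bar> \<le> K"
  shows "bog s A B \<le> bog s A K"
proof -
  have 1: "disp A B \<ge> s" "(disp A B)\<^sup>2 = A\<^sup>2 - B\<^sup>2"
    using disp_ge[where s=s and A=A and B=B] disp_square[where s=s and A=A and B=B] assms by auto
  have 2: "disp A K \<ge> s" "(disp A K)\<^sup>2 = A\<^sup>2 - K\<^sup>2"
    using disp_ge[where s=s and A=A and B=K] disp_square[where s=s and A=A and B=K] assms by auto
  have K: "B\<^sup>2 \<le> K\<^sup>2" using B by (simp add: abs_le_square_iff[symmetric])
  have "(disp A B - disp A K) * (2 * s) \<le> (disp A B - disp A K) * (disp A B + disp A K)"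
  proof (rule mult_left_mono)
    show "0 \<le> disp A B - disp A K" using K unfolding disp_def by simp
  qed (use 1 2 in simp)
  also have "\<dots> = K\<^sup>2 - B\<^sup>2" using 1(2) 2(2) by (simp add: power2_eq_square algebra_simps)
  finally have "disp A B - disp A K \<le> (K\<^sup>2 - B\<^sup>2) / (2 * s)" using s by (simp add: field_simps)
  then show ?thesis by (simp add: bog_def diff_divide_distrib)
qed

lemma bog_nonneg:
  assumes "s > 0" "A \<ge> s + \<bar>B\<bar>"
  shows "bog s A B \<ge> 0"
proof -
  have "bog s A 0 = 0" using assms by (simp add: bog_def disp_def)
  moreover have "bog s A \<bar>B\<bar> = bog s A B" by (simp add: bog_def disp_def)
  ultimately show ?thesis using bog_mono[of s "\<bar>B\<bar>" A 0] assms by simp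
qed

lemma divide_le_divide_iff_pos:
  fixes a b c d :: real
  shows "b > 0 \<Longrightarrow> d > 0 \<Longrightarrow> a / b \<le> c / d \<longleftrightarrow> a * d \<le> c * b"
  by (simp add: divide_simps mult.commute)

text \<open>The function \<open>Dr \<rho>\<close> is the common decay of all the errors; its lattice average is of order
  \<open>sqrt \<rho>\<close>.\<close>

definition Dr :: "real \<Rightarrow> real \<Rightarrow> real" where "Dr \<rho> s = \<rho> / (s * (s + \<rho>))"

text \<open>The total coefficient of an occupation: kinetic energy s, direct and exchange energy 2 *
  \<rho> * v0 relative to the condensate, and -\<rho> * \<kappa> because depletion weakens the
  pairing energy of the condensate.\<close>

definition Am :: "real \<Rightarrow> real \<Rightarrow> real \<Rightarrow> real \<Rightarrow> real" where
  "Am \<rho> v0 \<kappa> s = s + 2 * \<rho> * v0 - \<rho> * \<kappa>"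

context
  fixes \<rho> v0 \<kappa> :: real
  assumes \<rho>: "\<rho> > 0" and \<kappa>: "\<kappa> > 0" and v0: "v0 \<ge> \<kappa>"
begin

lemma \<rho>_le: "\<rho> * \<kappa> \<le> \<rho> * v0"
  using \<rho> v0 by simp

lemma Am_ge: "Am \<rho> v0 \<kappa> s \<ge> s + \<rho> * \<kappa>" and Am_ge': "Am \<rho> v0 \<kappa> s \<ge> s + \<rho> * v0" and Am_le: "Am \<rho> v0 \<kappa> s \<le> s + 2 * \<rho> * v0"
  using \<rho>_le \<rho> \<kappa> by (simp_all add: Am_def)

context
  fixes s g \<theta> :: real
  assumes s: "s > 0" and g: "\<bar>g\<bar> \<le> \<kappa>" and \<theta>: "0 \<le> \<theta>" "\<theta> \<le> 1"
begin

abbreviation (input) "BB \<equiv> \<rho> * (\<theta> * g)"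
abbreviation (input) "cc \<equiv> amp (Am \<rho> v0 \<kappa> s) BB"
abbreviation (input) "et \<equiv> alp cc + \<rho> * (\<theta> * g / (2 * s))"

lemma BB_le: "\<bar>BB\<bar> \<le> \<rho> * \<kappa>"
proof -
  have "\<theta> * \<bar>g\<bar> \<le> 1 * \<kappa>" using \<theta> g by (intro mult_mono) auto
  then show ?thesis using \<rho> \<theta> by (simp add: abs_mult)
qed

lemma Am_BB: "Am \<rho> v0 \<kappa> s \<ge> s + \<bar>BB\<bar>"
  using Am_ge[of s] BB_le by linarith

lemma mode_c_less: "\<bar>cc\<bar> < 1"
  by (rule amp_eqs(3)[OF s Am_BB])

lemma mode_gam_le: "gam cc \<le> \<kappa>\<^sup>2 / (2 * min 1 v0) * (\<rho> * Dr \<rho> s)"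
proof -
  let ?S = "disp (Am \<rho> v0 \<kappa> s) BB"
  have S: "?S \<ge> s" by (rule disp_ge[OF s Am_BB])
  have m: "min 1 v0 > 0" "min 1 v0 \<le> 1" "min 1 v0 \<le> v0" using v0 \<kappa> by auto
  have B2: "BB\<^sup>2 \<le> (\<rho> * \<kappa>)\<^sup>2" using BB_le by (simp add: abs_le_square_iff[symmetric])
  have "min 1 v0 * (s + \<rho>) = min 1 v0 * s + min 1 v0 * \<rho>" by (simp add: algebra_simps)
  also have "\<dots> \<le> 1 * s + v0 * \<rho>" using m s \<rho> by (intro add_mono mult_right_mono) auto
  also have "\<dots> \<le> Am \<rho> v0 \<kappa> s + ?S" using Am_ge'[of s] S s by (simp add: mult.commute)
  finally have AS: "min 1 v0 * (s + \<rho>) \<le> Am \<rho> v0 \<kappa> s + ?S" .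
  have "gam cc = BB\<^sup>2 / (2 * ?S * (Am \<rho> v0 \<kappa> s + ?S))" by (rule gam_amp[OF s Am_BB])
  also have "\<dots> \<le> (\<rho> * \<kappa>)\<^sup>2 / (2 * s * (min 1 v0 * (s + \<rho>)))"
    using B2 S AS s m \<rho> by (intro frac_le mult_mono) auto
  also have "\<dots> = \<kappa>\<^sup>2 / (2 * min 1 v0) * (\<rho> * Dr \<rho> s)"
    by (simp add: Dr_def power2_eq_square mult_ac)
  finally show ?thesis .
qed

text \<open>The gap disp - s is at most 2 * \<rho> * v0 and also at most disp. The first bound is
  multiplied by s, the second by \<rho>, and the results are added.\<close>

lemma gap_le: "(disp (Am \<rho> v0 \<kappa> s) BB - s) * (s + \<rho>) \<le> (2 * v0 + 1) * \<rho> * disp (Am \<rho> v0 \<kappa> s) BB"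
proof -
  let ?S = "disp (Am \<rho> v0 \<kappa> s) BB"
  have S: "?S \<ge> s" "?S \<le> Am \<rho> v0 \<kappa> s" using disp_ge[OF s Am_BB] disp_le[OF s Am_BB] by auto
  have "(?S - s) * s \<le> (2 * \<rho> * v0) * ?S"
    using S Am_le[of s] s \<rho> v0 \<kappa> by (intro mult_mono) auto
  moreover have "(?S - s) * \<rho> \<le> ?S * \<rho>" using s \<rho> by (intro mult_right_mono) auto
  ultimately show ?thesis by (simp add: algebra_simps)
qed

lemma mode_et: "et = BB * (disp (Am \<rho> v0 \<kappa> s) BB - s) / (2 * s * disp (Am \<rho> v0 \<kappa> s) BB)"
proof -
  have S: "disp (Am \<rho> v0 \<kappa> s) BB > 0" using disp_ge[OF s Am_BB] s by linarith
  have "- B / (2 * S) + B / (2 * s) = B * (S - s) / (2 * s * S)" if "S > 0" for B S :: real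
    using that s by (simp add: field_simps)
  from this[OF S, of BB] show ?thesis unfolding amp_eqs[OF s Am_BB] by simp
qed

lemma mode_et_le: "\<bar>et\<bar> \<le> \<kappa> * (2 * v0 + 1) / 2 * (\<rho> * Dr \<rho> s)"
proof -
  let ?S = "disp (Am \<rho> v0 \<kappa> s) BB"
  have S: "?S \<ge> s" "?S > 0" using disp_ge[OF s Am_BB] s by auto
  have "\<bar>et\<bar> = \<bar>BB\<bar> * ((?S - s) / (2 * s * ?S))"
    unfolding mode_et using S s by (simp add: abs_mult)
  also have "\<dots> \<le> (\<rho> * \<kappa>) * ((2 * v0 + 1) * \<rho> / (2 * s * (s + \<rho>)))"
  proof (rule mult_mono[OF BB_le])
    show "(?S - s) / (2 * s * ?S) \<le> (2 * v0 + 1) * \<rho> / (2 * s * (s + \<rho>))"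
    proof -
      have "(?S - s) * (s + \<rho>) * (2 * s) \<le> (2 * v0 + 1) * \<rho> * ?S * (2 * s)"
        using gap_le s by (intro mult_right_mono) auto
      then show ?thesis using S s \<rho> by (subst divide_le_divide_iff_pos) (auto simp only: mult_ac mult_pos_pos zero_less_numeral add_pos_pos)
    qed
  qed (use S s \<rho> \<kappa> in auto)
  also have "\<dots> = \<kappa> * (2 * v0 + 1) / 2 * (\<rho> * Dr \<rho> s)"
    by (simp add: Dr_def mult_ac)
  finally show ?thesis .
qed

text \<open>The amplitude is optimal for the truncated coupling \<rho> * \<theta> * g, whereas the
  energy contains \<rho> * g. \<open>R\<close> is the resulting mismatch. At low momentum it is
  small because 1 - \<theta> is.\<close>

lemma mode_upper:
  assumes \<delta>: "s < 2 * \<rho> * v0 \<Longrightarrow> 1 - \<theta> \<le> d" and d: "d \<ge> 0"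
  shows "Am \<rho> v0 \<kappa> s * gam cc + \<rho> * (g * et) - \<rho>\<^sup>2 / 2 * (g * (\<theta> * g / (2 * s)))
    \<le> bog s (Am \<rho> v0 \<kappa> s) (\<rho> * \<kappa>) + d * (\<kappa>\<^sup>2 * (2 * v0 + 1) / 4) * (\<rho>\<^sup>2 * Dr \<rho> s)"
proof -
  let ?S = "disp (Am \<rho> v0 \<kappa> s) BB"
  have S: "?S \<ge> s" "?S > 0" "?S \<le> Am \<rho> v0 \<kappa> s" using disp_ge[OF s Am_BB] disp_le[OF s Am_BB] s by auto
  define R where "R = \<rho>\<^sup>2 * \<theta> * (1 - \<theta>) * g\<^sup>2 * (1 / (4 * s) - 1 / (2 * ?S))"
  have "Am \<rho> v0 \<kappa> s * gam cc + \<rho> * (g * et) - \<rho>\<^sup>2 / 2 * (g * (\<theta> * g / (2 * s)))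
      = (Am \<rho> v0 \<kappa> s * gam cc + BB * alp cc + BB\<^sup>2 / (4 * s)) + R"
  proof -
    define i j where "i = 1 / (4 * s)" and "j = 1 / (2 * ?S)"
    have 1: "alp cc = - BB * j" "\<theta> * g / (2 * s) = 2 * (\<theta> * g * i)" "BB\<^sup>2 / (4 * s) = BB\<^sup>2 * i"
      by (simp_all add: amp_eqs[OF s Am_BB] i_def j_def)
    show ?thesis unfolding R_def 1 i_def[symmetric] j_def[symmetric]
      by (simp add: algebra_simps power2_eq_square)
  qed
  also have "\<dots> = bog s (Am \<rho> v0 \<kappa> s) BB + R" by (simp add: mode_energy[OF s Am_BB])
  also have "bog s (Am \<rho> v0 \<kappa> s) BB \<le> bog s (Am \<rho> v0 \<kappa> s) (\<rho> * \<kappa>)" by (rule bog_mono[OF s Am_ge BB_le])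
  also have "R \<le> d * (\<kappa>\<^sup>2 * (2 * v0 + 1) / 4) * (\<rho>\<^sup>2 * Dr \<rho> s)"
  proof (cases "s < 2 * \<rho> * v0")
    case True
    have g2: "g\<^sup>2 \<le> \<kappa>\<^sup>2" using g by (simp add: abs_le_square_iff[symmetric])
    have "R \<le> \<rho>\<^sup>2 * \<theta> * (1 - \<theta>) * g\<^sup>2 * (1 / (4 * s))"
      unfolding R_def using \<theta> S by (intro mult_left_mono) auto
    also have "\<dots> \<le> \<rho>\<^sup>2 * 1 * d * \<kappa>\<^sup>2 * (1 / (4 * s))"
      using \<theta> g2 \<delta>[OF True] s by (intro mult_right_mono mult_mono) auto
    also have "\<dots> \<le> \<rho>\<^sup>2 * 1 * d * \<kappa>\<^sup>2 * ((2 * v0 + 1) * Dr \<rho> s / 4)"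
    proof (rule mult_left_mono)
      have "\<rho> + s \<le> (2 * v0 + 1) * \<rho>" using True by (simp add: algebra_simps)
      then have "1 / s \<le> (2 * v0 + 1) * Dr \<rho> s" 
        using s \<rho> unfolding Dr_def times_divide_eq_right by (subst divide_le_divide_iff_pos) (auto simp: add.commute)
      then show "1 / (4 * s) \<le> (2 * v0 + 1) * Dr \<rho> s / 4" by simp
    qed (use d in simp)
    also have "\<dots> = d * (\<kappa>\<^sup>2 * (2 * v0 + 1) / 4) * (\<rho>\<^sup>2 * Dr \<rho> s)" by simp
    finally show ?thesis .
  next
    case False
    \<comment> \<open>At high momentum the mismatch has a favourable sign, so no closeness of the
      cutoff to 1 is required there.\<close>
    have "?S \<le> 2 * s" using S(3) Am_le[of s] False by linarith
    then have "1 / (4 * s) - 1 / (2 * ?S) \<le> 0" using S s by (simp add: divide_simps)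
    then have "R \<le> 0" unfolding R_def using \<theta> by (intro mult_nonneg_nonpos) auto
    also have "0 \<le> d * (\<kappa>\<^sup>2 * (2 * v0 + 1) / 4) * (\<rho>\<^sup>2 * Dr \<rho> s)"
      using d v0 \<kappa> s \<rho> by (simp add: Dr_def)
    finally show ?thesis .
  qed
  finally show ?thesis by simp
qed

text \<open>Both terms of order B^2 / s cancel up to the difference A + disp - 2 * s, which is at
  most 4 * \<rho> * v0. This yields the extra decay recorded in \<open>Dr\<close>.\<close>

lemma bog_le: "bog s (Am \<rho> v0 \<kappa> s) (\<rho> * \<kappa>) \<le> \<kappa>\<^sup>2 * v0 / min 1 v0 * (\<rho>\<^sup>2 * Dr \<rho> s)"
proof -
  let ?K = "\<rho> * \<kappa>"
  let ?S = "disp (Am \<rho> v0 \<kappa> s) ?K"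
  have AK: "Am \<rho> v0 \<kappa> s \<ge> s + \<bar>?K\<bar>" using Am_ge[of s] \<rho> \<kappa> by simp
  have S: "?S \<ge> s" "?S \<le> Am \<rho> v0 \<kappa> s" using disp_ge[OF s AK] disp_le[OF s AK] by auto
  have m: "min 1 v0 > 0" "min 1 v0 \<le> 1" "min 1 v0 \<le> v0" using v0 \<kappa> by auto
  have "min 1 v0 * (s + \<rho>) = min 1 v0 * s + min 1 v0 * \<rho>" by (simp add: algebra_simps)
  also have "\<dots> \<le> 1 * s + v0 * \<rho>" using m s \<rho> by (intro add_mono mult_right_mono) auto
  also have "\<dots> \<le> Am \<rho> v0 \<kappa> s + ?S" using Am_ge'[of s] S s by (simp add: mult.commute)
  finally have AS: "min 1 v0 * (s + \<rho>) \<le> Am \<rho> v0 \<kappa> s + ?S" .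
  have pos: "min 1 v0 * (s + \<rho>) > 0" using m s \<rho> by simp
  have AS0: "Am \<rho> v0 \<kappa> s + ?S > 0" using pos AS by linarith
  have "?K\<^sup>2 = (Am \<rho> v0 \<kappa> s - ?S) * (Am \<rho> v0 \<kappa> s + ?S)" using disp_square[OF s AK] by (simp add: power2_eq_square algebra_simps)
  then have "Am \<rho> v0 \<kappa> s - ?S = ?K\<^sup>2 / (Am \<rho> v0 \<kappa> s + ?S)" using AS0 by simp
  then have "bog s (Am \<rho> v0 \<kappa> s) ?K = (?K\<^sup>2 / (2 * s) - ?K\<^sup>2 / (Am \<rho> v0 \<kappa> s + ?S)) / 2" by (simp add: bog_def)
  also have "\<dots> = ?K\<^sup>2 * ((Am \<rho> v0 \<kappa> s + ?S - 2 * s) / (4 * s * (Am \<rho> v0 \<kappa> s + ?S)))"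
    using s AS0 by (simp add: field_simps)
  also have "\<dots> \<le> ?K\<^sup>2 * (4 * \<rho> * v0 / (4 * s * (min 1 v0 * (s + \<rho>))))"
    using S Am_le[of s] AS pos s \<rho> v0 \<kappa> by (intro mult_left_mono frac_le) auto
  also have "\<dots> = \<kappa>\<^sup>2 * v0 / min 1 v0 * (\<rho>\<^sup>2 * Dr \<rho> s)"
    by (simp add: Dr_def power2_eq_square mult_ac)
  finally show ?thesis .
qed

end

end

section \<open>An upper bound for the energy\<close>

definition occ :: "(real^3 \<Rightarrow> real) \<Rightarrow> real \<Rightarrow> real^3 \<Rightarrow> real" where
  "occ c N0 p = (if p = 0 then N0 else gam (c p))"

definition anom :: "(real^3 \<Rightarrow> real) \<Rightarrow> real \<Rightarrow> real^3 \<Rightarrow> real" where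
  "anom c N0 p = (if p = 0 then N0 else alp (c p))"

definition av :: "real \<Rightarrow> (real^3) set \<Rightarrow> (real^3 \<Rightarrow> real) \<Rightarrow> real" where
  "av L P f = 1 / L ^ 3 * sum f P"

definition energy :: "(real^3 \<Rightarrow> real) \<Rightarrow> real \<Rightarrow> (real^3) set \<Rightarrow> (real^3 \<Rightarrow> real) \<Rightarrow> real \<Rightarrow> real" where
  "energy vh L P c N0 = (\<Sum>p\<in>P. (norm p)\<^sup>2 * gam (c p)) + 1 / (2 * L ^ 3) *
     (vh 0 * (\<Sum>p\<in>insert 0 P. occ c N0 p)\<^sup>2
      + (\<Sum>p\<in>insert 0 P. \<Sum>r\<in>insert 0 P. vh (p - r) * (anom c N0 p * anom c N0 r))
      + (\<Sum>p\<in>insert 0 P. \<Sum>r\<in>insert 0 P. vh (p - r) * (occ c N0 p * occ c N0 r)) - vh 0 * (2 * N0\<^sup>2))"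

lemma gam_nonneg: "\<bar>c\<bar> < 1 \<Longrightarrow> gam c \<ge> 0"
  by (simp add: gam_def abs_square_less_1 less_imp_le)

text \<open>The passage to position space. The double sum is an integral of V against |sum of f p *
  exp (i p.x)|^2, whose sine part vanishes because f is even.\<close>

lemma double_sum_cos:
  fixes V :: "real^3 \<Rightarrow> real"
  assumes int: "\<And>u. integrable lborel (\<lambda>x. V x * cos (u \<bullet> x))"
    and S: "finite S" "\<And>p. p \<in> S \<Longrightarrow> - p \<in> S" "\<And>p. f (- p) = f p"
  shows "(\<Sum>p\<in>S. \<Sum>r\<in>S. (LINT x|lborel. V x * cos ((p - r) \<bullet> x)) * (f p * f r)) = (LINT x|lborel. V x * (\<Sum>p\<in>S. f p * cos (p \<bullet> x))\<^sup>2)"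
proof -
  have sin0: "(\<Sum>p\<in>S. f p * sin (p \<bullet> x)) = 0" for x
  proof -
    have "(\<Sum>p\<in>S. f p * sin (p \<bullet> x)) = (\<Sum>p\<in>S. f (- p) * sin ((- p) \<bullet> x))"
      by (rule sum.reindex_bij_witness[of _ uminus uminus]) (use S in auto)
    also have "\<dots> = - (\<Sum>p\<in>S. f p * sin (p \<bullet> x))" by (simp add: S sum_negf)
    finally show ?thesis by simp
  qed
  have "(\<Sum>p\<in>S. \<Sum>r\<in>S. (LINT x|lborel. V x * cos ((p - r) \<bullet> x)) * (f p * f r)) = (LINT x|lborel. (\<Sum>p\<in>S. \<Sum>r\<in>S. V x * cos ((p - r) \<bullet> x) * (f p * f r)))"
    by (subst Bochner_Integration.integral_sum, intro Bochner_Integration.integrable_sum integrable_mult_left int,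
        intro sum.cong refl, subst Bochner_Integration.integral_sum, intro integrable_mult_left int,
        intro sum.cong refl, simp)
  also have "\<dots> = (LINT x|lborel. V x * (\<Sum>p\<in>S. f p * cos (p \<bullet> x))\<^sup>2)"
  proof (intro Bochner_Integration.integral_cong refl)
    fix x
    have "(\<Sum>p\<in>S. \<Sum>r\<in>S. V x * cos ((p - r) \<bullet> x) * (f p * f r))
      = V x * ((\<Sum>p\<in>S. \<Sum>r\<in>S. (f p * cos (p \<bullet> x)) * (f r * cos (r \<bullet> x))) + (\<Sum>p\<in>S. \<Sum>r\<in>S. (f p * sin (p \<bullet> x)) * (f r * sin (r \<bullet> x))))"
      by (simp add: inner_diff_left cos_diff sum_distrib_left sum.distrib[symmetric] algebra_simps)
    also have "\<dots> = V x * ((\<Sum>p\<in>S. f p * cos (p \<bullet> x))\<^sup>2 + (\<Sum>p\<in>S. f p * sin (p \<bullet> x))\<^sup>2)"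
      by (simp add: power2_eq_square sum_product)
    finally show "(\<Sum>p\<in>S. \<Sum>r\<in>S. V x * cos ((p - r) \<bullet> x) * (f p * f r)) = V x * (\<Sum>p\<in>S. f p * cos (p \<bullet> x))\<^sup>2"
      by (simp add: sin0)
  qed
  finally show ?thesis .
qed

context scattering_profile begin

definition vh :: "real^3 \<Rightarrow> real" where "vh u = (LINT x|lborel. v (norm x) * cos (u \<bullet> x))"

definition V0 :: real where "V0 = (LINT x|lborel. v (norm (x::real^3)))"

lemma vh_0: "vh 0 = V0"
  by (simp add: vh_def V0_def)

lemma integrable_v_bounded:
  fixes h :: "real^3 \<Rightarrow> real"
  assumes [measurable]: "h \<in> borel_measurable borel" and h: "\<And>x. \<bar>h x\<bar> \<le> M"
  shows "integrable lborel (\<lambda>x. v (norm x) * h x)"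
  by (rule Bochner_Integration.integrable_bound[OF integrable_mult_right[OF integrable_v, of M]])
    (use h v_nonneg order_trans[OF abs_ge_zero h] in \<open>auto intro!: AE_I2 mult_left_mono simp: abs_mult mult.commute[of M]\<close>)

lemma integrable_vcos: "integrable lborel (\<lambda>x::real^3. v (norm x) * cos (u \<bullet> x))"
  by (rule integrable_v_bounded[where M = 1]) auto

lemma abs_vh_le: "\<bar>vh u\<bar> \<le> V0"
proof -
  have "\<bar>vh u\<bar> \<le> (LINT x|lborel. \<bar>v (norm x) * cos (u \<bullet> x)\<bar>)"
    unfolding vh_def by (rule integral_abs_bound)
  also have "\<dots> \<le> V0"
    unfolding V0_def using v_nonneg
    by (intro integral_mono integrable_abs integrable_vcos integrable_v) (auto simp: abs_mult mult_left_le)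
  finally show ?thesis .
qed

lemma \<kappa>_le_V0: "\<kappa> \<le> V0"
  unfolding \<kappa>_def V0_def using gh_integrable[of 0] by (intro integral_mono integrable_v gs_le) simp

text \<open>The optimal amplitude for the truncated coupling. It vanishes beyond the cutoff because
  \<theta> does.\<close>

definition cb :: "nat \<Rightarrow> real \<Rightarrow> real^3 \<Rightarrow> real" where
  "cb n \<rho> p = amp (Am \<rho> V0 \<kappa> ((norm p)\<^sup>2)) (\<rho> * (\<theta> n (norm p) * Gh (norm p)))"

definition CX :: real where "CX = \<kappa>\<^sup>2 / (2 * min 1 V0) + \<kappa> * (2 * V0 + 1) / 2"

text \<open>The deviation of the pairing from its main part, which is -\<rho> times the cut-off
  transform of the scattering solution.\<close>

definition eta :: "nat \<Rightarrow> real \<Rightarrow> real^3 \<Rightarrow> real" where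
  "eta n \<rho> p = alp (cb n \<rho> p) + \<rho> * om n p"

context
  fixes L \<rho> :: real and n :: nat and P :: "(real^3) set"
  assumes L: "L > 0" and \<rho>: "\<rho> > 0" and n: "n > 0" and \<kappa>0: "\<kappa> > 0"
    and P: "finite P" "P \<subseteq> dual_lattice L - {0}" "\<And>p. p \<in> P \<Longrightarrow> - p \<in> P"
    and Pn: "\<And>p. p \<in> dual_lattice L \<Longrightarrow> p \<noteq> 0 \<Longrightarrow> norm p < real n \<Longrightarrow> p \<in> P"
begin

abbreviation "ca \<equiv> cb n \<rho>"
abbreviation "ea \<equiv> eta n \<rho>"
abbreviation "d1 \<equiv> (LINT x|lborel. v (norm x) * \<bar>\<phi> (norm x) - WL n L x\<bar>)"
abbreviation "d2 \<equiv> (LINT x|lborel. v (norm x) * (\<phi> (norm x) - WL n L x)\<^sup>2)"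

lemma av_mono: "(\<And>p. p \<in> P \<Longrightarrow> f p \<le> g p) \<Longrightarrow> av L P f \<le> av L P g"
  unfolding av_def using L by (intro mult_left_mono sum_mono) auto

lemma av_linear:
  "av L P (\<lambda>p. f p + g p) = av L P f + av L P g" "av L P (\<lambda>p. f p - g p) = av L P f - av L P g"
  "av L P (\<lambda>p. k * f p) = k * av L P f" "av L P (\<lambda>p. f p * k) = av L P f * k"
  by (simp_all add: av_def sum.distrib sum_subtractf sum_distrib_left[symmetric] sum_distrib_right[symmetric] add_divide_distrib diff_divide_distrib)

lemma abs_av: "\<bar>av L P f\<bar> \<le> av L P (\<lambda>p. \<bar>f p\<bar>)"
  unfolding av_def using L by (simp add: abs_mult divide_right_mono)

lemma P0: "0 \<notin> P" using P by auto

lemma WL_av: "WL n L x = av L P (\<lambda>p. om n p * cos (p \<bullet> x))"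
proof -
  have "av L P (\<lambda>p. om n p * cos (p \<bullet> x)) = 1 / (2 * pi) ^ 3 * (LINT p|lborel. lattice_step L (\<lambda>p. om n p * cos (p \<bullet> x)) p)"
    unfolding av_def by (rule WL_eq[OF L n P(1,2)]) (rule Pn)
  then show ?thesis by (simp only: WL_integral[OF L n])
qed

lemma mode_facts:
  assumes "p \<in> P"
  shows "(norm p)\<^sup>2 > 0" "\<bar>ca p\<bar> < 1"
proof -
  show 1: "(norm p)\<^sup>2 > 0" using assms P0 by auto
  show "\<bar>ca p\<bar> < 1"
    unfolding cb_def by (rule mode_c_less[OF \<rho> \<kappa>0 \<kappa>_le_V0 1 abs_Gh_le \<theta>_nonneg \<theta>_le_1])
qed

lemma ca_sym: "ca (- p) = ca p"
  by (simp add: cb_def)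

abbreviation "X \<equiv> av L P (\<lambda>p. gam (ca p)) + av L P (\<lambda>p. \<bar>ea p\<bar>)"
abbreviation "N0 \<equiv> \<rho> * L ^ 3 - (\<Sum>p\<in>P. gam (ca p))"

lemma gam_ca: "p \<in> P \<Longrightarrow> gam (ca p) \<ge> 0"
  by (intro gam_nonneg mode_facts)

lemma sum_occ: "(\<Sum>p\<in>insert 0 P. occ ca N0 p) = \<rho> * L ^ 3"
proof -
  have "(\<Sum>p\<in>P. occ ca N0 p) = (\<Sum>p\<in>P. gam (ca p))" using P0 by (intro sum.cong) (auto simp: occ_def)
  then show ?thesis using P0 P(1) by (simp add: occ_def)
qed

text \<open>Since V >= 0, every Fourier coefficient is at most the one at 0; with nonnegative
  occupations the exchange energy is bounded by the direct energy.\<close>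

lemma sum_occ2_le:
  assumes "N0 \<ge> 0"
  shows "(\<Sum>p\<in>insert 0 P. \<Sum>r\<in>insert 0 P. vh (p - r) * (occ ca N0 p * occ ca N0 r)) \<le> V0 * (\<rho> * L ^ 3)\<^sup>2"
proof -
  have nn: "occ ca N0 p \<ge> 0" if "p \<in> insert 0 P" for p using assms that gam_ca by (auto simp: occ_def)
  have "(\<Sum>p\<in>insert 0 P. \<Sum>r\<in>insert 0 P. vh (p - r) * (occ ca N0 p * occ ca N0 r))
      \<le> (\<Sum>p\<in>insert 0 P. \<Sum>r\<in>insert 0 P. V0 * (occ ca N0 p * occ ca N0 r))"
    using nn abs_vh_le by (intro sum_mono mult_right_mono mult_nonneg_nonneg) (auto intro: order_trans[OF abs_ge_self])
  also have "\<dots> = V0 * (\<Sum>p\<in>insert 0 P. occ ca N0 p)\<^sup>2"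
    unfolding power2_eq_square sum_product by (simp only: sum_distrib_left)
  finally show ?thesis unfolding sum_occ .
qed

lemma integral_av_cos:
  "integrable lborel (\<lambda>x. gs (norm x) * av L P (\<lambda>p. f p * cos (p \<bullet> x)))"
  "(LINT x|lborel. gs (norm x) * av L P (\<lambda>p. f p * cos (p \<bullet> x))) = av L P (\<lambda>p. Gh (norm p) * f p)"
proof -
  have eq: "gs (norm x) * av L P (\<lambda>p. f p * cos (p \<bullet> x)) = 1 / L ^ 3 * (\<Sum>p\<in>P. f p * (gs (norm x) * cos (p \<bullet> x)))" for x
    unfolding av_def by (simp add: sum_distrib_left mult_ac)
  show "integrable lborel (\<lambda>x. gs (norm x) * av L P (\<lambda>p. f p * cos (p \<bullet> x)))"
    unfolding eq by (intro integrable_mult_right Bochner_Integration.integrable_sum gh_integrable)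
  show "(LINT x|lborel. gs (norm x) * av L P (\<lambda>p. f p * cos (p \<bullet> x))) = av L P (\<lambda>p. Gh (norm p) * f p)"
    unfolding eq
    by (subst integral_mult_right_zero, subst Bochner_Integration.integral_sum, intro integrable_mult_right gh_integrable)
      (simp only: integral_mult_right_zero gh_eq av_def mult.commute[of "Gh _"])
qed

text \<open>The condensate contributes \<rho> minus the depletion, and the pairing -\<rho> times the
  lattice approximation of w plus \<open>ea\<close>. So the cosine sum is \<rho> * (1 - w) up to
  terms that \<open>X\<close> controls.\<close>

lemma anom_sum: "(\<Sum>p\<in>insert 0 P. anom ca N0 p * cos (p \<bullet> x)) = L ^ 3 * (\<rho> * (1 - WL n L x) + (av L P (\<lambda>p. ea p * cos (p \<bullet> x)) - av L P (\<lambda>p. gam (ca p))))"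
proof -
  have 1: "(\<Sum>p\<in>P. anom ca N0 p * cos (p \<bullet> x)) = L ^ 3 * av L P (\<lambda>p. alp (ca p) * cos (p \<bullet> x))"
    using P0 L by (auto simp: anom_def av_def intro!: sum.cong)
  have 2: "av L P (\<lambda>p. ea p * cos (p \<bullet> x)) = av L P (\<lambda>p. alp (ca p) * cos (p \<bullet> x)) + \<rho> * WL n L x"
    unfolding WL_av av_linear(3)[symmetric] av_linear(1)[symmetric] by (simp add: eta_def algebra_simps)
  have 3: "(\<Sum>p\<in>P. gam (ca p)) = L ^ 3 * av L P (\<lambda>p. gam (ca p))" using L by (simp add: av_def)
  have "(\<Sum>p\<in>insert 0 P. anom ca N0 p * cos (p \<bullet> x)) = N0 + (\<Sum>p\<in>P. anom ca N0 p * cos (p \<bullet> x))"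
    unfolding sum.insert[OF P(1) P0] by (simp add: anom_def)
  also have "\<dots> = N0 + L ^ 3 * av L P (\<lambda>p. alp (ca p) * cos (p \<bullet> x))" by (simp only: 1)
  finally show ?thesis unfolding 2 3 by (simp add: algebra_simps)
qed

lemma integrable_error:
  "integrable lborel (\<lambda>x. v (norm x) * \<bar>\<phi> (norm x) - WL n L x\<bar>)"
  "integrable lborel (\<lambda>x. v (norm x) * (\<phi> (norm x) - WL n L x)\<^sup>2)"
  using WL_diff_bound[OF n L] by (auto intro!: integrable_v_bounded)

text \<open>The square is expanded pointwise around \<rho> * (1 - \<phi>). Terms with g = v * (1 -
  \<phi>) are kept exactly, since they integrate to averages of \<open>Gh\<close>. Everything else
  is estimated through the error \<open>?D\<close> of the lattice sum and through
  \<open>X\<close>.\<close>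

lemma pairing_le:
  "(LINT x|lborel. v (norm x) * (\<Sum>p\<in>insert 0 P. anom ca N0 p * cos (p \<bullet> x))\<^sup>2)
    \<le> (L ^ 3)\<^sup>2 * (\<rho>\<^sup>2 * (\<kappa> - av L P (\<lambda>p. Gh (norm p) * om n p) + d1 + d2)
      + 2 * \<rho> * (av L P (\<lambda>p. Gh (norm p) * ea p) - av L P (\<lambda>p. gam (ca p)) * \<kappa>) + 2 * \<rho> * X * d1 + X\<^sup>2 * V0)"
proof -
  let ?g = "\<lambda>x::real^3. gs (norm x)" and ?D = "\<lambda>x. \<phi> (norm x) - WL n L x" and ?v = "\<lambda>x::real^3. v (norm x)"
  let ?h = "\<lambda>x. av L P (\<lambda>p. ea p * cos (p \<bullet> x))" and ?\<gamma> = "av L P (\<lambda>p. gam (ca p))"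
  let ?F = "\<lambda>x. \<rho>\<^sup>2 * (?g x - ?g x * av L P (\<lambda>p. om n p * cos (p \<bullet> x)) + ?v x * \<bar>?D x\<bar> + ?v x * (?D x)\<^sup>2)
      + 2 * \<rho> * (?g x * ?h x - ?\<gamma> * ?g x) + 2 * \<rho> * X * (?v x * \<bar>?D x\<bar>) + X\<^sup>2 * ?v x"
  have ig: "integrable lborel ?g" using gh_integrable[of 0] by simp
  have hX: "\<bar>?h x - ?\<gamma>\<bar> \<le> X" for x
  proof -
    have "\<bar>?h x\<bar> \<le> av L P (\<lambda>p. \<bar>ea p * cos (p \<bullet> x)\<bar>)" by (rule abs_av)
    also have "\<dots> \<le> av L P (\<lambda>p. \<bar>ea p\<bar>)" by (intro av_mono) (simp add: abs_mult mult_left_le)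
    finally have "\<bar>?h x\<bar> \<le> av L P (\<lambda>p. \<bar>ea p\<bar>)" .
    moreover have "\<bar>?\<gamma>\<bar> \<le> ?\<gamma>"
    proof -
      have "?\<gamma> \<ge> 0" unfolding av_def using L gam_ca by (intro mult_nonneg_nonneg sum_nonneg) auto
      then show ?thesis by simp
    qed
    ultimately show ?thesis by linarith
  qed
  have iF: "integrable lborel ?F"
    by (intro Bochner_Integration.integrable_add Bochner_Integration.integrable_diff integrable_mult_right ig integral_av_cos integrable_error integrable_v)
  have le: "?v x * (\<rho> * (1 - WL n L x) + (?h x - ?\<gamma>))\<^sup>2 \<le> ?F x" for x
  proof -
    let ?u = "?h x - ?\<gamma>" and ?w = "WL n L x" and ?f = "\<phi> (norm x)"
    have g: "?g x = ?v x * (1 - ?f)" by (simp add: gs_def)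
    \<comment> \<open>Inserting 1 - ?w = (1 - ?f) + ?D, one factor ?w is retained next to ?g: v * (1
      - ?w)^2 equals ?g * (1 - ?w) + ?g * ?D + v * ?D^2.\<close>
    have "?v x * (\<rho> * (1 - ?w) + ?u)\<^sup>2
      = \<rho>\<^sup>2 * (?g x - ?g x * ?w + ?g x * ?D x + ?v x * (?D x)\<^sup>2) + 2 * \<rho> * (?g x * ?u) + 2 * \<rho> * (?v x * (?D x * ?u)) + ?u\<^sup>2 * ?v x"
      unfolding g by (simp add: power2_eq_square algebra_simps)
    also have "\<dots> \<le> \<rho>\<^sup>2 * (?g x - ?g x * ?w + ?v x * \<bar>?D x\<bar> + ?v x * (?D x)\<^sup>2) + 2 * \<rho> * (?g x * ?u) + 2 * \<rho> * (?v x * (\<bar>?D x\<bar> * X)) + X\<^sup>2 * ?v x"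
    proof (intro add_mono mult_left_mono order_refl mult_right_mono)
      have "?g x * ?D x \<le> ?g x * \<bar>?D x\<bar>" using gs_nonneg by (intro mult_left_mono) auto
      also have "\<dots> \<le> ?v x * \<bar>?D x\<bar>" using gs_le by (intro mult_right_mono) auto
      finally show "?g x * ?D x \<le> ?v x * \<bar>?D x\<bar>" .
      have "?D x * ?u \<le> \<bar>?D x\<bar> * \<bar>?u\<bar>" by (simp add: abs_mult[symmetric])
      also have "\<dots> \<le> \<bar>?D x\<bar> * X" using hX by (intro mult_left_mono) auto
      finally show "?D x * ?u \<le> \<bar>?D x\<bar> * X" .
      show "?u\<^sup>2 \<le> X\<^sup>2" using hX[of x] by (simp only: abs_le_square_iff[symmetric] abs_of_nonneg[OF order_trans[OF abs_ge_zero hX[of x]]])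
    qed (use \<rho> v_nonneg gs_nonneg in auto)
    also have "\<dots> = ?F x" unfolding WL_av[symmetric] by (simp add: algebra_simps)
    finally show ?thesis .
  qed
  have int_F: "(LINT x|lborel. ?F x) = \<rho>\<^sup>2 * (\<kappa> - av L P (\<lambda>p. Gh (norm p) * om n p) + d1 + d2)
      + 2 * \<rho> * (av L P (\<lambda>p. Gh (norm p) * ea p) - ?\<gamma> * \<kappa>) + 2 * \<rho> * X * d1 + X\<^sup>2 * V0"
    unfolding \<kappa>_def V0_def integral_av_cos(2)[symmetric]
    by (simp only: Bochner_Integration.integral_add Bochner_Integration.integral_diff integral_mult_right_zero
      Bochner_Integration.integrable_add Bochner_Integration.integrable_diff integrable_mult_right ig integral_av_cos(1) integrable_error integrable_v)
  have "(LINT x|lborel. ?v x * (\<Sum>p\<in>insert 0 P. anom ca N0 p * cos (p \<bullet> x))\<^sup>2) = (LINT x|lborel. (L ^ 3)\<^sup>2 * (?v x * (\<rho> * (1 - WL n L x) + (?h x - ?\<gamma>))\<^sup>2))"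
    unfolding anom_sum by (simp only: power_mult_distrib mult.left_commute)
  also have "\<dots> \<le> (LINT x|lborel. (L ^ 3)\<^sup>2 * ?F x)"
    by (rule integral_mono'[OF integrable_mult_right[OF iF]]) (use le order_trans[OF _ le] v_nonneg in \<open>auto intro!: mult_left_mono mult_nonneg_nonneg\<close>)
  also have "\<dots> = (L ^ 3)\<^sup>2 * (LINT x|lborel. ?F x)" by (rule integral_mult_right_zero)
  finally show ?thesis unfolding int_F .
qed

text \<open>The direct term, the exchange bound and the condensate correction add up to 2 * \<rho> *
  V0 times the depletion minus V0 times its square, per volume. The negative square is dropped,
  which leaves an expression additive over the modes.\<close>

lemma energy_le_mode_sum:
  assumes N0: "N0 \<ge> 0"
  shows "energy vh L P ca N0 \<le> L ^ 3 * (\<rho>\<^sup>2 * \<kappa> / 2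
    + av L P (\<lambda>p. Am \<rho> V0 \<kappa> ((norm p)\<^sup>2) * gam (ca p) + \<rho> * (Gh (norm p) * ea p) - \<rho>\<^sup>2 / 2 * (Gh (norm p) * om n p))
    + \<rho>\<^sup>2 / 2 * (d1 + d2) + \<rho> * X * d1 + X\<^sup>2 * V0 / 2)"
proof -
  let ?O = "L ^ 3" and ?\<gamma> = "av L P (\<lambda>p. gam (ca p))" and ?k = "av L P (\<lambda>p. (norm p)\<^sup>2 * gam (ca p))"
  let ?go = "av L P (\<lambda>p. Gh (norm p) * om n p)" and ?ge = "av L P (\<lambda>p. Gh (norm p) * ea p)"
  have O: "?O > 0" using L by simp
  have \<gamma>: "(\<Sum>p\<in>P. gam (ca p)) = ?O * ?\<gamma>" "(\<Sum>p\<in>P. (norm p)\<^sup>2 * gam (ca p)) = ?O * ?k"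
    using O by (simp_all add: av_def)
  have V0: "V0 \<ge> 0" using order_trans[OF \<kappa>_nonneg \<kappa>_le_V0] .
  have T2: "(\<Sum>p\<in>insert 0 P. \<Sum>r\<in>insert 0 P. vh (p - r) * (anom ca N0 p * anom ca N0 r))
      = (LINT x|lborel. v (norm x) * (\<Sum>p\<in>insert 0 P. anom ca N0 p * cos (p \<bullet> x))\<^sup>2)"
    unfolding vh_def
  proof (rule double_sum_cos[OF integrable_vcos])
    show "anom ca N0 (- p) = anom ca N0 p" for p by (simp add: anom_def ca_sym)
  qed (use P in auto)
  let ?R = "\<rho>\<^sup>2 * (\<kappa> - ?go + d1 + d2) + 2 * \<rho> * (?ge - ?\<gamma> * \<kappa>) + 2 * \<rho> * X * d1 + X\<^sup>2 * V0"
  have "energy vh L P ca N0 \<le> ?O * ?k + 1 / (2 * ?O) * (V0 * (\<rho> * ?O)\<^sup>2 + ?O\<^sup>2 * ?R + V0 * (\<rho> * ?O)\<^sup>2 - V0 * (2 * N0\<^sup>2))"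
    unfolding energy_def sum_occ \<gamma>(2) vh_0 T2 using pairing_le sum_occ2_le[OF N0] O
    by (intro add_left_mono mult_left_mono add_mono diff_right_mono) auto
  also have "\<dots> = ?O * (?k + ?R / 2) + 1 / ?O * (V0 * ((\<rho> * ?O)\<^sup>2 - N0\<^sup>2))"
    using O by (simp add: field_simps power2_eq_square)
  also have "1 / ?O * (V0 * ((\<rho> * ?O)\<^sup>2 - N0\<^sup>2)) = ?O * (2 * \<rho> * V0 * ?\<gamma> - V0 * ?\<gamma>\<^sup>2)"
    unfolding \<gamma>(1) using O by (simp add: field_simps power2_eq_square)
  also have "?O * (?k + ?R / 2) + ?O * (2 * \<rho> * V0 * ?\<gamma> - V0 * ?\<gamma>\<^sup>2) \<le> ?O * (?k + ?R / 2 + 2 * \<rho> * V0 * ?\<gamma>)"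
    using O V0 by (simp add: distrib_left right_diff_distrib)
  also have "?k + ?R / 2 + 2 * \<rho> * V0 * ?\<gamma> = \<rho>\<^sup>2 * \<kappa> / 2
      + (?k + (2 * \<rho> * V0 - \<rho> * \<kappa>) * ?\<gamma> + \<rho> * ?ge - \<rho>\<^sup>2 / 2 * ?go) + \<rho>\<^sup>2 / 2 * (d1 + d2) + \<rho> * X * d1 + X\<^sup>2 * V0 / 2"
    by (simp add: field_simps)
  also have "?k + (2 * \<rho> * V0 - \<rho> * \<kappa>) * ?\<gamma> + \<rho> * ?ge - \<rho>\<^sup>2 / 2 * ?go
      = av L P (\<lambda>p. Am \<rho> V0 \<kappa> ((norm p)\<^sup>2) * gam (ca p) + \<rho> * (Gh (norm p) * ea p) - \<rho>\<^sup>2 / 2 * (Gh (norm p) * om n p))"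
    unfolding av_linear(3)[symmetric] av_linear(1,2)[symmetric]
    by (rule arg_cong[where f = "av L P"], rule ext) (simp add: Am_def algebra_simps)
  finally show ?thesis .
qed

abbreviation "DD \<equiv> av L P (\<lambda>p. Dr \<rho> ((norm p)\<^sup>2))"

lemma V0_pos: "V0 > 0" using \<kappa>0 \<kappa>_le_V0 by simp

lemma X_le: "0 \<le> X" "X \<le> CX * (\<rho> * DD)"
proof -
  have 0: "0 \<le> av L P (\<lambda>p. gam (ca p))" "0 \<le> av L P (\<lambda>p. \<bar>ea p\<bar>)"
    unfolding av_def using L gam_ca by (auto intro!: sum_nonneg divide_nonneg_nonneg)
  then show "0 \<le> X" by simp
  have 1: "av L P (\<lambda>p. gam (ca p)) \<le> av L P (\<lambda>p. \<kappa>\<^sup>2 / (2 * min 1 V0) * (\<rho> * Dr \<rho> ((norm p)\<^sup>2)))"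
    unfolding cb_def
    by (intro av_mono mode_gam_le[OF \<rho> \<kappa>0 \<kappa>_le_V0 _ abs_Gh_le \<theta>_nonneg \<theta>_le_1] mode_facts(1))
  have 2: "av L P (\<lambda>p. \<bar>ea p\<bar>) \<le> av L P (\<lambda>p. \<kappa> * (2 * V0 + 1) / 2 * (\<rho> * Dr \<rho> ((norm p)\<^sup>2)))"
    unfolding cb_def eta_def om_def
    by (intro av_mono mode_et_le[OF \<rho> \<kappa>0 \<kappa>_le_V0 _ abs_Gh_le \<theta>_nonneg \<theta>_le_1] mode_facts(1))
  show "X \<le> CX * (\<rho> * DD)"
    using add_mono[OF 1 2] unfolding av_linear(3) CX_def by (simp add: distrib_right)
qed

lemma energy_le:
  assumes N0: "N0 \<ge> 0"
  shows "energy vh L P ca N0 \<le> L ^ 3 * (\<rho>\<^sup>2 * \<kappa> / 2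
    + av L P (\<lambda>p. bog ((norm p)\<^sup>2) (Am \<rho> V0 \<kappa> ((norm p)\<^sup>2)) (\<rho> * \<kappa>))
    + sqrt (2 * \<rho> * V0) * (\<kappa>\<^sup>2 * (2 * V0 + 1) / 4) * (\<rho>\<^sup>2 * DD)
    + \<rho>\<^sup>2 / 2 * (d1 + d2) + \<rho> * X * d1 + X\<^sup>2 * V0 / 2)"
proof -
  have "av L P (\<lambda>p. Am \<rho> V0 \<kappa> ((norm p)\<^sup>2) * gam (ca p) + \<rho> * (Gh (norm p) * ea p) - \<rho>\<^sup>2 / 2 * (Gh (norm p) * om n p))
    \<le> av L P (\<lambda>p. bog ((norm p)\<^sup>2) (Am \<rho> V0 \<kappa> ((norm p)\<^sup>2)) (\<rho> * \<kappa>) + sqrt (2 * \<rho> * V0) * (\<kappa>\<^sup>2 * (2 * V0 + 1) / 4) * (\<rho>\<^sup>2 * Dr \<rho> ((norm p)\<^sup>2)))"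
    unfolding cb_def eta_def om_def
  proof (intro av_mono mode_upper[OF \<rho> \<kappa>0 \<kappa>_le_V0 _ abs_Gh_le \<theta>_nonneg \<theta>_le_1] mode_facts(1))
    \<comment> \<open>This justifies the parameter d of \<open>mode_upper\<close>: below the
      threshold the cutoff deviates from 1 by at most |p| / n, hence by at most sqrt (2 * \<rho> *
      V0).\<close>
    fix p assume "(norm p)\<^sup>2 < 2 * \<rho> * V0"
    then have "norm p \<le> sqrt (2 * \<rho> * V0)" by (intro real_le_rsqrt) simp
    moreover have "1 - \<theta> n (norm p) \<le> norm p / real n" by (simp add: \<theta>_def)
    moreover have "norm p / real n \<le> norm p" using n by (simp add: divide_le_eq mult_le_cancel_left1)
    ultimately show "1 - \<theta> n (norm p) \<le> sqrt (2 * \<rho> * V0)" by linarith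
  qed (use \<rho> V0_pos in auto)
  also have "\<dots> = av L P (\<lambda>p. bog ((norm p)\<^sup>2) (Am \<rho> V0 \<kappa> ((norm p)\<^sup>2)) (\<rho> * \<kappa>)) + sqrt (2 * \<rho> * V0) * (\<kappa>\<^sup>2 * (2 * V0 + 1) / 4) * (\<rho>\<^sup>2 * DD)"
    unfolding av_linear(1,3) ..
  finally show ?thesis
    using L by (intro order_trans[OF energy_le_mode_sum[OF N0]] mult_left_mono) auto
qed

end

end

section \<open>The second-order term\<close>

lemma square_substitution:
  fixes f :: "real \<Rightarrow> real"
  assumes [measurable]: "f \<in> borel_measurable borel"
  shows "(LINT u|lborel. indicator {0<..} u * f u) = (LINT s|lborel. indicator {0<..} s * (2 * s * f (s\<^sup>2)))"
proof -
  have "(LINT u|lborel. indicator {0<..} u * f u) = (LINT u|density lborel (\<lambda>u. ennreal (1 * indicator {0<..} u)). f u)"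
    by (subst integral_density) (auto simp: indicator_def)
  also have "\<dots> = (LINT s|density lborel (\<lambda>s. ennreal (2 * s * indicator {0<..} s)). f (s\<^sup>2))"
    unfolding distr_square[symmetric] by (subst integral_distr) auto
  also have "\<dots> = (LINT s|lborel. indicator {0<..} s * (2 * s * f (s\<^sup>2)))"
    by (subst integral_density) (auto simp: indicator_def intro!: Bochner_Integration.integral_cong)
  finally show ?thesis .
qed

lemma Dr_le_Dm:
  assumes "0 < \<rho>" "\<rho> \<le> 1" "r > 0"
  shows "Dr \<rho> (r\<^sup>2) \<le> Dm r"
proof -
  have "\<rho> * (r\<^sup>2 + 1) \<le> r\<^sup>2 + \<rho>" using assms by (simp add: distrib_left mult_right_le_one_le)
  then have "\<rho> * (r\<^sup>2 + 1) * r\<^sup>2 \<le> (r\<^sup>2 + \<rho>) * r\<^sup>2" by (rule mult_right_mono) simp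
  then show ?thesis using assms unfolding Dr_def Dm_def
    by (subst divide_le_divide_iff_pos) (auto simp: add_pos_pos mult_ac)
qed

lemma Dr_radial:
  assumes \<rho>: "\<rho> > 0"
  shows "integrable lborel (\<lambda>s. indicator {0<..} s * (s\<^sup>2 * Dr \<rho> (s\<^sup>2)))"
    and "(LINT p|lborel. Dr \<rho> ((norm (p::real^3))\<^sup>2)) = 2 * pi\<^sup>2 * sqrt \<rho>"
proof -
  have eq: "indicator {0<..} s * (s\<^sup>2 * Dr \<rho> (s\<^sup>2)) = 1 / 2 * (indicator {0<..} s * (2 / (1 + (1 / \<rho>) * s\<^sup>2)))" for s
  proof (cases "s > 0")
    case True
    have "s\<^sup>2 + \<rho> \<noteq> 0" using \<rho> by (smt (verit) zero_le_power2)
    moreover have "1 + (1 / \<rho>) * s\<^sup>2 = (s\<^sup>2 + \<rho>) / \<rho>" using \<rho> by (simp add: field_simps)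
    ultimately show ?thesis using True \<rho> by (simp add: Dr_def)
  qed simp
  have c: "1 / \<rho> > 0" using \<rho> by simp
  show i: "integrable lborel (\<lambda>s. indicator {0<..} s * (s\<^sup>2 * Dr \<rho> (s\<^sup>2)))"
    unfolding eq by (rule integrable_mult_right[OF has_bochner_lorentz(1)[OF c]])
  have "(LINT p|lborel. Dr \<rho> ((norm (p::real^3))\<^sup>2)) = (LINT s|lborel. indicator {0<..} s * (4 * pi * s\<^sup>2 * Dr \<rho> (s\<^sup>2)))"
    by (rule radial_integral(2)[where F = "\<lambda>s. Dr \<rho> (s\<^sup>2)", OF _ i]) (simp add: Dr_def)
  also have "\<dots> = (LINT s|lborel. 2 * pi * (indicator {0<..} s * (2 / (1 + (1 / \<rho>) * s\<^sup>2))))"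
  proof (rule Bochner_Integration.integral_cong[OF refl])
    fix s
    show "indicator {0<..} s * (4 * pi * s\<^sup>2 * Dr \<rho> (s\<^sup>2)) = 2 * pi * (indicator {0<..} s * (2 / (1 + (1 / \<rho>) * s\<^sup>2)))"
    proof -
      have "indicator {0<..} s * (4 * pi * s\<^sup>2 * Dr \<rho> (s\<^sup>2)) = 4 * pi * (indicator {0<..} s * (s\<^sup>2 * Dr \<rho> (s\<^sup>2)))"
        by (simp only: mult_ac)
      then show ?thesis unfolding eq by simp
    qed
  qed
  also have "\<dots> = 2 * pi * (pi / sqrt (1 / \<rho>))" by (simp only: integral_mult_right_zero has_bochner_lorentz(2)[OF c])
  also have "\<dots> = 2 * pi\<^sup>2 * sqrt \<rho>" using \<rho> by (simp add: real_sqrt_divide power2_eq_square)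
  finally show "(LINT p|lborel. Dr \<rho> ((norm (p::real^3))\<^sup>2)) = 2 * pi\<^sup>2 * sqrt \<rho>" .
qed

text \<open>By positivity every finite set of modes gives at most the full lattice sum, which tends
  to the integral. The strict inequality in the hypothesis makes the bound hold for large boxes
  uniformly in P.\<close>

lemma lattice_average_limit:
  fixes f :: "real^3 \<Rightarrow> real"
  assumes f: "f \<in> borel_measurable borel" "\<And>p. p \<noteq> 0 \<Longrightarrow> isCont f p" "\<And>p. f p \<ge> 0"
    "\<And>p. p \<noteq> 0 \<Longrightarrow> f p \<le> C * Dm (norm p)" and B: "(LINT p|lborel. f p) < (2 * pi) ^ 3 * B"
  shows "\<forall>\<^sub>F L in at_top. \<forall>P. finite P \<longrightarrow> P \<subseteq> dual_lattice L - {0} \<longrightarrow> av L P f \<le> B"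
proof -
  have b: "p \<noteq> 0 \<Longrightarrow> \<bar>f p\<bar> \<le> C * Dm (norm p)" for p using f(3,4) by simp
  have "\<forall>\<^sub>F L in at_top. (LINT p|lborel. lattice_step L f p) < (2 * pi) ^ 3 * B"
    by (rule order_tendstoD(2)[OF riemann_limit[OF f(1,2) b] B])
  with eventually_gt_at_top[of 0] show ?thesis
  proof (eventually_elim, intro allI impI)
    fix L :: real and P assume L: "0 < L" and lt: "(LINT p|lborel. lattice_step L f p) < (2 * pi) ^ 3 * B"
      and P: "finite P" "P \<subseteq> dual_lattice L - {0}"
    have "(2 * pi) ^ 3 * av L P f = (2 * pi) ^ 3 / L ^ 3 * sum f P" by (simp add: av_def)
    also have "\<dots> \<le> (LINT p|lborel. lattice_step L f p)" by (rule lattice_sum_le[OF L P f(1,3) b])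
    finally have "(2 * pi) ^ 3 * av L P f \<le> (2 * pi) ^ 3 * B" using lt by linarith
    then show "av L P f \<le> B" by (rule mult_left_le_imp_le) simp
  qed
qed

context scattering_profile begin

text \<open>At \<open>p = 0\<close> the expression is a junk value, possibly negative, hence the maximum.\<close>

definition bog_density :: "real \<Rightarrow> real \<Rightarrow> real" where
  "bog_density \<rho> r = max 0 (bog (r\<^sup>2) (Am \<rho> V0 \<kappa> (r\<^sup>2)) (\<rho> * \<kappa>))"

definition target_density :: "real \<Rightarrow> real" where
  "target_density \<rho> = \<rho>\<^sup>2 * \<kappa> / 2 + 1 / (2 * pi) ^ 3 * (LINT p|lborel. bog_density \<rho> (norm (p::real^3)))"

text \<open>The coefficient of \<rho>^3 in the error. The 2 covers the excess of the Riemann sum and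
  the quadratic lattice error, the next summand the cutoff at low momentum, and the last two the
  terms linear and quadratic in \<open>X\<close>.\<close>

definition CE :: real where
  "CE = 2 + sqrt (2 * V0) * (\<kappa>\<^sup>2 * (2 * V0 + 1) / 4) + CX + CX\<^sup>2 * V0 / 2"

context
  fixes \<rho> :: real
  assumes \<rho>: "\<rho> > 0" "\<rho> \<le> 1" and \<kappa>0: "\<kappa> > 0"
begin

lemma V0_pos': "V0 > 0" using \<kappa>0 \<kappa>_le_V0 by simp

lemma bog_density_eq:
  assumes "r > 0"
  shows "bog_density \<rho> r = bog (r\<^sup>2) (Am \<rho> V0 \<kappa> (r\<^sup>2)) (\<rho> * \<kappa>)"
proof -
  have r2: "r\<^sup>2 > 0" using assms by simp
  have "Am \<rho> V0 \<kappa> (r\<^sup>2) \<ge> r\<^sup>2 + \<bar>\<rho> * \<kappa>\<bar>" using Am_ge[OF \<rho>(1) \<kappa>0 \<kappa>_le_V0, of "r\<^sup>2"] \<rho> \<kappa>0 by simp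
  from bog_nonneg[OF r2 this] show ?thesis by (simp add: bog_density_def)
qed

lemma bog_density_le_Dr:
  assumes "r > 0"
  shows "bog_density \<rho> r \<le> \<kappa>\<^sup>2 * V0 / min 1 V0 * (\<rho>\<^sup>2 * Dr \<rho> (r\<^sup>2))"
  unfolding bog_density_eq[OF assms] by (rule bog_le[OF \<rho>(1) \<kappa>0 \<kappa>_le_V0, where g = 0 and \<theta> = 0]) (use assms \<kappa>0 in auto)

lemma bog_density_le_Dm:
  assumes "r > 0"
  shows "bog_density \<rho> r \<le> \<kappa>\<^sup>2 * V0 / min 1 V0 * Dm r"
proof -
  have "\<rho>\<^sup>2 * Dr \<rho> (r\<^sup>2) \<le> 1 * Dm r"
    using \<rho> Dr_le_Dm[OF \<rho> assms] assms by (intro mult_mono) (auto simp: power_le_one Dr_def)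
  then show ?thesis
    using V0_pos' by (intro order_trans[OF bog_density_le_Dr[OF assms]] mult_left_mono) auto
qed

lemma bog_density_measurable [measurable]: "bog_density \<rho> \<in> borel_measurable borel"
  unfolding bog_density_def[abs_def] bog_def disp_def Am_def by measurable

lemma bog_density_integrable: "integrable lborel (\<lambda>s. indicator {0<..} s * (s\<^sup>2 * bog_density \<rho> s))"
proof (rule Bochner_Integration.integrable_bound[OF integrable_mult_right[OF Dr_radial(1)[OF \<rho>(1)], of "\<kappa>\<^sup>2 * V0 / min 1 V0 * \<rho>\<^sup>2"]])
  show "AE s in lborel. norm (indicator {0<..} s * (s\<^sup>2 * bog_density \<rho> s)) \<le> norm (\<kappa>\<^sup>2 * V0 / min 1 V0 * \<rho>\<^sup>2 * (indicator {0<..} s * (s\<^sup>2 * Dr \<rho> (s\<^sup>2))))"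
  proof (intro AE_I2)
    fix s :: real
    show "norm (indicator {0<..} s * (s\<^sup>2 * bog_density \<rho> s)) \<le> norm (\<kappa>\<^sup>2 * V0 / min 1 V0 * \<rho>\<^sup>2 * (indicator {0<..} s * (s\<^sup>2 * Dr \<rho> (s\<^sup>2))))"
    proof (cases "s > 0")
      case True
      have "s\<^sup>2 * bog_density \<rho> s \<le> s\<^sup>2 * (\<kappa>\<^sup>2 * V0 / min 1 V0 * (\<rho>\<^sup>2 * Dr \<rho> (s\<^sup>2)))"
        by (intro mult_left_mono bog_density_le_Dr True) simp
      also have "\<dots> = \<kappa>\<^sup>2 * V0 / min 1 V0 * \<rho>\<^sup>2 * (s\<^sup>2 * Dr \<rho> (s\<^sup>2))" by (simp add: mult_ac)
      finally have "s\<^sup>2 * bog_density \<rho> s \<le> \<kappa>\<^sup>2 * V0 / min 1 V0 * \<rho>\<^sup>2 * (s\<^sup>2 * Dr \<rho> (s\<^sup>2))" .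
      moreover have "0 \<le> s\<^sup>2 * bog_density \<rho> s" by (simp add: bog_density_def)
      ultimately show ?thesis using True by (simp only: indicator_simps greaterThan_iff if_True mult_1 real_norm_def)
    qed simp
  qed
qed measurable

lemma bog_density_isCont:
  assumes "p \<noteq> 0"
  shows "isCont (\<lambda>p::real^3. bog_density \<rho> (norm p)) p"
  unfolding bog_density_def bog_def disp_def Am_def using assms by (intro continuous_intros) auto

lemma eventually_bog_density:
  "\<forall>\<^sub>F L in at_top. \<forall>P. finite P \<longrightarrow> P \<subseteq> dual_lattice L - {0} \<longrightarrow>
     av L P (\<lambda>p. bog_density \<rho> (norm p)) \<le> 1 / (2 * pi) ^ 3 * (LINT p|lborel. bog_density \<rho> (norm (p::real^3))) + \<rho> ^ 3"
proof (rule lattice_average_limit)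
  show "(\<lambda>p::real^3. bog_density \<rho> (norm p)) \<in> borel_measurable borel" by measurable
  show "(LINT p|lborel. bog_density \<rho> (norm (p::real^3))) < (2 * pi) ^ 3 * (1 / (2 * pi) ^ 3 * (LINT p|lborel. bog_density \<rho> (norm (p::real^3))) + \<rho> ^ 3)"
    using \<rho> by (simp add: distrib_left)
  show "bog_density \<rho> (norm p) \<ge> 0" for p :: "real^3" by (simp add: bog_density_def)
  show "bog_density \<rho> (norm p) \<le> \<kappa>\<^sup>2 * V0 / min 1 V0 * Dm (norm p)" if "p \<noteq> 0" for p :: "real^3"
    by (rule bog_density_le_Dm) (use that in simp)
qed (rule bog_density_isCont)

text \<open>The integral is 2 * pi^2 * sqrt \<rho>, and 2 * pi^2 < (2 * pi)^3 leaves the strict room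
  needed for the limit. This square root sets the size of the depletion.\<close>

lemma eventually_Dr:
  "\<forall>\<^sub>F L in at_top. \<forall>P. finite P \<longrightarrow> P \<subseteq> dual_lattice L - {0} \<longrightarrow>
     av L P (\<lambda>p. Dr \<rho> ((norm p)\<^sup>2)) \<le> sqrt \<rho>"
proof (rule lattice_average_limit[where C = 1])
  show "(\<lambda>p::real^3. Dr \<rho> ((norm p)\<^sup>2)) \<in> borel_measurable borel" unfolding Dr_def by measurable
  show "isCont (\<lambda>p::real^3. Dr \<rho> ((norm p)\<^sup>2)) p" if "p \<noteq> 0" for p
  proof -
    have "(norm p)\<^sup>2 + \<rho> \<noteq> 0" using \<rho> by (smt (verit) zero_le_power2)
    then show ?thesis unfolding Dr_def using that by (intro continuous_intros) auto
  qed
  have "2 * pi\<^sup>2 * sqrt \<rho> < (2 * pi) ^ 3 * sqrt \<rho>"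
  proof (rule mult_strict_right_mono)
    have "2 * pi\<^sup>2 * 1 < 2 * pi\<^sup>2 * (4 * pi)" using pi_gt3 by (intro mult_strict_left_mono) auto
    then show "2 * pi\<^sup>2 < (2 * pi) ^ 3" by (simp add: power2_eq_square power3_eq_cube)
  qed (use \<rho> in simp)
  then show "(LINT p|lborel. Dr \<rho> ((norm (p::real^3))\<^sup>2)) < (2 * pi) ^ 3 * sqrt \<rho>"
    unfolding Dr_radial(2)[OF \<rho>(1)] .
qed (use \<rho> Dr_le_Dm in \<open>auto simp: Dr_def\<close>)

lemma CX_nonneg: "CX \<ge> 0"
  using V0_pos' \<kappa>0 by (simp add: CX_def)

text \<open>The cutoff is chosen so that both lattice errors stay below \<rho>. Quantifying over all
  P that contain the modes below the cutoff leaves room for an additional pair. The smallness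
  condition keeps at least half of the particles in the condensate.\<close>

theorem upper_state:
  assumes small: "CX * sqrt \<rho> \<le> 1 / 2"
  obtains n where "n > 0" "\<forall>\<^sub>F L in at_top. \<forall>P. finite P \<longrightarrow> P \<subseteq> dual_lattice L - {0} \<longrightarrow> (\<forall>p\<in>P. - p \<in> P) \<longrightarrow>
      (\<forall>p\<in>dual_lattice L. p \<noteq> 0 \<longrightarrow> norm p < real n \<longrightarrow> p \<in> P) \<longrightarrow>
      (\<Sum>p\<in>P. gam (cb n \<rho> p)) \<le> \<rho> * L ^ 3 / 2 \<and>
      energy vh L P (cb n \<rho>) (\<rho> * L ^ 3 - (\<Sum>p\<in>P. gam (cb n \<rho> p))) \<le> L ^ 3 * (target_density \<rho> + CE * \<rho> ^ 3)"
proof -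
  obtain n where n: "n > 0" and err: "\<forall>\<^sub>F L in at_top. (LINT x|lborel. v (norm x) * \<bar>\<phi> (norm x) - WL n L x\<bar>) < \<rho>
    \<and> (LINT x|lborel. v (norm x) * (\<phi> (norm x) - WL n L x)\<^sup>2) < \<rho>"
    using discrete_error[OF \<rho>(1)] by blast
  show ?thesis
  proof (rule that[OF n])
    show "\<forall>\<^sub>F L in at_top. \<forall>P. finite P \<longrightarrow> P \<subseteq> dual_lattice L - {0} \<longrightarrow> (\<forall>p\<in>P. - p \<in> P) \<longrightarrow>
      (\<forall>p\<in>dual_lattice L. p \<noteq> 0 \<longrightarrow> norm p < real n \<longrightarrow> p \<in> P) \<longrightarrow>
      (\<Sum>p\<in>P. gam (cb n \<rho> p)) \<le> \<rho> * L ^ 3 / 2 \<and>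
      energy vh L P (cb n \<rho>) (\<rho> * L ^ 3 - (\<Sum>p\<in>P. gam (cb n \<rho> p))) \<le> L ^ 3 * (target_density \<rho> + CE * \<rho> ^ 3)"
      using eventually_gt_at_top[of 0] err eventually_bog_density eventually_Dr
    proof (eventually_elim, intro allI impI)
      fix L :: real and P
      assume L: "0 < L" and err: "(LINT x|lborel. v (norm x) * \<bar>\<phi> (norm x) - WL n L x\<bar>) < \<rho> \<and> (LINT x|lborel. v (norm x) * (\<phi> (norm x) - WL n L x)\<^sup>2) < \<rho>"
        and b: "\<forall>P. finite P \<longrightarrow> P \<subseteq> dual_lattice L - {0} \<longrightarrow>
             av L P (\<lambda>p. bog_density \<rho> (norm p)) \<le> 1 / (2 * pi) ^ 3 * (LINT p|lborel. bog_density \<rho> (norm (p::real^3))) + \<rho> ^ 3"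
        and d: "\<forall>P. finite P \<longrightarrow> P \<subseteq> dual_lattice L - {0} \<longrightarrow> av L P (\<lambda>p. Dr \<rho> ((norm p)\<^sup>2)) \<le> sqrt \<rho>"
        and P: "finite P" "P \<subseteq> dual_lattice L - {0}" "\<forall>p\<in>P. - p \<in> P"
        and Pn: "\<forall>p\<in>dual_lattice L. p \<noteq> 0 \<longrightarrow> norm p < real n \<longrightarrow> p \<in> P"
      let ?d1 = "LINT x|lborel. v (norm x) * \<bar>\<phi> (norm x) - WL n L x\<bar>"
      let ?d2 = "LINT x|lborel. v (norm x) * (\<phi> (norm x) - WL n L x)\<^sup>2"
      let ?\<gamma> = "av L P (\<lambda>p. gam (cb n \<rho> p))" and ?D = "av L P (\<lambda>p. Dr \<rho> ((norm p)\<^sup>2))"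
      let ?X = "?\<gamma> + av L P (\<lambda>p. \<bar>eta n \<rho> p\<bar>)"
      note ctx = L \<rho>(1) n \<kappa>0 P(1,2) P(3)[rule_format] Pn[rule_format]
      have X: "0 \<le> ?X" "?X \<le> CX * (\<rho> * ?D)" using X_le[OF ctx] by blast+
      have D: "?D \<le> sqrt \<rho>" using d P by blast
      have X2: "?X \<le> CX * (\<rho> * sqrt \<rho>)"
        using CX_nonneg \<rho> D by (intro order_trans[OF X(2)] mult_left_mono) auto
      have "?\<gamma> \<le> ?X" unfolding av_def using L by (simp add: sum_nonneg)
      also have "\<dots> \<le> \<rho> * (1 / 2)"
      proof -
        have "CX * (\<rho> * sqrt \<rho>) \<le> \<rho> * (1 / 2)"
          using mult_left_mono[OF small, of \<rho>] \<rho> by (simp add: mult_ac)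
        then show ?thesis using X2 by (rule order_trans[rotated])
      qed
      finally have "L ^ 3 * ?\<gamma> \<le> L ^ 3 * (\<rho> * (1 / 2))" using L by (intro mult_left_mono) auto
      moreover have O\<gamma>: "L ^ 3 * ?\<gamma> = (\<Sum>p\<in>P. gam (cb n \<rho> p))" using L by (simp add: av_def)
      ultimately have \<gamma>: "(\<Sum>p\<in>P. gam (cb n \<rho> p)) \<le> \<rho> * L ^ 3 / 2" by (simp add: mult_ac)
      moreover have "\<rho> * L ^ 3 / 2 \<le> \<rho> * L ^ 3" using \<rho> L by simp
      ultimately have N0: "0 \<le> \<rho> * L ^ 3 - (\<Sum>p\<in>P. gam (cb n \<rho> p))" by linarith
      have bog: "av L P (\<lambda>p. bog ((norm p)\<^sup>2) (Am \<rho> V0 \<kappa> ((norm p)\<^sup>2)) (\<rho> * \<kappa>)) = av L P (\<lambda>p. bog_density \<rho> (norm p))"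
        unfolding av_def using P by (intro arg_cong2[where f = "(*)"] sum.cong refl bog_density_eq[symmetric]) auto
      let ?k = "\<kappa>\<^sup>2 * (2 * V0 + 1) / 4"
      have k: "?k \<ge> 0" using V0_pos' by simp
      have sq: "sqrt \<rho> * sqrt \<rho> = \<rho>" using \<rho> by simp
      have sq1: "sqrt \<rho> \<le> 1" using \<rho> by simp
      have t1: "sqrt (2 * \<rho> * V0) * ?k * (\<rho>\<^sup>2 * ?D) \<le> sqrt (2 * V0) * ?k * \<rho> ^ 3"
      proof -
        have "sqrt (2 * \<rho> * V0) * ?k * (\<rho>\<^sup>2 * ?D) \<le> sqrt (2 * \<rho> * V0) * ?k * (\<rho>\<^sup>2 * sqrt \<rho>)"
          using D k V0_pos' \<rho> by (intro mult_left_mono) auto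
        also have "\<dots> = sqrt (2 * V0) * ?k * (\<rho>\<^sup>2 * (sqrt \<rho> * sqrt \<rho>))"
          by (simp only: real_sqrt_mult mult_ac)
        also have "\<dots> = sqrt (2 * V0) * ?k * \<rho> ^ 3" unfolding sq by (simp add: power3_eq_cube power2_eq_square)
        finally show ?thesis .
      qed
      have t2: "\<rho>\<^sup>2 / 2 * (?d1 + ?d2) \<le> \<rho> ^ 3"
      proof -
        have "\<rho>\<^sup>2 / 2 * (?d1 + ?d2) \<le> \<rho>\<^sup>2 / 2 * (\<rho> + \<rho>)" using err by (intro mult_left_mono add_mono) auto
        then show ?thesis by (simp add: power3_eq_cube power2_eq_square)
      qed
      have t3: "\<rho> * ?X * ?d1 \<le> CX * \<rho> ^ 3"
      proof -
        have "?X \<le> CX * (\<rho> * 1)"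
          using CX_nonneg \<rho> sq1 by (intro order_trans[OF X2] mult_left_mono) auto
        then have "\<rho> * ?X * ?d1 \<le> \<rho> * (CX * (\<rho> * 1)) * \<rho>"
          using err X(1) \<rho> CX_nonneg by (intro mult_mono mult_left_mono integral_nonneg_AE AE_I2) (auto intro!: mult_nonneg_nonneg v_nonneg)
        then show ?thesis by (simp add: power3_eq_cube mult_ac)
      qed
      have t4: "?X\<^sup>2 * V0 / 2 \<le> CX\<^sup>2 * V0 / 2 * \<rho> ^ 3"
      proof -
        have "?X\<^sup>2 \<le> (CX * (\<rho> * sqrt \<rho>))\<^sup>2" by (rule power_mono[OF X2 X(1)])
        also have "\<dots> = CX\<^sup>2 * (\<rho>\<^sup>2 * (sqrt \<rho> * sqrt \<rho>))" by (simp add: power2_eq_square mult_ac)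
        also have "\<dots> = CX\<^sup>2 * \<rho> ^ 3" unfolding sq by (simp add: power3_eq_cube power2_eq_square)
        finally have "?X\<^sup>2 * (V0 / 2) \<le> CX\<^sup>2 * \<rho> ^ 3 * (V0 / 2)" using V0_pos' by (intro mult_right_mono) auto
        then show ?thesis by (simp add: mult_ac)
      qed
      have b': "av L P (\<lambda>p. bog_density \<rho> (norm p)) \<le> 1 / (2 * pi) ^ 3 * (LINT p|lborel. bog_density \<rho> (norm (p::real^3))) + \<rho> ^ 3"
        using b P by blast
      have "energy vh L P (cb n \<rho>) (\<rho> * L ^ 3 - (\<Sum>p\<in>P. gam (cb n \<rho> p))) \<le> L ^ 3 * (\<rho>\<^sup>2 * \<kappa> / 2
        + av L P (\<lambda>p. bog_density \<rho> (norm p)) + sqrt (2 * \<rho> * V0) * ?k * (\<rho>\<^sup>2 * ?D)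
        + \<rho>\<^sup>2 / 2 * (?d1 + ?d2) + \<rho> * ?X * ?d1 + ?X\<^sup>2 * V0 / 2)"
        using energy_le[OF ctx N0] unfolding bog .
      also have "\<dots> \<le> L ^ 3 * (target_density \<rho> + CE * \<rho> ^ 3)"
      proof (rule mult_left_mono)
        have "CE * \<rho> ^ 3 = 2 * \<rho> ^ 3 + sqrt (2 * V0) * ?k * \<rho> ^ 3 + CX * \<rho> ^ 3 + CX\<^sup>2 * V0 / 2 * \<rho> ^ 3"
          unfolding CE_def by (simp only: distrib_right)
        then show "\<rho>\<^sup>2 * \<kappa> / 2 + av L P (\<lambda>p. bog_density \<rho> (norm p)) + sqrt (2 * \<rho> * V0) * ?k * (\<rho>\<^sup>2 * ?D)
          + \<rho>\<^sup>2 / 2 * (?d1 + ?d2) + \<rho> * ?X * ?d1 + ?X\<^sup>2 * V0 / 2 \<le> target_density \<rho> + CE * \<rho> ^ 3"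
          unfolding target_density_def using t1 t2 t3 t4 b' by linarith
      qed (use L in simp)
      finally show "(\<Sum>p\<in>P. gam (cb n \<rho> p)) \<le> \<rho> * L ^ 3 / 2 \<and>
        energy vh L P (cb n \<rho>) (\<rho> * L ^ 3 - (\<Sum>p\<in>P. gam (cb n \<rho> p))) \<le> L ^ 3 * (target_density \<rho> + CE * \<rho> ^ 3)"
        using \<gamma> by blast
    qed
  qed
qed

text \<open>Scaling the radius by sqrt t with t = \<kappa> * \<rho> turns the coefficients into t
  times functions of y = s^2 and h. The three-dimensional volume supplies t^(3/2) and the density t
  / 2, and the substitution y = s^2 produces the weight sqrt y.\<close>

lemma bog_density_integral:
  defines "h \<equiv> V0 / \<kappa> - 1"
  shows "(LINT p|lborel. bog_density \<rho> (norm (p::real^3))) = pi * (\<kappa> * \<rho>)\<^sup>2 * sqrt (\<kappa> * \<rho>) * Phi h"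
proof -
  define t where "t = \<kappa> * \<rho>"
  have t: "t > 0" using \<kappa>0 \<rho> by (simp add: t_def)
  define f where "f y = sqrt ((y + 2*h) * (y + 2 + 2*h)) - (y + 1 + 2*h) + 1 / (2*y)" for y
  have [measurable]: "f \<in> borel_measurable borel" unfolding f_def[abs_def] by measurable
  have V0: "V0 = \<kappa> * (1 + h)" using \<kappa>0 by (simp add: h_def)
  have scaled: "bog_density \<rho> (sqrt t * s) = t / 2 * f (s\<^sup>2)" if s: "s > 0" for s
  proof -
    have s2: "(sqrt t * s)\<^sup>2 = t * s\<^sup>2" using t by (simp add: power_mult_distrib)
    have A: "Am \<rho> V0 \<kappa> (t * s\<^sup>2) = t * (s\<^sup>2 + 1 + 2 * h)"
      unfolding Am_def V0 t_def by (simp add: algebra_simps)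
    \<comment> \<open>The difference of squares (y + 1 + 2 * h)^2 - 1 factors as (y + 2 * h) * (y +
      2 + 2 * h) with y = s^2.\<close>
    have "disp (t * (s\<^sup>2 + 1 + 2 * h)) t = sqrt (t\<^sup>2 * ((s\<^sup>2 + 2*h) * (s\<^sup>2 + 2 + 2*h)))"
      unfolding disp_def by (rule arg_cong[where f = sqrt]) (simp add: power2_eq_square algebra_simps)
    also have "\<dots> = t * sqrt ((s\<^sup>2 + 2*h) * (s\<^sup>2 + 2 + 2*h))" using t by (simp add: real_sqrt_mult)
    finally have d: "disp (t * (s\<^sup>2 + 1 + 2 * h)) t = t * sqrt ((s\<^sup>2 + 2*h) * (s\<^sup>2 + 2 + 2*h))" .
    have "bog_density \<rho> (sqrt t * s) = bog (t * s\<^sup>2) (t * (s\<^sup>2 + 1 + 2 * h)) t"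
      using bog_density_eq[of "sqrt t * s"] t s by (simp add: s2 A t_def[symmetric] mult.commute[of \<rho> \<kappa>])
    also have "\<dots> = t / 2 * f (s\<^sup>2)"
    proof -
      have k: "t\<^sup>2 / (2 * (t * s\<^sup>2)) = t * (1 / (2 * s\<^sup>2))" using t by (simp add: power2_eq_square)
      have "(t * q - t * b + t * k) / 2 = t / 2 * (q - b + k)" for q b k by (simp add: algebra_simps)
      then show ?thesis unfolding bog_def d f_def k .
    qed
    finally show ?thesis .
  qed
  have "(LINT p|lborel. bog_density \<rho> (norm (p::real^3))) = (LINT s|lborel. indicator {0<..} s * (4 * pi * s\<^sup>2 * bog_density \<rho> s))"
    by (rule radial_integral(2)[OF bog_density_measurable bog_density_integrable])
  also have "\<dots> = \<bar>sqrt t\<bar> *\<^sub>R (LINT s|lborel. indicator {0<..} (0 + sqrt t * s) * (4 * pi * (0 + sqrt t * s)\<^sup>2 * bog_density \<rho> (0 + sqrt t * s)))"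
    by (rule lborel_integral_real_affine) (use t in simp)
  also have "(LINT s|lborel. indicator {0<..} (0 + sqrt t * s) * (4 * pi * (0 + sqrt t * s)\<^sup>2 * bog_density \<rho> (0 + sqrt t * s)))
      = (LINT s|lborel. pi * t\<^sup>2 * (indicator {0<..} s * (2 * s * (sqrt (s\<^sup>2) * f (s\<^sup>2)))))"
  proof (rule Bochner_Integration.integral_cong[OF refl])
    fix s
    show "indicator {0<..} (0 + sqrt t * s) * (4 * pi * (0 + sqrt t * s)\<^sup>2 * bog_density \<rho> (0 + sqrt t * s))
      = pi * t\<^sup>2 * (indicator {0<..} s * (2 * s * (sqrt (s\<^sup>2) * f (s\<^sup>2))))"
    proof (cases "s > 0")
      case True
      have "(sqrt t * s)\<^sup>2 = t * s\<^sup>2" using t by (simp add: power_mult_distrib)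
      moreover have "4 * pi * (t * s\<^sup>2) * (t / 2 * y) = pi * t\<^sup>2 * (2 * s * (s * y))" for y
        by (simp add: power2_eq_square)
      ultimately show ?thesis using t True by (simp add: scaled[OF True])
    next
      case False
      then show ?thesis using t by (simp add: zero_less_mult_iff)
    qed
  qed
  also have "\<dots> = pi * t\<^sup>2 * (LINT s|lborel. indicator {0<..} s * (2 * s * (sqrt (s\<^sup>2) * f (s\<^sup>2))))"
    by (rule integral_mult_right_zero)
  also have "(LINT s|lborel. indicator {0<..} s * (2 * s * (sqrt (s\<^sup>2) * f (s\<^sup>2)))) = (LINT y|lborel. indicator {0<..} y * (sqrt y * f y))"
    by (rule square_substitution[symmetric]) measurable
  also have "\<dots> = Phi h" unfolding Phi_def f_def set_lebesgue_integral_def by simp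
  finally show ?thesis using t unfolding t_def by (simp add: mult_ac)
qed

end

end

section \<open>Raising the energy with a pair of large momentum\<close>

lemma energy_cong:
  assumes "\<And>p. p \<in> P \<Longrightarrow> c p = c' p"
  shows "energy vh L P c N0 = energy vh L P c' N0"
proof -
  have "occ c N0 p = occ c' N0 p" "anom c N0 p = anom c' N0 p" if "p \<in> insert 0 P" for p
    using that assms by (auto simp: occ_def anom_def)
  then show ?thesis
    using assms unfolding energy_def by (auto intro!: arg_cong2[where f = "(+)"] arg_cong2[where f = "(*)"] arg_cong2[where f = "(-)"] arg_cong[where f = "\<lambda>x. x\<^sup>2"] sum.cong)
qed

lemma gam_le_1: "\<bar>t\<bar> \<le> 1 / sqrt 2 \<Longrightarrow> gam t \<le> 1"
proof -
  assume "\<bar>t\<bar> \<le> 1 / sqrt 2"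
  then have "\<bar>t\<bar>\<^sup>2 \<le> (1 / sqrt 2)\<^sup>2" by (intro power_mono) auto
  then have "t\<^sup>2 \<le> 1 / 2" by (simp add: power_divide)
  then show ?thesis by (simp add: gam_def divide_le_eq)
qed

lemma gam_inv_sqrt2: "gam (1 / sqrt 2) = 1"
  by (simp add: gam_def power_divide)

lemma dual_lattice_far:
  assumes "L > 0"
  obtains k where "k \<in> dual_lattice L" "norm k > R" "k \<noteq> 0"
proof -
  obtain m :: nat where m: "\<bar>R\<bar> * L / (2 * pi) < real m" using reals_Archimedean2 by blast
  then have R: "\<bar>R\<bar> < 2 * pi / L * real m" using assms by (simp add: field_simps)
  define k :: "real^3" where "k = (2 * pi / L * real m) *\<^sub>R axis 1 1"
  have nk: "norm k = 2 * pi / L * real m" using assms by (simp add: k_def)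
  have "k \<in> dual_lattice L"
    unfolding dual_lattice_def
  proof (intro CollectI allI)
    fix i :: 3
    show "\<exists>j::int. k $ i = 2 * pi / L * of_int j"
      by (rule exI[of _ "if i = 1 then int m else 0"]) (simp add: k_def axis_def)
  qed
  moreover have "norm k > R" "norm k > 0" using R nk by linarith+
  ultimately show ?thesis using that by force
qed

context scattering_profile begin

text \<open>Both double sums are integrals of V times a square. The single negative contribution is
  the condensate correction, so the kinetic energy of one mode bounds the energy from below.\<close>

lemma energy_ge:
  assumes L: "L > 0" and P: "finite P" "0 \<notin> P" "\<And>p. p \<in> P \<Longrightarrow> - p \<in> P"
    and c: "\<And>p. c (- p) = c p" "\<And>p. \<bar>c p\<bar> < 1" and M0: "M0 \<ge> 0" and k: "k \<in> P"
  shows "energy vh L P c M0 \<ge> (norm k)\<^sup>2 * gam (c k) - V0 * (M0 + (\<Sum>p\<in>P. gam (c p)))\<^sup>2 / (2 * L ^ 3)"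
proof -
  have nn: "(\<Sum>p\<in>insert 0 P. \<Sum>r\<in>insert 0 P. vh (p - r) * (f p * f r)) \<ge> 0" if f: "\<And>p. f (- p) = f p" for f
  proof -
    have "(\<Sum>p\<in>insert 0 P. \<Sum>r\<in>insert 0 P. vh (p - r) * (f p * f r)) = (LINT x|lborel. v (norm x) * (\<Sum>p\<in>insert 0 P. f p * cos (p \<bullet> x))\<^sup>2)"
      unfolding vh_def by (rule double_sum_cos[OF integrable_vcos]) (use P f in auto)
    also have "\<dots> \<ge> 0" using v_nonneg by (intro Bochner_Integration.integral_nonneg) auto
    finally show ?thesis .
  qed
  have V0: "V0 \<ge> 0" using order_trans[OF \<kappa>_nonneg \<kappa>_le_V0] .
  let ?g = "\<Sum>p\<in>P. gam (c p)"
  have g: "?g \<ge> 0" using c by (intro sum_nonneg gam_nonneg) auto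
  have so: "(\<Sum>p\<in>insert 0 P. occ c M0 p) = M0 + ?g"
  proof -
    have "(\<Sum>p\<in>P. occ c M0 p) = ?g" using P by (intro sum.cong) (auto simp: occ_def)
    then show ?thesis using P by (simp add: occ_def)
  qed
  have "(norm k)\<^sup>2 * gam (c k) \<le> (\<Sum>p\<in>P. (norm p)\<^sup>2 * gam (c p))"
    by (rule member_le_sum[OF k _ P(1)]) (use c in \<open>auto intro!: mult_nonneg_nonneg gam_nonneg\<close>)
  moreover have "1 / (2 * L ^ 3) * (- (V0 * (M0 + ?g)\<^sup>2)) \<le> 1 / (2 * L ^ 3) * (V0 * (M0 + ?g)\<^sup>2
      + (\<Sum>p\<in>insert 0 P. \<Sum>r\<in>insert 0 P. vh (p - r) * (anom c M0 p * anom c M0 r))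
      + (\<Sum>p\<in>insert 0 P. \<Sum>r\<in>insert 0 P. vh (p - r) * (occ c M0 p * occ c M0 r)) - V0 * (2 * M0\<^sup>2))"
  proof (rule mult_left_mono)
    \<comment> \<open>The condensate does not exceed the total number, so the correction -2 * V0 *
      M0^2 is compensated by the direct term up to one copy of it.\<close>
    have "M0\<^sup>2 \<le> (M0 + ?g)\<^sup>2" using M0 g by (intro power_mono) auto
    then have "V0 * M0\<^sup>2 \<le> V0 * (M0 + ?g)\<^sup>2" using V0 by (rule mult_left_mono)
    moreover have "(\<Sum>p\<in>insert 0 P. \<Sum>r\<in>insert 0 P. vh (p - r) * (anom c M0 p * anom c M0 r)) \<ge> 0"
      by (rule nn) (simp add: anom_def c)
    moreover have "(\<Sum>p\<in>insert 0 P. \<Sum>r\<in>insert 0 P. vh (p - r) * (occ c M0 p * occ c M0 r)) \<ge> 0"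
      by (rule nn) (simp add: occ_def c)
    ultimately show "- (V0 * (M0 + ?g)\<^sup>2) \<le> V0 * (M0 + ?g)\<^sup>2
      + (\<Sum>p\<in>insert 0 P. \<Sum>r\<in>insert 0 P. vh (p - r) * (anom c M0 p * anom c M0 r))
      + (\<Sum>p\<in>insert 0 P. \<Sum>r\<in>insert 0 P. vh (p - r) * (occ c M0 p * occ c M0 r)) - V0 * (2 * M0\<^sup>2)" by linarith
  qed (use L in simp)
  ultimately show ?thesis unfolding energy_def so vh_0 by simp
qed

text \<open>Only the extra pair varies, and the condensate adjusts to keep the particle number
  fixed. At t = 1 / sqrt 2 each of the two extra modes holds exactly one particle on
  average.\<close>

theorem exact_state:
  assumes \<rho>: "0 < \<rho>" "\<rho> \<le> 1" and \<kappa>0: "\<kappa> > 0" and small: "CX * sqrt \<rho> \<le> 1 / 2"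
  shows "\<forall>\<^sub>F L in at_top. \<exists>P c M0. pair_state L c M0 P \<and> M0 + (\<Sum>p\<in>P. gam (c p)) = \<rho> * L ^ 3 \<and>
    energy vh L P c M0 = L ^ 3 * (target_density \<rho> + CE * \<rho> ^ 3)"
proof -
  obtain n where n: "n > 0" and up: "\<forall>\<^sub>F L in at_top. \<forall>P. finite P \<longrightarrow> P \<subseteq> dual_lattice L - {0} \<longrightarrow> (\<forall>p\<in>P. - p \<in> P) \<longrightarrow>
      (\<forall>p\<in>dual_lattice L. p \<noteq> 0 \<longrightarrow> norm p < real n \<longrightarrow> p \<in> P) \<longrightarrow>
      (\<Sum>p\<in>P. gam (cb n \<rho> p)) \<le> \<rho> * L ^ 3 / 2 \<and>
      energy vh L P (cb n \<rho>) (\<rho> * L ^ 3 - (\<Sum>p\<in>P. gam (cb n \<rho> p))) \<le> L ^ 3 * (target_density \<rho> + CE * \<rho> ^ 3)"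
    using upper_state[OF \<rho> \<kappa>0 small] by blast
  have "filterlim (\<lambda>L. \<rho> * L ^ 3) at_top at_top"
    using \<rho> by (intro filterlim_tendsto_pos_mult_at_top[OF tendsto_const] filterlim_pow_at_top filterlim_ident) auto
  \<comment> \<open>The depletion is at most half of the particles plus two for the extra pair, so
    more than four particles leave a positive condensate.\<close>
  then have "\<forall>\<^sub>F L in at_top. 4 < \<rho> * L ^ 3" by (rule filterlim_at_top_dense[THEN iffD1, rule_format])
  with up eventually_gt_at_top[of 0] show ?thesis
  proof eventually_elim
    fix L :: real
    assume up: "\<forall>P. finite P \<longrightarrow> P \<subseteq> dual_lattice L - {0} \<longrightarrow> (\<forall>p\<in>P. - p \<in> P) \<longrightarrow>
      (\<forall>p\<in>dual_lattice L. p \<noteq> 0 \<longrightarrow> norm p < real n \<longrightarrow> p \<in> P) \<longrightarrow>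
      (\<Sum>p\<in>P. gam (cb n \<rho> p)) \<le> \<rho> * L ^ 3 / 2 \<and>
      energy vh L P (cb n \<rho>) (\<rho> * L ^ 3 - (\<Sum>p\<in>P. gam (cb n \<rho> p))) \<le> L ^ 3 * (target_density \<rho> + CE * \<rho> ^ 3)"
      and L: "0 < L" and big: "4 < \<rho> * L ^ 3"
    let ?Y = "L ^ 3 * (target_density \<rho> + CE * \<rho> ^ 3)" and ?N = "\<rho> * L ^ 3"
    \<comment> \<open>The kinetic energy of one particle of momentum k has to exceed the desired
      energy plus the largest possible deficit in \<open>energy_ge\<close>.\<close>
    define K where "K = ?Y + V0 * ?N\<^sup>2 / (2 * L ^ 3)"
    obtain k where k: "k \<in> dual_lattice L" "norm k > max (real n) (sqrt \<bar>K\<bar>)" "k \<noteq> 0"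
      using dual_lattice_far[OF L] by blast
    have kn: "norm k > real n" using k by simp
    have kK: "(norm k)\<^sup>2 \<ge> K"
    proof -
      have "(sqrt \<bar>K\<bar>)\<^sup>2 \<le> (norm k)\<^sup>2" using k by (intro power_mono) auto
      then show ?thesis by simp
    qed
    define P where "P = ({p \<in> dual_lattice L. norm p \<le> real n} - {0}) \<union> {k, - k}"
    have P: "finite P" "P \<subseteq> dual_lattice L - {0}" "\<And>p. p \<in> P \<Longrightarrow> - p \<in> P" "k \<in> P" "- k \<in> P"
      using finite_dual_lattice_ball[OF L] k uminus_in_dual_lattice by (auto simp: P_def)
    have Pn: "\<And>p. p \<in> dual_lattice L \<Longrightarrow> p \<noteq> 0 \<Longrightarrow> norm p < real n \<Longrightarrow> p \<in> P" by (auto simp: P_def)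
    have bound: "(\<Sum>p\<in>P. gam (cb n \<rho> p)) \<le> ?N / 2" "energy vh L P (cb n \<rho>) (?N - (\<Sum>p\<in>P. gam (cb n \<rho> p))) \<le> ?Y"
      using up P Pn by blast+
    have cbk: "cb n \<rho> k = 0" "cb n \<rho> (- k) = 0" using kn n by (simp_all add: cb_def \<theta>_eq_0)
    define c where "c t p = (if p = k \<or> p = - k then t else if p \<in> P then cb n \<rho> p else 0)" for t p
    define G where "G t = (\<Sum>p\<in>P. gam (c t p))" for t
    have c_sym: "c t (- p) = c t p" for t p
    proof -
      have "- p \<in> P \<longleftrightarrow> p \<in> P" using P(3)[of p] P(3)[of "- p"] by auto
      moreover have "- p = k \<longleftrightarrow> p = - k" by auto
      moreover have "- p = - k \<longleftrightarrow> p = k" by auto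
      ultimately show ?thesis by (auto simp: c_def cb_def)
    qed
    have cb_less: "\<bar>cb n \<rho> p\<bar> < 1" if "p \<in> P" for p
      using mode_facts(2)[OF L \<rho>(1) n \<kappa>0 P(1,2,3) Pn that] .
    have t1: "\<bar>t\<bar> < 1" if "t \<in> {0..1 / sqrt 2}" for t
    proof -
      have "1 / sqrt 2 < (1::real)" by simp
      then show ?thesis using that by (simp only: atLeastAtMost_iff) linarith
    qed
    have c_less: "\<bar>c t p\<bar> < 1" if "t \<in> {0..1 / sqrt 2}" for t p
      using t1[OF that] cb_less by (auto simp: c_def)
    have G_le: "G t \<le> ?N / 2 + 2" if t: "t \<in> {0..1 / sqrt 2}" for t
    proof -
      have g0: "gam t \<ge> 0" by (rule gam_nonneg[OF t1[OF t]])
      have "G t \<le> (\<Sum>p\<in>P. gam (cb n \<rho> p) + (if p = k then gam t else 0) + (if p = - k then gam t else 0))"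
        unfolding G_def
      proof (rule sum_mono)
        fix p assume p: "p \<in> P"
        show "gam (c t p) \<le> gam (cb n \<rho> p) + (if p = k then gam t else 0) + (if p = - k then gam t else 0)"
          using p g0 cbk gam_nonneg[OF cb_less[OF p]] by (auto simp: c_def)
      qed
      also have "\<dots> = (\<Sum>p\<in>P. gam (cb n \<rho> p)) + gam t + gam t"
        using P by (simp add: sum.distrib)
      also have "\<dots> \<le> ?N / 2 + 1 + 1" using t by (intro add_mono bound gam_le_1) auto
      finally show ?thesis by simp
    qed
    \<comment> \<open>The condensate is \<open>?N - G t\<close>, so the number constraint holds
      along the whole path on which the intermediate value theorem is applied.\<close>
    define F where "F t = energy vh L P (c t) (?N - G t)" for t
    have "F 0 = energy vh L P (cb n \<rho>) (?N - (\<Sum>p\<in>P. gam (cb n \<rho> p)))"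
    proof -
      have eq: "c 0 p = cb n \<rho> p" if "p \<in> P" for p using that cbk by (auto simp: c_def)
      then have "G 0 = (\<Sum>p\<in>P. gam (cb n \<rho> p))" unfolding G_def by (intro sum.cong) auto
      then show ?thesis unfolding F_def using energy_cong[OF eq] by simp
    qed
    then have F0: "F 0 \<le> ?Y" using bound by simp
    have F1: "?Y \<le> F (1 / sqrt 2)"
    proof -
      have t: "1 / sqrt 2 \<in> {0..1 / sqrt (2::real)}" by simp
      have "F (1 / sqrt 2) \<ge> (norm k)\<^sup>2 * gam (c (1 / sqrt 2) k) - V0 * ((?N - G (1 / sqrt 2)) + (\<Sum>p\<in>P. gam (c (1 / sqrt 2) p)))\<^sup>2 / (2 * L ^ 3)"
        unfolding F_def
        by (rule energy_ge[OF L P(1)]) (use P c_sym c_less[OF t] G_le[OF t] big in auto)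
      then have "F (1 / sqrt 2) \<ge> (norm k)\<^sup>2 - V0 * ?N\<^sup>2 / (2 * L ^ 3)"
        unfolding G_def[symmetric] by (simp add: c_def gam_inv_sqrt2)
      then show ?thesis using kK unfolding K_def by linarith
    qed
    have cg: "continuous_on {0..1 / sqrt 2} (\<lambda>t. gam (c t p))" "continuous_on {0..1 / sqrt 2} (\<lambda>t. alp (c t p))" for p
    proof -
      have nz: "\<forall>t\<in>{0..1 / sqrt 2}. 1 - (t::real)\<^sup>2 \<noteq> 0"
      proof
        fix t :: real assume "t \<in> {0..1 / sqrt 2}"
        then have "t\<^sup>2 < 1" using t1[of t] by (simp add: abs_square_less_1)
        then show "1 - t\<^sup>2 \<noteq> 0" by simp
      qed
      have "continuous_on {0..1 / sqrt 2} (\<lambda>t. gam t)" "continuous_on {0..1 / sqrt 2} (\<lambda>t. alp t)"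
        unfolding gam_def alp_def using nz by (intro continuous_intros; blast)+
      then show "continuous_on {0..1 / sqrt 2} (\<lambda>t. gam (c t p))" "continuous_on {0..1 / sqrt 2} (\<lambda>t. alp (c t p))"
        unfolding c_def by (cases "p = k \<or> p = - k"; simp)+
    qed
    have cG: "continuous_on {0..1 / sqrt 2} G" unfolding G_def[abs_def] by (intro continuous_intros cg)
    have co: "continuous_on {0..1 / sqrt 2} (\<lambda>t. occ (c t) (?N - G t) p)" "continuous_on {0..1 / sqrt 2} (\<lambda>t. anom (c t) (?N - G t) p)" for p
      unfolding occ_def anom_def using cg cG by (cases "p = 0"; auto intro!: continuous_intros)+
    have "continuous_on {0..1 / sqrt 2} F"
      unfolding F_def[abs_def] energy_def by (intro continuous_intros cg co cG)
    then obtain t where t: "0 \<le> t" "t \<le> 1 / sqrt 2" "F t = ?Y"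
      using IVT'[of F 0 ?Y "1 / sqrt 2"] F0 F1 by auto
    have t': "t \<in> {0..1 / sqrt 2}" using t by simp
    have "pair_state L (c t) (?N - G t) P"
    proof
      show "finite P" "P \<subseteq> dual_lattice L - {0}" by (rule P)+
      show "c t p = 0" if "p \<notin> P" for p using that P by (auto simp: c_def)
      show "c t (- p) = c t p" for p by (rule c_sym)
      show "- p \<in> P" if "p \<in> P" for p using that by (rule P)
      show "\<bar>c t p\<bar> < 1" for p by (rule c_less[OF t'])
      show "0 < ?N - G t" using G_le[OF t'] big by linarith
    qed
    moreover have "(?N - G t) + (\<Sum>p\<in>P. gam (c t p)) = ?N" by (simp add: G_def)
    ultimately show "\<exists>P c M0. pair_state L c M0 P \<and> M0 + (\<Sum>p\<in>P. gam (c p)) = \<rho> * L ^ 3 \<and>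
      energy vh L P c M0 = ?Y"
      using t(3) unfolding F_def by blast
  qed
qed

end

section \<open>Identification of the constants and the final estimate\<close>

lemma integral_odd_eq_0:
  fixes f :: "real^3 \<Rightarrow> real"
  assumes [measurable]: "f \<in> borel_measurable borel" and odd: "\<And>x. f (- x) = - f x"
  shows "(LINT x|lborel. f x) = 0"
proof -
  have "orthogonal_transformation (uminus :: real^3 \<Rightarrow> real^3)"
    unfolding orthogonal_transformation_def by (auto intro: linearI)
  then have "(LINT x|lborel. f x) = (LINT x|distr lborel borel uminus. f x)"
    by (simp only: distr_orthogonal_transformation)
  also have "\<dots> = (LINT x|lborel. f (- x))" by (rule integral_distr) auto
  also have "\<dots> = - (LINT x|lborel. f x)" unfolding odd by simp
  finally show ?thesis by simp
qed

lemma (in pair_state) energy_eq: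
  assumes f: "\<And>u. fourier V u = complex_of_real (vh u)" and s: "(\<lambda>u. (vh u)\<^sup>2) summable_on dual_lattice L"
  shows "expectation (hamiltonian V L) \<Psi> = complex_of_real (energy vh L P c N0)"
    and "expectation (number_op L) \<Psi> = complex_of_real (N0 + (\<Sum>p\<in>P. gam (c p)))"
proof -
  have "gt p = occ c N0 p" "alt p = anom c N0 p" "ga p = gam (c p)" for p
    by (auto simp: gt_def alt_def occ_def anom_def ga_def al_def gam_def alp_def)
  then show "expectation (hamiltonian V L) \<Psi> = complex_of_real (energy vh L P c N0)"
    "expectation (number_op L) \<Psi> = complex_of_real (N0 + (\<Sum>p\<in>P. gam (c p)))"
    unfolding expectation_hamiltonian[OF f s] expectation_number energy_def by simp_all
qed

context scattering_profile begin

lemma fourier_eq: "fourier (\<lambda>x. v (norm x)) u = complex_of_real (vh u)"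
proof -
  have isn: "integrable lborel (\<lambda>x::real^3. v (norm x) * sin (u \<bullet> x))"
    by (rule integrable_v_bounded[where M = 1]) auto
  have s0: "(LINT x|lborel. v (norm x) * sin (u \<bullet> x)) = 0"
    by (rule integral_odd_eq_0) auto
  have "exp (- \<i> * complex_of_real (u \<bullet> x)) * complex_of_real (v (norm x))
      = complex_of_real (v (norm x) * cos (u \<bullet> x)) - \<i> * complex_of_real (v (norm x) * sin (u \<bullet> x))" for x
  proof -
    have "exp (- \<i> * complex_of_real (u \<bullet> x)) = cis (- (u \<bullet> x))" by (simp add: cis_conv_exp)
    then show ?thesis by (simp add: complex_eq_iff)
  qed
  then have "fourier (\<lambda>x. v (norm x)) u
      = (LINT x|lborel. complex_of_real (v (norm x) * cos (u \<bullet> x)) - \<i> * complex_of_real (v (norm x) * sin (u \<bullet> x)))"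
    unfolding fourier_def by simp
  also have "\<dots> = (LINT x|lborel. complex_of_real (v (norm x) * cos (u \<bullet> x))) - (LINT x|lborel. \<i> * complex_of_real (v (norm x) * sin (u \<bullet> x)))"
    by (intro Bochner_Integration.integral_diff integrable_mult_right integrable_of_real integrable_vcos isn)
  also have "\<dots> = complex_of_real (vh u)"
    unfolding integral_mult_right_zero integral_complex_of_real s0 by (simp add: vh_def)
  finally show ?thesis .
qed

text \<open>g is continuous and nonnegative. A vanishing integral would make the nonempty open set
  where it is nonzero a null set.\<close>

lemma \<kappa>_pos:
  assumes "r \<ge> 0" "v r > 0"
  shows "\<kappa> > 0"
proof (rule ccontr)
  assume "\<not> \<kappa> > 0"
  then have "\<kappa> = 0" using \<kappa>_nonneg by simp
  moreover have "integrable lborel (\<lambda>x::real^3. gs (norm x))" using gh_integrable[of 0] by simp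
  ultimately have "AE x in lborel. gs (norm (x::real^3)) = 0"
    unfolding \<kappa>_def using integral_nonneg_eq_0_iff_AE[of lborel "\<lambda>x::real^3. gs (norm x)"] gs_nonneg by simp
  moreover have "{x::real^3. gs (norm x) \<noteq> 0} \<in> sets borel" by measurable
  ultimately have null: "{x::real^3. gs (norm x) \<noteq> 0} \<in> null_sets lborel"
    by (subst (asm) AE_iff_null) auto
  have "continuous_on UNIV (\<lambda>x::real^3. gs (norm x))"
    unfolding gs_def by (intro continuous_intros continuous_on_compose2[OF cont_v] continuous_on_compose2[OF cont_\<phi>]) auto
  then have "open {x::real^3. gs (norm x) \<noteq> 0}" by (intro open_Collect_neq continuous_intros)
  moreover have "r *\<^sub>R axis 1 1 \<in> {x::real^3. gs (norm x) \<noteq> 0}"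
    using assms \<phi>_less[of r] by (simp add: gs_def)
  ultimately have "\<not> negligible {x::real^3. gs (norm x) \<noteq> 0}" by (intro open_not_negligible) blast+
  then show False using null by (simp add: negligible_iff_null_sets null_sets_completionI)
qed

lemma scattering_length_eq:
  assumes "\<And>x. scattering_w (\<lambda>x. v (norm x)) x = \<phi> (norm x)"
  shows "scattering_length (\<lambda>x. v (norm x)) = \<kappa> / (8 * pi)"
  unfolding scattering_length_def \<kappa>_def gs_def assms by simp

text \<open>With \<kappa> = 8 * pi * a the leading term \<rho>^2 * \<kappa> / 2 becomes 4 * pi * a *
  \<rho>^2. The identity \<open>s8\<close> rewrites sqrt (\<kappa> * \<rho>) through the customary
  parameter a^3 * \<rho>.\<close>

lemma target_density_eq:
  assumes "0 < \<rho>" "\<rho> \<le> 1" "\<kappa> > 0"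
  defines "a \<equiv> \<kappa> / (8 * pi)"
  shows "L ^ 3 * target_density \<rho> = 4 * pi * \<rho> * (\<rho> * L ^ 3) * a + Q_term a (\<rho> * L ^ 3) \<rho> (V0 / (8 * pi * a) - 1)"
proof -
  have \<kappa>: "\<kappa> = 8 * pi * a" by (simp add: a_def)
  have a: "a > 0" using assms by (simp add: a_def)
  have s8: "sqrt (\<kappa> * \<rho>) * a = pi / 2 * (sqrt (32 / pi) * sqrt (a ^ 3 * \<rho>))"
  proof -
    have "sqrt (\<kappa> * \<rho>) * a = sqrt (8 * pi * a ^ 3 * \<rho>)"
      using a assms unfolding \<kappa> by (intro real_sqrt_unique[symmetric]) (simp_all add: power_mult_distrib power2_eq_square power3_eq_cube)
    also have "\<dots> = sqrt ((pi / 2)\<^sup>2 * (32 / pi * (a ^ 3 * \<rho>)))"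
      by (rule arg_cong[where f = sqrt]) (simp add: power2_eq_square field_simps)
    also have "\<dots> = pi / 2 * (sqrt (32 / pi) * sqrt (a ^ 3 * \<rho>))"
      unfolding real_sqrt_mult by simp
    finally show ?thesis .
  qed
  let ?\<Phi> = "Phi (V0 / \<kappa> - 1)" and ?s = "sqrt (\<kappa> * \<rho>)"
  have "1 / (2 * pi) ^ 3 * (LINT p|lborel. bog_density \<rho> (norm (p::real^3))) = 8 * a * \<rho>\<^sup>2 * (?s * a) * ?\<Phi>"
  proof -
    have "1 / (2 * pi) ^ 3 * (LINT p|lborel. bog_density \<rho> (norm (p::real^3))) = 1 / (2 * pi) ^ 3 * (pi * (8 * pi * a * \<rho>)\<^sup>2 * ?s * ?\<Phi>)"
      unfolding bog_density_integral[OF assms(1-3)] using \<kappa> by simp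
    also have "\<dots> = 8 * a * \<rho>\<^sup>2 * (?s * a) * ?\<Phi>"
      by (simp add: power2_eq_square power3_eq_cube)
    finally show ?thesis .
  qed
  then have "target_density \<rho> = 4 * pi * \<rho>\<^sup>2 * a + 8 * a * \<rho>\<^sup>2 * (?s * a) * ?\<Phi>"
    unfolding target_density_def using \<kappa> by simp
  then show ?thesis
    unfolding s8 Q_term_def \<kappa>[symmetric] by (simp add: power2_eq_square algebra_simps)
qed

end

theorem theorem1:
  fixes Vt :: "real^3 \<Rightarrow> real"
  assumes "smooth Vt"
    and "radial Vt"
    and "\<forall>x. Vt x \<ge> 0"
    and "\<exists>x. Vt x \<noteq> 0"
    and "\<exists>C0 \<delta>. C0 > 0 \<and> \<delta> > 0 \<and> (\<forall>x. Vt x \<le> C0 * (1 + norm x) powr (- 3 - \<delta>))"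
  shows "\<exists>lam0>0. \<forall>lam. 0 < lam \<and> lam < lam0 \<longrightarrow>
    (let V = (\<lambda>x. lam * Vt x);
         a = scattering_length V;
         h = Re (fourier V 0) / (8 * pi * a) - 1
     in \<exists>\<rho>0>0. \<exists>C. \<forall>\<rho>. 0 < \<rho> \<and> \<rho> < \<rho>0 \<longrightarrow>
       (\<exists>L0>0. \<forall>L\<ge>L0. let N = \<rho> * L ^ 3 in
         \<exists>(c :: real^3 \<Rightarrow> real) (N0 :: real).
           (\<forall>k \<in> dual_lattice L - {0}. \<bar>c k\<bar> < 1 \<and> c k = c (- k)) \<and>
           N0 > 0 \<and>
           (let \<Psi> = trial_state L c N0
            in \<Psi> \<in> number_domain L \<and>
               \<Psi> \<in> hamiltonian_domain V L \<and>
               expectation (number_op L) \<Psi> = complex_of_real N \<and>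
               (\<exists>E :: real.
                  expectation (hamiltonian V L) \<Psi> = complex_of_real E \<and>
                  \<bar>E - 4 * pi * \<rho> * N * a - Q_term a N \<rho> h\<bar> \<le> C * N * \<rho>\<^sup>2 * \<bar>ln \<rho>\<bar>))))"
proof -
  obtain C0 \<delta> where C0: "C0 > 0" and \<delta>: "\<delta> > 0" and dec: "\<And>x. Vt x \<le> C0 * (1 + norm x) powr (- 3 - \<delta>)"
    using assms(5) by blast
  obtain x0 where x0: "Vt x0 \<noteq> 0" using assms(4) by blast
  have Vt_cont: "continuous_on UNIV Vt"
    using assms(1) unfolding smooth_def by (metis C_k.simps(1))
  then have [measurable]: "Vt \<in> borel_measurable borel" by (rule borel_measurable_continuous_onI)
  define u where "u s = Vt (s *\<^sub>R axis 1 1)" for s :: real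
  have Vt_u: "Vt x = u (norm x)" for x
    using assms(2) unfolding radial_def u_def by (elim allE[of _ x] allE[of _ "norm x *\<^sub>R axis 1 1"]) simp
  have u_cont: "continuous_on UNIV u"
    unfolding u_def by (intro continuous_on_compose2[OF Vt_cont] continuous_intros) auto
  have [measurable]: "u \<in> borel_measurable borel" using u_cont by (rule borel_measurable_continuous_onI)
  have u_nonneg: "u s \<ge> 0" for s using assms(3) by (simp add: u_def)
  have u_le: "u s \<le> C0 * (1 + s) powr (- 3 - \<delta>)" if "s > 0" for s
    using dec[of "s *\<^sub>R axis 1 1"] that by (simp add: u_def)
  have int_u2: "integrable lborel (\<lambda>s. indicator {0<..} s * (s\<^sup>2 * u s))"
  proof (rule Bochner_Integration.integrable_bound[OF integrable_mult_right[OF powr_square_integrable[OF \<delta>], of C0]])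
    show "AE s in lborel. norm (indicator {0<..} s * (s\<^sup>2 * u s)) \<le> norm (C0 * (indicator {0<..} s * (s\<^sup>2 * (1 + s) powr (- 3 - \<delta>))))"
    proof (intro AE_I2)
      fix s :: real
      show "norm (indicator {0<..} s * (s\<^sup>2 * u s)) \<le> norm (C0 * (indicator {0<..} s * (s\<^sup>2 * (1 + s) powr (- 3 - \<delta>))))"
        using mult_left_mono[OF u_le, of s "s\<^sup>2"] u_nonneg[of s] C0 by (cases "s > 0") (auto simp: abs_mult mult_ac)
    qed
  qed measurable
  have int_u1: "integrable lborel (\<lambda>s. indicator {0<..} s * (s * u s))"
  proof (rule Bochner_Integration.integrable_bound[OF integrable_mult_right[OF powr_integrable[OF \<delta>], of C0]])
    show "AE s in lborel. norm (indicator {0<..} s * (s * u s)) \<le> norm (C0 * (indicator {0<..} s * (1 + s) powr (- 1 - \<delta>)))"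
    proof (intro AE_I2)
      fix s :: real
      show "norm (indicator {0<..} s * (s * u s)) \<le> norm (C0 * (indicator {0<..} s * (1 + s) powr (- 1 - \<delta>)))"
      proof (cases "s > 0")
        case True
        have "s * u s \<le> (1 + s) powr 2 * (C0 * (1 + s) powr (- 3 - \<delta>))"
        proof (rule mult_mono)
          have "s \<le> (1 + s)\<^sup>2" using True by (simp add: power2_eq_square algebra_simps)
          then show "s \<le> (1 + s) powr 2" using True by simp
        qed (use True u_le u_nonneg in auto)
        also have "\<dots> = C0 * ((1 + s) powr 2 * (1 + s) powr (- 3 - \<delta>))" by simp
        also have "(1 + s) powr 2 * (1 + s) powr (- 3 - \<delta>) = (1 + s) powr (2 + (- 3 - \<delta>))" by (rule powr_add[symmetric])
        also have "2 + (- 3 - \<delta>) = - 1 - \<delta>" by simp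
        finally show ?thesis using True u_nonneg[of s] C0 by (simp add: abs_mult)
      qed simp
    qed
  qed measurable
  \<comment> \<open>The contraction condition reads lam * Jt < 1. The threshold 1 / (1 + Jt) ensures
    it and is well defined without excluding Jt = 0.\<close>
  define Jt where "Jt = (LINT s|lborel. indicator {0<..} s * (s * u s))"
  have Jt: "Jt \<ge> 0" unfolding Jt_def using u_nonneg by (intro Bochner_Integration.integral_nonneg) (auto simp: indicator_def)
  show ?thesis
  proof (rule exI[of _ "1 / (1 + Jt)"], intro conjI allI impI)
    show "1 / (1 + Jt) > 0" using Jt by simp
    fix lam assume lam: "0 < lam \<and> lam < 1 / (1 + Jt)"
    define v where "v s = lam * u s" for s
    have V_v: "lam * Vt x = v (norm x)" for x by (simp add: v_def Vt_u)
    interpret profile v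
    proof
      show "continuous_on UNIV v" unfolding v_def by (intro continuous_intros u_cont)
      show "v s \<ge> 0" for s using lam u_nonneg by (simp add: v_def)
      show "integrable lborel (\<lambda>s. indicator {0<..} s * (s * v s))"
        using integrable_mult_right[OF int_u1, of lam] by (simp add: v_def mult_ac)
      show "integrable lborel (\<lambda>s. indicator {0<..} s * (s\<^sup>2 * v s))"
        using integrable_mult_right[OF int_u2, of lam] by (simp add: v_def mult_ac)
    qed
    have "J = (LINT s|lborel. lam * (indicator {0<..} s * (s * u s)))"
      unfolding J_def v_def by (intro Bochner_Integration.integral_cong) auto
    then have Jl: "J = lam * Jt" unfolding Jt_def by simp
    show "let V = (\<lambda>x. lam * Vt x);
         a = scattering_length V;
         h = Re (fourier V 0) / (8 * pi * a) - 1
     in \<exists>\<rho>0>0. \<exists>C. \<forall>\<rho>. 0 < \<rho> \<and> \<rho> < \<rho>0 \<longrightarrow>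
       (\<exists>L0>0. \<forall>L\<ge>L0. let N = \<rho> * L ^ 3 in
         \<exists>(c :: real^3 \<Rightarrow> real) (N0 :: real).
           (\<forall>k \<in> dual_lattice L - {0}. \<bar>c k\<bar> < 1 \<and> c k = c (- k)) \<and>
           N0 > 0 \<and>
           (let \<Psi> = trial_state L c N0
            in \<Psi> \<in> number_domain L \<and>
               \<Psi> \<in> hamiltonian_domain V L \<and>
               expectation (number_op L) \<Psi> = complex_of_real N \<and>
               (\<exists>E :: real.
                  expectation (hamiltonian V L) \<Psi> = complex_of_real E \<and>
                  \<bar>E - 4 * pi * \<rho> * N * a - Q_term a N \<rho> h\<bar> \<le> C * N * \<rho>\<^sup>2 * \<bar>ln \<rho>\<bar>)))"
    proof -
      have "lam * (1 + Jt) < 1" using lam Jt by (simp add: pos_less_divide_eq)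
      then have J1: "J < 1" unfolding Jl using lam by (simp add: distrib_left)
      obtain \<phi> where \<phi>: "continuous_on UNIV \<phi>" "\<And>r. 0 \<le> \<phi> r" "\<And>r. \<phi> r < 1"
          "\<And>x. scattering_w (\<lambda>x. v (norm x)) x = \<phi> (norm x)" "\<And>r. \<phi> r = (LINT t|lborel. kern r t * (v t * (1 - \<phi> t) / 2))"
        using scattering_w_radial[of "\<lambda>x. v (norm x)", OF refl J1] by blast
      interpret scattering_profile v \<phi>
        by unfold_locales (rule \<phi>)+
      have V_eq: "(\<lambda>x. lam * Vt x) = (\<lambda>x. v (norm x))" using V_v by (rule ext)
      have \<kappa>: "\<kappa> > 0"
      proof (rule \<kappa>_pos)
        show "v (norm x0) > 0" unfolding V_v[symmetric] using lam x0 assms(3) by (simp add: order_less_le)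
      qed simp
      define a where "a = \<kappa> / (8 * pi)"
      have sl: "scattering_length (\<lambda>x. v (norm x)) = a"
        unfolding a_def by (rule scattering_length_eq[OF \<phi>(4)])
      \<comment> \<open>The first bound makes |ln \<rho>| at least 1, so that an error of order
        \<rho>^3 per volume fits the claim. The second gives CX * sqrt \<rho> <= 1 / 2, as
        \<open>exact_state\<close> requires.\<close>
      define r0 where "r0 = min (exp (- 1)) ((1 / (2 * (CX + 1)))\<^sup>2)"
      have CX: "CX \<ge> 0" by (rule CX_nonneg[where \<rho> = 1]) (use \<kappa> in auto)
      have r0: "r0 > 0" unfolding r0_def using CX by simp
      have state: "\<exists>L0>0. \<forall>L\<ge>L0. \<exists>c N0. (\<forall>k \<in> dual_lattice L - {0}. \<bar>c k\<bar> < 1 \<and> c k = c (- k)) \<and> N0 > 0 \<and>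
           trial_state L c N0 \<in> number_domain L \<and> trial_state L c N0 \<in> hamiltonian_domain (\<lambda>x. v (norm x)) L \<and>
           expectation (number_op L) (trial_state L c N0) = complex_of_real (\<rho> * L ^ 3) \<and>
           (\<exists>E. expectation (hamiltonian (\<lambda>x. v (norm x)) L) (trial_state L c N0) = complex_of_real E \<and>
             \<bar>E - 4 * pi * \<rho> * (\<rho> * L ^ 3) * a - Q_term a (\<rho> * L ^ 3) \<rho> (V0 / (8 * pi * a) - 1)\<bar> \<le> \<bar>CE\<bar> * (\<rho> * L ^ 3) * \<rho>\<^sup>2 * \<bar>ln \<rho>\<bar>)"
        if \<rho>: "0 < \<rho>" "\<rho> < r0" for \<rho>
      proof -
        have e: "\<rho> < exp (- 1)" using \<rho> by (simp add: r0_def)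
        have "ln \<rho> < - 1" using ln_less_cancel_iff[of \<rho> "exp (- 1)"] \<rho> e by simp
        then have ln: "1 \<le> \<bar>ln \<rho>\<bar>" by simp
        have "exp (- 1) \<le> (1::real)" by simp
        then have \<rho>1: "\<rho> \<le> 1" using e by linarith
        have "sqrt \<rho> \<le> 1 / (2 * (CX + 1))"
          using \<rho> CX by (intro real_le_lsqrt) (auto simp: r0_def)
        then have "CX * sqrt \<rho> \<le> CX * (1 / (2 * (CX + 1)))" using CX by (rule mult_left_mono)
        also have "\<dots> \<le> 1 / 2" using CX by (simp add: divide_le_eq)
        finally have small: "CX * sqrt \<rho> \<le> 1 / 2" .
        obtain L1 where L1: "\<And>L. L \<ge> L1 \<Longrightarrow> \<exists>P c N0. pair_state L c N0 P \<and> N0 + (\<Sum>p\<in>P. gam (c p)) = \<rho> * L ^ 3 \<and>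
            energy vh L P c N0 = L ^ 3 * (target_density \<rho> + CE * \<rho> ^ 3)"
          using exact_state[OF \<rho>(1) \<rho>1 \<kappa> small] unfolding eventually_at_top_linorder by blast
        show ?thesis
        proof (rule exI[of _ "max L1 1"], intro conjI allI impI)
          fix L assume "max L1 1 \<le> L"
          then have L: "L > 0" "L \<ge> L1" by auto
          obtain P c M where ps: "pair_state L c M P" and N: "M + (\<Sum>p\<in>P. gam (c p)) = \<rho> * L ^ 3"
            and E: "energy vh L P c M = L ^ 3 * (target_density \<rho> + CE * \<rho> ^ 3)"
            using L1[OF L(2)] by blast
          have "v (norm x) \<le> lam * C0 * (1 + norm x) powr (- 3 - \<delta>)" for x :: "real^3"
            using mult_left_mono[OF dec, of lam x] lam unfolding V_v[symmetric] by (simp add: mult.assoc)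
          then have sq: "(\<lambda>u. (vh u)\<^sup>2) summable_on dual_lattice L"
            unfolding vh_def using v_nonneg by (intro fourier_square_summable[OF L(1) \<delta>]) auto
          \<comment> \<open>The energy was tuned to the target plus exactly CE * \<rho>^3 per
            volume, hence an equality and the constant |CE|.\<close>
          have "\<bar>L ^ 3 * (target_density \<rho> + CE * \<rho> ^ 3) - 4 * pi * \<rho> * (\<rho> * L ^ 3) * a - Q_term a (\<rho> * L ^ 3) \<rho> (V0 / (8 * pi * a) - 1)\<bar>
              = \<bar>CE\<bar> * (\<rho> * L ^ 3) * \<rho>\<^sup>2 * 1"
            using target_density_eq[OF \<rho>(1) \<rho>1 \<kappa>, of L, folded a_def] L \<rho>
            by (simp add: distrib_left abs_mult power2_eq_square power3_eq_cube)
          also have "\<dots> \<le> \<bar>CE\<bar> * (\<rho> * L ^ 3) * \<rho>\<^sup>2 * \<bar>ln \<rho>\<bar>"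
            using ln L \<rho> by (intro mult_left_mono) auto
          finally have le: "\<bar>L ^ 3 * (target_density \<rho> + CE * \<rho> ^ 3) - 4 * pi * \<rho> * (\<rho> * L ^ 3) * a - Q_term a (\<rho> * L ^ 3) \<rho> (V0 / (8 * pi * a) - 1)\<bar>
              \<le> \<bar>CE\<bar> * (\<rho> * L ^ 3) * \<rho>\<^sup>2 * \<bar>ln \<rho>\<bar>" .
          show "\<exists>c N0. (\<forall>k \<in> dual_lattice L - {0}. \<bar>c k\<bar> < 1 \<and> c k = c (- k)) \<and> N0 > 0 \<and>
           trial_state L c N0 \<in> number_domain L \<and> trial_state L c N0 \<in> hamiltonian_domain (\<lambda>x. v (norm x)) L \<and>
           expectation (number_op L) (trial_state L c N0) = complex_of_real (\<rho> * L ^ 3) \<and>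
           (\<exists>E. expectation (hamiltonian (\<lambda>x. v (norm x)) L) (trial_state L c N0) = complex_of_real E \<and>
             \<bar>E - 4 * pi * \<rho> * (\<rho> * L ^ 3) * a - Q_term a (\<rho> * L ^ 3) \<rho> (V0 / (8 * pi * a) - 1)\<bar> \<le> \<bar>CE\<bar> * (\<rho> * L ^ 3) * \<rho>\<^sup>2 * \<bar>ln \<rho>\<bar>)"
          proof (rule exI[of _ c], rule exI[of _ M], intro conjI ballI)
            show "\<bar>c k\<bar> < 1" "c k = c (- k)" for k
              using pair_state.c_less[OF ps] pair_state.c_sym[OF ps] by auto
            show "M > 0" by (rule pair_state.N0[OF ps])
            show "trial_state L c M \<in> number_domain L" by (rule pair_state.Psi_number_domain[OF ps])
            show "trial_state L c M \<in> hamiltonian_domain (\<lambda>x. v (norm x)) L"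
              by (rule pair_state.Psi_hamiltonian_domain[OF ps fourier_eq sq])
            show "expectation (number_op L) (trial_state L c M) = complex_of_real (\<rho> * L ^ 3)"
              using pair_state.energy_eq(2)[OF ps fourier_eq sq] N by simp
            show "\<exists>E. expectation (hamiltonian (\<lambda>x. v (norm x)) L) (trial_state L c M) = complex_of_real E \<and>
             \<bar>E - 4 * pi * \<rho> * (\<rho> * L ^ 3) * a - Q_term a (\<rho> * L ^ 3) \<rho> (V0 / (8 * pi * a) - 1)\<bar> \<le> \<bar>CE\<bar> * (\<rho> * L ^ 3) * \<rho>\<^sup>2 * \<bar>ln \<rho>\<bar>"
              using pair_state.energy_eq(1)[OF ps fourier_eq sq] le unfolding E by blast
          qed
        qed simp
      qed
      show ?thesis
        unfolding Let_def V_eq sl fourier_eq Re_complex_of_real vh_0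
        by (rule exI[of _ r0], rule conjI[OF r0], rule exI[of _ "\<bar>CE\<bar>"], intro allI impI, rule state) auto
    qed
  qed
qed

end
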